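(* Let $1<p<\infty$ and let $U\subset\ell_2^m$ be either $\ell_2^m$ itself or a bounded open subset having the extension property. The mapping $$\Upsilon:W^1_p(U;\mathcal{Q}_Q(\ell_2^n))\to Y_p(U;\mathcal{Q}_Q(\ell_2^n)):f\mapsto\xi\circ f$$ is well defined and induces a bijection $$\boldsymbol{\Upsilon}:\mathbf{W}^1_p(U;\mathcal{Q}_Q(\ell_2^n))\to\mathbf{Y}_p(U;\mathcal{Q}_Q(\ell_2^n))$$ between the quotients by equality $\mathcal{L}^m$-almost everywhere. Moreover, for $f\in W^1_p(U;\mathcal{Q}_Q(\ell_2^n))$: (1) $\int_U\mathcal{G}_2(f(x),Q[\![0]\!])^p\,d\mathcal{L}^m(x)=\int_U\|\Upsilon(f)(x)\|^p\,d\mathcal{L}^m(x)$; (2) if $f$ is Lipschitz then $\int_U|Df(x)|^p\,d\mathcal{L}^m(x)=\int_U|||D\Upsilon(f)(x)|||^p\,d\mathcal{L}^m(x)$.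
   Context: $Q,m,n\ge1$ are integers; $\ell_2^k$ is $\mathbb{R}^k$ with the Euclidean norm. $\mathcal{Q}_Q(\ell_2^n)$ is the quotient of $(\ell_2^n)^Q$ by the permutation action of $S_Q$; the class of $(y_1,\dots,y_Q)$ is $[\![y_1,\dots,y_Q]\!]$, $Q[\![0]\!]=[\![0,\dots,0]\!]$, and $\mathcal{G}_2([\![y_1,\dots,y_Q]\!],[\![y_1',\dots,y_Q']\!])=\min_{\sigma\in S_Q}\big(\sum_i\|y_i-y'_{\sigma(i)}\|^2\big)^{1/2}$. Embedding: $\xi:\mathcal{Q}_Q(\mathbb{R}^n)\to\mathbb{R}^N$, with $N=N(n,Q)$, is the (Almgren–White) map satisfying, for some $\alpha=\alpha(n,Q)\in(0,1]$: (A) $\alpha\,\mathcal{G}_2(v,v')\le\|\xi(v)-\xi(v')\|\le\mathcal{G}_2(v,v')$ for all $v,v'$; (B) for every $v$ there is $r>0$ such that $\|\xi(v)-\xi(v')\|=\mathcal{G}_2(v,v')$ whenever $\mathcal{G}_2(v,v')<r$; (C) $\|\xi(v)\|=\mathcal{G}_2(v,Q[\![0]\!])$ for all $v$. (Such $N$, $\alpha$, $\xi$ exist.) $U$ has the extension property if for every $1<p<\infty$ there is a continuous linear extension operator from the classical Sobolev space $W^{1,p}(U)$ to $W^{1,p}(\mathbb{R}^m)$. For linear $L:\ell_2^m\to\ell_2^\nu$, $|||L|||=\big(\sum_{j=1}^m\sum_{k=1}^\nu\langle L(e_j),e_k\rangle^2\big)^{1/2}$ with respect to canonical bases. A Borel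 map $f:U\to\mathcal{Q}_Q(\ell_2^n)$ is approximately differentiable at $a\in U$ if there are affine maps $A_1,\dots,A_Q:\ell_2^m\to\ell_2^n$ such that for every $\varepsilon>0$ the set $\{x:\mathcal{G}_2(f(x),[\![A_1(x),\dots,A_Q(x)]\!])>\varepsilon\|x-a\|\}$ has $m$-dimensional density $0$ at $a$; the unordered tuple is unique; with $L_i=A_i-A_i(0)$ put $|Df(a)|=\big(\sum_i|||L_i|||^2\big)^{1/2}$. Lipschitz maps are approximately differentiable $\mathcal{L}^m$-a.e. $L_p(U;\mathcal{Q}_Q(\ell_2^n))$: Borel maps $f:U\to\mathcal{Q}_Q(\ell_2^n)$ with $\int_U\mathcal{G}_2(f,Q[\![0]\!])^pd\mathcal{L}^m<\infty$; $d_p(f,g)=(\int_U\mathcal{G}_2(f,g)^pd\mathcal{L}^m)^{1/p}$. $W^1_p(U;\mathcal{Q}_Q(\ell_2^n))$: those $f\in L_p(U;\mathcal{Q}_Q(\ell_2^n))$ for which there are Lipschitz maps $f_j:\ell_2^m\to\mathcal{Q}_Q(\ell_2^n)$ with $f_j|_U\in L_p(U;\mathcal{Q}_Q(\ell_2^n))$, $\sup_j\int_U|Df_j|^pd\mathcal{L}^m<\infty$ and $d_p(f,f_j)\to0$. $Y_p(U;\mathcal{Q}_Q(\ell_2^n))$: Borel functions $g:U\to\mathbb{R}^N$ belonging to the classical Sobolev space $W^{1,p}(U;\mathbb{R}^N)$ with $g(x)\in\xi(\mathcal{Q}_Q(\ell_2^n))$ for $\mathcal{L}^m$-almost every $x\in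 U$. *)

theory Defs
  imports "HOL-Analysis.Analysis"
begin

section \<open>Unordered tuples\<close>

text \<open>The index type \<open>'q\<close> has \<open>Q\<close> elements; \<open>perm_tuple \<sigma> y\<close> is
  the tuple \<open>i \<mapsto> y\<^bsub>\<sigma>(i)\<^esub>\<close>.\<close>

definition perm_tuple :: "('q \<Rightarrow> 'q) \<Rightarrow> 'a ^ 'q \<Rightarrow> 'a ^ ('q::finite)"
  where "perm_tuple \<sigma> y = (\<chi> i. y $ \<sigma> i)"

definition perm_equiv :: "'a ^ 'q \<Rightarrow> 'a ^ ('q::finite) \<Rightarrow> bool"
  where "perm_equiv y z \<longleftrightarrow> (\<exists>\<sigma>. \<sigma> permutes UNIV \<and> z = perm_tuple \<sigma> y)"

lemma perm_tuple_id [simp]: "perm_tuple id y = y"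
  by (simp add: perm_tuple_def)

lemma perm_tuple_comp: "perm_tuple \<tau> (perm_tuple \<sigma> y) = perm_tuple (\<sigma> \<circ> \<tau>) y"
  by (simp add: perm_tuple_def)

lemma perm_equiv_equivp: "equivp (perm_equiv :: 'a ^ 'q \<Rightarrow> 'a ^ 'q::finite \<Rightarrow> bool)"
proof (rule equivpI)
  show "reflp (perm_equiv :: 'a ^ 'q \<Rightarrow> 'a ^ 'q \<Rightarrow> bool)"
    by (rule reflpI) (metis perm_equiv_def perm_tuple_id permutes_id)
  show "symp (perm_equiv :: 'a ^ 'q \<Rightarrow> 'a ^ 'q \<Rightarrow> bool)"
  proof (rule sympI)
    fix y z :: "'a ^ 'q"
    assume "perm_equiv y z"
    then obtain \<sigma> where \<sigma>: "\<sigma> permutes UNIV" "z = perm_tuple \<sigma> y"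
      by (auto simp: perm_equiv_def)
    then have "y = perm_tuple (inv \<sigma>) z"
      by (simp add: perm_tuple_comp permutes_inv_o)
    then show "perm_equiv z y"
      using \<sigma> permutes_inv by (auto simp: perm_equiv_def)
  qed
  show "transp (perm_equiv :: 'a ^ 'q \<Rightarrow> 'a ^ 'q \<Rightarrow> bool)"
  proof (rule transpI)
    fix x y z :: "'a ^ 'q"
    assume "perm_equiv x y" "perm_equiv y z"
    then show "perm_equiv x z"
      by (metis perm_equiv_def perm_tuple_comp permutes_compose)
  qed
qed

quotient_type ('a, 'q) qtuple = "('a::real_normed_vector) ^ ('q::finite)" / perm_equiv
  by (rule perm_equiv_equivp)

definition G2 :: "('a::real_normed_vector) ^ 'q \<Rightarrow> 'a ^ ('q::finite) \<Rightarrow> real"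
  where "G2 y z = Min ((\<lambda>\<sigma>. sqrt (\<Sum>i\<in>UNIV. (norm (y $ i - z $ \<sigma> i))\<^sup>2)) ` {\<sigma>. \<sigma> permutes UNIV})"

lemma sqrt_sum_eq_dist: "sqrt (\<Sum>i\<in>UNIV. (norm (y $ i - z $ \<sigma> i))\<^sup>2) = dist y (perm_tuple \<sigma> z)"
  by (simp add: dist_norm norm_vec_def L2_set_def perm_tuple_def)

lemma G2_eq: "G2 y z = Min ((\<lambda>\<sigma>. dist y (perm_tuple \<sigma> z)) ` {\<sigma>. \<sigma> permutes UNIV})"
  unfolding G2_def sqrt_sum_eq_dist ..

lemma dist_perm_tuple:
  fixes y z :: "('a::real_normed_vector) ^ 'q::finite"
  assumes "\<sigma> permutes UNIV"
  shows "dist (perm_tuple \<sigma> y) (perm_tuple \<sigma> z) = dist y z"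
proof -
  have "(\<Sum>i\<in>UNIV. (norm (y $ \<sigma> i - z $ \<sigma> i))\<^sup>2) = (\<Sum>i\<in>UNIV. (norm (y $ i - z $ i))\<^sup>2)"
    using sum.permute[OF assms, of "\<lambda>i. (norm (y $ i - z $ i))\<^sup>2"] by (simp add: o_def)
  then show ?thesis
    by (simp add: dist_norm norm_vec_def L2_set_def perm_tuple_def)
qed

lemma G2_le: "\<sigma> permutes UNIV \<Longrightarrow> G2 y z \<le> dist y (perm_tuple \<sigma> z)"
  unfolding G2_eq by (rule Min_le) (auto simp: finite_permutations)

lemma G2_obtain: obtains \<sigma> where "\<sigma> permutes UNIV" "G2 y z = dist y (perm_tuple \<sigma> z)"
proof -
  have "(\<lambda>\<sigma>. dist y (perm_tuple \<sigma> z)) ` {\<sigma>. \<sigma> permutes UNIV} \<noteq> {}"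
    using permutes_id by blast
  then have "G2 y z \<in> (\<lambda>\<sigma>. dist y (perm_tuple \<sigma> z)) ` {\<sigma>. \<sigma> permutes UNIV}"
    unfolding G2_eq by (intro Min_in) (auto simp: finite_permutations)
  with that show ?thesis
    by auto
qed

lemma G2_sym_le: "G2 z y \<le> G2 y z"
proof -
  obtain \<sigma> where \<sigma>: "\<sigma> permutes UNIV" "G2 y z = dist y (perm_tuple \<sigma> z)"
    by (rule G2_obtain)
  have "dist y (perm_tuple \<sigma> z) = dist (perm_tuple (inv \<sigma>) y) (perm_tuple (inv \<sigma>) (perm_tuple \<sigma> z))"
    by (rule dist_perm_tuple[symmetric]) (rule permutes_inv[OF \<sigma>(1)])
  also have "\<dots> = dist z (perm_tuple (inv \<sigma>) y)"
    using \<sigma>(1) by (simp add: perm_tuple_comp permutes_inv_o dist_commute)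
  also have "\<dots> \<ge> G2 z y"
    by (rule G2_le) (rule permutes_inv[OF \<sigma>(1)])
  finally show ?thesis
    using \<sigma>(2) by simp
qed

lemma G2_commute: "G2 y z = G2 z y"
  by (intro antisym G2_sym_le)

lemma G2_triangle: "G2 x z \<le> G2 x y + G2 y z"
proof -
  obtain \<sigma> where \<sigma>: "\<sigma> permutes UNIV" "G2 x y = dist x (perm_tuple \<sigma> y)"
    by (rule G2_obtain)
  obtain \<tau> where \<tau>: "\<tau> permutes UNIV" "G2 y z = dist y (perm_tuple \<tau> z)"
    by (rule G2_obtain)
  have "G2 x z \<le> dist x (perm_tuple (\<tau> \<circ> \<sigma>) z)"
    by (rule G2_le) (rule permutes_compose[OF \<sigma>(1) \<tau>(1)])
  also have "\<dots> = dist x (perm_tuple \<sigma> (perm_tuple \<tau> z))"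
    by (simp add: perm_tuple_comp)
  also have "\<dots> \<le> dist x (perm_tuple \<sigma> y) + dist (perm_tuple \<sigma> y) (perm_tuple \<sigma> (perm_tuple \<tau> z))"
    by (rule dist_triangle)
  also have "\<dots> = G2 x y + G2 y z"
    using \<sigma> \<tau> by (simp add: dist_perm_tuple)
  finally show ?thesis .
qed

lemma G2_eq_0_iff: "G2 y z = 0 \<longleftrightarrow> perm_equiv y z"
proof
  assume "G2 y z = 0"
  then obtain \<sigma> where "\<sigma> permutes UNIV" "y = perm_tuple \<sigma> z"
    by (metis G2_obtain dist_eq_0_iff)
  then have "perm_equiv z y"
    by (auto simp: perm_equiv_def)
  then show "perm_equiv y z"
    by (rule equivp_symp[OF perm_equiv_equivp])
next
  assume "perm_equiv y z"
  then have "perm_equiv z y"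
    by (rule equivp_symp[OF perm_equiv_equivp])
  then obtain \<sigma> where \<sigma>: "\<sigma> permutes UNIV" "y = perm_tuple \<sigma> z"
    by (auto simp: perm_equiv_def)
  then have "G2 y z \<le> 0"
    using G2_le[OF \<sigma>(1), of y z] by simp
  moreover have "G2 y z \<ge> 0"
    by (metis G2_obtain zero_le_dist)
  ultimately show "G2 y z = 0"
    by simp
qed

lemma G2_perm_equiv:
  assumes "perm_equiv y y'" "perm_equiv z z'"
  shows "G2 y z = G2 y' z'"
proof -
  have "G2 y y' = 0" "G2 z z' = 0"
    using assms by (simp_all add: G2_eq_0_iff)
  then show ?thesis
    using G2_triangle[of y z y'] G2_triangle[of y' z z'] G2_triangle[of y' z' y]
      G2_triangle[of y z' z] G2_commute[of y y'] G2_commute[of z z']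
    by simp
qed

instantiation qtuple :: (real_normed_vector, finite) metric_space
begin

lift_definition dist_qtuple :: "('a, 'b) qtuple \<Rightarrow> ('a, 'b) qtuple \<Rightarrow> real" is G2
  by (rule G2_perm_equiv)

definition uniformity_qtuple :: "(('a, 'b) qtuple \<times> ('a, 'b) qtuple) filter"
  where "uniformity_qtuple = (INF e\<in>{0<..}. principal {(x, y). dist x y < e})"

definition open_qtuple :: "('a, 'b) qtuple set \<Rightarrow> bool"
  where "open_qtuple S = (\<forall>x\<in>S. \<forall>\<^sub>F (x', y) in uniformity. x' = x \<longrightarrow> y \<in> S)"

instance
proof
  fix x y z :: "('a, 'b) qtuple"
  show "dist x y = 0 \<longleftrightarrow> x = y"
    by transfer (rule G2_eq_0_iff)
  show "dist x y \<le> dist x z + dist y z"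
    by transfer (metis G2_commute G2_triangle)
qed (simp_all add: uniformity_qtuple_def open_qtuple_def)

end

abbreviation qzero :: "('a::real_normed_vector, 'q::finite) qtuple"
  where "qzero \<equiv> abs_qtuple 0"

definition almgren_white :: "(('a::real_normed_vector, 'q::finite) qtuple \<Rightarrow> 'b::real_normed_vector) \<Rightarrow> bool"
  where "almgren_white \<xi> \<longleftrightarrow>
    (\<exists>\<alpha>. 0 < \<alpha> \<and> \<alpha> \<le> 1 \<and>
       (\<forall>v v'. \<alpha> * dist v v' \<le> norm (\<xi> v - \<xi> v') \<and> norm (\<xi> v - \<xi> v') \<le> dist v v')) \<and>
    (\<forall>v. \<exists>r>0. \<forall>v'. dist v v' < r \<longrightarrow> norm (\<xi> v - \<xi> v') = dist v v') \<and>
    (\<forall>v. norm (\<xi> v) = dist v qzero)"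

section \<open>Classical Sobolev spaces\<close>

text \<open>Functions on an open set \<open>U\<close> are total functions; everything below depends
  only on their values on \<open>U\<close>. Elements of \<open>L\<^sub>p\<close> and Sobolev spaces are functions, not classes.\<close>

definition hs_norm :: "('a::euclidean_space \<Rightarrow> 'b::euclidean_space) \<Rightarrow> real"
  where "hs_norm L = sqrt (\<Sum>j\<in>Basis. \<Sum>k\<in>Basis. (L j \<bullet> k)\<^sup>2)"

definition Lp_fun :: "real \<Rightarrow> 'a::euclidean_space set \<Rightarrow> ('a \<Rightarrow> 'b::euclidean_space) \<Rightarrow> bool"
  where "Lp_fun p U g \<longleftrightarrow> g \<in> borel_measurable (lebesgue_on U) \<and>
    (\<integral>\<^sup>+x. ennreal (norm (g x) powr p) \<partial>lebesgue_on U) < \<infinity>"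

primrec C_k :: "nat \<Rightarrow> ('a::real_normed_vector \<Rightarrow> 'b::real_normed_vector) \<Rightarrow> bool"
  where
    "C_k 0 f \<longleftrightarrow> continuous_on UNIV f"
  | "C_k (Suc k) f \<longleftrightarrow> f differentiable_on UNIV \<and> (\<forall>v. C_k k (\<lambda>x. frechet_derivative f (at x) v))"

definition test_function :: "'a::euclidean_space set \<Rightarrow> ('a \<Rightarrow> real) \<Rightarrow> bool"
  where "test_function U \<phi> \<longleftrightarrow> (\<forall>k. C_k k \<phi>) \<and>
    compact (closure {x. \<phi> x \<noteq> 0}) \<and> closure {x. \<phi> x \<noteq> 0} \<subseteq> U"

definition loc_integrable :: "'a::euclidean_space set \<Rightarrow> ('a \<Rightarrow> 'b::euclidean_space) \<Rightarrow> bool"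
  where "loc_integrable U g \<longleftrightarrow> (\<forall>K. compact K \<and> K \<subseteq> U \<longrightarrow> integrable (lebesgue_on K) g)"

text \<open>\<open>G x\<close> is the differential at \<open>x\<close>: its values on the basis vectors are the weak
  partial derivatives of \<open>g\<close>.\<close>

definition weak_deriv ::
    "'a::euclidean_space set \<Rightarrow> ('a \<Rightarrow> 'b::euclidean_space) \<Rightarrow> ('a \<Rightarrow> 'a \<Rightarrow> 'b) \<Rightarrow> bool"
  where "weak_deriv U g G \<longleftrightarrow>
    loc_integrable U g \<and> (\<forall>x. linear (G x)) \<and>
    (\<forall>v\<in>Basis. loc_integrable U (\<lambda>x. G x v) \<and>
      (\<forall>\<phi>. test_function U \<phi> \<longrightarrow>
        integral\<^sup>L (lebesgue_on U) (\<lambda>x. frechet_derivative \<phi> (at x) v *\<^sub>R g x) =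
        - integral\<^sup>L (lebesgue_on U) (\<lambda>x. \<phi> x *\<^sub>R G x v)))"

definition sobolev :: "real \<Rightarrow> 'a::euclidean_space set \<Rightarrow> ('a \<Rightarrow> 'b::euclidean_space) set"
  where "sobolev p U = {g. Lp_fun p U g \<and>
    (\<exists>G. weak_deriv U g G \<and> (\<forall>v\<in>Basis. Lp_fun p U (\<lambda>x. G x v)))}"

text \<open>Only determined up to equality almost everywhere in \<open>U\<close>. For Lipschitz \<open>g\<close> it agrees
  almost everywhere with the pointwise derivative.\<close>

definition weak_D :: "'a::euclidean_space set \<Rightarrow> ('a \<Rightarrow> 'b::euclidean_space) \<Rightarrow> 'a \<Rightarrow> 'a \<Rightarrow> 'b"
  where "weak_D U g = (SOME G. weak_deriv U g G)"

definition sobolev_norm :: "real \<Rightarrow> 'a::euclidean_space set \<Rightarrow> ('a \<Rightarrow> 'b::euclidean_space) \<Rightarrow> real"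
  where "sobolev_norm p U g =
    (integral\<^sup>L (lebesgue_on U) (\<lambda>x. norm (g x) powr p) +
     integral\<^sup>L (lebesgue_on U) (\<lambda>x. hs_norm (weak_D U g x) powr p)) powr (1 / p)"

text \<open>Linearity is required up to null sets. Boundedness, together with linearity, makes the
  operator respect equality almost everywhere, so that it acts on the Banach spaces of classes.\<close>

definition extension_operator ::
    "real \<Rightarrow> 'a::euclidean_space set \<Rightarrow> (('a \<Rightarrow> real) \<Rightarrow> ('a \<Rightarrow> real)) \<Rightarrow> bool"
  where "extension_operator p U E \<longleftrightarrow>
    (\<forall>g\<in>sobolev p U. E g \<in> sobolev p UNIV \<and> (AE x in lebesgue_on U. E g x = g x)) \<and>
    (\<forall>g\<in>sobolev p U. \<forall>h\<in>sobolev p U. AE x in lebesgue. E (\<lambda>y. g y + h y) x = E g x + E h x) \<and>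
    (\<forall>g\<in>sobolev p U. \<forall>c. AE x in lebesgue. E (\<lambda>y. c * g y) x = c * E g x) \<and>
    (\<exists>C. \<forall>g\<in>sobolev p U. sobolev_norm p UNIV (E g) \<le> C * sobolev_norm p U g)"

definition extension_property :: "'a::euclidean_space set \<Rightarrow> bool"
  where "extension_property U \<longleftrightarrow> (\<forall>p>1. \<exists>E. extension_operator p U E)"

section \<open>Multiple-valued Sobolev maps\<close>

definition density_zero :: "'a::euclidean_space set \<Rightarrow> 'a \<Rightarrow> bool"
  where "density_zero S a \<longleftrightarrow>
    ((\<lambda>r. measure lebesgue (S \<inter> cball a r) / measure lebesgue (cball a r)) \<longlongrightarrow> 0) (at_right 0)"

text \<open>\<open>A i\<close> is the affine map \<open>A\<^sub>i\<close>. The maps \<open>f\<close> to which this is applied are Borel on the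
  open set \<open>U\<close>, so the sets whose density is taken are measurable.\<close>

definition approx_affine ::
    "'a::euclidean_space set \<Rightarrow> ('a \<Rightarrow> ('b::euclidean_space, 'q::finite) qtuple) \<Rightarrow> 'a \<Rightarrow> ('q \<Rightarrow> 'a \<Rightarrow> 'b) \<Rightarrow> bool"
  where "approx_affine U f a A \<longleftrightarrow>
    (\<forall>i. linear (\<lambda>x. A i x - A i 0)) \<and>
    (\<forall>\<epsilon>>0. density_zero {x\<in>U. dist (f x) (abs_qtuple (\<chi> i. A i x)) > \<epsilon> * norm (x - a)} a)"

definition approx_differentiable ::
    "'a::euclidean_space set \<Rightarrow> ('a \<Rightarrow> ('b::euclidean_space, 'q::finite) qtuple) \<Rightarrow> 'a \<Rightarrow> bool"
  where "approx_differentiable U f a \<longleftrightarrow> (\<exists>A. approx_affine U f a A)"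

text \<open>\<open>|Df(a)|\<close>; the value 0 outside the set of approximate differentiability is a convention.\<close>

definition qD_norm ::
    "'a::euclidean_space set \<Rightarrow> ('a \<Rightarrow> ('b::euclidean_space, 'q::finite) qtuple) \<Rightarrow> 'a \<Rightarrow> real"
  where "qD_norm U f a =
    (if approx_differentiable U f a
     then let A = (SOME A. approx_affine U f a A)
          in sqrt (\<Sum>i\<in>UNIV. (hs_norm (\<lambda>x. A i x - A i 0))\<^sup>2)
     else 0)"

definition Lp_q ::
    "real \<Rightarrow> 'a::euclidean_space set \<Rightarrow> ('a \<Rightarrow> ('b::euclidean_space, 'q::finite) qtuple) set"
  where "Lp_q p U = {f. f \<in> borel_measurable (restrict_space borel U) \<and>
    (\<integral>\<^sup>+x. ennreal (dist (f x) qzero powr p) \<partial>lebesgue_on U) < \<infinity>}"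

text \<open>The integral is finite for \<open>f, g \<in> Lp_q p U\<close>, so \<open>enn2real\<close> loses nothing there.\<close>

definition dist_Lp ::
    "real \<Rightarrow> 'a::euclidean_space set \<Rightarrow> ('a \<Rightarrow> 'b::metric_space) \<Rightarrow> ('a \<Rightarrow> 'b) \<Rightarrow> real"
  where "dist_Lp p U f g =
    enn2real (\<integral>\<^sup>+x. ennreal (dist (f x) (g x) powr p) \<partial>lebesgue_on U) powr (1 / p)"

definition W1p ::
    "real \<Rightarrow> 'a::euclidean_space set \<Rightarrow> ('a \<Rightarrow> ('b::euclidean_space, 'q::finite) qtuple) set"
  where "W1p p U = {f \<in> Lp_q p U. \<exists>F :: nat \<Rightarrow> 'a \<Rightarrow> ('b, 'q) qtuple.
    (\<forall>j. \<exists>C. C-lipschitz_on UNIV (F j)) \<and>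
    (\<forall>j. F j \<in> Lp_q p U) \<and>
    (SUP j. \<integral>\<^sup>+x. ennreal (qD_norm UNIV (F j) x powr p) \<partial>lebesgue_on U) < \<infinity> \<and>
    (\<lambda>j. dist_Lp p U f (F j)) \<longlonglongrightarrow> 0}"

definition Yp ::
    "(('b::euclidean_space, 'q::finite) qtuple \<Rightarrow> 'c::euclidean_space) \<Rightarrow> real \<Rightarrow> 'a::euclidean_space set \<Rightarrow> ('a \<Rightarrow> 'c) set"
  where "Yp \<xi> p U = {g \<in> sobolev p U. g \<in> borel_measurable (restrict_space borel U) \<and>
    (AE x in lebesgue_on U. g x \<in> range \<xi>)}"

definition ae_rel :: "'a::euclidean_space set \<Rightarrow> ('a \<Rightarrow> 'b) set \<Rightarrow> (('a \<Rightarrow> 'b) \<times> ('a \<Rightarrow> 'b)) set"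
  where "ae_rel U S = {(f, g). f \<in> S \<and> g \<in> S \<and> (AE x in lebesgue_on U. f x = g x)}"

end

(*
  The embedding \<xi> has a Lipschitz left inverse R, because maps into Q-tuples satisfy a McShane-type
  extension theorem: away from the domain one interpolates between finitely many clusters of
  coordinates, by induction on Q. So both spaces can be compared through Lipschitz maps.

  If Lipschitz maps F_j with bounded energies converge to f in L_p, then the maps \<xi> o F_j are Lipschitz,
  and at almost every point |D F_j| equals the Hilbert-Schmidt norm of D(\<xi> o F_j), since \<xi> is isometric
  seen from each base point. Weak compactness of bounded sets of L_p turns the bounded derivatives
  of \<xi> o F_j into weak derivatives of \<xi> o f.

  Conversely, extend a Sobolev map g with values in the image of \<xi> to the whole space. Its differences
  g(x + c) - g(x) are O(|c|) in L_p, hence so are those of its mollifications m_j, and R o m_j are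
  Lipschitz maps with bounded energies converging to R o g.
*)
theory Submission
  imports Defs
begin

text \<open>Outside \<open>U\<close> an extended Sobolev map leaves the image of
  \<open>\<xi>\<close>, and a mollification leaves it everywhere, so the left inverse
  \<open>R\<close> must be Lipschitz on the whole target space; this forces the extension theorem
  for tuples. The obstacle there is that labels cannot be chosen consistently: a tuple splits into
  independent smaller ones only on balls of radius proportional to its spread, and the spread may
  tend to 0. Once the mean is subtracted, the spread is comparable to the largest entry
  \<open>s\<close>. Balls of size comparable to \<open>s\<close> fall into separated classes whose
  number depends on the dimension alone, so the Lipschitz constant is multiplied a bounded number of
  times; a cut-off that agrees with \<open>s\<close> on the domain makes the extension vanish
  elsewhere. Since \<open>R\<close> maps into a space without linear structure, energies are carried
  through it by L_p bounds on translates, which any Lipschitz map preserves up to a factor, and not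
  by a chain rule. Almost everywhere differentiability of Lipschitz maps rests on the same
  compactness as the Sobolev limits: difference quotients are bounded, and a weak limit of them is
  integrated along lines.\<close>

section \<open>Lipschitz extension of tuples up to permutation\<close>

text \<open>Each cone \<open>f a + C * dist a x\<close> is C-Lipschitz in \<open>x\<close>, hence so
  is their lower envelope; the Lipschitz bound on \<open>f\<close> says that over a point of
  \<open>A\<close> no other cone lies below the value of \<open>f\<close>.\<close>

lemma mcshane_real:
  fixes f :: "'e::metric_space \<Rightarrow> real"
  assumes f: "C-lipschitz_on A f"
  shows "\<exists>g. C-lipschitz_on UNIV g \<and> (\<forall>x\<in>A. g x = f x)"
proof (cases "A = {}")
  case True
  then show ?thesis
    using f by (intro exI[of _ "\<lambda>_. 0"]) (auto simp: lipschitz_on_def)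
next
  case False
  then obtain a0 where a0: "a0 \<in> A"
    by auto
  have C: "0 \<le> C"
    using f lipschitz_on_nonneg by blast
  define g where "g x = (INF a\<in>A. f a + C * dist a x)" for x
  have bd: "f a0 - C * dist a0 x \<le> f a + C * dist a x" if "a \<in> A" for a x
  proof -
    have "f a0 - f a \<le> C * dist a0 a"
      using lipschitz_onD[OF f a0 that] by (simp add: dist_real_def)
    also have "\<dots> \<le> C * (dist a0 x + dist a x)"
      using C by (intro mult_left_mono dist_triangle2)
    finally show ?thesis
      by (simp add: algebra_simps)
  qed
  then have bdd: "bdd_below ((\<lambda>a. f a + C * dist a x) ` A)" for x
    by (intro bdd_belowI2)
  have step: "g x \<le> g y + C * dist x y" for x y
  proof -
    have "g x - C * dist x y \<le> f a + C * dist a y" if "a \<in> A" for a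
    proof -
      have "g x \<le> f a + C * dist a x"
        unfolding g_def by (rule cINF_lower[OF bdd that])
      also have "\<dots> \<le> f a + C * (dist a y + dist x y)"
        using C by (intro add_left_mono mult_left_mono) (auto simp: dist_commute intro: dist_triangle2)
      finally show ?thesis
        by (simp add: algebra_simps)
    qed
    then have "g x - C * dist x y \<le> g y"
      unfolding g_def[of y] using False by (intro cINF_greatest)
    then show ?thesis
      by simp
  qed
  have "C-lipschitz_on UNIV g"
  proof (rule lipschitz_onI[OF _ C])
    fix x y
    show "dist (g x) (g y) \<le> C * dist x y"
      using step[of x y] step[of y x] by (simp add: dist_real_def abs_le_iff dist_commute)
  qed
  moreover have "g x = f x" if "x \<in> A" for x
  proof (rule antisym)
    show "g x \<le> f x"
      using cINF_lower[OF bdd that, of x] by (simp add: g_def)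
    show "f x \<le> g x"
      unfolding g_def using False lipschitz_onD[OF f that]
      by (intro cINF_greatest) (auto simp: dist_real_def abs_le_iff dist_commute algebra_simps)
  qed
  ultimately show ?thesis
    by blast
qed

text \<open>The coordinates are extended separately, which costs the factor \<open>DIM('b)\<close>;
  the later arguments are insensitive to such factors.\<close>

lemma mcshane:
  fixes f :: "'e::metric_space \<Rightarrow> 'b::euclidean_space"
  assumes f: "C-lipschitz_on A f"
  shows "\<exists>g. (real DIM('b) * C)-lipschitz_on UNIV g \<and> (\<forall>x\<in>A. g x = f x)"
proof -
  have "\<exists>g. C-lipschitz_on UNIV g \<and> (\<forall>x\<in>A. g x = f x \<bullet> b)" if "b \<in> Basis" for b :: 'b
  proof (rule mcshane_real, rule lipschitz_onI)
    fix x y assume "x \<in> A" "y \<in> A"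
    then have "norm (f x - f y) \<le> C * dist x y"
      using lipschitz_onD[OF f] by (simp add: dist_norm)
    then show "dist (f x \<bullet> b) (f y \<bullet> b) \<le> C * dist x y"
      using Basis_le_norm[OF that, of "f x - f y"] by (simp add: dist_real_def inner_diff_left)
  qed (use f lipschitz_on_nonneg in blast)
  then obtain h where h: "\<And>b::'b. b \<in> Basis \<Longrightarrow> C-lipschitz_on UNIV (h b) \<and> (\<forall>x\<in>A. h b x = f x \<bullet> b)"
    by metis
  have "dist (\<Sum>b\<in>Basis. h b x *\<^sub>R b) (\<Sum>b\<in>Basis. h b y *\<^sub>R b) \<le> real DIM('b) * C * dist x y" for x y
  proof -
    have "dist (\<Sum>b\<in>Basis. h b x *\<^sub>R b) (\<Sum>b\<in>Basis. h b y *\<^sub>R b) = norm (\<Sum>b\<in>Basis. (h b x - h b y) *\<^sub>R b)"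
      by (simp add: dist_norm sum_subtractf[symmetric] scaleR_diff_left)
    also have "\<dots> \<le> (\<Sum>b\<in>(Basis::'b set). C * dist x y)"
    proof (rule sum_norm_le)
      fix b :: 'b assume b: "b \<in> Basis"
      show "norm ((h b x - h b y) *\<^sub>R b) \<le> C * dist x y"
        using lipschitz_onD[OF conjunct1[OF h[OF b]], of x y] b by (simp add: dist_real_def)
    qed
    finally show ?thesis
      by simp
  qed
  moreover have "(\<Sum>b\<in>Basis. h b x *\<^sub>R b) = f x" if "x \<in> A" for x
    using h that by (simp add: euclidean_representation)
  ultimately show ?thesis
    using f lipschitz_on_nonneg[OF f]
    by (intro exI[of _ "\<lambda>x. \<Sum>b\<in>Basis. h b x *\<^sub>R b"]) (auto intro!: lipschitz_onI)
qed

text \<open>The indices form a set and not a type because the induction passes from \<open>I\<close>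
  to proper subsets. The maximum over matched coordinates replaces the Euclidean sum of
  \<open>G2\<close>, to which it is comparable; it glues over disjoint unions of index sets without
  change of constant.\<close>

definition qnear :: "'i set \<Rightarrow> real \<Rightarrow> ('i \<Rightarrow> 'b::metric_space) \<Rightarrow> ('i \<Rightarrow> 'b) \<Rightarrow> bool"
  where "qnear I d y z \<longleftrightarrow> (\<exists>\<sigma>. \<sigma> permutes I \<and> (\<forall>i\<in>I. dist (y i) (z (\<sigma> i)) \<le> d))"

definition qlip :: "'i set \<Rightarrow> real \<Rightarrow> 'e::metric_space set \<Rightarrow> ('e \<Rightarrow> 'i \<Rightarrow> 'b::metric_space) \<Rightarrow> bool"
  where "qlip I L A f \<longleftrightarrow> (\<forall>x\<in>A. \<forall>y\<in>A. qnear I (L * dist x y) (f x) (f y))"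

lemma qlipD: "qlip I L A f \<Longrightarrow> x \<in> A \<Longrightarrow> y \<in> A \<Longrightarrow> qnear I (L * dist x y) (f x) (f y)"
  by (simp add: qlip_def)

lemma qnear_pointwise: "(\<And>i. i \<in> I \<Longrightarrow> dist (y i) (z i) \<le> d) \<Longrightarrow> qnear I d y z"
  unfolding qnear_def by (intro exI[of _ id]) (auto simp: permutes_id)

lemma qnear_sym:
  assumes "qnear I d y z" shows "qnear I d z y"
proof -
  obtain \<sigma> where \<sigma>: "\<sigma> permutes I" "\<And>i. i \<in> I \<Longrightarrow> dist (y i) (z (\<sigma> i)) \<le> d"
    using assms by (auto simp: qnear_def)
  have "dist (z i) (y (inv \<sigma> i)) \<le> d" if "i \<in> I" for i
    using \<sigma>(2)[of "inv \<sigma> i"] permutes_inverses[OF \<sigma>(1)] permutes_in_image[OF permutes_inv[OF \<sigma>(1)]] that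
    by (simp add: dist_commute)
  then show ?thesis
    unfolding qnear_def using permutes_inv[OF \<sigma>(1)] by blast
qed

lemma qnear_trans:
  assumes "qnear I d y z" "qnear I e z w" shows "qnear I (d + e) y w"
proof -
  obtain \<sigma> where \<sigma>: "\<sigma> permutes I" "\<And>i. i \<in> I \<Longrightarrow> dist (y i) (z (\<sigma> i)) \<le> d"
    using assms by (auto simp: qnear_def)
  obtain \<tau> where \<tau>: "\<tau> permutes I" "\<And>i. i \<in> I \<Longrightarrow> dist (z i) (w (\<tau> i)) \<le> e"
    using assms by (auto simp: qnear_def)
  have "dist (y i) (w ((\<tau> \<circ> \<sigma>) i)) \<le> d + e" if "i \<in> I" for i
    using \<sigma>(2)[OF that] \<tau>(2)[of "\<sigma> i"] permutes_in_image[OF \<sigma>(1)] that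
      dist_triangle[of "y i" "w (\<tau> (\<sigma> i))" "z (\<sigma> i)"] by simp
  then show ?thesis
    unfolding qnear_def using permutes_compose[OF \<sigma>(1) \<tau>(1)] by blast
qed

lemma qnear_mono: "qnear I d y z \<Longrightarrow> d \<le> e \<Longrightarrow> qnear I e y z"
  unfolding qnear_def by (meson order_trans)

text \<open>Relabelling the coordinates at each point separately, however discontinuously, changes
  nothing here. Labels can thus be chosen to suit a splitting of the indices and be put back
  afterwards.\<close>

lemma qlip_transfer:
  assumes "qlip I L A g" "\<And>x. x \<in> A \<Longrightarrow> qnear I 0 (f x) (g x)"
  shows "qlip I L A f"
  unfolding qlip_def
proof safe
  fix x y assume xy: "x \<in> A" "y \<in> A"
  show "qnear I (L * dist x y) (f x) (f y)"
    using qnear_trans[OF qnear_trans[OF assms(2)[OF xy(1)] qlipD[OF assms(1) xy]] qnear_sym[OF assms(2)[OF xy(2)]]]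
    by simp
qed

lemma qlip_mono:
  assumes "qlip I L A f" "L \<le> M" "B \<subseteq> A" shows "qlip I M B f"
  unfolding qlip_def
proof safe
  fix x y assume "x \<in> B" "y \<in> B"
  then have "qnear I (L * dist x y) (f x) (f y)"
    using assms by (auto simp: qlip_def)
  then show "qnear I (M * dist x y) (f x) (f y)"
    by (rule qnear_mono) (simp add: mult_right_mono assms)
qed

lemma qlip_Un:
  assumes "I = J \<union> J'" "J \<inter> J' = {}" "qlip J L A f" "qlip J' L A f"
  shows "qlip I L A f"
  unfolding qlip_def
proof safe
  fix x y assume xy: "x \<in> A" "y \<in> A"
  obtain \<sigma> where \<sigma>: "\<sigma> permutes J" "\<And>i. i \<in> J \<Longrightarrow> dist (f x i) (f y (\<sigma> i)) \<le> L * dist x y"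
    using qlipD[OF assms(3) xy] by (auto simp: qnear_def)
  obtain \<tau> where \<tau>: "\<tau> permutes J'" "\<And>i. i \<in> J' \<Longrightarrow> dist (f x i) (f y (\<tau> i)) \<le> L * dist x y"
    using qlipD[OF assms(4) xy] by (auto simp: qnear_def)
  have "\<sigma> permutes I" "\<tau> permutes I"
    using \<sigma>(1) \<tau>(1) assms(1) by (auto intro: permutes_subset)
  then have "\<tau> \<circ> \<sigma> permutes I"
    by (rule permutes_compose)
  moreover have "dist (f x i) (f y ((\<tau> \<circ> \<sigma>) i)) \<le> L * dist x y" if "i \<in> I" for i
  proof (cases "i \<in> J")
    case True
    then have "\<sigma> i \<notin> J'"
      using assms(2) permutes_in_image[OF \<sigma>(1)] by blast
    then show ?thesis
      using True \<sigma>(2) permutes_not_in[OF \<tau>(1)] by simp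
  next
    case False
    then show ?thesis
      using \<tau>(2) that assms(1) permutes_not_in[OF \<sigma>(1)] by simp
  qed
  ultimately show "qnear I (L * dist x y) (f x) (f y)"
    unfolding qnear_def by blast
qed

text \<open>The \<open>itself\<close> arguments fix the types of domain and target, which otherwise
  occur only under the quantifiers. The constant \<open>K\<close> is uniform in \<open>A\<close>,
  \<open>L\<close> and \<open>f\<close>, so that it can be fed into the induction over index
  sets.\<close>

definition qext :: "'i set \<Rightarrow> real \<Rightarrow> 'e::metric_space itself \<Rightarrow> 'b::metric_space itself \<Rightarrow> bool"
  where "qext I K TE TB \<longleftrightarrow> (\<forall>A L (f :: 'e \<Rightarrow> 'i \<Rightarrow> 'b). 0 < L \<longrightarrow> qlip I L A f \<longrightarrow>
    (\<exists>g. qlip I (K * L) UNIV g \<and> (\<forall>x\<in>A. g x = f x)))"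

lemma qextD:
  fixes f :: "'e::metric_space \<Rightarrow> 'i \<Rightarrow> 'b::metric_space"
  assumes "qext I K TYPE('e) TYPE('b)" "0 < L" "qlip I L A f"
  shows "\<exists>g. qlip I (K * L) UNIV g \<and> (\<forall>x\<in>A. g x = f x)"
  using assms unfolding qext_def by blast

text \<open>On a small ball around \<open>x0\<close> the coordinates can be labelled by those of
  \<open>f x0\<close>. If the entries of \<open>f x0\<close> with labels in \<open>J\<close> are far
  from those in \<open>J'\<close>, no efficient matching between two tuples over the ball mixes the
  groups, so \<open>f\<close> is a pair of independent maps with fewer coordinates, which extend by
  assumption.\<close>

lemma qlip_split_extend:
  fixes f :: "'e::metric_space \<Rightarrow> 'i \<Rightarrow> 'b::metric_space"
  assumes fin: "finite I" and I: "I = J \<union> J'" "J \<inter> J' = {}"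
    and K: "qext J K TYPE('e) TYPE('b)" "qext J' K TYPE('e) TYPE('b)"
    and L: "0 < L" and f: "qlip I L A f"
    and x0: "x0 \<in> A" and A: "A \<subseteq> cball x0 \<rho>"
    and gap: "\<And>i j. i \<in> J \<Longrightarrow> j \<in> J' \<Longrightarrow> 4 * L * \<rho> < dist (f x0 i) (f x0 j)"
  shows "\<exists>g. qlip I (K * L) UNIV g \<and> (\<forall>x\<in>A. g x = f x)"
proof -
  have "\<exists>\<tau>. \<tau> permutes I \<and> (\<forall>i\<in>I. dist (f x0 i) (f x (\<tau> i)) \<le> L * \<rho>)" if "x \<in> A" for x
    using qlipD[OF f x0 that] qnear_mono[of I "L * dist x0 x" "f x0" "f x" "L * \<rho>"] A that L
    by (auto simp: qnear_def subset_iff intro: mult_left_mono)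
  then obtain \<tau> where \<tau>: "\<And>x. x \<in> A \<Longrightarrow> \<tau> x permutes I"
    "\<And>x i. x \<in> A \<Longrightarrow> i \<in> I \<Longrightarrow> dist (f x0 i) (f x (\<tau> x i)) \<le> L * \<rho>"
    by metis
  \<comment> \<open>\<open>f'\<close> is \<open>f\<close> relabelled so that coordinate
    \<open>i\<close> stays within \<open>L * \<rho>\<close> of \<open>f x0 i\<close>.\<close>
  define f' where "f' x i = f x (\<tau> x i)" for x i
  have f'0: "qnear I 0 (f' x) (f x)" if "x \<in> A" for x
    unfolding qnear_def f'_def using \<tau>(1)[OF that] by (intro exI[of _ "\<tau> x"]) auto
  have f': "qlip I L A f'"
    by (rule qlip_transfer[OF f f'0])
  have pres: "qlip J1 L A f'"
    if J: "J1 \<union> J2 = I" "J1 \<inter> J2 = {}"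
      and gap': "\<And>i j. i \<in> J1 \<Longrightarrow> j \<in> J2 \<Longrightarrow> 4 * L * \<rho> < dist (f x0 i) (f x0 j)" for J1 J2
    unfolding qlip_def
  proof safe
    fix x y assume xy: "x \<in> A" "y \<in> A"
    obtain \<sigma> where \<sigma>: "\<sigma> permutes I" "\<And>i. i \<in> I \<Longrightarrow> dist (f' x i) (f' y (\<sigma> i)) \<le> L * dist x y"
      using qlipD[OF f' xy] by (auto simp: qnear_def)
    have dxy: "dist x y \<le> 2 * \<rho>"
    proof -
      have "dist x0 x \<le> \<rho>" "dist x0 y \<le> \<rho>"
        using A xy by auto
      then show ?thesis
        using dist_triangle3[of x y x0] by linarith
    qed
    have inJ: "\<sigma> i \<in> J1" if i: "i \<in> J1" for i
    proof (rule ccontr)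
      assume "\<sigma> i \<notin> J1"
      have iI: "i \<in> I" "\<sigma> i \<in> I"
        using i J permutes_in_image[OF \<sigma>(1)] by auto
      then have "\<sigma> i \<in> J2"
        using \<open>\<sigma> i \<notin> J1\<close> J by blast
      then have "4 * L * \<rho> < dist (f x0 i) (f x0 (\<sigma> i))"
        using gap' i by blast
      also have "\<dots> \<le> dist (f x0 i) (f' x i) + dist (f' x i) (f' y (\<sigma> i)) + dist (f' y (\<sigma> i)) (f x0 (\<sigma> i))"
        by (metis add_right_mono dist_triangle order_trans)
      \<comment> \<open>From \<open>f x0 i\<close> to \<open>f' x i\<close>, on to
        \<open>f' y (\<sigma> i)\<close> and then to \<open>f x0 (\<sigma> i)\<close>: the radius
        counts once, twice (the diameter) and once more, whence the factor 4 in the gap.\<close>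
      also have "\<dots> \<le> L * \<rho> + L * (2 * \<rho>) + L * \<rho>"
        using \<tau>(2)[OF xy(1) iI(1)] \<tau>(2)[OF xy(2) iI(2)] \<sigma>(2)[OF iI(1)] mult_left_mono[OF dxy less_imp_le[OF L]]
        by (intro add_mono) (auto simp: f'_def dist_commute)
      finally show False
        by simp
    qed
    define \<sigma>' where "\<sigma>' i = (if i \<in> J1 then \<sigma> i else i)" for i
    have "\<sigma>' permutes J1"
    proof -
      have "inj_on \<sigma> J1"
        using permutes_inj[OF \<sigma>(1)] by (rule inj_on_subset) auto
      then have "inj_on \<sigma>' J1"
        by (simp add: \<sigma>'_def inj_on_def)
      moreover have "\<sigma>' ` J1 \<subseteq> J1" "finite J1"
        using inJ J fin by (auto simp: \<sigma>'_def intro: finite_subset)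
      ultimately have "bij_betw \<sigma>' J1 J1"
        by (simp add: bij_betw_def endo_inj_surj)
      then show ?thesis
        by (rule bij_imp_permutes) (simp add: \<sigma>'_def)
    qed
    moreover have "dist (f' x i) (f' y (\<sigma>' i)) \<le> L * dist x y" if "i \<in> J1" for i
      using \<sigma>(2)[of i] that J by (auto simp: \<sigma>'_def)
    ultimately show "qnear J1 (L * dist x y) (f' x) (f' y)"
      unfolding qnear_def by blast
  qed
  have "qlip J L A f'"
    by (rule pres[of J J']) (use I gap in auto)
  then obtain g1 where g1: "qlip J (K * L) UNIV g1" "\<And>x. x \<in> A \<Longrightarrow> g1 x = f' x"
    using qextD[OF K(1) L] by blast
  have "qlip J' L A f'"
  proof (rule pres[of J' J])
    fix i j assume "i \<in> J'" "j \<in> J"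
    then show "4 * L * \<rho> < dist (f x0 i) (f x0 j)"
      using gap[of j i] by (simp add: dist_commute)
  qed (use I in auto)
  then obtain g2 where g2: "qlip J' (K * L) UNIV g2" "\<And>x. x \<in> A \<Longrightarrow> g2 x = f' x"
    using qextD[OF K(2) L] by blast
  define g where "g x i = (if i \<in> J then g1 x i else g2 x i)" for x i
  have "qlip J (K * L) UNIV g"
    by (rule qlip_transfer[OF g1(1)]) (auto simp: g_def intro: qnear_pointwise)
  moreover have "qlip J' (K * L) UNIV g"
    by (rule qlip_transfer[OF g2(1)], rule qnear_pointwise) (use I in \<open>auto simp: g_def\<close>)
  ultimately have g: "qlip I (K * L) UNIV g"
    by (rule qlip_Un[OF I])
  \<comment> \<open>\<open>g\<close> extends the relabelled map \<open>f'\<close>; on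
    \<open>A\<close> the original labels are put back.\<close>
  have "qlip I (K * L) UNIV (\<lambda>x. if x \<in> A then f x else g x)"
  proof (rule qlip_transfer[OF g])
    fix x
    have "qnear I 0 (f x) (g x)" if "x \<in> A"
    proof -
      have "g x = f' x"
        using g1(2)[OF that] g2(2)[OF that] by (auto simp: g_def)
      then show ?thesis
        using qnear_sym[OF f'0[OF that]] by simp
    qed
    then show "qnear I 0 (if x \<in> A then f x else g x) (g x)"
      by (auto intro: qnear_pointwise)
  qed
  then show ?thesis
    by (intro exI[of _ "\<lambda>x. if x \<in> A then f x else g x"]) auto
qed

text \<open>Pigeonhole: measured from \<open>v j0\<close> in units of \<open>s / card I\<close>, the
  values reach at least \<open>card I\<close>. The ceilings of the values at the indices other than
  \<open>j0\<close> cannot fill \<open>{1..card I}\<close>, and a missed integer \<open>m\<close>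
  leaves a gap of one unit.\<close>

lemma real_gap:
  fixes v :: "'i \<Rightarrow> real"
  assumes I: "finite I" and i0: "i0 \<in> I" "j0 \<in> I" and s: "0 < s" "s \<le> v i0 - v j0"
  shows "\<exists>J J'. I = J \<union> J' \<and> J \<inter> J' = {} \<and> J \<noteq> {} \<and> J' \<noteq> {} \<and>
    (\<forall>i\<in>J. \<forall>j\<in>J'. s / card I \<le> v i - v j)"
proof -
  define n where "n = card I"
  have n: "0 < n"
    using I i0 by (auto simp: n_def card_gt_0_iff)
  define k where "k i = \<lceil>(v i - v j0) * n / s\<rceil>" for i
  have "card (k ` (I - {j0})) < card {1..int n}"
    using card_image_le[of "I - {j0}" k] I i0 n by (auto simp: n_def)
  then have "\<not> {1..int n} \<subseteq> k ` (I - {j0})"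
    using card_mono[of "k ` (I - {j0})" "{1..int n}"] I by auto
  then obtain m where m: "1 \<le> m" "m \<le> int n" "m \<notin> k ` (I - {j0})"
    by (metis atLeastAtMost_iff subsetI)
  have kj0: "k j0 = 0"
    by (simp add: k_def)
  have km: "k i \<noteq> m" if "i \<in> I" for i
    using m kj0 that by (cases "i = j0") auto
  have "int n \<le> k i0"
  proof -
    have "real n \<le> (v i0 - v j0) * n / s"
      using s mult_right_mono[OF s(2), of "real n"] by (simp add: pos_le_divide_eq mult.commute)
    then show ?thesis
      by (simp add: k_def le_ceiling_iff)
  qed
  then have ki0: "m < k i0"
    using m km[OF i0(1)] by linarith
  define J where "J = {i \<in> I. m < k i}"
  have "s / n \<le> v i - v j" if "i \<in> J" "j \<in> I - J" for i j
  proof -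
    have "m < k i" "k j \<le> m - 1"
      using that km[of j] by (auto simp: J_def)
    \<comment> \<open>No ceiling equals \<open>m\<close>: an index above has ceiling at least
      \<open>m + 1\<close>, hence value beyond \<open>m\<close>, and one below has value at most
      \<open>m - 1\<close>.\<close>
    then have "real_of_int m < (v i - v j0) * n / s" "(v j - v j0) * n / s \<le> real_of_int (m - 1)"
      unfolding k_def less_ceiling_iff ceiling_le_iff by auto
    then have "1 \<le> (v i - v j0) * n / s - (v j - v j0) * n / s"
      by simp
    also have "\<dots> = (v i - v j) * n / s"
      using s by (simp add: field_simps)
    finally show ?thesis
      using s n by (simp add: field_simps)
  qed
  then show ?thesis
    using ki0 i0 kj0 m by (intro exI[of _ J] exI[of _ "I - J"]) (auto simp: J_def n_def)
qed

text \<open>Project to the direction of \<open>y i0\<close>. As the sum vanishes, some entry has a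
  nonpositive projection, so the projections spread over at least \<open>norm (y i0)\<close> and
  \<open>real_gap\<close> applies; projecting does not increase distances.\<close>

lemma tuple_gap:
  fixes y :: "'i \<Rightarrow> 'b::euclidean_space"
  assumes I: "finite I" and i0: "i0 \<in> I" and pos: "0 < norm (y i0)" and mean: "(\<Sum>i\<in>I. y i) = 0"
  shows "\<exists>J J'. I = J \<union> J' \<and> J \<inter> J' = {} \<and> J \<noteq> {} \<and> J' \<noteq> {} \<and>
    (\<forall>i\<in>J. \<forall>j\<in>J'. norm (y i0) / card I \<le> dist (y i) (y j))"
proof -
  define u where "u = y i0 /\<^sub>R norm (y i0)"
  have u: "norm u = 1" "y i0 \<bullet> u = norm (y i0)"
    using pos by (auto simp: u_def power2_norm_eq_inner[symmetric] power2_eq_square)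
  have "\<exists>j\<in>I. y j \<bullet> u \<le> 0"
  proof (rule ccontr)
    assume "\<not> ?thesis"
    then have "0 < (\<Sum>j\<in>I. y j \<bullet> u)"
      using I i0 by (intro sum_pos) auto
    then show False
      using mean by (simp add: inner_sum_left[symmetric])
  qed
  then obtain j0 where j0: "j0 \<in> I" "y j0 \<bullet> u \<le> 0"
    by auto
  have proj: "y i \<bullet> u - y j \<bullet> u \<le> dist (y i) (y j)" for i j
    using Cauchy_Schwarz_ineq2[of "y i - y j" u] u by (simp add: inner_diff_left dist_norm)
  have le: "norm (y i0) \<le> y i0 \<bullet> u - y j0 \<bullet> u"
    using u j0 by simp
  obtain J J' where "I = J \<union> J'" "J \<inter> J' = {}" "J \<noteq> {}" "J' \<noteq> {}"
    "\<And>i j. i \<in> J \<Longrightarrow> j \<in> J' \<Longrightarrow> norm (y i0) / card I \<le> y i \<bullet> u - y j \<bullet> u"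
    using real_gap[OF I i0 j0(1) pos le] by metis
  then show ?thesis
    using order_trans[OF _ proj] by (intro exI[of _ J] exI[of _ J']) auto
qed

text \<open>The Whitney-type covering: \<open>cell\<close> records the dyadic scale of \<open>s\<close> and a grid cube of
  comparable size, \<open>col\<close> its class modulo a coarser lattice.\<close>

lemma scale_colouring:
  fixes TE :: "'e::euclidean_space itself"
  assumes P: "48 * real DIM('e) + 1 \<le> real P"
  defines "colours \<equiv> {0..<4::int} \<times> ((Basis :: 'e set) \<rightarrow>\<^sub>E {0..<int P})"
  assumes \<epsilon>: "0 < \<epsilon>" "24 * \<epsilon> \<le> 7/8"
  shows "\<exists>(cell :: 'e \<Rightarrow> real \<Rightarrow> int \<times> ('e \<Rightarrow> int)) (col :: int \<times> ('e \<Rightarrow> int) \<Rightarrow> (int \<times> ('e \<Rightarrow> int))).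
    (\<forall>c. col c \<in> colours) \<and>
    (\<forall>x x' s s'. 0 < s \<longrightarrow> 0 < s' \<longrightarrow> cell x s = cell x' s' \<longrightarrow> dist x x' \<le> \<epsilon> * s' \<and> s \<le> 2 * s') \<and>
    (\<forall>x x' s s'. 0 < s \<longrightarrow> 0 < s' \<longrightarrow> cell x s \<noteq> cell x' s' \<longrightarrow> col (cell x s) = col (cell x' s') \<longrightarrow>
       \<bar>s - s'\<bar> \<le> dist x x' \<longrightarrow> 24 * \<epsilon> * s \<le> dist x x')"
proof -
  define lev where "lev s = \<lfloor>log 2 s\<rfloor>" for s :: real
  \<comment> \<open>Side length of the grid at level \<open>k\<close>: \<open>DIM('e)\<close>
    coordinates, each off by at most \<open>sc k\<close>, add up to
    \<open>\<epsilon> * 2 powr k\<close>.\<close>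
  define sc where "sc k = \<epsilon> / DIM('e) * 2 powr real_of_int k" for k
  define cell where "cell x s = (lev s, restrict (\<lambda>b. \<lfloor>x \<bullet> b / sc (lev s)\<rfloor>) (Basis :: 'e set))" for x :: 'e and s
  \<comment> \<open>Distinct cells of equal colour have either levels that differ by at least 4, or
    the same level and some grid index that differs by at least \<open>P\<close>.\<close>
  define col where "col c = (fst c mod 4, restrict (\<lambda>b. snd c b mod int P) (Basis :: 'e set))" for c :: "int \<times> ('e \<Rightarrow> int)"
  have P0: "0 < P"
    using P by (cases P) auto
  have scpos: "0 < sc k" for k
    using \<epsilon> by (simp add: sc_def)
  have absdiv: "\<bar>a / c - b / c\<bar> = \<bar>a - b\<bar> / c" if "0 < c" for a b c :: real
    using that by (metis abs_divide abs_of_pos diff_divide_distrib)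
  have lev: "2 powr lev s \<le> s" "s < 2 * 2 powr lev s" if "0 < s" for s
  proof -
    have "2 powr lev s \<le> 2 powr log 2 s"
      by (simp add: lev_def)
    then show "2 powr lev s \<le> s"
      using that by simp
    have "2 powr log 2 s < 2 powr (lev s + 1)"
      by (intro powr_less_mono) (auto simp: lev_def)
    then show "s < 2 * 2 powr lev s"
      using that by (simp add: powr_add)
  qed
  have colr: "col c \<in> colours" for c
    using P0 by (auto simp: col_def colours_def)
  have near: "dist x x' \<le> \<epsilon> * s' \<and> s \<le> 2 * s'" if s: "0 < s" "0 < s'" and eq: "cell x s = cell x' s'" for x x' s s'
  proof -
    have k: "lev s = lev s'"
      using eq by (simp add: cell_def)
    have "\<bar>(x - x') \<bullet> b\<bar> \<le> sc (lev s')" if b: "b \<in> Basis" for b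
    proof -
      have "\<lfloor>x \<bullet> b / sc (lev s')\<rfloor> = \<lfloor>x' \<bullet> b / sc (lev s')\<rfloor>"
        using arg_cong[OF eq, of "\<lambda>c. snd c b"] b k by (simp add: cell_def)
      then have "\<bar>x \<bullet> b / sc (lev s') - x' \<bullet> b / sc (lev s')\<bar> \<le> 1"
        by linarith
      then show ?thesis
        using scpos[of "lev s'"] by (simp add: absdiv inner_diff_left divide_le_eq)
    qed
    then have "norm (x - x') \<le> (\<Sum>b\<in>(Basis::'e set). sc (lev s'))"
      by (intro order_trans[OF norm_le_l1] sum_mono)
    also have "\<dots> = \<epsilon> * 2 powr lev s'"
      by (simp add: sc_def)
    also have "\<dots> \<le> \<epsilon> * s'"
      using \<epsilon> lev s by (intro mult_left_mono) auto
    finally show ?thesis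
      using lev[OF s(1)] lev[OF s(2)] k by (simp add: dist_norm)
  qed
  have far: "24 * \<epsilon> * s \<le> dist x x'"
    if s: "0 < s" "0 < s'" and ne: "cell x s \<noteq> cell x' s'" and eq: "col (cell x s) = col (cell x' s')"
      and d: "\<bar>s - s'\<bar> \<le> dist x x'" for x x' s s'
  proof (cases "lev s = lev s'")
    case True
    have "\<exists>b\<in>Basis. \<lfloor>x \<bullet> b / sc (lev s)\<rfloor> \<noteq> \<lfloor>x' \<bullet> b / sc (lev s)\<rfloor>"
    proof (rule ccontr)
      assume "\<not> ?thesis"
      then have "restrict (\<lambda>b. \<lfloor>x \<bullet> b / sc (lev s)\<rfloor>) Basis = restrict (\<lambda>b. \<lfloor>x' \<bullet> b / sc (lev s)\<rfloor>) (Basis :: 'e set)"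
        by (intro restrict_ext) blast
      then show False
        using ne True by (simp add: cell_def)
    qed
    then obtain b where b: "b \<in> Basis" "\<lfloor>x \<bullet> b / sc (lev s)\<rfloor> \<noteq> \<lfloor>x' \<bullet> b / sc (lev s)\<rfloor>"
      by blast
    define z where "z = \<lfloor>x \<bullet> b / sc (lev s)\<rfloor>"
    define z' where "z' = \<lfloor>x' \<bullet> b / sc (lev s)\<rfloor>"
    have "z mod int P = z' mod int P"
      using arg_cong[OF eq, of "\<lambda>c. snd c b"] b True by (simp add: col_def cell_def z_def z'_def)
    then have "int P dvd z - z'"
      by (simp add: mod_eq_dvd_iff)
    then have "int P \<le> \<bar>z - z'\<bar>"
      using b(2) by (intro zdvd_imp_le) (auto simp: z_def z'_def)
    \<comment> \<open>Floors that differ by at least \<open>P\<close> come from numbers that differ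
      by more than \<open>P - 1\<close>. Since \<open>24 * \<epsilon> * s\<close> is at most
      \<open>48 * DIM('e) * sc (lev s)\<close>, this is where the lower bound on \<open>P\<close>
      comes from.\<close>
    then have "real P - 1 \<le> \<bar>x \<bullet> b / sc (lev s) - x' \<bullet> b / sc (lev s)\<bar>"
      unfolding z_def z'_def by linarith
    then have "(real P - 1) * sc (lev s) \<le> \<bar>(x - x') \<bullet> b\<bar>"
      using scpos[of "lev s"] by (simp add: absdiv inner_diff_left le_divide_eq)
    also have "\<dots> \<le> dist x x'"
      using Basis_le_norm[OF b(1)] by (simp add: dist_norm)
    finally have 1: "(real P - 1) * sc (lev s) \<le> dist x x'" .
    have "24 * \<epsilon> * s \<le> 24 * \<epsilon> * (2 * 2 powr lev s)"
      using \<epsilon> lev(2)[OF s(1)] by (intro mult_left_mono) auto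
    also have "\<dots> = (48 * real DIM('e)) * sc (lev s)"
      by (simp add: sc_def)
    also have "\<dots> \<le> (real P - 1) * sc (lev s)"
      using P scpos[of "lev s"] by (intro mult_right_mono) auto
    finally show ?thesis
      using 1 by simp
  next
    case False
    \<comment> \<open>Four levels are a factor 16, of which 2 is lost because \<open>s\<close> lies
      between \<open>2 powr lev s\<close> and its double. So one scale is at least 8 times the
      other, and \<open>\<bar>s - s'\<bar>\<close> is at least \<open>7/8\<close> of the larger
      one.\<close>
    have sep: "2 * 2 powr real_of_int k * 8 \<le> 2 powr real_of_int l" if "k < l" "k mod 4 = l mod 4" for k l :: int
    proof -
      have "4 \<le> l - k"
        using that by presburger
      then have "2 powr real_of_int (k + 4) \<le> 2 powr real_of_int l"
        by simp
      then show ?thesis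
        by (simp add: powr_add)
    qed
    have m4: "lev s mod 4 = lev s' mod 4"
      using eq by (simp add: col_def cell_def)
    have small: "24 * \<epsilon> * s \<le> 7/8 * s"
      using \<epsilon> s by (intro mult_right_mono) auto
    consider "lev s < lev s'" | "lev s' < lev s"
      using False by linarith
    then show ?thesis
    proof cases
      case 1
      have "8 * s \<le> s'"
        using sep[OF 1 m4] lev[OF s(1)] lev[OF s(2)] by linarith
      then show ?thesis
        using d small s by linarith
    next
      case 2
      have "8 * s' \<le> s"
        using sep[OF 2 m4[symmetric]] lev[OF s(1)] lev[OF s(2)] by linarith
      then show ?thesis
        using d small s by linarith
    qed
  qed
  show ?thesis
  proof (intro exI[of _ cell] exI[of _ col] conjI allI impI)
    show "col c \<in> colours" for c
      by (rule colr)
  next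
    fix x x' :: 'e and s s' :: real
    assume "0 < s" "0 < s'" "cell x s = cell x' s'"
    from near[OF this] show "dist x x' \<le> \<epsilon> * s'" "s \<le> 2 * s'"
      by auto
  next
    fix x x' :: 'e and s s' :: real
    assume "0 < s" "0 < s'" "cell x s \<noteq> cell x' s'" "col (cell x s) = col (cell x' s')" "\<bar>s - s'\<bar> \<le> dist x x'"
    then show "24 * \<epsilon> * s \<le> dist x x'"
      by (rule far)
  qed
qed

text \<open>The balls are attached all at once, each with its own local extension. Two points whose
  extensions are unrelated are compared by way of the centres, which lie in \<open>A\<close>; the
  separation makes this detour at most twice the distance, whence the constant
  \<open>2 * K * L\<close>.\<close>

lemma qlip_colour_step:
  fixes f :: "'e::metric_space \<Rightarrow> 'i \<Rightarrow> 'b::metric_space"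
  assumes f: "qlip I L A f" and L: "0 \<le> L" and K: "1 \<le> K" and X: "X \<subseteq> A"
    and r: "\<And>x. x \<in> X \<Longrightarrow> 0 \<le> r x"
    and sep: "\<And>x x'. x \<in> X \<Longrightarrow> x' \<in> X \<Longrightarrow> x \<noteq> x' \<Longrightarrow> 8 * r x \<le> dist x x'"
    and loc: "\<And>x. x \<in> X \<Longrightarrow> \<exists>g. qlip I (K * L) UNIV g \<and> (\<forall>y\<in>A \<inter> cball x (4 * r x). g y = f y)"
  shows "\<exists>g. qlip I (2 * K * L) (A \<union> (\<Union>x\<in>X. cball x (r x))) g \<and> (\<forall>y\<in>A. g y = f y)"
proof -
  obtain F where F: "\<And>x. x \<in> X \<Longrightarrow> qlip I (K * L) UNIV (F x)"
    "\<And>x y. x \<in> X \<Longrightarrow> y \<in> A \<Longrightarrow> dist x y \<le> 4 * r x \<Longrightarrow> F x y = f y"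
    using loc by (metis IntI mem_cball)
  define B where "B = (\<Union>x\<in>X. cball x (r x))"
  have "\<exists>x. x \<in> X \<and> dist x y \<le> r x" if "y \<in> B" for y
    using that by (auto simp: B_def)
  then obtain ctr where ctr: "\<And>y. y \<in> B \<Longrightarrow> ctr y \<in> X" "\<And>y. y \<in> B \<Longrightarrow> dist (ctr y) y \<le> r (ctr y)"
    by metis
  define g where "g y = (if y \<in> A then f y else F (ctr y) y)" for y
  have KL: "0 \<le> K * L" "L \<le> K * L"
    using K L mult_right_mono[OF K L] by auto
  have anchor: "qnear I (K * L * r (ctr y)) (g y) (f (ctr y))" if y: "y \<in> B" "y \<notin> A" for y
  proof -
    have c: "ctr y \<in> A"
      using ctr(1)[OF y(1)] X by auto
    have "F (ctr y) (ctr y) = f (ctr y)"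
      using F(2)[OF ctr(1)[OF y(1)] c] r[OF ctr(1)[OF y(1)]] by simp
    then have "qnear I (K * L * dist y (ctr y)) (g y) (f (ctr y))"
      using qlipD[OF F(1)[OF ctr(1)[OF y(1)]], of y "ctr y"] y by (simp add: g_def)
    then show ?thesis
      by (rule qnear_mono) (use ctr(2)[OF y(1)] KL in \<open>auto simp: dist_commute intro: mult_left_mono\<close>)
  qed
  have 1: "qnear I (2 * K * L * dist y z) (g y) (g z)" if y: "y \<in> B" "y \<notin> A" and z: "z \<in> A" for y z
  proof (cases "dist (ctr y) z \<le> 4 * r (ctr y)")
    case True
    have "qnear I (K * L * dist y z) (g y) (g z)"
      using qlipD[OF F(1)[OF ctr(1)[OF y(1)]], of y z] F(2)[OF ctr(1)[OF y(1)] z True] y z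
      by (simp add: g_def)
    then show ?thesis
      by (rule qnear_mono) (use mult_nonneg_nonneg[OF KL(1) zero_le_dist[of y z]] in \<open>simp add: mult.assoc\<close>)
  next
    case False
    let ?x = "ctr y"
    have x: "?x \<in> A"
      using ctr(1)[OF y(1)] X by auto
    have r: "0 \<le> r ?x"
      using r ctr y by auto
    have d: "dist ?x z \<le> dist y z + r ?x"
      using dist_triangle[of ?x z y] ctr(2)[OF y(1)] by linarith
    have "qnear I (K * L * r ?x + L * dist ?x z) (g y) (g z)"
      using qnear_trans[OF anchor[OF y] qlipD[OF f x z]] z by (simp add: g_def)
    then show ?thesis
    proof (rule qnear_mono)
      have "K * L * r ?x + L * dist ?x z \<le> K * L * r ?x + K * L * dist ?x z"
        using KL by (intro add_left_mono mult_right_mono) auto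
      also have "\<dots> = K * L * (r ?x + dist ?x z)"
        by (simp add: algebra_simps)
      \<comment> \<open>With \<open>r\<close> the radius at the centre,
        \<open>4 * r < dist ?x z \<le> dist y z + r\<close>, so \<open>r\<close> is less than a
        third of \<open>dist y z\<close> and the detour is at most \<open>5/3\<close> of it.\<close>
      also have "\<dots> \<le> K * L * (2 * dist y z)"
        using KL d False r by (intro mult_left_mono) auto
      finally show "K * L * r ?x + L * dist ?x z \<le> 2 * K * L * dist y z"
        by simp
    qed
  qed
  have 2: "qnear I (2 * K * L * dist y z) (g y) (g z)" if y: "y \<in> B" "y \<notin> A" and z: "z \<in> B" "z \<notin> A" for y z
  proof (cases "ctr y = ctr z")
    case True
    then have "qnear I (K * L * dist y z) (g y) (g z)"
      using qlipD[OF F(1)[OF ctr(1)[OF y(1)]], of y z] y z by (simp add: g_def)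
    then show ?thesis
      by (rule qnear_mono) (use mult_nonneg_nonneg[OF KL(1) zero_le_dist[of y z]] in \<open>simp add: mult.assoc\<close>)
  next
    case False
    let ?x = "ctr y" and ?x' = "ctr z"
    have x: "?x \<in> A" "?x' \<in> A"
      using ctr(1)[OF y(1)] ctr(1)[OF z(1)] X by auto
    have s: "8 * r ?x \<le> dist ?x ?x'" "8 * r ?x' \<le> dist ?x ?x'"
      using sep[OF ctr(1)[OF y(1)] ctr(1)[OF z(1)] False] sep[OF ctr(1)[OF z(1)] ctr(1)[OF y(1)]] False
      by (auto simp: dist_commute)
    have d: "dist ?x ?x' \<le> dist y z + r ?x + r ?x'"
      using dist_triangle[of ?x ?x' y] dist_triangle[of y ?x' z] ctr(2)[OF y(1)] ctr(2)[OF z(1)]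
      by (simp add: dist_commute)
    have "qnear I (K * L * r ?x + L * dist ?x ?x' + K * L * r ?x') (g y) (g z)"
      by (rule qnear_trans[OF qnear_trans[OF anchor[OF y] qlipD[OF f x]] qnear_sym[OF anchor[OF z]]])
    then show ?thesis
    proof (rule qnear_mono)
      have "K * L * r ?x + L * dist ?x ?x' + K * L * r ?x' \<le> K * L * r ?x + K * L * dist ?x ?x' + K * L * r ?x'"
        using KL by (intro add_right_mono add_left_mono mult_right_mono) auto
      also have "\<dots> = K * L * (r ?x + dist ?x ?x' + r ?x')"
        by (simp add: algebra_simps)
      \<comment> \<open>Both radii are at most an eighth of the distance of the centres, which is
        therefore at most \<open>4/3 * dist y z\<close>; the whole detour is at most
        \<open>5/3 * dist y z\<close>.\<close>
      also have "\<dots> \<le> K * L * (2 * dist y z)"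
        using KL d s zero_le_dist[of y z] by (intro mult_left_mono) linarith+
      finally show "K * L * r ?x + L * dist ?x ?x' + K * L * r ?x' \<le> 2 * K * L * dist y z"
        by simp
    qed
  qed
  have 3: "qnear I (2 * K * L * dist y z) (g y) (g z)" if "y \<in> A" "z \<in> A" for y z
  proof (rule qnear_mono)
    show "qnear I (L * dist y z) (g y) (g z)"
      using qlipD[OF f that] that by (simp add: g_def)
    show "L * dist y z \<le> 2 * K * L * dist y z"
      using KL by (intro mult_right_mono) auto
  qed
  have "qlip I (2 * K * L) (A \<union> B) g"
    unfolding qlip_def
  proof (intro ballI)
    fix y z assume "y \<in> A \<union> B" "z \<in> A \<union> B"
    then show "qnear I (2 * K * L * dist y z) (g y) (g z)"
      using 1[of y z] 2[of y z] 3[of y z] qnear_sym[OF 1[of z y]] by (auto simp: dist_commute)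
  qed
  then show ?thesis
    by (intro exI[of _ g]) (auto simp: g_def B_def)
qed

text \<open>Colours are treated one after the other, each multiplying the constant by
  \<open>2 * K\<close>; thus the number of colours enters and not the number of balls. The
  hypothesis \<open>loc\<close> speaks of an arbitrary extension \<open>h\<close> of
  \<open>f\<close>, because the map to be extended changes with each colour, and allows for every
  constant met on the way.\<close>

lemma qlip_colours:
  fixes f :: "'e::metric_space \<Rightarrow> 'i \<Rightarrow> 'b::metric_space"
  assumes f: "qlip I 1 A f" and K: "1 \<le> K" and S: "finite S"
    and X: "\<And>c. X c \<subseteq> A" and r: "\<And>c x. x \<in> X c \<Longrightarrow> 0 \<le> r x"
    and sep: "\<And>c x x'. x \<in> X c \<Longrightarrow> x' \<in> X c \<Longrightarrow> x \<noteq> x' \<Longrightarrow> 8 * r x \<le> dist x x'"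
    and loc: "\<And>c x L B h. x \<in> X c \<Longrightarrow> 0 < L \<Longrightarrow> L \<le> (2 * K) ^ card S \<Longrightarrow> qlip I L B h \<Longrightarrow> A \<subseteq> B \<Longrightarrow>
       (\<forall>y\<in>A. h y = f y) \<Longrightarrow> \<exists>g. qlip I (K * L) UNIV g \<and> (\<forall>y\<in>B \<inter> cball x (4 * r x). g y = h y)"
  shows "\<exists>g. qlip I ((2 * K) ^ card S) (A \<union> (\<Union>c\<in>S. \<Union>x\<in>X c. cball x (r x))) g \<and> (\<forall>y\<in>A. g y = f y)"
proof -
  have "\<exists>g. qlip I ((2 * K) ^ card T) (A \<union> (\<Union>c\<in>T. \<Union>x\<in>X c. cball x (r x))) g \<and> (\<forall>y\<in>A. g y = f y)"
    if "finite T" "T \<subseteq> S" for T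
    using that
  proof (induction T rule: finite_induct)
    case empty
    then show ?case
      using f by auto
  next
    case (insert c T)
    let ?B = "A \<union> (\<Union>c\<in>T. \<Union>x\<in>X c. cball x (r x))" and ?L = "(2 * K) ^ card T"
    obtain h where h: "qlip I ?L ?B h" "\<forall>y\<in>A. h y = f y"
      using insert by auto
    have "card T \<le> card S"
      using card_mono[OF S, of T] insert.prems by simp
    then have L: "0 < ?L" "?L \<le> (2 * K) ^ card S"
      by (intro zero_less_power power_increasing; use K in simp)+
    have "\<exists>g. qlip I (2 * K * ?L) (?B \<union> (\<Union>x\<in>X c. cball x (r x))) g \<and> (\<forall>y\<in>?B. g y = h y)"
    proof (rule qlip_colour_step[OF h(1)])
      show "\<exists>g. qlip I (K * ?L) UNIV g \<and> (\<forall>y\<in>?B \<inter> cball x (4 * r x). g y = h y)" if "x \<in> X c" for x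
        by (rule loc[OF that L h(1) _ h(2)]) auto
    qed (use K L X r sep in auto)
    then obtain g where g: "qlip I (2 * K * ?L) (?B \<union> (\<Union>x\<in>X c. cball x (r x))) g" "\<forall>y\<in>?B. g y = h y"
      by blast
    have "2 * K * ?L = (2 * K) ^ card (insert c T)"
      using insert by simp
    moreover have "?B \<union> (\<Union>x\<in>X c. cball x (r x)) = A \<union> (\<Union>c\<in>insert c T. \<Union>x\<in>X c. cball x (r x))"
      by auto
    ultimately show ?case
      using g h(2) by (intro exI[of _ g]) auto
  qed
  then show ?thesis
    using S by blast
qed

text \<open>For \<open>t \<ge> 0\<close> this is the nearest-point projection to the cube of
  half-width \<open>t\<close>. It is Lipschitz in \<open>t\<close> and \<open>v\<close> together
  (\<open>dist_box_clamp\<close>), so the cube may vary with the point.\<close>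

definition box_clamp :: "real \<Rightarrow> 'b::euclidean_space \<Rightarrow> 'b"
  where "box_clamp t v = (\<Sum>b\<in>Basis. max (-t) (min t (v \<bullet> b)) *\<^sub>R b)"

lemma box_clamp_id: "norm v \<le> t \<Longrightarrow> box_clamp t v = v"
proof -
  assume v: "norm v \<le> t"
  have "max (-t) (min t (v \<bullet> b)) = v \<bullet> b" if "b \<in> Basis" for b
    using Basis_le_norm[OF that, of v] v by auto
  then show ?thesis
    by (simp add: box_clamp_def euclidean_representation)
qed

lemma dist_box_clamp:
  fixes v w :: "'b::euclidean_space"
  shows "dist (box_clamp t v) (box_clamp u w) \<le> real DIM('b) * (\<bar>t - u\<bar> + dist v w)"
proof -
  have "dist (box_clamp t v) (box_clamp u w)
      = norm (\<Sum>b\<in>(Basis::'b set). (max (-t) (min t (v \<bullet> b)) - max (-u) (min u (w \<bullet> b))) *\<^sub>R b)"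
    by (simp add: box_clamp_def dist_norm sum_subtractf[symmetric] scaleR_diff_left)
  also have "\<dots> \<le> (\<Sum>b\<in>(Basis::'b set). \<bar>t - u\<bar> + dist v w)"
  proof (rule sum_norm_le)
    fix b :: 'b assume b: "b \<in> Basis"
    have "\<bar>v \<bullet> b - w \<bullet> b\<bar> \<le> dist v w"
      using Basis_le_norm[OF b, of "v - w"] by (simp add: dist_norm inner_diff_left)
    then show "norm ((max (-t) (min t (v \<bullet> b)) - max (-u) (min u (w \<bullet> b))) *\<^sub>R b) \<le> \<bar>t - u\<bar> + dist v w"
      using b by (simp add: max_def min_def abs_if split: if_splits)
  qed
  finally show ?thesis
    by simp
qed

lemma norm_box_clamp:
  fixes v :: "'b::euclidean_space"
  assumes "0 \<le> t" shows "norm (box_clamp t v) \<le> real DIM('b) * t"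
proof -
  have "norm (box_clamp t v) \<le> (\<Sum>b\<in>(Basis::'b set). t)"
    unfolding box_clamp_def using assms by (intro sum_norm_le) auto
  then show ?thesis
    by simp
qed

text \<open>For mean zero, the largest entry \<open>s x\<close> forces a gap of at least
  \<open>s x / n\<close> in \<open>f x\<close> (\<open>tuple_gap\<close>), so on a ball of radius a
  small multiple of \<open>s x\<close> the map splits and extends by assumption. The balls cover a
  neighbourhood of the points with \<open>s x > 0\<close> whose width is proportional to
  \<open>s\<close>; beyond it the extension is brought down to 0 by clamping.\<close>

lemma qlip_mean_zero_extend:
  fixes TE :: "'e::euclidean_space itself" and TB :: "'b::euclidean_space itself"
  assumes I: "finite I" "I \<noteq> {}" and K: "1 \<le> K" and J: "\<And>J. J \<subset> I \<Longrightarrow> qext J K TYPE('e) TYPE('b)"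
  shows "\<exists>C\<ge>1. \<forall>A (f :: 'e \<Rightarrow> 'i \<Rightarrow> 'b). qlip I 1 A f \<longrightarrow> (\<forall>x\<in>A. (\<Sum>i\<in>I. f x i) = 0) \<longrightarrow>
    (\<exists>g. qlip I C UNIV g \<and> (\<forall>x\<in>A. \<forall>i\<in>I. g x i = f x i))"
proof -
  define n where "n = card I"
  have n: "1 \<le> real n"
    using I by (simp add: n_def Suc_le_eq card_gt_0_iff)
  define P where "P = 48 * DIM('e) + 1"
  define cols where "cols = {0..<4::int} \<times> ((Basis :: 'e set) \<rightarrow>\<^sub>E {0..<int P})"
  have cols: "finite cols"
    unfolding cols_def by (intro finite_cartesian_product finite_PiE) auto
  define M where "M = (2 * K) ^ card cols"
  have M: "1 \<le> M"
    unfolding M_def using K by (intro one_le_power) simp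
  \<comment> \<open>Chosen so that the radii \<open>r x = 3 * \<epsilon> * s x\<close> below satisfy
    \<open>4 * L * (4 * r x) < s x / n\<close> for every constant \<open>L \<le> M\<close> met while
    the colours are treated; this amounts to \<open>48 < 100\<close>.\<close>
  define \<epsilon> where "\<epsilon> = 1 / (100 * n * M)"
  have nM: "1 \<le> n * M"
    using n M mult_mono[of 1 n 1 M] by simp
  have \<epsilon>: "0 < \<epsilon>" "\<epsilon> \<le> 1 / 100" "48 * (n * M) * \<epsilon> < 1"
  proof -
    have "\<epsilon> = 1 / (100 * (n * M))"
      by (simp add: \<epsilon>_def)
    then show "0 < \<epsilon>" "\<epsilon> \<le> 1 / 100" "48 * (n * M) * \<epsilon> < 1"
      using nM by (simp_all add: divide_le_eq)
  qed
  have "\<exists>(cell :: 'e \<Rightarrow> real \<Rightarrow> int \<times> ('e \<Rightarrow> int)) (col :: int \<times> ('e \<Rightarrow> int) \<Rightarrow> (int \<times> ('e \<Rightarrow> int))).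
    (\<forall>c. col c \<in> cols) \<and>
    (\<forall>x x' s s'. 0 < s \<longrightarrow> 0 < s' \<longrightarrow> cell x s = cell x' s' \<longrightarrow> dist x x' \<le> \<epsilon> * s' \<and> s \<le> 2 * s') \<and>
    (\<forall>x x' s s'. 0 < s \<longrightarrow> 0 < s' \<longrightarrow> cell x s \<noteq> cell x' s' \<longrightarrow> col (cell x s) = col (cell x' s') \<longrightarrow>
       \<bar>s - s'\<bar> \<le> dist x x' \<longrightarrow> 24 * \<epsilon> * s \<le> dist x x')"
    unfolding cols_def by (rule scale_colouring) (use \<epsilon> in \<open>auto simp: P_def\<close>)
  then obtain cell :: "'e \<Rightarrow> real \<Rightarrow> int \<times> ('e \<Rightarrow> int)" and col :: "int \<times> ('e \<Rightarrow> int) \<Rightarrow> (int \<times> ('e \<Rightarrow> int))"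
    where col: "\<And>c. col c \<in> cols"
      and near: "\<And>x x' s s'. 0 < s \<Longrightarrow> 0 < s' \<Longrightarrow> cell x s = cell x' s' \<Longrightarrow> dist x x' \<le> \<epsilon> * s' \<and> s \<le> 2 * s'"
      and far: "\<And>x x' s s'. 0 < s \<Longrightarrow> 0 < s' \<Longrightarrow> cell x s \<noteq> cell x' s' \<Longrightarrow> col (cell x s) = col (cell x' s') \<Longrightarrow>
       \<bar>s - s'\<bar> \<le> dist x x' \<Longrightarrow> 24 * \<epsilon> * s \<le> dist x x'"
    by metis
  \<comment> \<open>\<open>1 / \<epsilon>\<close> is the slope of the clamping height
    \<open>T\<close>, and \<open>M\<close> is the constant of the extension to the balls.\<close>
  define C where "C = real DIM('b) * (1 / \<epsilon> + M)"
  have "1 \<le> real DIM('b)"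
    by (simp add: DIM_positive Suc_leI)
  then have C: "1 \<le> C" "M \<le> C"
    using mult_mono[of 1 "real DIM('b)" 1 "1 / \<epsilon> + M"] mult_mono[of 1 "real DIM('b)" M "1 / \<epsilon> + M"] M \<epsilon>
    by (auto simp: C_def add_increasing)
  have "\<exists>g. qlip I C UNIV g \<and> (\<forall>x\<in>A. \<forall>i\<in>I. g x i = f x i)"
    if f: "qlip I 1 A f" and mean: "\<And>x. x \<in> A \<Longrightarrow> (\<Sum>i\<in>I. f x i) = 0" for A and f :: "'e \<Rightarrow> 'i \<Rightarrow> 'b"
  proof (cases "A = {}")
    case True
    then show ?thesis
      using C by (intro exI[of _ "\<lambda>_ _. 0"]) (auto simp: qlip_def intro!: qnear_pointwise)
  next
    case False
    then obtain a0 where a0: "a0 \<in> A"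
      by auto
    define s where "s x = Max ((\<lambda>i. norm (f x i)) ` I)" for x
    have s_ge: "norm (f x i) \<le> s x" if "i \<in> I" for x i
      using I that by (simp add: s_def)
    have s_at: "\<exists>i\<in>I. s x = norm (f x i)" for x
    proof -
      have "s x \<in> (\<lambda>i. norm (f x i)) ` I"
        unfolding s_def using I by (intro Max_in) auto
      then show ?thesis
        by auto
    qed
    have s_nn: "0 \<le> s x" for x
      using s_at[of x] by auto
    \<comment> \<open>A matching moves the largest entry by at most \<open>dist x y\<close>; hence
      \<open>s\<close> is 1-Lipschitz on \<open>A\<close>.\<close>
    have s_le: "s x \<le> s y + dist x y" if xy: "x \<in> A" "y \<in> A" for x y
    proof -
      obtain \<sigma> where \<sigma>: "\<sigma> permutes I" "\<And>i. i \<in> I \<Longrightarrow> dist (f x i) (f y (\<sigma> i)) \<le> dist x y"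
        using qlipD[OF f xy] by (auto simp: qnear_def)
      obtain i where i: "i \<in> I" "s x = norm (f x i)"
        using s_at by blast
      have "norm (f x i) \<le> norm (f y (\<sigma> i)) + dist (f x i) (f y (\<sigma> i))"
        by (simp add: dist_norm norm_triangle_sub)
      then show ?thesis
        using i \<sigma>(2)[OF i(1)] s_ge[of "\<sigma> i" y] permutes_in_image[OF \<sigma>(1)] by auto
    qed
    have s_lip: "\<bar>s x - s y\<bar> \<le> dist x y" if "x \<in> A" "y \<in> A" for x y
      using s_le[OF that] s_le[OF that(2,1)] by (simp add: dist_commute abs_le_iff)
    define cl where "cl x = cell x (s x)" for x
    \<comment> \<open>One point of \<open>A\<close> is kept for each occupied cell;
      \<open>X c\<close> collects those whose cell has colour \<open>c\<close>.\<close>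
    define rep where "rep c = (SOME x. x \<in> A \<and> 0 < s x \<and> cl x = c)" for c
    have rep: "rep (cl x) \<in> A" "0 < s (rep (cl x))" "cl (rep (cl x)) = cl x" if "x \<in> A" "0 < s x" for x
      using someI[of "\<lambda>y. y \<in> A \<and> 0 < s y \<and> cl y = cl x" x] that by (auto simp: rep_def)
    define X where "X c = {x \<in> A. 0 < s x \<and> x = rep (cl x) \<and> col (cl x) = c}" for c
    \<comment> \<open>Three times \<open>\<epsilon> * s x\<close>, because a point within
      \<open>\<epsilon> * s a\<close> of \<open>a\<close> lies within
      \<open>2 * \<epsilon> * s x + \<epsilon> * s x\<close> of the representative \<open>x\<close>
      of the cell of \<open>a\<close>, given \<open>s a \<le> 2 * s x\<close>.\<close>
    define r where "r x = 3 * \<epsilon> * s x" for x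
    have "\<exists>g. qlip I ((2 * K) ^ card cols) (A \<union> (\<Union>c\<in>cols. \<Union>x\<in>X c. cball x (r x))) g \<and> (\<forall>y\<in>A. g y = f y)"
    proof (rule qlip_colours[OF f K cols])
      fix c show "X c \<subseteq> A"
        by (auto simp: X_def)
    next
      fix c x assume "x \<in> X c" then show "0 \<le> r x"
        using \<epsilon> s_nn by (simp add: r_def)
    next
      fix c x x' assume x: "x \<in> X c" "x' \<in> X c" "x \<noteq> x'"
      have e: "x = rep (cl x)" "x' = rep (cl x')" and A: "x \<in> A" "0 < s x" "x' \<in> A" "0 < s x'"
        and cc: "col (cl x) = c" "col (cl x') = c"
        using x unfolding X_def by blast+
      have "cl x \<noteq> cl x'"
        using e x(3) by metis
      then show "8 * r x \<le> dist x x'"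
        using far[OF A(2,4) _ _ s_lip[OF A(1,3)]] cc by (simp add: cl_def r_def)
    next
      fix c x L B and h :: "'e \<Rightarrow> 'i \<Rightarrow> 'b"
      assume x: "x \<in> X c" and L: "0 < L" "L \<le> (2 * K) ^ card cols" and h: "qlip I L B h" "A \<subseteq> B" "\<forall>y\<in>A. h y = f y"
      have xA: "x \<in> A" "0 < s x" "h x = f x"
        using x h(3) unfolding X_def by blast+
      obtain i where i: "i \<in> I" "s x = norm (f x i)"
        using s_at by blast
      obtain J1 J2 where J12: "I = J1 \<union> J2" "J1 \<inter> J2 = {}" "J1 \<noteq> {}" "J2 \<noteq> {}"
        and gap: "\<forall>i\<in>J1. \<forall>j\<in>J2. s x / n \<le> dist (f x i) (f x j)"
        using tuple_gap[OF I(1) i(1) _ mean[OF xA(1)]] xA(2) unfolding i(2) n_def by blast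
      have sub: "J1 \<subset> I" "J2 \<subset> I"
        using J12 by auto
      show "\<exists>g. qlip I (K * L) UNIV g \<and> (\<forall>y\<in>B \<inter> cball x (4 * r x). g y = h y)"
      proof (rule qlip_split_extend[OF I(1) J12(1,2) J[OF sub(1)] J[OF sub(2)] L(1)])
        show "qlip I L (B \<inter> cball x (4 * r x)) h"
          using h(1) by (rule qlip_mono) auto
        show "x \<in> B \<inter> cball x (4 * r x)"
          using xA h \<epsilon> by (auto simp: r_def)
        show "B \<inter> cball x (4 * r x) \<subseteq> cball x (4 * r x)"
          by auto
        fix i j assume ij: "i \<in> J1" "j \<in> J2"
        have "4 * L * (4 * r x) = 48 * L * \<epsilon> * s x"
          by (simp add: r_def)
        also have "\<dots> \<le> 48 * M * \<epsilon> * s x"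
          using L \<epsilon> xA by (intro mult_right_mono mult_left_mono) (auto simp: M_def)
        also have "\<dots> < s x / n"
          using \<epsilon>(3) n xA(2) mult_strict_right_mono[OF \<epsilon>(3) xA(2)] by (simp add: less_divide_eq mult_ac)
        also have "\<dots> \<le> dist (h x i) (h x j)"
          using gap ij xA by simp
        finally show "4 * L * (4 * r x) < dist (h x i) (h x j)" .
      qed
    qed
    then obtain g1 where g1: "qlip I M (A \<union> (\<Union>c\<in>cols. \<Union>x\<in>X c. cball x (r x))) g1"
      and g1A: "\<And>y. y \<in> A \<Longrightarrow> g1 y = f y"
      unfolding M_def by blast
    define A1 where "A1 = A \<union> (\<Union>c\<in>cols. \<Union>x\<in>X c. cball x (r x))"
    \<comment> \<open>\<open>T\<close> is the upper envelope of cones of slope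
      \<open>1 / \<epsilon>\<close> and height \<open>s a\<close> over \<open>a\<close>, cut at 0.
      It agrees with \<open>s\<close> on \<open>A\<close> because \<open>s\<close> is 1-Lipschitz
      there, and it is positive only within \<open>\<epsilon> * s a\<close> of some
      \<open>a\<close>, thus inside \<open>A1\<close>.\<close>
    define t where "t y a = max 0 (s a - dist a y / \<epsilon>)" for y a
    define T where "T y = (SUP a\<in>A. t y a)" for y
    have k: "dist a y \<le> dist a y / \<epsilon>" for a y :: 'e
      using \<epsilon> mult_right_mono[of \<epsilon> 1 "dist a y"] by (simp add: le_divide_eq mult.commute)
    have tb: "t y a \<le> s a' + dist a' y" if "a \<in> A" "a' \<in> A" for y a a'
      using s_le[OF that] s_nn[of a'] k[of a y] dist_triangle[of a a' y] by (simp add: t_def dist_commute)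
    then have bdd: "bdd_above (t y ` A)" for y
      using a0 by (intro bdd_aboveI2[of _ _ "s a0 + dist a0 y"]) auto
    have T_nn: "0 \<le> T y" for y
      using cSUP_upper2[OF bdd[of y] a0, of 0] by (simp add: T_def t_def)
    have T_A: "T y = s y" if "y \<in> A" for y
    proof (rule antisym)
      show "T y \<le> s y"
        unfolding T_def using a0 tb[OF _ that, of _ y] by (intro cSUP_least) auto
      show "s y \<le> T y"
        unfolding T_def by (rule cSUP_upper2[OF bdd that]) (simp add: t_def)
    qed
    have T_le: "T y \<le> T z + dist y z / \<epsilon>" for y z
      unfolding T_def[of y]
    proof (rule cSUP_least)
      fix a assume a: "a \<in> A"
      have "dist a z / \<epsilon> \<le> dist a y / \<epsilon> + dist y z / \<epsilon>"
        using \<epsilon> dist_triangle[of a z y] by (simp add: add_divide_distrib[symmetric] divide_right_mono)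
      then have "t y a \<le> t z a + dist y z / \<epsilon>"
        using \<epsilon> by (auto simp: t_def max_def)
      also have "t z a \<le> T z"
        unfolding T_def by (rule cSUP_upper[OF a bdd])
      finally show "t y a \<le> T z + dist y z / \<epsilon>"
        by simp
    qed (use a0 in auto)
    have T_lip: "\<bar>T y - T z\<bar> \<le> dist y z / \<epsilon>" for y z
      using T_le[of y z] T_le[of z y] by (simp add: abs_le_iff dist_commute)
    have T_pos: "y \<in> A1" if "0 < T y" for y
    proof -
      have "\<exists>a\<in>A. 0 < t y a"
      proof (rule ccontr)
        assume "\<not> ?thesis"
        then have "T y \<le> 0"
          unfolding T_def using False by (intro cSUP_least) auto
        then show False
          using that by simp
      qed
      then obtain a where a: "a \<in> A" "0 < t y a"
        by auto
      then have "dist a y / \<epsilon> < s a"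
        by (simp add: t_def split: if_splits)
      moreover have "0 \<le> dist a y / \<epsilon>"
        using \<epsilon> by simp
      ultimately have sa: "0 < s a"
        by linarith
      have d: "dist a y < \<epsilon> * s a"
        using \<open>dist a y / \<epsilon> < s a\<close> \<epsilon> by (simp add: divide_less_eq mult.commute)
      let ?x = "rep (cl a)"
      note x = rep[OF a(1) sa]
      have n: "dist a ?x \<le> \<epsilon> * s ?x" "s a \<le> 2 * s ?x"
        using near[OF sa x(2), of a ?x] x(3) by (auto simp: cl_def)
      have "\<epsilon> * s a \<le> \<epsilon> * (2 * s ?x)"
        using n(2) \<epsilon> by (intro mult_left_mono) auto
      then have "dist ?x y \<le> r ?x"
        using dist_triangle3[of ?x y a] d n by (simp add: r_def)
      moreover have "?x \<in> X (col (cl a))"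
        using x by (simp add: X_def)
      ultimately show ?thesis
        unfolding A1_def using col[of "cl a"] by (intro UnI2 UN_I[of "col (cl a)"] UN_I[of ?x]) auto
    qed
    \<comment> \<open>Nothing is cut off on \<open>A\<close>, where the entries have norm at most
      \<open>s = T\<close>; and \<open>g1\<close> is consulted only where \<open>T\<close> is
      positive, inside the set on which it is controlled.\<close>
    define g where "g y i = (if 0 < T y then box_clamp (T y) (g1 y i) else 0)" for y i
    have g_one: "qnear I (C * dist y z) (g y) (g z)" if Tz: "\<not> 0 < T z" for y z
    proof (rule qnear_pointwise)
      fix i
      have "dist (g y i) (g z i) \<le> real DIM('b) * T y"
        using norm_box_clamp[OF T_nn[of y], of "g1 y i"] Tz T_nn[of y] by (auto simp: g_def)
      also have "\<dots> \<le> real DIM('b) * (dist y z / \<epsilon>)"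
        using T_lip[of y z] Tz T_nn[of z] by (intro mult_left_mono) auto
      also have "\<dots> \<le> C * dist y z"
        unfolding C_def mult.assoc using M by (intro mult_left_mono) (auto simp: algebra_simps)
      finally show "dist (g y i) (g z i) \<le> C * dist y z" .
    qed
    have g_two: "qnear I (C * dist y z) (g y) (g z)" if T0: "0 < T y" "0 < T z" for y z
    proof -
      obtain \<sigma> where \<sigma>: "\<sigma> permutes I" "\<And>i. i \<in> I \<Longrightarrow> dist (g1 y i) (g1 z (\<sigma> i)) \<le> M * dist y z"
        using qlipD[OF g1[folded A1_def] T_pos[OF T0(1)] T_pos[OF T0(2)]] by (auto simp: qnear_def)
      have "dist (g y i) (g z (\<sigma> i)) \<le> C * dist y z" if "i \<in> I" for i
      proof -
        have "dist (g y i) (g z (\<sigma> i)) \<le> real DIM('b) * (\<bar>T y - T z\<bar> + dist (g1 y i) (g1 z (\<sigma> i)))"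
          using dist_box_clamp T0 by (simp add: g_def)
        also have "\<dots> \<le> real DIM('b) * (dist y z / \<epsilon> + M * dist y z)"
          using T_lip \<sigma>(2)[OF that] by (intro mult_left_mono add_mono) auto
        finally show ?thesis
          by (simp add: C_def algebra_simps)
      qed
      then show ?thesis
        unfolding qnear_def using \<sigma>(1) by blast
    qed
    have "qlip I C UNIV g"
      unfolding qlip_def
    proof (intro ballI)
      fix y z
      show "qnear I (C * dist y z) (g y) (g z)"
        using g_one[of z y] g_two[of y z] qnear_sym[OF g_one[of y z]] by (auto simp: dist_commute)
    qed
    moreover have "g x i = f x i" if "x \<in> A" "i \<in> I" for x i
    proof (cases "0 < s x")
      case True
      then show ?thesis
        using s_ge[OF that(2), of x] T_A[OF that(1)] g1A[OF that(1)] by (simp add: g_def box_clamp_id)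
    next
      case False
      then have "norm (f x i) \<le> 0"
        using s_ge[OF that(2), of x] by linarith
      then show ?thesis
        using False T_A[OF that(1)] by (simp add: g_def)
    qed
    ultimately show ?thesis
      by blast
  qed
  then show ?thesis
    using C by blast
qed

text \<open>The mean does not depend on the labelling, so it is an ordinary Lipschitz map and
  extends by \<open>mcshane\<close>; what remains has mean zero.\<close>

lemma qlip_extend_step:
  fixes I :: "'i set"
  assumes I: "finite I" "I \<noteq> {}" and K: "1 \<le> K"
    and J: "\<And>J. J \<subset> I \<Longrightarrow> qext J K TYPE('e::euclidean_space) TYPE('b::euclidean_space)"
  shows "\<exists>C\<ge>1. qext I C TYPE('e) TYPE('b)"
proof -
  obtain C where C: "1 \<le> C" and ext: "\<And>A (f :: 'e \<Rightarrow> 'i \<Rightarrow> 'b). qlip I 1 A f \<Longrightarrow> (\<forall>x\<in>A. (\<Sum>i\<in>I. f x i) = 0) \<Longrightarrow>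
    (\<exists>g. qlip I C UNIV g \<and> (\<forall>x\<in>A. \<forall>i\<in>I. g x i = f x i))"
    using qlip_mean_zero_extend[OF I K J] by metis
  define n where "n = real (card I)"
  have n: "0 < n"
    using I by (simp add: n_def card_gt_0_iff)
  have "\<exists>g. qlip I ((2 * C + real DIM('b)) * L) UNIV g \<and> (\<forall>x\<in>A. g x = f x)"
    if L: "0 < L" and f: "qlip I L A f" for A L and f :: "'e \<Rightarrow> 'i \<Rightarrow> 'b"
  proof -
    define m where "m x = (\<Sum>i\<in>I. f x i) /\<^sub>R n" for x
    have m: "L-lipschitz_on A m"
    proof (rule lipschitz_onI)
      fix x y assume xy: "x \<in> A" "y \<in> A"
      obtain \<sigma> where \<sigma>: "\<sigma> permutes I" "\<And>i. i \<in> I \<Longrightarrow> dist (f x i) (f y (\<sigma> i)) \<le> L * dist x y"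
        using qlipD[OF f xy] by (auto simp: qnear_def)
      have "m x - m y = (\<Sum>i\<in>I. f x i - f y (\<sigma> i)) /\<^sub>R n"
        using sum.permute[OF \<sigma>(1), of "f y"] by (simp add: m_def sum_subtractf scaleR_diff_right o_def)
      then have "dist (m x) (m y) = norm (\<Sum>i\<in>I. f x i - f y (\<sigma> i)) / n"
        using n by (simp add: dist_norm divide_inverse mult.commute)
      also have "\<dots> \<le> (\<Sum>i\<in>I. L * dist x y) / n"
        using n \<sigma>(2) by (intro divide_right_mono sum_norm_le) (auto simp: dist_norm)
      also have "\<dots> = L * dist x y"
        using n by (simp add: n_def)
      finally show "dist (m x) (m y) \<le> L * dist x y" .
    qed (use L in simp)
    obtain mt where mt: "(real DIM('b) * L)-lipschitz_on UNIV mt" "\<And>x. x \<in> A \<Longrightarrow> mt x = m x"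
      using mcshane[OF m] by blast
    \<comment> \<open>\<open>f\<close> and its mean each contribute \<open>L\<close> to the
      Lipschitz constant of the difference, whence the divisor \<open>2 * L\<close>.\<close>
    define f0 where "f0 x i = (f x i - m x) /\<^sub>R (2 * L)" for x i
    have "qlip I 1 A f0"
      unfolding qlip_def
    proof (intro ballI)
      fix x y assume xy: "x \<in> A" "y \<in> A"
      obtain \<sigma> where \<sigma>: "\<sigma> permutes I" "\<And>i. i \<in> I \<Longrightarrow> dist (f x i) (f y (\<sigma> i)) \<le> L * dist x y"
        using qlipD[OF f xy] by (auto simp: qnear_def)
      have "dist (f0 x i) (f0 y (\<sigma> i)) \<le> 1 * dist x y" if "i \<in> I" for i
      proof -
        have "dist (f0 x i) (f0 y (\<sigma> i)) = norm ((f x i - f y (\<sigma> i)) - (m x - m y)) / (2 * L)"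
        proof -
          have "f0 x i - f0 y (\<sigma> i) = ((f x i - f y (\<sigma> i)) - (m x - m y)) /\<^sub>R (2 * L)"
            by (simp add: f0_def algebra_simps)
          then have "dist (f0 x i) (f0 y (\<sigma> i)) = inverse (2 * L) * norm ((f x i - f y (\<sigma> i)) - (m x - m y))"
            unfolding dist_norm using L by (simp only: norm_scaleR) simp
          then show ?thesis
            by (simp only: divide_inverse_commute)
        qed
        also have "\<dots> \<le> (L * dist x y + L * dist x y) / (2 * L)"
        proof (rule divide_right_mono)
          show "norm ((f x i - f y (\<sigma> i)) - (m x - m y)) \<le> L * dist x y + L * dist x y"
            using norm_triangle_ineq4[of "f x i - f y (\<sigma> i)" "m x - m y"] \<sigma>(2)[OF that] lipschitz_onD[OF m xy]
            unfolding dist_norm by linarith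
        qed (use L in simp)
        also have "\<dots> = 1 * dist x y"
          using L by simp
        finally show ?thesis .
      qed
      then show "qnear I (1 * dist x y) (f0 x) (f0 y)"
        unfolding qnear_def using \<sigma>(1) by blast
    qed
    moreover have "(\<Sum>i\<in>I. f0 x i) = 0" for x
    proof -
      have "(\<Sum>i\<in>I. f0 x i) = ((\<Sum>i\<in>I. f x i) - n *\<^sub>R m x) /\<^sub>R (2 * L)"
        by (simp add: f0_def scaleR_sum_right[symmetric] sum_subtractf n_def sum_constant_scaleR)
      then show ?thesis
        using n by (simp add: m_def)
    qed
    ultimately obtain g0 where g0: "qlip I C UNIV g0" "\<And>x i. x \<in> A \<Longrightarrow> i \<in> I \<Longrightarrow> g0 x i = f0 x i"
      using ext[of A f0] by metis
    define g where "g x i = (2 * L) *\<^sub>R g0 x i + mt x" for x i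
    have g: "qlip I ((2 * C + real DIM('b)) * L) UNIV g"
      unfolding qlip_def
    proof (intro ballI)
      fix x y :: 'e
      obtain \<sigma> where \<sigma>: "\<sigma> permutes I" "\<And>i. i \<in> I \<Longrightarrow> dist (g0 x i) (g0 y (\<sigma> i)) \<le> C * dist x y"
        using qlipD[OF g0(1), of x y] by (auto simp: qnear_def)
      have "dist (g x i) (g y (\<sigma> i)) \<le> (2 * C + real DIM('b)) * L * dist x y" if "i \<in> I" for i
      proof -
        have "dist (g x i) (g y (\<sigma> i)) = norm ((2 * L) *\<^sub>R (g0 x i - g0 y (\<sigma> i)) + (mt x - mt y))"
          by (simp add: g_def dist_norm algebra_simps)
        also have "\<dots> \<le> (2 * L) * dist (g0 x i) (g0 y (\<sigma> i)) + dist (mt x) (mt y)"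
          using L norm_triangle_ineq[of "(2 * L) *\<^sub>R (g0 x i - g0 y (\<sigma> i))" "mt x - mt y"] by (simp add: dist_norm)
        also have "\<dots> \<le> (2 * L) * (C * dist x y) + real DIM('b) * L * dist x y"
          using L \<sigma>(2)[OF that] lipschitz_onD[OF mt(1), of x y] by (intro add_mono mult_left_mono) auto
        finally show ?thesis
          by (simp add: algebra_simps)
      qed
      then show "qnear I ((2 * C + real DIM('b)) * L * dist x y) (g x) (g y)"
        unfolding qnear_def using \<sigma>(1) by blast
    qed
    have "g x i = f x i" if "x \<in> A" "i \<in> I" for x i
      using g0(2)[OF that] mt(2)[OF that(1)] L by (simp add: g_def f0_def)
    then have "qlip I ((2 * C + real DIM('b)) * L) UNIV (\<lambda>x. if x \<in> A then f x else g x)"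
      by (intro qlip_transfer[OF g]) (auto intro: qnear_pointwise)
    then show ?thesis
      by (intro exI[of _ "\<lambda>x. if x \<in> A then f x else g x"]) auto
  qed
  then show ?thesis
    using C unfolding qext_def by (intro exI[of _ "2 * C + real DIM('b)"]) auto
qed

text \<open>Induction over proper subsets, with the largest of their constants. A single index is no
  exception: there the mean-zero part vanishes and the step reduces to
  \<open>mcshane\<close>.\<close>

theorem qlip_extend:
  assumes "finite I"
  shows "\<exists>C\<ge>1. qext I C TYPE('e::euclidean_space) TYPE('b::euclidean_space)"
  using assms
proof (induction I rule: finite_psubset_induct)
  case (psubset I)
  show ?case
  proof (cases "I = {}")
    case True
    then show ?thesis
      by (intro exI[of _ 1]) (auto simp: qext_def qlip_def intro!: qnear_pointwise)
  next
    case False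
    have "\<forall>J. \<exists>C. J \<subset> I \<longrightarrow> 1 \<le> C \<and> qext J C TYPE('e) TYPE('b)"
      using psubset by blast
    then obtain C where C: "\<And>J. J \<subset> I \<Longrightarrow> 1 \<le> C J \<and> qext J (C J) TYPE('e) TYPE('b)"
      by metis
    define K where "K = Max (C ` {J. J \<subset> I})"
    have fin: "finite (C ` {J. J \<subset> I})"
      using psubset(1) by (auto intro: finite_subset[of _ "Pow I"])
    have K: "C J \<le> K" if "J \<subset> I" for J
      unfolding K_def using fin that by (intro Max_ge) auto
    have "qext J K TYPE('e) TYPE('b)" if J: "J \<subset> I" for J
      unfolding qext_def
    proof (intro allI impI)
      fix A L and f :: "'e \<Rightarrow> 'a \<Rightarrow> 'b"
      assume L: "0 < L" "qlip J L A f"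
      then obtain g where g: "qlip J (C J * L) UNIV g" "\<forall>x\<in>A. g x = f x"
        using qextD[OF conjunct2[OF C[OF J]]] by blast
      then show "\<exists>g. qlip J (K * L) UNIV g \<and> (\<forall>x\<in>A. g x = f x)"
        using K[OF J] L by (intro exI[of _ g] conjI qlip_mono[OF g(1)]) auto
    qed
    moreover have "1 \<le> K"
    proof -
      have "{} \<subset> I"
        using False by auto
      then show ?thesis
        using C[of "{}"] K[of "{}"] by linarith
    qed
    ultimately show ?thesis
      using qlip_extend_step[OF psubset(1) False] by blast
  qed
qed

section \<open>Weak limits of bounded sequences in \<open>L\<^sub>p\<close>\<close>

text \<open>The mean value theorem on either side of 1, where \<open>z powr (p - 1)\<close> lies
  strictly above or strictly below 1. The strictness is what uniform convexity is built on.\<close>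

lemma powr_bernoulli_strict:
  fixes x p :: real
  assumes p: "1 < p" and x: "0 \<le> x" "x \<noteq> 1"
  shows "1 + p * (x - 1) < x powr p"
proof (cases "x = 0")
  case True
  then show ?thesis using p by simp
next
  case False
  then have x0: "0 < x" using x by simp
  have D: "((\<lambda>y. y powr p) has_real_derivative p * y powr (p - 1)) (at y)" if "0 < y" for y
    using that by (auto intro!: derivative_eq_intros)
  consider "1 < x" | "x < 1" using x by linarith
  then show ?thesis
  proof cases
    case 1
    obtain z where z: "1 < z" "z < x" "x powr p - 1 powr p = (x - 1) * (p * z powr (p - 1))"
      using MVT2[OF 1, of "\<lambda>y. y powr p" "\<lambda>y. p * y powr (p - 1)"] D by auto
    have "1 < z powr (p - 1)"
      using z p by (simp add: gr_one_powr)
    then have "(x - 1) * (p * 1) < (x - 1) * (p * z powr (p - 1))"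
      using 1 p by (intro mult_strict_left_mono) auto
    then show ?thesis
      using z(3) by (simp add: mult.commute)
  next
    case 2
    obtain z where z: "x < z" "z < 1" "1 powr p - x powr p = (1 - x) * (p * z powr (p - 1))"
      using MVT2[OF 2, of "\<lambda>y. y powr p" "\<lambda>y. p * y powr (p - 1)"] D x0 by auto
    have "z powr (p - 1) < 1 powr (p - 1)"
      using z x0 p by (intro powr_less_mono2) auto
    then have "(1 - x) * (p * z powr (p - 1)) < (1 - x) * (p * 1)"
      using 2 p by (intro mult_strict_left_mono) auto
    then have "1 - x powr p < (1 - x) * p"
      using z(3) by simp
    then show ?thesis
      by (simp add: algebra_simps)
  qed
qed

lemma powr_bernoulli:
  fixes x p :: real
  assumes "1 < p" "0 \<le> x"
  shows "1 + p * (x - 1) \<le> x powr p"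
  using powr_bernoulli_strict[OF assms] by (cases "x = 1") auto

text \<open>Add the strict tangent inequalities at the midpoint \<open>m\<close>, scaled to 1; the
  linear terms cancel.\<close>

lemma powr_midpoint_strict:
  fixes s t p :: real
  assumes p: "1 < p" and st: "0 \<le> s" "0 \<le> t" "s \<noteq> t"
  shows "((s + t) / 2) powr p < (s powr p + t powr p) / 2"
proof -
  define m where "m = (s + t) / 2"
  have m: "0 < m"
    using st by (auto simp: m_def)
  have "1 + p * (s / m - 1) < (s / m) powr p" "1 + p * (t / m - 1) < (t / m) powr p"
    using st m by (intro powr_bernoulli_strict[OF p]; simp add: m_def)+
  then have "2 + p * ((s + t) / m - 2) < (s / m) powr p + (t / m) powr p"
    by (simp add: algebra_simps add_divide_distrib)
  also have "(s + t) / m = 2"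
    using m by (simp add: divide_eq_eq) (simp add: m_def)
  also have "(s / m) powr p + (t / m) powr p = (s powr p + t powr p) / m powr p"
    using st m by (simp add: powr_divide add_divide_distrib)
  finally have "2 * m powr p < s powr p + t powr p"
    using m by (simp add: less_divide_eq)
  then show ?thesis
    by (simp add: m_def)
qed

text \<open>Unequal norms are settled by strict convexity of the power, equal norms by the
  parallelogram law, which makes the midpoint strictly shorter.\<close>

lemma norm_powr_midpoint_strict:
  fixes a b :: "'c::real_inner"
  assumes p: "1 < p" and ab: "a \<noteq> b"
  shows "norm ((1/2) *\<^sub>R (a + b)) powr p < (norm a powr p + norm b powr p) / 2"
proof (cases "norm a = norm b")
  case False
  have "norm ((1/2) *\<^sub>R (a + b)) powr p \<le> ((norm a + norm b) / 2) powr p"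
    using p by (intro powr_mono2) (auto intro: norm_triangle_ineq)
  also have "\<dots> < (norm a powr p + norm b powr p) / 2"
    using p False by (intro powr_midpoint_strict) auto
  finally show ?thesis .
next
  case True
  have "norm (a + b)^2 + norm (a - b)^2 = 2 * norm a ^2 + 2 * norm b^2"
    by (simp add: power2_norm_eq_inner inner_add_left inner_add_right inner_diff_left inner_diff_right)
  moreover have "0 < norm (a - b)^2"
    using ab by simp
  ultimately have "norm (a + b)^2 < 2 * norm a ^2 + 2 * norm b^2"
    by linarith
  then have "norm (a + b)^2 < (2 * norm b)^2"
    using True by (simp add: power_mult_distrib)
  then have "norm (a + b) < 2 * norm b"
    by (rule power2_less_imp_less) simp
  then have "norm ((1/2) *\<^sub>R (a + b)) powr p < norm b powr p"
    using p by (intro powr_less_mono2) auto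
  then show ?thesis
    using True by simp
qed

lemma norm_powr_midpoint:
  fixes a b :: "'c::real_inner"
  assumes p: "1 < p"
  shows "norm ((1/2) *\<^sub>R (a + b)) powr p \<le> (norm a powr p + norm b powr p) / 2"
proof (cases "a = b")
  case True
  then have "(1/2) *\<^sub>R (a + b) = b"
    by (simp add: scaleR_2[symmetric])
  then show ?thesis using True by simp
qed (use norm_powr_midpoint_strict[OF p, of a b] in simp)

lemma powr_add_le:
  fixes s t p :: real
  assumes "0 < p" "0 \<le> s" "0 \<le> t"
  shows "(s + t) powr p \<le> 2 powr p * (s powr p + t powr p)"
proof -
  have "(s + t) powr p \<le> (2 * max s t) powr p"
    using assms by (intro powr_mono2) auto
  also have "\<dots> = 2 powr p * max s t powr p"
    using assms by (simp add: powr_mult)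
  also have "\<dots> \<le> 2 powr p * (s powr p + t powr p)"
    by (intro mult_left_mono) (auto simp: max_def)
  finally show ?thesis .
qed

text \<open>Uniform convexity of the \<open>p\<close>-th power, by compactness of the unit sphere and homogeneity.\<close>

lemma uniform_convexity_powr:
  fixes TC :: "'c::euclidean_space itself"
  assumes p: "1 < p" and \<epsilon>: "0 < \<epsilon>"
  shows "\<exists>C\<ge>0. \<forall>a b :: 'c. norm (a - b) powr p \<le> \<epsilon> * (norm a powr p + norm b powr p)
    + C * ((norm a powr p + norm b powr p) / 2 - norm ((1/2) *\<^sub>R (a + b)) powr p)"
proof -
  define D where "D z = (norm (fst z) powr p + norm (snd z) powr p) / 2 - norm ((1/2) *\<^sub>R (fst z + snd z)) powr p"
    for z :: "'c \<times> 'c"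
  \<comment> \<open>Normalised pairs that are not close together. On this compact set the convexity
    deficit \<open>D\<close> is bounded below by a positive \<open>\<delta>\<close>.\<close>
  define S where "S = {z :: 'c \<times> 'c. norm (fst z) powr p + norm (snd z) powr p = 1 \<and> \<epsilon> \<le> norm (fst z - snd z) powr p}"
  have c: "continuous_on UNIV (\<lambda>z. norm (h z) powr p)" if "continuous_on UNIV h" for h :: "'c \<times> 'c \<Rightarrow> 'c"
    using p that by (intro continuous_on_powr' continuous_intros) auto
  have c1: "continuous_on UNIV (\<lambda>z :: 'c \<times> 'c. norm (fst z) powr p)" "continuous_on UNIV (\<lambda>z :: 'c \<times> 'c. norm (snd z) powr p)"
    "continuous_on UNIV (\<lambda>z :: 'c \<times> 'c. norm ((1/2) *\<^sub>R (fst z + snd z)) powr p)" "continuous_on UNIV (\<lambda>z :: 'c \<times> 'c. norm (fst z - snd z) powr p)"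

    by - (rule c, (intro continuous_intros)[1])+
  have D: "continuous_on UNIV D"
    unfolding D_def by (intro continuous_on_diff continuous_on_divide continuous_on_add continuous_on_const c1) auto
  have "closed S"
    unfolding S_def by (intro closed_Collect_conj closed_Collect_eq closed_Collect_le continuous_on_add continuous_on_const c1)
  moreover have "bounded S"
  proof (rule bounded_subset)
    show "S \<subseteq> cball 0 1 \<times> cball 0 1"
    proof
      fix z assume z: "z \<in> S"
      have le1: "t \<le> 1" if "t powr p \<le> 1" "0 \<le> t" for t :: real
      proof (rule ccontr)
        assume "\<not> t \<le> 1"
        then have "1 < t powr p"
          using p by (intro gr_one_powr) auto
        then show False
          using that by simp
      qed
      have "norm (fst z) \<le> 1" "norm (snd z) \<le> 1"
      proof -
        have "norm (fst z) powr p + norm (snd z) powr p = 1"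
          using z by (simp add: S_def)
        then have "norm (fst z) powr p \<le> 1" "norm (snd z) powr p \<le> 1"
          using powr_ge_zero[of "norm (fst z)" p] powr_ge_zero[of "norm (snd z)" p] by linarith+
        then show "norm (fst z) \<le> 1" "norm (snd z) \<le> 1"
          by (auto intro: le1)
      qed
      then show "z \<in> cball 0 1 \<times> cball 0 1"
        by (cases z) auto
    qed
  qed (auto intro: bounded_Times)
  ultimately have S: "compact S"
    using compact_eq_bounded_closed by blast
  have Dnn: "0 \<le> D z" for z
    using norm_powr_midpoint[OF p, of "fst z" "snd z"] by (simp add: D_def)
  obtain \<delta> where \<delta>: "0 < \<delta>" "\<And>z. z \<in> S \<Longrightarrow> \<delta> \<le> D z"
  proof (cases "S = {}")
    case True
    then show ?thesis using that[of 1] by auto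
  next
    case False
    then obtain z where z: "z \<in> S" "\<And>y. y \<in> S \<Longrightarrow> D z \<le> D y"
      using continuous_attains_inf[OF S False continuous_on_subset[OF D]] by auto
    have "fst z \<noteq> snd z"
      using z(1) \<epsilon> by (auto simp: S_def)
    then have "0 < D z"
      using norm_powr_midpoint_strict[OF p, of "fst z" "snd z"] by (simp add: D_def)
    then show ?thesis
      using that z by blast
  qed
  \<comment> \<open>Then \<open>C * D\<close> is at least \<open>2 powr p\<close> on
    \<open>S\<close>, which bounds \<open>norm (a - b) powr p\<close> for every normalised
    pair.\<close>
  define C where "C = 2 powr p / \<delta>"
  have C: "0 \<le> C"
    using \<delta> by (simp add: C_def)
  have unit: "norm (a - b) powr p \<le> \<epsilon> + C * D (a, b)" if "norm a powr p + norm b powr p = 1" for a b :: 'c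
  proof (cases "\<epsilon> \<le> norm (a - b) powr p")
    case True
    then have "\<delta> \<le> D (a, b)"
      using that by (intro \<delta>(2)) (simp add: S_def)
    then have "2 powr p \<le> C * D (a, b)"
      using \<delta>(1) mult_left_mono[of \<delta> "D (a,b)" C] C by (simp add: C_def)
    moreover have "norm (a - b) powr p \<le> (norm a + norm b) powr p"
      using p by (intro powr_mono2 norm_triangle_ineq4) auto
    ultimately show ?thesis
      using powr_add_le[of p "norm a" "norm b"] p that \<epsilon> by simp
  qed (use C Dnn[of "(a, b)"] in \<open>simp add: add_increasing2\<close>)
  have "norm (a - b) powr p \<le> \<epsilon> * (norm a powr p + norm b powr p)
    + C * ((norm a powr p + norm b powr p) / 2 - norm ((1/2) *\<^sub>R (a + b)) powr p)" for a b :: 'c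
  proof (cases "a = 0 \<and> b = 0")
    case False
    define s where "s = norm a powr p + norm b powr p"
    \<comment> \<open>Division by \<open>t\<close> normalises the pair; all terms are homogeneous of
      degree \<open>p\<close>.\<close>
    define t where "t = s powr (1 / p)"
    have s: "0 < s"
      using False by (auto simp: s_def add_pos_nonneg add_nonneg_pos)
    have t: "0 < t" "t powr p = s"
      using s p by (auto simp: t_def powr_powr)
    have sc: "norm (z /\<^sub>R t) powr p = norm z powr p / s" for z :: 'c
    proof -
      have "norm (z /\<^sub>R t) = norm z / t"
        using t by (simp add: divide_inverse)
      then show ?thesis
        using t by (simp add: powr_divide)
    qed
    have "norm (a /\<^sub>R t) powr p + norm (b /\<^sub>R t) powr p = 1"
      unfolding sc using s by (simp add: add_divide_distrib[symmetric] s_def)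
    from unit[OF this] have "norm (a - b) powr p / s \<le> \<epsilon> + C * ((norm a powr p / s + norm b powr p / s) / 2 - norm ((1/2) *\<^sub>R (a + b)) powr p / s)"
      unfolding D_def fst_conv snd_conv by (simp only: sc scaleR_diff_right[symmetric] scaleR_add_right[symmetric] scaleR_left_commute)
    then have "norm (a - b) powr p \<le> (\<epsilon> + C * ((norm a powr p / s + norm b powr p / s) / 2 - norm ((1/2) *\<^sub>R (a + b)) powr p / s)) * s"
      using s by (simp add: divide_le_eq)
    also have "\<dots> = \<epsilon> * s + C * ((norm a powr p + norm b powr p) / 2 - norm ((1/2) *\<^sub>R (a + b)) powr p)"
      using s by (simp add: field_simps)
    finally show ?thesis
      by (simp add: s_def)
  qed auto
  then show ?thesis
    using C by blast
qed

section \<open>Integrability, test integrals and completeness in L_p\<close>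

definition Lpn :: "'a measure \<Rightarrow> real \<Rightarrow> ('a \<Rightarrow> 'b::real_normed_vector) \<Rightarrow> ennreal"
  where "Lpn M p v = (\<integral>\<^sup>+x. ennreal (norm (v x) powr p) \<partial>M)"

lemma Lpn_integrable:
  fixes v :: "'a \<Rightarrow> 'b::euclidean_space"
  assumes "v \<in> borel_measurable M" "Lpn M p v < \<infinity>"
  shows "integrable M (\<lambda>x. norm (v x) powr p)" "Lpn M p v = ennreal (\<integral>x. norm (v x) powr p \<partial>M)"
proof -
  show 1: "integrable M (\<lambda>x. norm (v x) powr p)"
    using assms by (intro integrableI_bounded) (auto simp: Lpn_def)
  show "Lpn M p v = ennreal (\<integral>x. norm (v x) powr p \<partial>M)"
    unfolding Lpn_def by (rule nn_integral_eq_integral[OF 1]) auto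
qed

lemma Lpn_add_le:
  fixes v w :: "'a \<Rightarrow> 'b::euclidean_space"
  assumes p: "0 < p" and m: "v \<in> borel_measurable M" "w \<in> borel_measurable M"
    and h: "\<And>x. x \<in> space M \<Longrightarrow> norm (z x) \<le> norm (v x) + norm (w x)"
  shows "Lpn M p z \<le> ennreal (2 powr p) * (Lpn M p v + Lpn M p w)"
proof -
  have "Lpn M p z \<le> (\<integral>\<^sup>+x. ennreal (2 powr p) * (ennreal (norm (v x) powr p) + ennreal (norm (w x) powr p)) \<partial>M)"
    unfolding Lpn_def
  proof (rule nn_integral_mono)
    fix x assume x: "x \<in> space M"
    have "norm (z x) powr p \<le> (norm (v x) + norm (w x)) powr p"
      using p h[OF x] by (intro powr_mono2) auto
    also have "\<dots> \<le> 2 powr p * (norm (v x) powr p + norm (w x) powr p)"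
      using p by (intro powr_add_le) auto
    finally show "ennreal (norm (z x) powr p) \<le> ennreal (2 powr p) * (ennreal (norm (v x) powr p) + ennreal (norm (w x) powr p))"
      by (simp add: ennreal_mult''[symmetric] ennreal_plus[symmetric] del: ennreal_plus)
  qed
  also have "\<dots> = ennreal (2 powr p) * (Lpn M p v + Lpn M p w)"
    unfolding Lpn_def using m by (subst nn_integral_cmult) (auto simp: nn_integral_add)
  finally show ?thesis .
qed

lemma Lpn_add_finite:
  fixes v w :: "'a \<Rightarrow> 'b::euclidean_space"
  assumes "0 < p" "v \<in> borel_measurable M" "w \<in> borel_measurable M"
    and "\<And>x. x \<in> space M \<Longrightarrow> norm (z x) \<le> norm (v x) + norm (w x)"
    and "Lpn M p v < \<infinity>" "Lpn M p w < \<infinity>"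
  shows "Lpn M p z < \<infinity>"
  using Lpn_add_le[OF assms(1-4)] assms(5,6)
  by (auto simp: less_top[symmetric] ennreal_mult_eq_top_iff top_unique)

text \<open>The bound \<open>norm v \<le> 1 + norm v powr p\<close> takes the place of Hoelder's
  inequality: on a set of finite measure both summands are integrable.\<close>

lemma Lp_mult_integrable:
  fixes v :: "'a \<Rightarrow> 'b::euclidean_space"
  assumes p: "1 \<le> p" and v: "v \<in> borel_measurable M" "Lpn M p v < \<infinity>"
    and \<psi>: "\<psi> \<in> borel_measurable M" "\<And>x. \<bar>\<psi> x\<bar> \<le> B"
    and T: "T \<in> sets M" "emeasure M T < \<infinity>" "\<And>x. x \<in> space M \<Longrightarrow> x \<notin> T \<Longrightarrow> \<psi> x = 0"
  shows "integrable M (\<lambda>x. \<psi> x *\<^sub>R v x)"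
proof (rule Bochner_Integration.integrable_bound)
  show "integrable M (\<lambda>x. B * (indicator T x + norm (v x) powr p))"
    using T by (intro integrable_mult_right Bochner_Integration.integrable_add Lpn_integrable v) auto
  show "AE x in M. norm (\<psi> x *\<^sub>R v x) \<le> norm (B * (indicator T x + norm (v x) powr p))"
  proof (rule AE_I2)
    fix x assume x: "x \<in> space M"
    have B: "0 \<le> B"
      using \<psi>(2)[of x] by simp
    have "norm (v x) \<le> 1 + norm (v x) powr p"
    proof (cases "norm (v x) \<le> 1")
      case False
      then have "norm (v x) powr 1 \<le> norm (v x) powr p"
        using p by (intro powr_mono) auto
      then show ?thesis by simp
    qed (simp add: add_increasing2)
    then have "\<bar>\<psi> x\<bar> * norm (v x) \<le> B * (1 + norm (v x) powr p)"
      using \<psi>(2)[of x] B by (intro mult_mono) auto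
    then show "norm (\<psi> x *\<^sub>R v x) \<le> norm (B * (indicator T x + norm (v x) powr p))"
      using T(3)[OF x] B by (cases "x \<in> T") auto
  qed
qed (use v \<psi> in measurable)

text \<open>Hoelder's inequality is replaced by \<open>norm z \<le> \<delta> + \<delta> powr (1 - p)
  * norm z powr p\<close>. Integrated over \<open>T\<close>, the first term is small by the choice
  of \<open>\<delta>\<close>, uniformly in \<open>n\<close>; the second tends to 0 for fixed
  \<open>\<delta>\<close>.\<close>

lemma Lp_test_tendsto:
  fixes v :: "nat \<Rightarrow> 'a \<Rightarrow> 'b::euclidean_space"
  assumes p: "1 < p" and v: "\<And>n. v n \<in> borel_measurable M" "\<And>n. Lpn M p (v n) < \<infinity>"
    and w: "w \<in> borel_measurable M" "Lpn M p w < \<infinity>"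
    and lim: "(\<lambda>n. Lpn M p (\<lambda>x. v n x - w x)) \<longlonglongrightarrow> 0"
    and \<psi>: "\<psi> \<in> borel_measurable M" "\<And>x. \<bar>\<psi> x\<bar> \<le> B"
    and T: "T \<in> sets M" "emeasure M T < \<infinity>" "\<And>x. x \<in> space M \<Longrightarrow> x \<notin> T \<Longrightarrow> \<psi> x = 0"
  shows "(\<lambda>n. \<integral>x. \<psi> x *\<^sub>R v n x \<partial>M) \<longlonglongrightarrow> (\<integral>x. \<psi> x *\<^sub>R w x \<partial>M)"
proof -
  define z where "z n x = v n x - w x" for n x
  have z: "z n \<in> borel_measurable M" "Lpn M p (z n) < \<infinity>" for n
  proof -
    show "z n \<in> borel_measurable M"
      unfolding z_def by (intro borel_measurable_diff v w)
    show "Lpn M p (z n) < \<infinity>"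
      by (rule Lpn_add_finite[of p "v n" M w]) (use p v w in \<open>auto simp: z_def intro: norm_triangle_ineq4\<close>)
  qed
  define I where "I n = (\<integral>x. norm (z n x) powr p \<partial>M)" for n
  have I: "Lpn M p (z n) = ennreal (I n)" "integrable M (\<lambda>x. norm (z n x) powr p)" "0 \<le> I n" for n
    unfolding I_def using Lpn_integrable[OF z, of n] by auto
  have I0: "I \<longlonglongrightarrow> 0"
    using lim I unfolding z_def[symmetric] by (simp add: tendsto_ennreal_iff[of _ _ 0, simplified ennreal_0] I)
  define B' where "B' = \<bar>B\<bar> + 1"
  define \<mu> where "\<mu> = measure M T"
  have int: "integrable M (\<lambda>x. \<psi> x *\<^sub>R v n x)" "integrable M (\<lambda>x. \<psi> x *\<^sub>R w x)" "integrable M (\<lambda>x. \<psi> x *\<^sub>R z n x)" for n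
    using Lp_mult_integrable[OF less_imp_le[OF p] v \<psi> T, of n] Lp_mult_integrable[OF less_imp_le[OF p] w \<psi> T]
      Lp_mult_integrable[OF less_imp_le[OF p] z \<psi> T, of n] by auto
  have bound: "norm (\<integral>x. \<psi> x *\<^sub>R z n x \<partial>M) \<le> B' * (\<delta> * \<mu> + \<delta> powr (1 - p) * I n)" if \<delta>: "0 < \<delta>" for \<delta> n
  proof -
    have "norm (\<integral>x. \<psi> x *\<^sub>R z n x \<partial>M) \<le> (\<integral>x. norm (\<psi> x *\<^sub>R z n x) \<partial>M)"
      by (rule integral_norm_bound)
    also have "\<dots> \<le> (\<integral>x. B' * (\<delta> * indicator T x + \<delta> powr (1 - p) * norm (z n x) powr p) \<partial>M)"
    proof (rule integral_mono)
      show "integrable M (\<lambda>x. norm (\<psi> x *\<^sub>R z n x))"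
        using int(3) by (rule integrable_norm)
      show "integrable M (\<lambda>x. B' * (\<delta> * indicator T x + \<delta> powr (1 - p) * norm (z n x) powr p))"
        using T I by (intro integrable_mult_right Bochner_Integration.integrable_add) auto
      fix x assume x: "x \<in> space M"
      show "norm (\<psi> x *\<^sub>R z n x) \<le> B' * (\<delta> * indicator T x + \<delta> powr (1 - p) * norm (z n x) powr p)"
      proof (cases "x \<in> T")
        case True
        have "norm (z n x) \<le> \<delta> + \<delta> powr (1 - p) * norm (z n x) powr p"
        proof (cases "norm (z n x) \<le> \<delta>")
          case False
          then have "norm (z n x) = norm (z n x) powr (1 - p) * norm (z n x) powr p"
            using \<delta> by (subst powr_add[symmetric]) auto
          also have "\<dots> \<le> \<delta> powr (1 - p) * norm (z n x) powr p"
            using False \<delta> p by (intro mult_right_mono powr_mono2') auto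
          finally show ?thesis using \<delta> by simp
        qed (simp add: add_increasing2)
        moreover have "\<bar>\<psi> x\<bar> \<le> B'"
          using \<psi>(2)[of x] by (simp add: B'_def)
        ultimately have "\<bar>\<psi> x\<bar> * norm (z n x) \<le> B' * (\<delta> + \<delta> powr (1 - p) * norm (z n x) powr p)"
          using \<delta> by (intro mult_mono) (auto simp: B'_def)
        then show ?thesis using True by simp
      qed (use T(3)[OF x] in \<open>simp add: B'_def\<close>)
    qed
    also have "\<dots> = B' * (\<delta> * \<mu> + \<delta> powr (1 - p) * I n)"
      using T I by (simp add: I_def \<mu>_def)
    finally show ?thesis .
  qed
  have "(\<lambda>n. \<integral>x. \<psi> x *\<^sub>R z n x \<partial>M) \<longlonglongrightarrow> 0"
  proof (rule LIMSEQ_I)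
    fix e :: real assume e: "0 < e"
    define \<delta> where "\<delta> = e / (2 * B' * (\<mu> + 1))"
    have B': "0 < B'" "0 \<le> \<mu>"
      by (auto simp: B'_def \<mu>_def)
    then have \<delta>: "0 < \<delta>"
      using e by (simp add: \<delta>_def add_nonneg_pos)
    have "B' * (\<delta> * \<mu>) \<le> B' * (\<delta> * (\<mu> + 1))"
      using B' \<delta> by (intro mult_left_mono) auto
    also have "\<dots> = e / 2"
      using B' by (simp add: \<delta>_def)
    finally have 1: "B' * (\<delta> * \<mu>) \<le> e / 2" .
    have "(\<lambda>n. B' * (\<delta> powr (1 - p) * I n)) \<longlonglongrightarrow> B' * (\<delta> powr (1 - p) * 0)"
      by (intro tendsto_intros I0)
    then have "\<forall>\<^sub>F n in sequentially. B' * (\<delta> powr (1 - p) * I n) < e / 2"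
      using e by (intro order_tendstoD) auto
    then obtain N where N: "\<And>n. N \<le> n \<Longrightarrow> B' * (\<delta> powr (1 - p) * I n) < e / 2"
      by (auto simp: eventually_sequentially)
    have "norm (\<integral>x. \<psi> x *\<^sub>R z n x \<partial>M) < e" if "N \<le> n" for n
      using bound[OF \<delta>, of n] 1 N[OF that] by (simp add: distrib_left)
    then show "\<exists>N. \<forall>n\<ge>N. norm ((\<integral>x. \<psi> x *\<^sub>R z n x \<partial>M) - 0) < e"
      by auto
  qed
  moreover have "(\<integral>x. \<psi> x *\<^sub>R z n x \<partial>M) = (\<integral>x. \<psi> x *\<^sub>R v n x \<partial>M) - (\<integral>x. \<psi> x *\<^sub>R w x \<partial>M)" for n
    unfolding z_def scaleR_diff_right by (rule Bochner_Integration.integral_diff[OF int(1,2)])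
  ultimately show ?thesis
    by (simp add: LIM_zero_iff)
qed

lemma ennreal_le_suminf: "f k \<le> (\<Sum>k. f k)" for f :: "nat \<Rightarrow> ennreal"
  using sum_le_suminf[of f "{k}"] by simp

lemma Lp_complete:
  fixes v :: "nat \<Rightarrow> 'a \<Rightarrow> 'b::euclidean_space"
  assumes p: "1 < p" and v[measurable]: "\<And>n. v n \<in> borel_measurable M"
    and cauchy: "\<And>e::real. 0 < e \<Longrightarrow> \<exists>N. \<forall>n\<ge>N. \<forall>m\<ge>N. Lpn M p (\<lambda>x. v n x - v m x) \<le> ennreal e"
  shows "\<exists>w\<in>borel_measurable M. (\<lambda>n. Lpn M p (\<lambda>x. v n x - w x)) \<longlonglongrightarrow> 0"
proof -
  have "\<forall>k. \<exists>N. \<forall>n\<ge>N. \<forall>m\<ge>N. Lpn M p (\<lambda>x. v n x - v m x) \<le> ennreal ((1/4) ^ k)"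
    using cauchy by simp
  then obtain N where N: "\<And>k n m. N k \<le> n \<Longrightarrow> N k \<le> m \<Longrightarrow> Lpn M p (\<lambda>x. v n x - v m x) \<le> ennreal ((1/4) ^ k)"
    by metis
  \<comment> \<open>Both \<open>r k\<close> and \<open>r (Suc k)\<close> lie at or beyond
    \<open>N k\<close>, so the \<open>k\<close>-th increment along \<open>r\<close> is at most
    \<open>(1/4) ^ k\<close> in \<open>p\<close>-th power.\<close>
  define r where "r k = k + (\<Sum>j\<le>k. N j)" for k
  have rN: "N k \<le> r k" for k
    unfolding r_def by (rule trans_le_add2, rule member_le_sum) auto
  have rS: "N k \<le> r (Suc k)" for k
    using rN[of k] by (simp add: r_def)
  have rk: "k \<le> r k" for k
    by (simp add: r_def)
  define a where "a k x = norm (v (r (Suc k)) x - v (r k) x)" for k x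
  have a[measurable]: "a k \<in> borel_measurable M" for k
    unfolding a_def by measurable
  \<comment> \<open>The weight \<open>2 ^ k\<close> is affordable against \<open>(1/4) ^ k\<close>,
    and its presence in an almost everywhere finite sum forces the increments to decay
    geometrically, with ratio \<open>(1/2) powr (1 / p)\<close>.\<close>
  have "(\<integral>\<^sup>+x. (\<Sum>k. ennreal (2 ^ k * a k x powr p)) \<partial>M) = (\<Sum>k. \<integral>\<^sup>+x. ennreal (2 ^ k * a k x powr p) \<partial>M)"
    by (rule nn_integral_suminf) measurable
  also have "\<dots> \<le> (\<Sum>k. ennreal ((1/2) ^ k))"
  proof (rule suminf_le)
    fix k
    have "(\<integral>\<^sup>+x. ennreal (2 ^ k * a k x powr p) \<partial>M) = ennreal (2 ^ k) * Lpn M p (\<lambda>x. v (r (Suc k)) x - v (r k) x)"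
      unfolding Lpn_def a_def by (subst nn_integral_cmult[symmetric]) (auto simp: ennreal_mult')
    also have "\<dots> \<le> ennreal (2 ^ k) * ennreal ((1/4) ^ k)"
      by (intro mult_left_mono N rN rS) auto
    also have "\<dots> = ennreal ((1/2) ^ k)"
      by (simp add: ennreal_mult'[symmetric] power_mult_distrib[symmetric])
    finally show "(\<integral>\<^sup>+x. ennreal (2 ^ k * a k x powr p) \<partial>M) \<le> ennreal ((1/2) ^ k)" .
  qed auto
  also have "\<dots> < \<infinity>"
    by (subst suminf_ennreal2) (auto intro: summable_geometric)
  finally have "AE x in M. (\<Sum>k. ennreal (2 ^ k * a k x powr p)) \<noteq> \<infinity>"
    by (intro nn_integral_PInf_AE) auto
  then have conv: "AE x in M. convergent (\<lambda>k. v (r k) x)"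
  proof eventually_elim
    case (elim x)
    define C where "C = enn2real (\<Sum>k. ennreal (2 ^ k * a k x powr p))"
    have C: "ennreal C = (\<Sum>k. ennreal (2 ^ k * a k x powr p))" "0 \<le> C"
      unfolding C_def using elim by (auto intro!: ennreal_enn2real enn2real_nonneg simp: less_top[symmetric])
    have "ennreal (2 ^ k * a k x powr p) \<le> ennreal C" for k
      unfolding C(1) by (rule ennreal_le_suminf)
    then have le: "2 ^ k * a k x powr p \<le> C" for k
      using C(2) ennreal_le_iff by blast
    define q where "q = (1/2::real) powr (1 / p)"
    have q: "0 < q" "q < 1"
      using p powr_less_mono2[of "1 / p" "1/2" 1] by (auto simp: q_def)
    have "a k x \<le> C powr (1 / p) * q ^ k" for k
    proof -
      have "a k x powr p \<le> C * (1/2) ^ k"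
        using mult_right_mono[OF le[of k], of "(1/2)^k"] by (simp add: power_one_over)
      then have "(a k x powr p) powr (1 / p) \<le> (C * (1/2) ^ k) powr (1 / p)"
        using p by (intro powr_mono2) auto
      also have "\<dots> = C powr (1 / p) * q ^ k"
      proof -
        have "((1/2::real) ^ k) powr (1 / p) = q ^ k"
          unfolding q_def by (subst (1 2) powr_realpow[symmetric]) (auto simp: powr_powr mult.commute)
        then show ?thesis
          using C(2) by (simp add: powr_mult)
      qed
      also have "(a k x powr p) powr (1 / p) = a k x"
        using p by (simp add: powr_powr a_def)
      finally show ?thesis .
    qed
    then have ak: "a k x \<le> C powr (1 / p) * q ^ k" for k .
    have "summable (\<lambda>k. norm (v (r (Suc k)) x - v (r k) x))"
    proof (rule summable_comparison_test'[where g = "\<lambda>k. C powr (1/p) * q ^ k" and N = 0])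
      show "summable (\<lambda>k. C powr (1/p) * q ^ k)"
        using q by (intro summable_mult summable_geometric) auto
      show "norm (norm (v (r (Suc k)) x - v (r k) x)) \<le> C powr (1/p) * q ^ k" for k
        using ak[of k] by (simp add: a_def)
    qed
    then have "summable (\<lambda>k. v (r (Suc k)) x - v (r k) x)"
      by (rule summable_norm_cancel)
    then have "convergent (\<lambda>n. v (r 0) x + (\<Sum>k<n. v (r (Suc k)) x - v (r k) x))"
      by (intro convergent_add convergent_const) (simp add: summable_iff_convergent)
    then show "convergent (\<lambda>k. v (r k) x)"
      using sum_lessThan_telescope[of "\<lambda>k. v (r k) x"] by simp
  qed
  define w where "w x = lim (\<lambda>k. v (r k) x)" for x
  have w[measurable]: "w \<in> borel_measurable M"
    unfolding w_def by (rule borel_measurable_lim_metric) auto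
  have small: "\<exists>N. \<forall>n\<ge>N. Lpn M p (\<lambda>x. v n x - w x) \<le> ennreal e" if e: "0 < e" for e
  proof -
    obtain N where N: "\<And>n m. N \<le> n \<Longrightarrow> N \<le> m \<Longrightarrow> Lpn M p (\<lambda>x. v n x - v m x) \<le> ennreal e"
      using cauchy[OF e] by blast
    have "Lpn M p (\<lambda>x. v n x - w x) \<le> ennreal e" if n: "N \<le> n" for n
    proof -
      have "Lpn M p (\<lambda>x. v n x - w x) \<le> (\<integral>\<^sup>+x. liminf (\<lambda>k. ennreal (norm (v n x - v (r k) x) powr p)) \<partial>M)"
        unfolding Lpn_def
      proof (rule nn_integral_mono_AE, use conv in eventually_elim)
        case (elim x)
        then have "(\<lambda>k. v (r k) x) \<longlonglongrightarrow> w x"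
          by (simp add: w_def convergent_LIMSEQ_iff)
        then have "(\<lambda>k. ennreal (norm (v n x - v (r k) x) powr p)) \<longlonglongrightarrow> ennreal (norm (v n x - w x) powr p)"
          using p by (intro tendsto_ennrealI tendsto_powr' tendsto_intros) auto
        then have "liminf (\<lambda>k. ennreal (norm (v n x - v (r k) x) powr p)) = ennreal (norm (v n x - w x) powr p)"
          by (rule lim_imp_Liminf[OF trivial_limit_sequentially])
        then show ?case
          by simp
      qed
      also have "\<dots> \<le> liminf (\<lambda>k. \<integral>\<^sup>+x. ennreal (norm (v n x - v (r k) x) powr p) \<partial>M)"
        by (rule nn_integral_liminf) measurable
      also have "\<dots> \<le> liminf (\<lambda>k. ennreal e)"
      proof (rule Liminf_mono)
        show "\<forall>\<^sub>F k in sequentially. (\<integral>\<^sup>+x. ennreal (norm (v n x - v (r k) x) powr p) \<partial>M) \<le> ennreal e"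
          unfolding eventually_sequentially
          using N[OF n, unfolded Lpn_def] rk order_trans by (intro exI[of _ N]) blast
      qed
      finally show ?thesis
        by (simp add: Liminf_const)
    qed
    then show ?thesis
      by blast
  qed
  have "(\<lambda>n. Lpn M p (\<lambda>x. v n x - w x)) \<longlonglongrightarrow> 0"
  proof (rule order_tendstoI)
    fix y :: ennreal assume "0 < y"
    then obtain q where q: "0 < q" "q < y"
      using dense by blast
    define e where "e = enn2real q"
    have eq: "ennreal e = q"
      unfolding e_def using q(2) by (intro ennreal_enn2real) (auto intro: less_le_trans)
    have e: "0 < e" "ennreal e < y"
      using q eq by (auto simp: ennreal_less_zero_iff[symmetric] simp del: ennreal_less_zero_iff)
    then show "\<forall>\<^sub>F n in sequentially. Lpn M p (\<lambda>x. v n x - w x) < y"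
      using small[OF e(1)] by (auto simp: eventually_sequentially intro: le_less_trans)
  qed simp
  then show ?thesis
    using w by blast
qed

text \<open>Only midpoints are taken, since the uniform convexity inequality speaks of nothing else.
  The index \<open>n\<close> bounds the sequence members from below, so the hulls shrink as
  \<open>n\<close> grows.\<close>

inductive mid_hull :: "(nat \<Rightarrow> 'a \<Rightarrow> 'b::real_vector) \<Rightarrow> nat \<Rightarrow> ('a \<Rightarrow> 'b) \<Rightarrow> bool" for u n
  where
    mid_hull_base: "n \<le> j \<Longrightarrow> mid_hull u n (u j)"
  | mid_hull_step: "mid_hull u n v \<Longrightarrow> mid_hull u n w \<Longrightarrow> mid_hull u n (\<lambda>x. (1/2) *\<^sub>R (v x + w x))"

lemma mid_hull_mono: "mid_hull u m v \<Longrightarrow> n \<le> m \<Longrightarrow> mid_hull u n v"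
  by (induction rule: mid_hull.induct) (auto intro: mid_hull_base mid_hull_step simp del: scaleR_add_right)

text \<open>Instead of reflexivity: near-minimisers of the norm over midpoint hulls of the tails form a
  Cauchy sequence by uniform convexity.\<close>

theorem Lp_weak_limit:
  fixes u :: "nat \<Rightarrow> 'a \<Rightarrow> 'b::euclidean_space"
  assumes p: "1 < p" and u: "\<And>j. u j \<in> borel_measurable M" and K: "\<And>j. Lpn M p (u j) \<le> ennreal K"
  shows "\<exists>w\<in>borel_measurable M. Lpn M p w < \<infinity> \<and>
    (\<forall>\<psi> B T l. \<psi> \<in> borel_measurable M \<longrightarrow> (\<forall>x. \<bar>\<psi> x\<bar> \<le> B) \<longrightarrow> T \<in> sets M \<longrightarrow> emeasure M T < \<infinity> \<longrightarrow>
      (\<forall>x\<in>space M. x \<notin> T \<longrightarrow> \<psi> x = 0) \<longrightarrow> (\<lambda>j. \<integral>x. \<psi> x *\<^sub>R u j x \<partial>M) \<longlonglongrightarrow> l \<longrightarrow>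
      (\<integral>x. \<psi> x *\<^sub>R w x \<partial>M) = l)"
proof -
  define K' where "K' = max K 0"
  have K': "0 \<le> K'" "\<And>j. Lpn M p (u j) \<le> ennreal K'"
    using order_trans[OF K ennreal_leI[of K K']] by (auto simp: K'_def)
  define \<Phi> where "\<Phi> v = (\<integral>x. norm (v x) powr p \<partial>M)" for v :: "'a \<Rightarrow> 'b"
  have hull: "v \<in> borel_measurable M \<and> integrable M (\<lambda>x. norm (v x) powr p) \<and> \<Phi> v \<le> K'" if "mid_hull u n v" for n v
    using that
  proof (induction rule: mid_hull.induct)
    case (mid_hull_base j)
    have "Lpn M p (u j) < \<infinity>"
      using K'(2)[of j] by (auto simp: le_less_trans)
    then show ?case
      using Lpn_integrable[OF u, of p j] K'(2)[of j] K'(1) u by (simp add: \<Phi>_def)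
  next
    case (mid_hull_step v w)
    then have [measurable]: "v \<in> borel_measurable M" "w \<in> borel_measurable M"
      by auto
    have i: "integrable M (\<lambda>x. (norm (v x) powr p + norm (w x) powr p) / 2)"
      using mid_hull_step by auto
    have i2: "integrable M (\<lambda>x. norm ((1/2) *\<^sub>R (v x + w x)) powr p)"
      by (rule Bochner_Integration.integrable_bound[OF i])
        (use norm_powr_midpoint[OF p] in \<open>auto intro!: AE_I2 simp del: norm_scaleR\<close>)
    have "\<Phi> (\<lambda>x. (1/2) *\<^sub>R (v x + w x)) \<le> (\<integral>x. (norm (v x) powr p + norm (w x) powr p) / 2 \<partial>M)"
      unfolding \<Phi>_def by (intro integral_mono i i2 norm_powr_midpoint[OF p])
    also have "\<dots> = (\<Phi> v + \<Phi> w) / 2"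
      using mid_hull_step by (simp add: \<Phi>_def)
    finally show ?case
      using mid_hull_step i2 by auto
  qed
  have \<Phi>_nn: "0 \<le> \<Phi> v" for v
    by (simp add: \<Phi>_def)
  \<comment> \<open>Infimum of the energy over the hull of the \<open>n\<close>-th tail. It
    increases with \<open>n\<close> and is bounded, hence converges to some
    \<open>D\<close>.\<close>
  define d where "d n = Inf (\<Phi> ` {v. mid_hull u n v})" for n
  have ne: "{v. mid_hull u n v} \<noteq> {}" for n
    using mid_hull_base[of n n u] by auto
  have bdd: "bdd_below (\<Phi> ` A)" for A
    using \<Phi>_nn by (intro bdd_belowI2[of _ 0])
  have d_le: "d n \<le> \<Phi> v" if "mid_hull u n v" for n v
    unfolding d_def using that bdd by (intro cInf_lower) auto
  have d_mono: "d n \<le> d m" if "n \<le> m" for n m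
  proof -
    have "{v. mid_hull u m v} \<subseteq> {v. mid_hull u n v}"
      using mid_hull_mono[OF _ that] by auto
    then show ?thesis
      unfolding d_def using ne[of m] bdd by (intro cInf_superset_mono image_mono) auto
  qed
  have dK: "d n \<le> K'" for n
    using d_le[OF mid_hull_base[of n n u]] hull[OF mid_hull_base[of n n u]] by auto
  have "incseq d"
    using d_mono by (simp add: incseq_def)
  then obtain D where D: "d \<longlonglongrightarrow> D" "\<And>n. d n \<le> D"
    using incseq_convergent[of d K'] dK by metis
  have "\<exists>v. mid_hull u n v \<and> \<Phi> v < d n + 1 / Suc n" for n
  proof -
    have "\<Phi> ` {v. mid_hull u n v} \<noteq> {}" "Inf (\<Phi> ` {v. mid_hull u n v}) < d n + 1 / Suc n"
      using ne[of n] by (auto simp: d_def)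
    from cInf_lessD[OF this] show ?thesis
      by blast
  qed
  then obtain v where v: "\<And>n. mid_hull u n (v n)" "\<And>n. \<Phi> (v n) < d n + 1 / Suc n"
    by metis
  have vm[measurable]: "v n \<in> borel_measurable M" and vi: "integrable M (\<lambda>x. norm (v n x) powr p)" and vK: "\<Phi> (v n) \<le> K'" for n
    using hull[OF v(1)[of n]] by auto
  have vL: "Lpn M p (v n) < \<infinity>" for n
    unfolding Lpn_def using vi[of n] by (subst nn_integral_eq_integral) auto
  have cauchy: "\<exists>N. \<forall>n\<ge>N. \<forall>m\<ge>N. Lpn M p (\<lambda>x. v n x - v m x) \<le> ennreal e" if e: "0 < e" for e
  proof -
    define \<epsilon> where "\<epsilon> = e / (4 * (K' + 1))"
    have \<epsilon>: "0 < \<epsilon>"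
      using e K' by (simp add: \<epsilon>_def)
    obtain C where C: "0 \<le> C" and uc: "\<And>a b :: 'b. norm (a - b) powr p \<le> \<epsilon> * (norm a powr p + norm b powr p)
        + C * ((norm a powr p + norm b powr p) / 2 - norm ((1/2) *\<^sub>R (a + b)) powr p)"
      using uniform_convexity_powr[OF p \<epsilon>] by blast
    have "(\<lambda>n. C * (1 / Suc n + (D - d n))) \<longlonglongrightarrow> C * (0 + (D - D))"
      by (intro tendsto_intros D LIMSEQ_Suc[OF lim_1_over_n])
    then have "\<forall>\<^sub>F n in sequentially. C * (1 / Suc n + (D - d n)) < e / 2"
      using e by (intro order_tendstoD) auto
    then obtain N where N: "C * (1 / Suc N + (D - d N)) < e / 2"
      by (auto simp: eventually_sequentially)
    have "Lpn M p (\<lambda>x. v n x - v m x) \<le> ennreal e" if nm: "N \<le> n" "N \<le> m" for n m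
    proof -
      \<comment> \<open>The midpoint of two near-minimisers competes for the infimum
        \<open>d N\<close>, so their convexity deficit is at most
        \<open>1 / Suc N + (D - d N)\<close>, and uniform convexity bounds their distance.\<close>
      have h: "mid_hull u N (\<lambda>x. (1/2) *\<^sub>R (v n x + v m x))"
        using mid_hull_mono[OF v(1)] nm by (intro mid_hull_step) auto
      have fin: "Lpn M p (\<lambda>x. v n x - v m x) < \<infinity>"
        by (rule Lpn_add_finite[of p "v n" M "v m"]) (use p vL in \<open>auto intro: norm_triangle_ineq4\<close>)
      note li = Lpn_integrable[OF _ fin, OF borel_measurable_diff[OF vm vm]]
      have 1: "1 / real (Suc n) \<le> 1 / Suc N" "1 / real (Suc m) \<le> 1 / Suc N"
        using nm by (auto intro!: divide_left_mono)
      have 2: "\<epsilon> * (\<Phi> (v n) + \<Phi> (v m)) \<le> e / 2"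
      proof -
        have "\<epsilon> * (\<Phi> (v n) + \<Phi> (v m)) \<le> \<epsilon> * (2 * (K' + 1))"
          using \<epsilon> vK[of n] vK[of m] by (intro mult_left_mono) auto
        also have "\<dots> = e / 2"
        proof -
          have "e / (4 * c) * (2 * c) = e / 2" if "0 < c" for c :: real
            using that by simp
          then show ?thesis
            unfolding \<epsilon>_def using K' by (meson add_nonneg_pos zero_less_one)
        qed
        finally show ?thesis .
      qed
      have "(\<Phi> (v n) + \<Phi> (v m)) / 2 - \<Phi> (\<lambda>x. (1/2) *\<^sub>R (v n x + v m x)) \<le> 1 / Suc N + (D - d N)"
        using less_le_trans[OF v(2)[of n] add_mono[OF D(2)[of n] 1(1)]]
          less_le_trans[OF v(2)[of m] add_mono[OF D(2)[of m] 1(2)]] d_le[OF h] by argo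
      then have 3: "C * ((\<Phi> (v n) + \<Phi> (v m)) / 2 - \<Phi> (\<lambda>x. (1/2) *\<^sub>R (v n x + v m x))) \<le> e / 2"
        using N C by (meson less_imp_le mult_left_mono order_trans)
      have "(\<integral>x. norm (v n x - v m x) powr p \<partial>M) \<le> (\<integral>x. \<epsilon> * (norm (v n x) powr p + norm (v m x) powr p)
        + C * ((norm (v n x) powr p + norm (v m x) powr p) / 2 - norm ((1/2) *\<^sub>R (v n x + v m x)) powr p) \<partial>M)"
        using li(1) vi hull[OF h] by (intro integral_mono uc) (auto simp del: norm_scaleR)
      also have "\<dots> = \<epsilon> * (\<Phi> (v n) + \<Phi> (v m)) + C * ((\<Phi> (v n) + \<Phi> (v m)) / 2 - \<Phi> (\<lambda>x. (1/2) *\<^sub>R (v n x + v m x)))"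
        using vi hull[OF h] by (simp add: \<Phi>_def del: norm_scaleR)
      also have "\<dots> \<le> e"
        using 2 3 by simp
      finally show ?thesis
        unfolding li(2) by (rule ennreal_leI)
    qed
    then show ?thesis by blast
  qed
  obtain w where w: "w \<in> borel_measurable M" "(\<lambda>n. Lpn M p (\<lambda>x. v n x - w x)) \<longlonglongrightarrow> 0"
    using Lp_complete[OF p vm cauchy] by blast
  have "\<forall>\<^sub>F n in sequentially. Lpn M p (\<lambda>x. v n x - w x) < 1"
    using w(2) by (intro order_tendstoD) auto
  then obtain n0 where n0: "Lpn M p (\<lambda>x. v n0 x - w x) < 1"
    by (auto simp: eventually_sequentially)
  have wL: "Lpn M p w < \<infinity>"
  proof (rule Lpn_add_finite[of p "\<lambda>x. v n0 x - w x" M "v n0"])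
    show "norm (w x) \<le> norm (v n0 x - w x) + norm (v n0 x)" for x
      using norm_triangle_sub[of "w x" "v n0 x"] by (simp add: norm_minus_commute)
    show "Lpn M p (\<lambda>x. v n0 x - w x) < \<infinity>"
      using n0 by (auto intro: less_trans)
  qed (use p vL w in auto)
  have "(\<integral>x. \<psi> x *\<^sub>R w x \<partial>M) = l"
    if \<psi>: "\<psi> \<in> borel_measurable M" "\<And>x. \<bar>\<psi> x\<bar> \<le> B"
      and T: "T \<in> sets M" "emeasure M T < \<infinity>" "\<And>x. x \<in> space M \<Longrightarrow> x \<notin> T \<Longrightarrow> \<psi> x = 0"
      and l: "(\<lambda>j. \<integral>x. \<psi> x *\<^sub>R u j x \<partial>M) \<longlonglongrightarrow> l" for \<psi> B T l
  proof (rule LIMSEQ_unique)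
    show "(\<lambda>n. \<integral>x. \<psi> x *\<^sub>R v n x \<partial>M) \<longlonglongrightarrow> (\<integral>x. \<psi> x *\<^sub>R w x \<partial>M)"
      by (rule Lp_test_tendsto[OF p vm vL w(1) wL w(2) \<psi> T])
    show "(\<lambda>n. \<integral>x. \<psi> x *\<^sub>R v n x \<partial>M) \<longlonglongrightarrow> l"
    proof (rule LIMSEQ_I)
      fix e :: real assume e: "0 < e"
      obtain N where N: "\<And>j. N \<le> j \<Longrightarrow> norm ((\<integral>x. \<psi> x *\<^sub>R u j x \<partial>M) - l) < e"
        using LIMSEQ_D[OF l e] by blast
      \<comment> \<open>A ball around \<open>l\<close> is convex, so test integrals that are close
        to \<open>l\<close> for all \<open>u j\<close> with \<open>N \<le> j\<close> stay close to
        it on the whole midpoint hull.\<close>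
      have "norm ((\<integral>x. \<psi> x *\<^sub>R f x \<partial>M) - l) < e" if "mid_hull u N f" for f
        using that
      proof (induction rule: mid_hull.induct)
        case (mid_hull_base j)
        then show ?case using N by simp
      next
        case (mid_hull_step f g)
        have i: "integrable M (\<lambda>x. \<psi> x *\<^sub>R h x)" if "mid_hull u N h" for h
        proof (rule Lp_mult_integrable[OF _ _ _ \<psi> T])
          show "h \<in> borel_measurable M" "Lpn M p h < \<infinity>"
            using hull[OF that] by (auto simp: Lpn_def nn_integral_eq_integral)
        qed (use p in auto)
        have "(\<integral>x. \<psi> x *\<^sub>R ((1/2) *\<^sub>R (f x + g x)) \<partial>M) = (\<integral>x. (1/2) *\<^sub>R (\<psi> x *\<^sub>R f x + \<psi> x *\<^sub>R g x) \<partial>M)"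
          by (intro Bochner_Integration.integral_cong) (auto simp: algebra_simps)
        also have "\<dots> = (1/2) *\<^sub>R ((\<integral>x. \<psi> x *\<^sub>R f x \<partial>M) + (\<integral>x. \<psi> x *\<^sub>R g x \<partial>M))"
          using i mid_hull_step by simp
        finally have "(\<integral>x. \<psi> x *\<^sub>R ((1/2) *\<^sub>R (f x + g x)) \<partial>M) - l
            = (1/2) *\<^sub>R (((\<integral>x. \<psi> x *\<^sub>R f x \<partial>M) - l) + ((\<integral>x. \<psi> x *\<^sub>R g x \<partial>M) - l))"
          by (simp add: algebra_simps scaleR_2[symmetric])
        then have "norm ((\<integral>x. \<psi> x *\<^sub>R ((1/2) *\<^sub>R (f x + g x)) \<partial>M) - l)
            \<le> (norm ((\<integral>x. \<psi> x *\<^sub>R f x \<partial>M) - l) + norm ((\<integral>x. \<psi> x *\<^sub>R g x \<partial>M) - l)) / 2"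
          by (simp add: norm_triangle_ineq)
        then show ?case
          using mid_hull_step.IH by simp
      qed
      then show "\<exists>N. \<forall>n\<ge>N. norm ((\<integral>x. \<psi> x *\<^sub>R v n x \<partial>M) - l) < e"
        using v(1) mid_hull_mono by blast
    qed
  qed
  then show ?thesis
    using w(1) wL by blast
qed

section \<open>Test functions and the fundamental lemma\<close>

lemma C_k_SucI:
  fixes f :: "'a::real_normed_vector \<Rightarrow> 'b::real_normed_vector"
  assumes "\<And>x. (f has_derivative D x) (at x)" "\<And>v. C_k k (\<lambda>x. D x v)"
  shows "C_k (Suc k) f"
proof -
  have "frechet_derivative f (at x) = D x" for x
    using frechet_derivative_at[OF assms(1)] by simp
  then show ?thesis
    using assms by (auto simp: differentiable_on_def differentiable_def)
qed

lemma C_k_SucD: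
  assumes "C_k (Suc k) f"
  shows "(f has_derivative frechet_derivative f (at x)) (at x)" "C_k k (\<lambda>x. frechet_derivative f (at x) v)"
  using assms by (auto simp: differentiable_on_def frechet_derivative_works)

lemma C_k_Suc_imp: "C_k (Suc k) f \<Longrightarrow> C_k k f"
proof (induction k arbitrary: f)
  case 0
  then show ?case
    by (auto intro: differentiable_imp_continuous_on)
next
  case (Suc k)
  show ?case
  proof (rule C_k_SucI)
    show "(f has_derivative frechet_derivative f (at x)) (at x)" for x
      by (rule C_k_SucD(1)[OF Suc.prems])
    show "C_k k (\<lambda>x. frechet_derivative f (at x) v)" for v
      by (rule Suc.IH[OF C_k_SucD(2)[OF Suc.prems]])
  qed
qed

lemma C_k_const: "C_k k (\<lambda>x. c)"
proof (induction k arbitrary: c)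
  case (Suc k)
  show ?case
    by (rule C_k_SucI[where D = "\<lambda>x v. 0"]) (auto intro: Suc)
qed (simp add: continuous_on_const)

lemma C_k_add:
  "C_k k f \<Longrightarrow> C_k k g \<Longrightarrow> C_k k (\<lambda>x. f x + g x)"
proof (induction k arbitrary: f g)
  case (Suc k)
  show ?case
    by (rule C_k_SucI, rule has_derivative_add[OF C_k_SucD(1)[OF Suc.prems(1)] C_k_SucD(1)[OF Suc.prems(2)]])
      (intro Suc.IH C_k_SucD(2)[OF Suc.prems(1)] C_k_SucD(2)[OF Suc.prems(2)])
qed (auto intro: continuous_on_add)

lemma C_k_mult:
  fixes f g :: "'a::real_normed_vector \<Rightarrow> real"
  shows "C_k k f \<Longrightarrow> C_k k g \<Longrightarrow> C_k k (\<lambda>x. f x * g x)"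
proof (induction k arbitrary: f g)
  case (Suc k)
  show ?case
    by (rule C_k_SucI, rule has_derivative_mult[OF C_k_SucD(1)[OF Suc.prems(1)] C_k_SucD(1)[OF Suc.prems(2)]])
      (intro C_k_add Suc.IH C_k_SucD(2)[OF Suc.prems(1)] C_k_SucD(2)[OF Suc.prems(2)]
        C_k_Suc_imp[OF Suc.prems(1)] C_k_Suc_imp[OF Suc.prems(2)])
qed (auto intro: continuous_on_mult)

lemma C_k_prod:
  fixes f :: "'i \<Rightarrow> 'a::real_normed_vector \<Rightarrow> real"
  assumes "finite I" "\<And>i. i \<in> I \<Longrightarrow> C_k k (f i)"
  shows "C_k k (\<lambda>x. \<Prod>i\<in>I. f i x)"
  using assms
  by (induction I rule: finite_induct) (auto intro!: C_k_mult C_k_const simp del: C_k.simps)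

lemma C_k_affine:
  fixes \<theta> :: "real \<Rightarrow> real" and w :: "'a::real_inner"
  shows "C_k k \<theta> \<Longrightarrow> C_k k (\<lambda>x. \<theta> (x \<bullet> w + c))"
proof (induction k arbitrary: \<theta>)
  case 0
  then have "continuous_on UNIV \<theta>"
    by simp
  then show ?case
    by (auto intro!: continuous_on_compose2[of UNIV \<theta>] continuous_intros)
next
  case (Suc k)
  have D: "((\<lambda>x. \<theta> (x \<bullet> w + c)) has_derivative (\<lambda>v. (v \<bullet> w) * frechet_derivative \<theta> (at (x \<bullet> w + c)) 1)) (at x)" for x
  proof -
    note d = C_k_SucD(1)[OF Suc.prems, of "x \<bullet> w + c"]
    have lin: "frechet_derivative \<theta> (at (x \<bullet> w + c)) t = t * frechet_derivative \<theta> (at (x \<bullet> w + c)) 1" for t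
      using linear_scale[OF has_derivative_linear[OF d], of t 1] by simp
    have "((\<lambda>x. x \<bullet> w + c) has_derivative (\<lambda>v. v \<bullet> w)) (at x)"
      by (auto intro!: derivative_eq_intros)
    from has_derivative_compose[OF this d] show ?thesis
      by (subst (asm) lin) simp
  qed
  show ?case
    by (rule C_k_SucI, rule D) (intro C_k_mult C_k_const Suc.IH C_k_SucD(2)[OF Suc.prems])
qed

text \<open>The classical flat function divided by \<open>t ^ j\<close>: derivatives stay in the
  span of this family, so smoothness of every order follows by one induction valid for all
  \<open>j\<close>.\<close>

definition flat :: "nat \<Rightarrow> real \<Rightarrow> real"
  where "flat j t = (if t \<le> 0 then 0 else exp (- (1 / t)) / t ^ j)"

lemma flat_at_right: "((\<lambda>t. exp (- (1 / t)) / t ^ j) \<longlongrightarrow> 0) (at_right (0::real))"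
proof -
  have "((\<lambda>x::real. x ^ j / exp x) \<longlongrightarrow> 0) at_top"
    by (rule tendsto_power_div_exp_0)
  then have "((\<lambda>t::real. inverse t ^ j / exp (inverse t)) \<longlongrightarrow> 0) (at_right 0)"
    by (rule filterlim_compose) (rule filterlim_inverse_at_top_right)
  then show ?thesis
    by (simp add: exp_minus divide_inverse power_inverse mult.commute)
qed

lemma flat_deriv: "(flat j has_real_derivative flat (j + 2) t - j * flat (j + 1) t) (at t)"
proof -
  consider "t < 0" | "0 < t" | "t = 0"
    by linarith
  then show ?thesis
  proof cases
    case 1
    have "((\<lambda>_. 0) has_real_derivative 0) (at t)"
      by simp
    then have "(flat j has_real_derivative 0) (at t)"
      by (rule has_field_derivative_transform_within_open[where S = "{..<0}"]) (use 1 in \<open>auto simp: flat_def\<close>)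
    then show ?thesis
      using 1 by (simp add: flat_def)
  next
    case 2
    have "((\<lambda>s. exp (- (1 / s)) / s ^ j) has_real_derivative exp (- (1 / t)) / t ^ (j + 2) - j * (exp (- (1 / t)) / t ^ (j + 1))) (at t)"
    proof (cases j)
      case 0
      then show ?thesis
        using 2 by (auto intro!: derivative_eq_intros simp: power2_eq_square)
    next
      case (Suc i)
      show ?thesis
        unfolding Suc using 2
        by (auto intro!: derivative_eq_intros simp: divide_simps power2_eq_square) (cases i; simp add: algebra_simps)
    qed
    then have "(flat j has_real_derivative exp (- (1 / t)) / t ^ (j + 2) - j * (exp (- (1 / t)) / t ^ (j + 1))) (at t)"
      by (rule has_field_derivative_transform_within_open[where S = "{0<..}"]) (use 2 in \<open>auto simp: flat_def\<close>)
    then show ?thesis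
      using 2 by (simp add: flat_def)
  next
    case 3
    have "((\<lambda>h. (flat j (0 + h) - flat j 0) / h) \<longlongrightarrow> 0) (at 0)"
      unfolding filterlim_at_split
    proof
      have "\<forall>\<^sub>F h in at_left 0. 0 = (flat j (0 + h) - flat j 0) / h"
        by (auto simp: eventually_at_left_field flat_def intro!: exI[of _ "-1"])
      then show "((\<lambda>h. (flat j (0 + h) - flat j 0) / h) \<longlongrightarrow> 0) (at_left 0)"
        by (rule Lim_transform_eventually[OF tendsto_const])
      \<comment> \<open>At 0 the difference quotient from the right is the formula for
        \<open>flat (j + 1)\<close>, which tends to 0.\<close>
      have "\<forall>\<^sub>F h in at_right 0. exp (- (1 / h)) / h ^ (j + 1) = (flat j (0 + h) - flat j 0) / h"
        by (auto simp: eventually_at_right_field flat_def intro!: exI[of _ "1"])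
      then show "((\<lambda>h. (flat j (0 + h) - flat j 0) / h) \<longlongrightarrow> 0) (at_right 0)"
        by (rule Lim_transform_eventually[OF flat_at_right])
    qed
    then show ?thesis
      using 3 by (simp add: DERIV_def flat_def)
  qed
qed

lemma C_k_flat: "C_k k (flat j)"
proof (induction k arbitrary: j)
  case 0
  have "isCont (flat j) t" for t
    by (rule DERIV_isCont[OF flat_deriv])
  then show ?case
    by (simp add: continuous_on_eq_continuous_at)
next
  case (Suc k)
  show ?case
  proof (rule C_k_SucI)
    show "(flat j has_derivative (\<lambda>v. (flat (j + 2) t + (- real j) * flat (j + 1) t) * v)) (at t)" for t
      using flat_deriv[of j t] by (simp add: has_field_derivative_def)
    show "C_k k (\<lambda>t. (flat (j + 2) t + (- real j) * flat (j + 1) t) * v)" for v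
      by (intro C_k_mult C_k_add C_k_const Suc.IH)
  qed
qed

text \<open>For \<open>n > 0\<close> this is smooth and positive exactly on the open box. It tends
  to the indicator of the box as \<open>n\<close> grows, since
  \<open>flat 0 t = exp (- (1 / t))\<close> tends to 1 as \<open>t\<close> grows.\<close>

definition box_bump :: "'a::euclidean_space \<Rightarrow> 'a \<Rightarrow> real \<Rightarrow> 'a \<Rightarrow> real"
  where "box_bump a c n x = (\<Prod>b\<in>Basis. flat 0 (n * ((x - a) \<bullet> b)) * flat 0 (n * ((c - x) \<bullet> b)))"

lemma box_bump_C_k: "C_k k (box_bump a c n)"
proof -
  have "C_k k (\<lambda>x. \<Prod>b\<in>Basis. flat 0 (x \<bullet> (n *\<^sub>R b) + (- n * (a \<bullet> b))) * flat 0 (x \<bullet> ((-n) *\<^sub>R b) + n * (c \<bullet> b)))"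
    by (intro C_k_prod C_k_mult C_k_affine C_k_flat) auto
  moreover have "(\<lambda>x. \<Prod>b\<in>Basis. flat 0 (x \<bullet> (n *\<^sub>R b) + (- n * (a \<bullet> b))) * flat 0 (x \<bullet> ((-n) *\<^sub>R b) + n * (c \<bullet> b))) = box_bump a c n"
    by (auto simp: box_bump_def fun_eq_iff inner_diff_left algebra_simps)
  ultimately show ?thesis
    by simp
qed

lemma flat0_bounds: "0 \<le> flat 0 t" "flat 0 t \<le> 1"
  by (auto simp: flat_def)

lemma box_bump_bounds: "0 \<le> box_bump a c n x" "box_bump a c n x \<le> 1"
  unfolding box_bump_def by (auto intro!: prod_nonneg prod_le_1 mult_nonneg_nonneg mult_le_one flat0_bounds)

lemma box_bump_support:
  assumes "0 < n" "box_bump a c n x \<noteq> 0"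
  shows "x \<in> box a c"
proof -
  have "0 < n * ((x - a) \<bullet> b)" "0 < n * ((c - x) \<bullet> b)" if "b \<in> Basis" for b
    using assms(2) that by (auto simp: box_bump_def flat_def split: if_splits)
  then show ?thesis
    using assms(1) by (auto simp: mem_box zero_less_mult_iff inner_diff_left)
qed

lemma test_function_box_bump:
  assumes "0 < n" "cbox a c \<subseteq> U"
  shows "test_function U (box_bump a c n)"
proof -
  have "{x. box_bump a c n x \<noteq> 0} \<subseteq> cbox a c"
    using box_bump_support[OF assms(1)] box_subset_cbox by blast
  then have cl: "closure {x. box_bump a c n x \<noteq> 0} \<subseteq> cbox a c"
    by (rule closure_minimal) (rule closed_cbox)
  moreover have "compact (closure {x. box_bump a c n x \<noteq> 0})"
    using compact_Int_closed[OF compact_cbox closed_closure] cl by (metis inf.absorb_iff2 inf_commute)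
  ultimately show ?thesis
    using assms box_bump_C_k by (auto simp: test_function_def)
qed

lemma box_bump_lim: "(\<lambda>n. box_bump a c (real (Suc n)) x) \<longlonglongrightarrow> indicator (box a c) x"
proof (cases "x \<in> box a c")
  case False
  then have "box_bump a c (real (Suc n)) x = 0" for n
    using box_bump_support[of "real (Suc n)" a c x] by auto
  then show ?thesis
    using False by simp
next
  case True
  have f: "(\<lambda>n. flat 0 (real (Suc n) * t)) \<longlonglongrightarrow> 1" if "0 < t" for t
  proof -
    have "(\<lambda>n. exp (- (1 / t * (1 / real (Suc n))))) \<longlonglongrightarrow> exp (- (1 / t * 0))"
      by (intro tendsto_intros LIMSEQ_Suc[OF lim_1_over_n])
    moreover have "exp (- (1 / t * (1 / real (Suc n)))) = flat 0 (real (Suc n) * t)" for n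
      using that by (simp add: flat_def zero_less_mult_iff not_le mult.commute)
    ultimately show ?thesis
      by simp
  qed
  have "(\<lambda>n. box_bump a c (real (Suc n)) x) \<longlonglongrightarrow> (\<Prod>b\<in>(Basis::'a set). 1 * 1)"
    unfolding box_bump_def using True
    by (intro tendsto_prod tendsto_mult f) (auto simp: mem_box inner_diff_left)
  then show ?thesis
    using True by simp
qed

lemma loc_integrable_cbox:
  assumes "loc_integrable U u" "cbox a c \<subseteq> U"
  shows "integrable lebesgue (\<lambda>x. indicator (cbox a c) x *\<^sub>R u x)"
proof -
  have "integrable (lebesgue_on (cbox a c)) u"
    using assms compact_cbox[of a c] unfolding loc_integrable_def by blast
  then show ?thesis
    by (simp add: integrable_restrict_space)
qed

lemma lebesgue_on_integral:
  fixes f :: "'a::euclidean_space \<Rightarrow> 'b::euclidean_space"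
  assumes "U \<in> sets lebesgue"
  shows "integral\<^sup>L (lebesgue_on U) f = (\<integral>x. indicator U x *\<^sub>R f x \<partial>lebesgue)"
  using assms by (subst integral_restrict_space) auto

text \<open>Testing with box bumps and dominated convergence give vanishing integrals over all boxes
  in \<open>U\<close>; Lebesgue's differentiation theorem then recovers the values of
  \<open>u\<close> from its integrals over small cubes.\<close>

theorem fundamental_lemma:
  fixes u :: "'a::euclidean_space \<Rightarrow> 'b::euclidean_space"
  assumes U: "open U" and u: "loc_integrable U u"
    and zero: "\<And>\<phi>. test_function U \<phi> \<Longrightarrow> integral\<^sup>L (lebesgue_on U) (\<lambda>x. \<phi> x *\<^sub>R u x) = 0"
  shows "AE x in lebesgue_on U. u x = 0"
proof -
  have Um: "U \<in> sets lebesgue"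
    using U by simp
  have box0: "(\<integral>x. indicator (box a c) x *\<^sub>R u x \<partial>lebesgue) = 0" if sub: "cbox a c \<subseteq> U" for a c
  proof (rule LIMSEQ_unique)
    note i = loc_integrable_cbox[OF u sub]
    have bump_eq: "indicator U x *\<^sub>R (box_bump a c (real (Suc n)) x *\<^sub>R u x)
        = box_bump a c (real (Suc n)) x *\<^sub>R (indicator (cbox a c) x *\<^sub>R u x)" for n x
    proof (cases "box_bump a c (real (Suc n)) x = 0")
      case False
      then have "x \<in> cbox a c" "x \<in> U"
        using box_bump_support[of "real (Suc n)" a c x] box_subset_cbox[of a c] sub by auto
      then show ?thesis
        by (simp del: of_nat_Suc)
    qed (simp del: of_nat_Suc)
    have z: "(\<integral>x. box_bump a c (real (Suc n)) x *\<^sub>R (indicator (cbox a c) x *\<^sub>R u x) \<partial>lebesgue) = 0" for n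
      using zero[OF test_function_box_bump[OF _ sub, of "real (Suc n)"]]
      unfolding lebesgue_on_integral[OF Um] bump_eq by simp
    have cont: "continuous_on UNIV (box_bump a c n)" for n
      using box_bump_C_k[of 0 a c n] by simp
    have bm: "box_bump a c n \<in> borel_measurable lebesgue" for n
      using borel_measurable_continuous_onI[OF cont] by (intro measurable_completion) simp
    have ib: "indicator (box a c) x *\<^sub>R (indicator (cbox a c) x *\<^sub>R u x) = indicator (box a c) x *\<^sub>R u x" for x
      using box_subset_cbox[of a c] by (auto simp: indicator_def)
    have "(\<lambda>n. \<integral>x. box_bump a c (real (Suc n)) x *\<^sub>R (indicator (cbox a c) x *\<^sub>R u x) \<partial>lebesgue)
        \<longlonglongrightarrow> (\<integral>x. indicator (box a c) x *\<^sub>R (indicator (cbox a c) x *\<^sub>R u x) \<partial>lebesgue)"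
    proof (rule integral_dominated_convergence[OF _ _ integrable_norm[OF i]])
      show "AE x in lebesgue. (\<lambda>n. box_bump a c (real (Suc n)) x *\<^sub>R (indicator (cbox a c) x *\<^sub>R u x))
          \<longlonglongrightarrow> indicator (box a c) x *\<^sub>R (indicator (cbox a c) x *\<^sub>R u x)"
        by (intro AE_I2 tendsto_scaleR box_bump_lim tendsto_const)
      show "AE x in lebesgue. norm (box_bump a c (real (Suc n)) x *\<^sub>R (indicator (cbox a c) x *\<^sub>R u x))
          \<le> norm (indicator (cbox a c) x *\<^sub>R u x)" for n
        using box_bump_bounds[of a c "real (Suc n)"] by (intro AE_I2) (auto simp: mult.assoc intro!: mult_left_le_one_le simp del: of_nat_Suc)
      show "(\<lambda>x. box_bump a c (real (Suc n)) x *\<^sub>R (indicator (cbox a c) x *\<^sub>R u x)) \<in> borel_measurable lebesgue" for n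
        by (intro borel_measurable_scaleR bm borel_measurable_integrable[OF i])
      show "(\<lambda>x. indicator (box a c) x *\<^sub>R (indicator (cbox a c) x *\<^sub>R u x)) \<in> borel_measurable lebesgue"
        by (intro borel_measurable_scaleR borel_measurable_integrable[OF i] borel_measurable_indicator) auto
    qed
    then show "(\<lambda>n::nat. 0::'b) \<longlonglongrightarrow> (\<integral>x. indicator (box a c) x *\<^sub>R u x \<partial>lebesgue)"
      unfolding z ib .
  qed simp
  have on_box: "AE x in lebesgue. x \<in> cbox \<alpha> \<beta> \<longrightarrow> u x = 0" if sub: "cbox \<alpha> \<beta> \<subseteq> U" for \<alpha> \<beta>
  proof -
    define f where "f x = indicator (cbox \<alpha> \<beta>) x *\<^sub>R u x" for x
    have fi: "integrable lebesgue f"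
      unfolding f_def by (rule loc_integrable_cbox[OF u sub])
    have set_i: "set_integrable lebesgue (cbox a c) f" for a c
      unfolding set_integrable_def by (rule integrable_mult_indicator[OF _ fi]) auto
    \<comment> \<open>A box meets \<open>cbox \<alpha> \<beta>\<close> in another box, which lies in
      \<open>U\<close>; the passage from closed to open boxes costs a null set.\<close>
    have int0: "integral (cbox a c) f = 0" for a c
    proof -
      obtain a' c' where ac: "cbox a c \<inter> cbox \<alpha> \<beta> = cbox a' c'"
        using Int_interval by blast
      have "integral (cbox a c) f = (\<integral>x. indicator (cbox a c) x *\<^sub>R f x \<partial>lebesgue)"
        using set_lebesgue_integral_eq_integral(2)[OF set_i] by (simp add: set_lebesgue_integral_def)
      also have "\<dots> = (\<integral>x. indicator (cbox a' c') x *\<^sub>R u x \<partial>lebesgue)"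
        unfolding ac[symmetric] f_def by (intro Bochner_Integration.integral_cong) (auto simp: indicator_def)
      also have "\<dots> = (\<integral>x. indicator (box a' c') x *\<^sub>R u x \<partial>lebesgue)"
      proof (rule integral_cong_AE)
        have s: "cbox a' c' \<subseteq> U"
          using ac sub by auto
        note i = loc_integrable_cbox[OF u s]
        show "(\<lambda>x. indicator (cbox a' c') x *\<^sub>R u x) \<in> borel_measurable lebesgue"
          by (rule borel_measurable_integrable[OF i])
        have "(\<lambda>x. indicator (box a' c') x *\<^sub>R (indicator (cbox a' c') x *\<^sub>R u x)) \<in> borel_measurable lebesgue"
          by (intro borel_measurable_scaleR borel_measurable_integrable[OF i] borel_measurable_indicator) auto
        moreover have "indicator (box a' c') x *\<^sub>R (indicator (cbox a' c') x *\<^sub>R u x) = indicator (box a' c') x *\<^sub>R u x" for x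
          using box_subset_cbox[of a' c'] by (auto simp: indicator_def)
        ultimately show "(\<lambda>x. indicator (box a' c') x *\<^sub>R u x) \<in> borel_measurable lebesgue"
          by (simp only:)
        have "negligible (cbox a' c' - box a' c')"
          by (rule negligible_frontier_interval)
        then have "AE x in lebesgue. x \<notin> cbox a' c' - box a' c'"
          unfolding negligible_iff_null_sets by (rule AE_not_in)
        then show "AE x in lebesgue. indicator (cbox a' c') x *\<^sub>R u x = indicator (box a' c') x *\<^sub>R u x"
          by eventually_elim (use box_subset_cbox[of a' c'] in \<open>auto simp: indicator_def\<close>)
      qed
      also have "\<dots> = 0"
        using ac sub by (intro box0) auto
      finally show ?thesis .
    qed
    have "f integrable_on cbox a c" for a c
      by (rule set_lebesgue_integral_eq_integral(1)[OF set_i])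
    then obtain N where N: "negligible N" and d: "\<And>x e. x \<notin> N \<Longrightarrow> 0 < e \<Longrightarrow>
        \<exists>d>0. \<forall>h. 0 < h \<and> h < d \<longrightarrow> norm (integral (cbox x (x + h *\<^sub>R One)) f /\<^sub>R h ^ DIM('a) - f x) < e"
      using integrable_ccontinuous_explicit[of f] by blast
    have "f x = 0" if "x \<notin> N" for x
    proof (rule ccontr)
      assume "f x \<noteq> 0"
      then have "0 < norm (f x)"
        by simp
      from d[OF that this] obtain d where d: "0 < d" "\<And>h. 0 < h \<Longrightarrow> h < d \<Longrightarrow>
          norm (integral (cbox x (x + h *\<^sub>R One)) f /\<^sub>R h ^ DIM('a) - f x) < norm (f x)"
        by blast
      show False
        using d(2)[of "d / 2"] d(1) int0 by simp
    qed
    then have f0: "x \<notin> N \<Longrightarrow> f x = 0" for x .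
    have "AE x in lebesgue. x \<notin> N"
      using N unfolding negligible_iff_null_sets by (rule AE_not_in)
    then show ?thesis
    proof eventually_elim
      case (elim x)
      show ?case
        using f0[OF elim] by (auto simp: f_def)
    qed
  qed
  obtain \<D> where D: "countable \<D>" "\<And>X. X \<in> \<D> \<Longrightarrow> X \<subseteq> U" "\<And>X. X \<in> \<D> \<Longrightarrow> \<exists>a b. X = cbox a b" "\<Union>\<D> = U"
    by (rule open_countable_Union_open_cbox[OF U]) blast
  have "AE x in lebesgue. \<forall>X\<in>\<D>. x \<in> X \<longrightarrow> u x = 0"
    unfolding AE_ball_countable[OF D(1)]
  proof
    fix X assume X: "X \<in> \<D>"
    then obtain a b where "X = cbox a b" "cbox a b \<subseteq> U"
      using D(2,3) by metis
    then show "AE x in lebesgue. x \<in> X \<longrightarrow> u x = 0"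
      using on_box by simp
  qed
  then have "AE x in lebesgue. x \<in> U \<longrightarrow> u x = 0"
    by eventually_elim (use D(4) in blast)
  then show ?thesis
    using Um by (simp add: AE_restrict_space_iff)
qed

section \<open>Weak derivatives along lines\<close>

text \<open>Functions of \<open>x + s *\<^sub>R v\<close> have to be jointly measurable for the
  product of two copies of \<open>lborel\<close>; composition with a Borel function guarantees this,
  composition with a merely Lebesgue measurable one does not.\<close>

lemma borel_representative:
  fixes f :: "'a::euclidean_space \<Rightarrow> 'b::euclidean_space"
  assumes "f \<in> borel_measurable lebesgue"
  shows "\<exists>g\<in>borel_measurable borel. AE x in lborel. f x = g x"
proof -
  have "\<exists>h\<in>borel_measurable lborel. AE x in lborel. f x \<bullet> b = h x" for b
    using assms by (intro completion_ex_borel_measurable_real) simp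
  then obtain h where h: "\<And>b. h b \<in> borel_measurable lborel" "\<And>b. AE x in lborel. f x \<bullet> b = h b x"
    by metis
  have "AE x in lborel. \<forall>b\<in>Basis. f x \<bullet> b = h b x"
    using h(2) by (subst AE_finite_all) auto
  then have "AE x in lborel. f x = (\<Sum>b\<in>Basis. h b x *\<^sub>R b)"
  proof eventually_elim
    case (elim x)
    have "(\<Sum>b\<in>Basis. h b x *\<^sub>R b) = (\<Sum>b\<in>Basis. (f x \<bullet> b) *\<^sub>R b)"
      using elim by (intro sum.cong) auto
    then show ?case
      by (simp add: euclidean_representation)
  qed
  moreover have "(\<lambda>x. \<Sum>b\<in>Basis. h b x *\<^sub>R b) \<in> borel_measurable borel"
    by (intro borel_measurable_sum borel_measurable_scaleR borel_measurable_const) (use h(1) in simp)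
  ultimately show ?thesis
    by (intro bexI[of _ "\<lambda>x. \<Sum>b\<in>Basis. h b x *\<^sub>R b"])
qed

lemma lborel_translate_nn:
  assumes "f \<in> borel_measurable borel"
  shows "(\<integral>\<^sup>+x. f (x + c) \<partial>lborel) = (\<integral>\<^sup>+x. f x \<partial>(lborel :: 'a::euclidean_space measure))"
proof -
  have "(\<integral>\<^sup>+x. f x \<partial>lborel) = (\<integral>\<^sup>+x. f x \<partial>distr lborel borel ((+) c))"
    by (simp add: lborel_distr_plus)
  also have "\<dots> = (\<integral>\<^sup>+x. f (c + x) \<partial>lborel)"
    using assms by (intro nn_integral_distr) auto
  finally show ?thesis
    by (simp add: add.commute)
qed

lemma lborel_translate:
  fixes f :: "'a::euclidean_space \<Rightarrow> 'b::euclidean_space"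
  assumes "f \<in> borel_measurable borel"
  shows "(\<integral>x. f (x + c) \<partial>lborel) = (\<integral>x. f x \<partial>lborel)"
    and "integrable lborel (\<lambda>x. f (x + c)) \<longleftrightarrow> integrable lborel f"
proof -
  have "(\<integral>x. f x \<partial>lborel) = (\<integral>x. f x \<partial>distr lborel borel ((+) c))"
    by (simp add: lborel_distr_plus)
  also have "\<dots> = (\<integral>x. f (c + x) \<partial>lborel)"
    using assms by (intro integral_distr) auto
  finally show "(\<integral>x. f (x + c) \<partial>lborel) = (\<integral>x. f x \<partial>lborel)"
    by (simp add: add.commute)
  have "integrable lborel f \<longleftrightarrow> integrable (distr lborel borel ((+) c)) f"
    by (simp add: lborel_distr_plus)
  also have "\<dots> \<longleftrightarrow> integrable lborel (\<lambda>x. f (c + x))"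
    using assms by (intro integrable_distr_eq) auto
  finally show "integrable lborel (\<lambda>x. f (x + c)) \<longleftrightarrow> integrable lborel f"
    by (simp add: add.commute)
qed

text \<open>Averaging the null set over its translates by \<open>s *\<^sub>R v\<close>, \<open>0 < s < 1\<close>, avoids rotating coordinates.\<close>

lemma AE_along_lines:
  fixes v :: "'a::euclidean_space"
  assumes P: "{x. P x} \<in> sets borel"
    and ae: "AE x in lborel. AE s in lborel. 0 < s \<and> s < 1 \<longrightarrow> P (x + s *\<^sub>R v)"
  shows "AE x in lborel. P x"
proof -
  define N where "N = {x. \<not> P x}"
  have N[measurable]: "N \<in> sets borel"
    using borel_comp[OF P] by (simp add: N_def Collect_neg_eq)
  \<comment> \<open>Fubini on the pairs with \<open>x + s *\<^sub>R v\<close> in \<open>N\<close>: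
    integrating over \<open>x\<close> first gives the measure of \<open>N\<close> by translation
    invariance, integrating over \<open>s\<close> first gives 0.\<close>
  define F where "F z = (indicator {0<..<1} (fst z) * indicator N (snd z + fst z *\<^sub>R v) :: ennreal)" for z :: "real \<times> 'a"
  have F[measurable]: "F \<in> borel_measurable (lborel \<Otimes>\<^sub>M lborel)"
    unfolding F_def by measurable
  have "(\<integral>\<^sup>+s. (\<integral>\<^sup>+x. F (s, x) \<partial>lborel) \<partial>lborel) = (\<integral>\<^sup>+s. indicator {0<..<1::real} s * emeasure lborel N \<partial>lborel)"
  proof (rule nn_integral_cong)
    fix s :: real
    have "(\<integral>\<^sup>+x. F (s, x) \<partial>lborel) = indicator {0<..<1::real} s * (\<integral>\<^sup>+x. indicator N (x + s *\<^sub>R v) \<partial>lborel)"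
      unfolding F_def by (simp add: nn_integral_cmult)
    also have "(\<integral>\<^sup>+x. indicator N (x + s *\<^sub>R v) \<partial>lborel) = emeasure lborel N"
      by (subst lborel_translate_nn) auto
    finally show "(\<integral>\<^sup>+x. F (s, x) \<partial>lborel) = indicator {0<..<1::real} s * emeasure lborel N" .
  qed
  also have "\<dots> = emeasure lborel N"
    by (simp add: nn_integral_multc)
  finally have 1: "(\<integral>\<^sup>+s. (\<integral>\<^sup>+x. F (s, x) \<partial>lborel) \<partial>lborel) = emeasure lborel N" .
  have "(\<integral>\<^sup>+s. (\<integral>\<^sup>+x. F (s, x) \<partial>lborel) \<partial>lborel) = (\<integral>\<^sup>+x. (\<integral>\<^sup>+s. F (s, x) \<partial>lborel) \<partial>lborel)"
  proof -
    have "(\<lambda>(s, x). F (s, x)) \<in> borel_measurable (lborel \<Otimes>\<^sub>M lborel)"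
      using F by (simp add: case_prod_beta')
    from lborel_pair.Fubini'[OF this] show ?thesis
      by (rule sym)
  qed
  also have "\<dots> = (\<integral>\<^sup>+x. 0 \<partial>(lborel :: 'a measure))"
  proof (rule nn_integral_cong_AE, use ae in eventually_elim)
    case (elim x)
    have "(\<integral>\<^sup>+s. F (s, x) \<partial>lborel) = (\<integral>\<^sup>+s. 0 \<partial>(lborel :: real measure))"
      by (rule nn_integral_cong_AE, use elim in eventually_elim) (auto simp: F_def N_def indicator_def)
    then show ?case
      by simp
  qed
  finally have "emeasure lborel N = 0"
    using 1 by simp
  then have "N \<in> null_sets lborel"
    using N by (intro null_setsI) auto
  then show ?thesis
    by (rule AE_I') (simp add: N_def)
qed

text \<open>A Borel form of local integrability on the whole space, suited to translations and
  product measures.\<close>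

definition loc_borel :: "('a::euclidean_space \<Rightarrow> 'b::euclidean_space) \<Rightarrow> bool"
  where "loc_borel f \<longleftrightarrow> f \<in> borel_measurable borel \<and> (\<forall>R. integrable lborel (\<lambda>x. indicator (cball 0 R) x *\<^sub>R f x))"

lemma loc_borel_compact:
  assumes "loc_borel f" "compact K"
  shows "integrable lborel (\<lambda>x. indicator K x *\<^sub>R f x)"
proof -
  obtain R where R: "\<And>x. x \<in> K \<Longrightarrow> norm x \<le> R"
    using compact_imp_bounded[OF assms(2)] by (auto simp: bounded_iff)
  have "integrable lborel (\<lambda>x. indicator K x *\<^sub>R (indicator (cball 0 R) x *\<^sub>R f x))"
    by (rule integrable_mult_indicator) (use assms in \<open>auto simp: loc_borel_def compact_imp_closed\<close>)
  moreover have "(\<lambda>x. indicator K x *\<^sub>R (indicator (cball 0 R) x *\<^sub>R f x)) = (\<lambda>x. indicator K x *\<^sub>R f x)"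
    using R by (auto simp: indicator_def fun_eq_iff)
  ultimately show ?thesis
    by (simp only:)
qed

lemma loc_borel_bounded_mult:
  fixes f :: "'a::euclidean_space \<Rightarrow> 'b::euclidean_space"
  assumes f: "loc_borel f" and h: "h \<in> borel_measurable borel" "\<And>x. \<bar>h x\<bar> \<le> B" "\<And>x. R < norm x \<Longrightarrow> h x = 0"
  shows "integrable lborel (\<lambda>x. h x *\<^sub>R f x)"
proof (rule Bochner_Integration.integrable_bound)
  show "integrable lborel (\<lambda>x. B * norm (indicator (cball 0 R) x *\<^sub>R f x))"
    using f unfolding loc_borel_def by (intro integrable_mult_right integrable_norm) blast
  have "f \<in> borel_measurable borel"
    using f by (simp add: loc_borel_def)
  then show "(\<lambda>x. h x *\<^sub>R f x) \<in> borel_measurable lborel"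
    using h(1) by (simp add: borel_measurable_scaleR)
  have B: "0 \<le> B"
    using h(2)[of 0] by linarith
  show "AE x in lborel. norm (h x *\<^sub>R f x) \<le> norm (B * norm (indicator (cball 0 R) x *\<^sub>R f x))"
  proof (rule AE_I2)
    fix x
    show "norm (h x *\<^sub>R f x) \<le> norm (B * norm (indicator (cball 0 R) x *\<^sub>R f x))"
      using h(2)[of x] h(3)[of x] B by (cases "norm x \<le> R") (auto simp: abs_mult intro: mult_right_mono)
  qed
qed

lemma loc_borel_imp_loc_integrable: "loc_borel f \<Longrightarrow> loc_integrable U f"
  unfolding loc_integrable_def
proof safe
  fix K :: "'a set" assume f: "loc_borel f" and K: "compact K"
  have "K \<in> sets borel" "f \<in> borel_measurable borel"
    using f K by (auto simp: loc_borel_def compact_imp_closed)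
  then have "(\<lambda>x. indicator K x *\<^sub>R f x) \<in> borel_measurable lborel"
    by (simp add: borel_measurable_scaleR borel_measurable_indicator)
  then have "integrable lebesgue (\<lambda>x. indicator K x *\<^sub>R f x)"
    using loc_borel_compact[OF f K] by (subst integrable_completion)
  then show "integrable (lebesgue_on K) f"
    using K by (subst integrable_restrict_space) (auto simp: lmeasurable_compact fmeasurableD)
qed

lemma test_function_facts:
  fixes \<phi> :: "'a::euclidean_space \<Rightarrow> real"
  assumes "test_function U \<phi>"
  shows "(\<phi> has_derivative frechet_derivative \<phi> (at x)) (at x)"
    and "continuous_on UNIV \<phi>" "continuous_on UNIV (\<lambda>x. frechet_derivative \<phi> (at x) v)"
    and "\<exists>R B. 0 \<le> B \<and> (\<forall>x. \<bar>\<phi> x\<bar> \<le> B \<and> \<bar>frechet_derivative \<phi> (at x) v\<bar> \<le> B) \<and>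
      (\<forall>x. R < norm x \<longrightarrow> \<phi> x = 0 \<and> frechet_derivative \<phi> (at x) v = 0)"
    and "x \<notin> U \<Longrightarrow> \<phi> x = 0" "x \<notin> U \<Longrightarrow> frechet_derivative \<phi> (at x) v = 0"
proof -
  have C: "C_k k \<phi>" for k
    using assms by (simp add: test_function_def)
  show d: "(\<phi> has_derivative frechet_derivative \<phi> (at x)) (at x)" for x
    using C_k_SucD(1)[OF C] .
  show c1: "continuous_on UNIV \<phi>"
    using C[of 0] by simp
  show c2: "continuous_on UNIV (\<lambda>x. frechet_derivative \<phi> (at x) v)" for v
    using C_k_SucD(2)[OF C[of "Suc 0"], of v] by simp
  define S where "S = closure {x. \<phi> x \<noteq> 0}"
  have S: "compact S" "S \<subseteq> U"
    using assms by (auto simp: test_function_def S_def)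
  have z1: "\<phi> x = 0" if "x \<notin> S" for x
    using that closure_subset[of "{x. \<phi> x \<noteq> 0}"] by (auto simp: S_def)
  have z2: "frechet_derivative \<phi> (at x) v = 0" if "x \<notin> S" for x v
  proof -
    have "((\<lambda>_. 0::real) has_derivative (\<lambda>_. 0)) (at x)"
      by simp
    then have "(\<phi> has_derivative (\<lambda>_. 0)) (at x)"
      by (rule has_derivative_transform_within_open[where s = "- S"])
        (use that S z1 in \<open>auto simp: compact_imp_closed open_Compl\<close>)
    then have "frechet_derivative \<phi> (at x) = (\<lambda>_. 0)"
      by (rule frechet_derivative_at[symmetric])
    then show ?thesis by simp
  qed
  show "x \<notin> U \<Longrightarrow> \<phi> x = 0" "x \<notin> U \<Longrightarrow> frechet_derivative \<phi> (at x) v = 0"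
    using z1 z2 S by auto
  obtain R where R: "\<And>x. x \<in> S \<Longrightarrow> norm x \<le> R"
    using compact_imp_bounded[OF S(1)] by (auto simp: bounded_iff)
  have bd: "\<exists>B\<ge>0. \<forall>x. \<bar>h x\<bar> \<le> B" if h: "continuous_on UNIV h" "\<And>x. x \<notin> S \<Longrightarrow> h x = 0" for h :: "'a \<Rightarrow> real"
  proof -
    have "compact (h ` S)"
      using S(1) continuous_on_subset[OF h(1)] by (intro compact_continuous_image) auto
    then obtain B where B: "0 < B" "\<And>x. x \<in> S \<Longrightarrow> \<bar>h x\<bar> \<le> B"
      using compact_imp_bounded[of "h ` S"] by (auto simp: bounded_pos)
    then have "\<bar>h x\<bar> \<le> B" for x
      using h(2)[of x] by (cases "x \<in> S") auto
    then show ?thesis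
      using B(1) by (intro exI[of _ B]) auto
  qed
  obtain B1 where B1: "0 \<le> B1" "\<And>x. \<bar>\<phi> x\<bar> \<le> B1"
    using bd[OF c1 z1] by blast
  obtain B2 where B2: "0 \<le> B2" "\<And>x. \<bar>frechet_derivative \<phi> (at x) v\<bar> \<le> B2"
    using bd[OF c2 z2] by blast
  show "\<exists>R B. 0 \<le> B \<and> (\<forall>x. \<bar>\<phi> x\<bar> \<le> B \<and> \<bar>frechet_derivative \<phi> (at x) v\<bar> \<le> B) \<and>
      (\<forall>x. R < norm x \<longrightarrow> \<phi> x = 0 \<and> frechet_derivative \<phi> (at x) v = 0)"
  proof (rule exI[of _ R], rule exI[of _ "max B1 B2"], intro conjI allI impI)
    fix x
    show "\<bar>\<phi> x\<bar> \<le> max B1 B2" "\<bar>frechet_derivative \<phi> (at x) v\<bar> \<le> max B1 B2"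
      using B1(2)[of x] B2(2)[of x] by (auto simp: le_max_iff_disj)
    assume "R < norm x"
    then have "x \<notin> S"
      using R by force
    then show "\<phi> x = 0" "frechet_derivative \<phi> (at x) v = 0"
      using z1 z2 by auto
  qed (use B1 in auto)
qed

lemma test_function_translate:
  fixes \<phi> :: "'a::euclidean_space \<Rightarrow> real"
  assumes "test_function UNIV \<phi>"
  shows "test_function UNIV (\<lambda>x. \<phi> (x + c))"
    and "frechet_derivative (\<lambda>x. \<phi> (x + c)) (at x) = frechet_derivative \<phi> (at (x + c))"
proof -
  have fd: "frechet_derivative (\<lambda>x. f (x + c)) (at x) = frechet_derivative f (at (x + c))"
    if "\<And>x. (f has_derivative frechet_derivative f (at x)) (at x)" for f :: "'a \<Rightarrow> real" and x
  proof -
    have "((\<lambda>x. x + c) has_derivative (\<lambda>v. v)) (at x)"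
      by (auto intro!: derivative_eq_intros)
    from has_derivative_compose[OF this that] show ?thesis
      by (rule frechet_derivative_at[symmetric])
  qed
  have ck: "C_k k f \<Longrightarrow> C_k k (\<lambda>x. f (x + c))" for k and f :: "'a \<Rightarrow> real"
  proof (induction k arbitrary: f)
    case 0
    then show ?case
      by (auto intro!: continuous_on_compose2[of UNIV f] continuous_intros)
  next
    case (Suc k)
    show ?case
    proof (rule C_k_SucI)
      have "((\<lambda>x. x + c) has_derivative (\<lambda>v. v)) (at x)" for x
        by (auto intro!: derivative_eq_intros)
      from has_derivative_compose[OF this C_k_SucD(1)[OF Suc.prems]]
      show "((\<lambda>x. f (x + c)) has_derivative frechet_derivative f (at (x + c))) (at x)" for x .
      show "C_k k (\<lambda>x. frechet_derivative f (at (x + c)) v)" for v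
        by (rule Suc.IH[OF C_k_SucD(2)[OF Suc.prems]])
    qed
  qed
  show "frechet_derivative (\<lambda>x. \<phi> (x + c)) (at x) = frechet_derivative \<phi> (at (x + c))"
    by (rule fd) (rule test_function_facts(1)[OF assms])
  obtain R where R: "\<And>x. R < norm x \<Longrightarrow> \<phi> x = 0"
    using test_function_facts(4)[OF assms, of 0] by blast
  have "{x. \<phi> (x + c) \<noteq> 0} \<subseteq> cball 0 (R + norm c)"
  proof
    fix x assume "x \<in> {x. \<phi> (x + c) \<noteq> 0}"
    then have "norm (x + c) \<le> R"
      using R[of "x + c"] by force
    then show "x \<in> cball 0 (R + norm c)"
      using norm_triangle_ineq4[of "x + c" c] by simp
  qed
  then have "closure {x. \<phi> (x + c) \<noteq> 0} \<subseteq> cball 0 (R + norm c)"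
    by (rule closure_minimal) simp
  then have "bounded (closure {x. \<phi> (x + c) \<noteq> 0})"
    using bounded_cball bounded_subset by blast
  then have "compact (closure {x. \<phi> (x + c) \<noteq> 0})"
    by (simp add: compact_eq_bounded_closed)
  then show "test_function UNIV (\<lambda>x. \<phi> (x + c))"
    using assms ck by (auto simp: test_function_def)
qed

lemma test_function_line:
  fixes \<phi> :: "'a::euclidean_space \<Rightarrow> real"
  assumes \<phi>: "test_function U \<phi>" and t: "0 \<le> t"
  shows "(\<integral>s. indicator {0..t} s * frechet_derivative \<phi> (at (x - s *\<^sub>R v)) v \<partial>lborel) = \<phi> x - \<phi> (x - t *\<^sub>R v)"
proof -
  note d = test_function_facts(1)[OF \<phi>]
  have D: "((\<lambda>s. - \<phi> (x - s *\<^sub>R v)) has_vector_derivative frechet_derivative \<phi> (at (x - s *\<^sub>R v)) v) (at s within {0..t})" for s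
  proof -
    have "((\<lambda>s. x - s *\<^sub>R v) has_derivative (\<lambda>h. - (h *\<^sub>R v))) (at s within {0..t})"
      by (auto intro!: derivative_eq_intros)
    from has_derivative_minus[OF has_derivative_compose[OF this d]]
    have "((\<lambda>s. - \<phi> (x - s *\<^sub>R v)) has_derivative (\<lambda>h. - frechet_derivative \<phi> (at (x - s *\<^sub>R v)) (- (h *\<^sub>R v)))) (at s within {0..t})" .
    moreover have "- frechet_derivative \<phi> (at (x - s *\<^sub>R v)) (- (h *\<^sub>R v)) = h *\<^sub>R frechet_derivative \<phi> (at (x - s *\<^sub>R v)) v" for h
      using has_derivative_linear[OF d[of "x - s *\<^sub>R v"]] by (simp add: linear_neg linear_scale)
    ultimately show ?thesis
      by (simp add: has_vector_derivative_def)
  qed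
  have c: "continuous_on {0..t} (\<lambda>s. frechet_derivative \<phi> (at (x - s *\<^sub>R v)) v)"
    by (rule continuous_on_compose2[OF test_function_facts(3)[OF \<phi>]]) (auto intro!: continuous_intros)
  show ?thesis
    using integral_FTC_Icc[OF t D c] by simp
qed

text \<open>Absolute integrability on the product, by Tonelli and translation invariance; it
  licenses the exchanges of integrals in \<open>weak_derivative_line\<close>.\<close>

lemma loc_borel_segment:
  fixes H :: "'a::euclidean_space \<Rightarrow> 'b::euclidean_space"
  assumes H: "loc_borel H" and h: "h \<in> borel_measurable borel" "\<And>x. \<bar>h x\<bar> \<le> B" "\<And>x. R < norm x \<Longrightarrow> h x = 0"
  shows "integrable (lborel \<Otimes>\<^sub>M lborel) (\<lambda>(x, s). (h x * indicator {0..t} s) *\<^sub>R H (x + s *\<^sub>R v))"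
proof -
  have Hm[measurable]: "H \<in> borel_measurable borel"
    using H by (simp add: loc_borel_def)
  note h(1)[measurable]
  define R' where "R' = R + \<bar>t\<bar> * norm v"
  define k where "k x = ennreal (norm (indicator (cball 0 R') x *\<^sub>R H x))" for x
  have k[measurable]: "k \<in> borel_measurable borel"
  proof -
    have "(\<lambda>x. indicator (cball 0 R') x *\<^sub>R H x) \<in> borel_measurable borel"
      by (rule borel_measurable_scaleR) (auto intro: borel_measurable_indicator Hm)
    from measurable_compose[OF measurable_compose[OF this borel_measurable_norm] measurable_ennreal] show ?thesis
      by (simp only: k_def[abs_def])
  qed
  define c where "c = (\<integral>\<^sup>+x. k x \<partial>lborel)"
  have c: "c < \<infinity>"
    using H unfolding loc_borel_def integrable_iff_bounded c_def k_def by blast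
  define F where "F z = (h (fst z) * indicator {0..t} (snd z)) *\<^sub>R H (fst z + snd z *\<^sub>R v)" for z
  have F[measurable]: "F \<in> borel_measurable (lborel \<Otimes>\<^sub>M lborel)"
    unfolding F_def by measurable
  have B: "0 \<le> B"
    using h(2)[of 0] by linarith
  have "(\<integral>\<^sup>+z. ennreal (norm (F z)) \<partial>(lborel \<Otimes>\<^sub>M lborel)) = (\<integral>\<^sup>+s. (\<integral>\<^sup>+x. ennreal (norm (F (x, s))) \<partial>lborel) \<partial>lborel)"
  proof -
    have "(\<lambda>(x, s). ennreal (norm (F (x, s)))) \<in> borel_measurable (lborel \<Otimes>\<^sub>M lborel)"
      by measurable
    from lborel_pair.nn_integral_snd[OF this] show ?thesis
      by (simp add: case_prod_beta')
  qed
  also have "\<dots> \<le> (\<integral>\<^sup>+s. indicator {0..t} s * (ennreal B * c) \<partial>lborel)"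
  proof (rule nn_integral_mono)
    fix s :: real
    show "(\<integral>\<^sup>+x. ennreal (norm (F (x, s))) \<partial>lborel) \<le> indicator {0..t} s * (ennreal B * c)"
    proof (cases "s \<in> {0..t}")
      case True
      have "(\<integral>\<^sup>+x. ennreal (norm (F (x, s))) \<partial>lborel)
          \<le> (\<integral>\<^sup>+x. ennreal B * k (x + s *\<^sub>R v) \<partial>lborel)"
      proof (rule nn_integral_mono)
        fix x :: 'a
        show "ennreal (norm (F (x, s))) \<le> ennreal B * k (x + s *\<^sub>R v)"
        proof (cases "norm x \<le> R")
          case nx: True
          have "norm (s *\<^sub>R v) \<le> \<bar>t\<bar> * norm v"
            using True by (auto intro!: mult_right_mono)
          then have "norm (x + s *\<^sub>R v) \<le> R'"
            using nx norm_triangle_ineq[of x "s *\<^sub>R v"] by (simp add: R'_def)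
          then show ?thesis
            using h(2)[of x] True B by (auto simp: F_def k_def ennreal_mult''[symmetric] intro!: ennreal_leI mult_right_mono)
        qed (use h(3)[of x] in \<open>simp add: F_def\<close>)
      qed
      also have "\<dots> = ennreal B * c"
        unfolding c_def by (subst nn_integral_cmult) (auto simp: lborel_translate_nn[OF k])
      finally show ?thesis
        using True by simp
    qed (simp add: F_def)
  qed
  also have "\<dots> = emeasure lborel {0..t} * (ennreal B * c)"
    by (simp add: nn_integral_multc)
  also have "\<dots> < \<infinity>"
    using c by (auto simp: ennreal_mult_less_top emeasure_lborel_Icc_eq)
  finally have "integrable (lborel \<Otimes>\<^sub>M lborel) F"
    by (intro integrableI_bounded F) simp
  then show ?thesis
    by (simp add: F_def[abs_def] case_prod_beta')
qed

text \<open>The fundamental theorem of calculus in direction \<open>v\<close>. Tested against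
  \<open>\<phi>\<close>, the translation moves over to \<open>\<phi>\<close>, where the ordinary
  fundamental theorem holds along lines; Fubini and the weak equation for translates of
  \<open>\<phi>\<close> then produce the test integral of the right-hand side.\<close>

theorem weak_derivative_line:
  fixes g H :: "'a::euclidean_space \<Rightarrow> 'b::euclidean_space"
  assumes g: "loc_borel g" and H: "loc_borel H" and t: "0 \<le> t"
    and weak: "\<And>\<phi>. test_function UNIV \<phi> \<Longrightarrow>
      (\<integral>x. frechet_derivative \<phi> (at x) v *\<^sub>R g x \<partial>lborel) = - (\<integral>x. \<phi> x *\<^sub>R H x \<partial>lborel)"
  shows "AE x in lborel. integrable lborel (\<lambda>s. indicator {0..t} s *\<^sub>R H (x + s *\<^sub>R v)) \<and>
    g (x + t *\<^sub>R v) - g x = (\<integral>s. indicator {0..t} s *\<^sub>R H (x + s *\<^sub>R v) \<partial>lborel)"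
proof -
  have gm[measurable]: "g \<in> borel_measurable borel" and Hm[measurable]: "H \<in> borel_measurable borel"
    using g H by (auto simp: loc_borel_def)
  define J where "J x = (\<integral>s. indicator {0..t} s *\<^sub>R H (x + s *\<^sub>R v) \<partial>lborel)" for x
  have J[measurable]: "J \<in> borel_measurable borel"
    unfolding J_def by measurable
  have prodJ: "integrable lborel (\<lambda>x. h x *\<^sub>R J x)"
    if h: "h \<in> borel_measurable borel" "\<And>x. \<bar>h x\<bar> \<le> B" "\<And>x. R < norm x \<Longrightarrow> h x = 0" for h B R
  proof -
    have "integrable lborel (\<lambda>x. \<integral>s. (h x * indicator {0..t} s) *\<^sub>R H (x + s *\<^sub>R v) \<partial>lborel)"
      using lborel_pair.integrable_fst'[OF loc_borel_segment[OF H h, where t = t and v = v]] by simp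
    then show ?thesis
      by (simp add: J_def scaleR_scaleR[symmetric] del: scaleR_scaleR)
  qed
  have ind: "\<bar>indicator (cball 0 R) x\<bar> \<le> (1::real)" for R and x :: 'a
    by (simp add: indicator_def)
  have ls: "AE x in lborel. integrable lborel (\<lambda>s. indicator {0..t} s *\<^sub>R H (x + s *\<^sub>R v))"
  proof -
    have "AE x in lborel. \<forall>n::nat. integrable lborel (\<lambda>s. (indicator (cball 0 (real n)) x * indicator {0..t} s) *\<^sub>R H (x + s *\<^sub>R v))"
      unfolding AE_all_countable
    proof
      fix n :: nat
      show "AE x in lborel. integrable lborel (\<lambda>s. (indicator (cball 0 (real n)) x * indicator {0..t} s) *\<^sub>R H (x + s *\<^sub>R v))"
        using lborel_pair.AE_integrable_fst'[OF loc_borel_segment[OF H, where h = "indicator (cball 0 (real n))" and B = 1 and R = "real n" and t = t and v = v]]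
        by (simp add: ind borel_measurable_indicator)
    qed
    then show ?thesis
    proof eventually_elim
      case (elim x)
      obtain n :: nat where "norm x \<le> real n"
        using real_arch_simple by blast
      then show ?case
        using elim[rule_format, of n] by simp
    qed
  qed
  \<comment> \<open>The defect vanishes against every test function, as shown below, and is
    therefore 0 almost everywhere by \<open>fundamental_lemma\<close>.\<close>
  define D where "D x = g (x + t *\<^sub>R v) - g x - J x" for x
  have gt: "loc_borel (\<lambda>x. g (x + t *\<^sub>R v))"
    unfolding loc_borel_def
  proof safe
    fix R
    have "integrable lborel (\<lambda>x. indicator (cball 0 R) (x - t *\<^sub>R v) *\<^sub>R g x)"
    proof (rule loc_borel_bounded_mult[OF g, of _ 1 "R + norm (t *\<^sub>R v)"])
      fix x :: 'a assume "R + norm (t *\<^sub>R v) < norm x"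
      then have "\<not> norm (x - t *\<^sub>R v) \<le> R"
        using norm_triangle_ineq2[of x "t *\<^sub>R v"] by linarith
      then show "indicator (cball 0 R) (x - t *\<^sub>R v) = (0::real)"
        by simp
    qed (auto simp: indicator_def)
    then have "integrable lborel (\<lambda>x. indicator (cball 0 R) ((x + t *\<^sub>R v) - t *\<^sub>R v) *\<^sub>R g (x + t *\<^sub>R v))"
      by (subst lborel_translate(2)[where f = "\<lambda>x. indicator (cball 0 R) (x - t *\<^sub>R v) *\<^sub>R g x"]) auto
    then show "integrable lborel (\<lambda>x. indicator (cball 0 R) x *\<^sub>R g (x + t *\<^sub>R v))"
      by simp
  qed measurable
  have "loc_borel D"
    unfolding loc_borel_def
  proof safe
    fix R
    have jR: "integrable lborel (\<lambda>x. indicator (cball 0 R) x *\<^sub>R J x)"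
      by (rule prodJ[where B = 1 and R = R]) (auto simp: ind intro: borel_measurable_indicator)
    have "integrable lborel (\<lambda>x. indicator (cball 0 R) x *\<^sub>R g (x + t *\<^sub>R v) - indicator (cball 0 R) x *\<^sub>R g x - indicator (cball 0 R) x *\<^sub>R J x)"
      using g gt jR by (intro Bochner_Integration.integrable_diff) (auto simp: loc_borel_def)
    then show "integrable lborel (\<lambda>x. indicator (cball 0 R) x *\<^sub>R D x)"
      by (simp add: D_def scaleR_diff_right)
  qed (unfold D_def[abs_def], measurable)
  then have Dl: "loc_integrable UNIV D" and Dm: "D \<in> borel_measurable borel"
    using loc_borel_imp_loc_integrable by (auto simp: loc_borel_def)
  have "(\<integral>x. \<phi> x *\<^sub>R D x \<partial>lborel) = 0" if \<phi>: "test_function UNIV \<phi>" for \<phi>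
  proof -
    obtain R B where B: "0 \<le> B" "\<And>x. \<bar>\<phi> x\<bar> \<le> B" "\<And>x. \<bar>frechet_derivative \<phi> (at x) v\<bar> \<le> B"
      and R: "\<And>x. R < norm x \<Longrightarrow> \<phi> x = 0" "\<And>x. R < norm x \<Longrightarrow> frechet_derivative \<phi> (at x) v = 0"
      using test_function_facts(4)[OF \<phi>, of v] by blast
    define \<phi>' where "\<phi>' x = frechet_derivative \<phi> (at x) v" for x
    have m[measurable]: "\<phi> \<in> borel_measurable borel" "\<phi>' \<in> borel_measurable borel"
      unfolding \<phi>'_def using test_function_facts(2,3)[OF \<phi>] by (auto intro: borel_measurable_continuous_onI)
    define R' where "R' = R + norm (t *\<^sub>R v)"
    have i1: "integrable lborel (\<lambda>x. \<phi> x *\<^sub>R g (x + t *\<^sub>R v))" "integrable lborel (\<lambda>x. \<phi> x *\<^sub>R g x)" "integrable lborel (\<lambda>x. \<phi> x *\<^sub>R J x)"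
      using loc_borel_bounded_mult[OF gt m(1) B(2) R(1)] loc_borel_bounded_mult[OF g m(1) B(2) R(1)]
        prodJ[OF m(1) B(2) R(1)] by auto
    have shift: "(\<integral>x. \<phi> x *\<^sub>R g (x + t *\<^sub>R v) \<partial>lborel) = (\<integral>x. \<phi> (x - t *\<^sub>R v) *\<^sub>R g x \<partial>lborel)"
      using lborel_translate(1)[where f = "\<lambda>x. \<phi> (x - t *\<^sub>R v) *\<^sub>R g x" and c = "t *\<^sub>R v"] by simp
    have i2: "integrable lborel (\<lambda>x. \<phi> (x - t *\<^sub>R v) *\<^sub>R g x)"
      using i1(1) lborel_translate(2)[where f = "\<lambda>x. \<phi> (x - t *\<^sub>R v) *\<^sub>R g x" and c = "t *\<^sub>R v"] by simp
    have gs: "integrable (lborel \<Otimes>\<^sub>M lborel) (\<lambda>(x, s). (indicator {0..t} s * \<phi>' (x - s *\<^sub>R v)) *\<^sub>R g x)"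
    proof (rule Bochner_Integration.integrable_bound)
      have "integrable (lborel \<Otimes>\<^sub>M lborel) (\<lambda>(x, s). (indicator (cball 0 R') x * indicator {0..t} s) *\<^sub>R g (x + s *\<^sub>R 0))"
        by (rule loc_borel_segment[OF g, where B = 1 and R = R']) (auto simp: ind intro: borel_measurable_indicator)
      from integrable_mult_right[OF integrable_norm[OF this], of B]
      show "integrable (lborel \<Otimes>\<^sub>M lborel) (\<lambda>(x, s). (B * norm (indicator (cball 0 R') x *\<^sub>R g x)) * indicator {0..t} s)"
        by (simp add: case_prod_beta' mult_ac)
      show "(\<lambda>(x, s). (indicator {0..t} s * \<phi>' (x - s *\<^sub>R v)) *\<^sub>R g x) \<in> borel_measurable (lborel \<Otimes>\<^sub>M lborel)"
        by measurable
      have "norm ((indicator {0..t} s * \<phi>' (x - s *\<^sub>R v)) *\<^sub>R g x) \<le> norm ((B * norm (indicator (cball 0 R') x *\<^sub>R g x)) * indicator {0..t} s)" for x s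
      proof (cases "s \<in> {0..t}")
        case True
        show ?thesis
        proof (cases "norm x \<le> R'")
          case nx: True
          then show ?thesis
            using True B(1) B(3)[of "x - s *\<^sub>R v"] by (simp add: \<phi>'_def mult_right_mono)
        next
          case False
          have "norm (s *\<^sub>R v) \<le> norm (t *\<^sub>R v)"
            using True by (auto intro!: mult_right_mono)
          then have "R < norm (x - s *\<^sub>R v)"
            using False norm_triangle_ineq2[of x "s *\<^sub>R v"] unfolding R'_def by linarith
          then show ?thesis
            using R(2) by (simp add: \<phi>'_def)
        qed
      qed simp
      then show "AE z in lborel \<Otimes>\<^sub>M lborel. norm (case z of (x, s) \<Rightarrow> (indicator {0..t} s * \<phi>' (x - s *\<^sub>R v)) *\<^sub>R g x)
          \<le> norm (case z of (x, s) \<Rightarrow> (B * norm (indicator (cball 0 R') x *\<^sub>R g x)) * indicator {0..t} s)"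
        by (intro AE_I2) (simp add: case_prod_beta')
    qed
    have "(\<integral>x. \<phi> x *\<^sub>R (g (x + t *\<^sub>R v) - g x) \<partial>lborel) = (\<integral>x. (\<phi> (x - t *\<^sub>R v) - \<phi> x) *\<^sub>R g x \<partial>lborel)"
      using i1 i2 shift by (simp add: scaleR_diff_right scaleR_diff_left)
    also have "\<dots> = (\<integral>x. - (\<integral>s. (indicator {0..t} s * \<phi>' (x - s *\<^sub>R v)) *\<^sub>R g x \<partial>lborel) \<partial>lborel)"
    proof (rule Bochner_Integration.integral_cong[OF refl])
      fix x
      have c: "continuous_on {0..t} (\<lambda>s. \<phi>' (x - s *\<^sub>R v))"
        unfolding \<phi>'_def by (rule continuous_on_compose2[OF test_function_facts(3)[OF \<phi>]]) (auto intro!: continuous_intros)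
      have "integrable lborel (\<lambda>s. indicator {0..t} s *\<^sub>R \<phi>' (x - s *\<^sub>R v))"
        by (rule borel_integrable_compact[OF _ c]) auto
      then have "(\<integral>s. (indicator {0..t} s * \<phi>' (x - s *\<^sub>R v)) *\<^sub>R g x \<partial>lborel) = (\<phi> x - \<phi> (x - t *\<^sub>R v)) *\<^sub>R g x"
        using test_function_line[OF \<phi> t, where x = x and v = v] by (simp add: \<phi>'_def)
      then show "(\<phi> (x - t *\<^sub>R v) - \<phi> x) *\<^sub>R g x = - (\<integral>s. (indicator {0..t} s * \<phi>' (x - s *\<^sub>R v)) *\<^sub>R g x \<partial>lborel)"
        by (simp add: scaleR_diff_left)
    qed
    also have "\<dots> = - (\<integral>x. (\<integral>s. (indicator {0..t} s * \<phi>' (x - s *\<^sub>R v)) *\<^sub>R g x \<partial>lborel) \<partial>lborel)"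
      by simp
    also have "(\<integral>x. (\<integral>s. (indicator {0..t} s * \<phi>' (x - s *\<^sub>R v)) *\<^sub>R g x \<partial>lborel) \<partial>lborel)
        = (\<integral>s. (\<integral>x. (indicator {0..t} s * \<phi>' (x - s *\<^sub>R v)) *\<^sub>R g x \<partial>lborel) \<partial>lborel)"
      by (rule lborel_pair.Fubini_integral[symmetric]) (rule gs)
    \<comment> \<open>Here the weak equation enters, for the test function translated by
      \<open>s *\<^sub>R v\<close>.\<close>
    also have "\<dots> = (\<integral>s. - (\<integral>x. (\<phi> x * indicator {0..t} s) *\<^sub>R H (x + s *\<^sub>R v) \<partial>lborel) \<partial>lborel)"
    proof (rule Bochner_Integration.integral_cong[OF refl])
      fix s :: real
      note tr = test_function_translate[OF \<phi>, of "- (s *\<^sub>R v)"]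
      have "(\<integral>x. \<phi>' (x - s *\<^sub>R v) *\<^sub>R g x \<partial>lborel) = - (\<integral>x. \<phi> (x - s *\<^sub>R v) *\<^sub>R H x \<partial>lborel)"
        using weak[OF tr(1)] unfolding tr(2) by (simp add: \<phi>'_def)
      also have "(\<integral>x. \<phi> (x - s *\<^sub>R v) *\<^sub>R H x \<partial>lborel) = (\<integral>x. \<phi> x *\<^sub>R H (x + s *\<^sub>R v) \<partial>lborel)"
        using lborel_translate(1)[where f = "\<lambda>x. \<phi> (x - s *\<^sub>R v) *\<^sub>R H x" and c = "s *\<^sub>R v"] by simp
      finally show "(\<integral>x. (indicator {0..t} s * \<phi>' (x - s *\<^sub>R v)) *\<^sub>R g x \<partial>lborel) = - (\<integral>x. (\<phi> x * indicator {0..t} s) *\<^sub>R H (x + s *\<^sub>R v) \<partial>lborel)"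
        by (cases "s \<in> {0..t}") auto
    qed
    also have "\<dots> = - (\<integral>s. (\<integral>x. (\<phi> x * indicator {0..t} s) *\<^sub>R H (x + s *\<^sub>R v) \<partial>lborel) \<partial>lborel)"
      by simp
    also have "(\<integral>s. (\<integral>x. (\<phi> x * indicator {0..t} s) *\<^sub>R H (x + s *\<^sub>R v) \<partial>lborel) \<partial>lborel)
        = (\<integral>x. (\<integral>s. (\<phi> x * indicator {0..t} s) *\<^sub>R H (x + s *\<^sub>R v) \<partial>lborel) \<partial>lborel)"
      by (rule lborel_pair.Fubini_integral) (rule loc_borel_segment[OF H m(1) B(2) R(1)])
    also have "\<dots> = (\<integral>x. \<phi> x *\<^sub>R J x \<partial>lborel)"
      by (simp add: J_def scaleR_scaleR[symmetric] del: scaleR_scaleR)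
    finally have "(\<integral>x. \<phi> x *\<^sub>R (g (x + t *\<^sub>R v) - g x) \<partial>lborel) = (\<integral>x. \<phi> x *\<^sub>R J x \<partial>lborel)"
      by simp
    then show ?thesis
      using i1 by (simp add: D_def scaleR_diff_right)
  qed
  moreover have "integral\<^sup>L (lebesgue_on UNIV) (\<lambda>x. \<phi> x *\<^sub>R D x) = (\<integral>x. \<phi> x *\<^sub>R D x \<partial>lborel)" if \<phi>: "test_function UNIV \<phi>" for \<phi>
  proof -
    have "\<phi> \<in> borel_measurable borel"
      using test_function_facts(2)[OF \<phi>] by (rule borel_measurable_continuous_onI)
    then show ?thesis
      unfolding lebesgue_on_UNIV_eq using Dm by (subst integral_completion) auto
  qed
  ultimately have "AE x in lebesgue_on UNIV. D x = 0"
    by (intro fundamental_lemma[OF open_UNIV Dl]) simp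
  then have "AE x in lborel. D x = 0"
    unfolding lebesgue_on_UNIV_eq AE_completion_iff .
  with ls show ?thesis
    by eventually_elim (simp add: D_def J_def)
qed

section \<open>Rademacher's theorem\<close>

lemma continuous_loc_borel:
  fixes g :: "'a::euclidean_space \<Rightarrow> 'b::euclidean_space"
  assumes "continuous_on UNIV g"
  shows "loc_borel g"
  unfolding loc_borel_def
proof safe
  show "g \<in> borel_measurable borel"
    by (rule borel_measurable_continuous_onI[OF assms])
  show "integrable lborel (\<lambda>x. indicator (cball 0 R) x *\<^sub>R g x)" for R
    by (rule borel_integrable_compact) (auto intro: continuous_on_subset[OF assms])
qed

lemma emeasure_cball_less_top: "emeasure lborel (cball (a :: 'a::euclidean_space) R) < top"
  using emeasure_bounded_finite[OF bounded_cball[of a R]] by simp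

lemma integrable_indicator_cball:
  "integrable lborel (indicator (cball a R) :: 'a::euclidean_space \<Rightarrow> real)"
  using emeasure_bounded_finite[OF bounded_cball[of a R]] by (simp add: integrable_indicator_iff)

lemma has_derivative_diff_quot:
  fixes f :: "'a::real_normed_vector \<Rightarrow> 'b::real_normed_vector"
  assumes "(f has_derivative D) (at x)"
  shows "(\<lambda>n. real (Suc n) *\<^sub>R (f (x + w /\<^sub>R real (Suc n)) - f x)) \<longlonglongrightarrow> D w"
proof (rule LIMSEQ_I)
  fix e :: real assume e: "0 < e"
  define e' where "e' = e / (norm w + 1)"
  have e': "0 < e'"
    using e by (simp add: e'_def add_nonneg_pos)
  have bl: "bounded_linear D"
    using assms by (rule has_derivative_bounded_linear)
  obtain d where d: "0 < d" "\<And>y. norm (y - x) < d \<Longrightarrow> norm (f y - f x - D (y - x)) \<le> e' * norm (y - x)"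
    using assms e' unfolding has_derivative_at_alt by blast
  have "(\<lambda>n. norm w * (1 / real (Suc n))) \<longlonglongrightarrow> norm w * 0"
    by (intro tendsto_intros LIMSEQ_Suc[OF lim_1_over_n])
  then have "\<forall>\<^sub>F n in sequentially. norm w * (1 / real (Suc n)) < d"
    using d by (intro order_tendstoD) auto
  then obtain N where N: "\<And>n. N \<le> n \<Longrightarrow> norm w * (1 / real (Suc n)) < d"
    by (auto simp: eventually_sequentially)
  have "norm (real (Suc n) *\<^sub>R (f (x + w /\<^sub>R real (Suc n)) - f x) - D w) < e" if "N \<le> n" for n
  proof -
    define r where "r = real (Suc n)"
    have r: "0 < r"
      by (simp add: r_def)
    have nw: "norm (w /\<^sub>R r) = norm w * (1 / r)"
      using r by (simp add: divide_inverse mult.commute)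
    have "D w = r *\<^sub>R D (w /\<^sub>R r)"
      using r linear_scale[OF bounded_linear.linear[OF bl], of "inverse r" w] by simp
    then have "r *\<^sub>R (f (x + w /\<^sub>R r) - f x) - D w = r *\<^sub>R (f (x + w /\<^sub>R r) - f x - D (w /\<^sub>R r))"
      by (simp add: scaleR_diff_right)
    then have "norm (r *\<^sub>R (f (x + w /\<^sub>R r) - f x) - D w) = r * norm (f (x + w /\<^sub>R r) - f x - D (w /\<^sub>R r))"
      using r by simp
    also have "\<dots> \<le> r * (e' * norm (w /\<^sub>R r))"
      using d(2)[of "x + w /\<^sub>R r"] N[OF that] nw r by (intro mult_left_mono) (auto simp: r_def)
    also have "\<dots> = e' * norm w"
      unfolding nw using r by simp
    also have "\<dots> < e' * (norm w + 1)"
      using e' by (intro mult_strict_left_mono) auto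
    also have "\<dots> = e"
    proof -
      have "norm w + 1 \<noteq> 0"
        using norm_ge_zero[of w] by linarith
      then show ?thesis
        by (simp add: e'_def)
    qed
    finally show ?thesis
      by (simp only: r_def)
  qed
  then show "\<exists>no. \<forall>n\<ge>no. norm (real (Suc n) *\<^sub>R (f (x + w /\<^sub>R real (Suc n)) - f x) - D w) < e"
    by blast
qed

text \<open>Integration by parts in discrete form: translation invariance turns the difference
  quotient of \<open>g\<close> in direction \<open>v\<close> into one of \<open>\<phi>\<close> in
  direction \<open>- v\<close>, which is bounded and converges pointwise.\<close>

lemma test_diff_quot_tendsto:
  fixes g :: "'a::euclidean_space \<Rightarrow> 'b::euclidean_space"
  assumes \<phi>: "test_function UNIV \<phi>" and g: "loc_borel g"
  shows "(\<lambda>n. \<integral>x. \<phi> x *\<^sub>R (real (Suc n) *\<^sub>R (g (x + v /\<^sub>R real (Suc n)) - g x)) \<partial>lborel)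
    \<longlonglongrightarrow> - (\<integral>x. frechet_derivative \<phi> (at x) v *\<^sub>R g x \<partial>lborel)"
proof -
  have gm[measurable]: "g \<in> borel_measurable borel"
    using g by (simp add: loc_borel_def)
  obtain R B where B: "0 \<le> B" "\<And>x. \<bar>\<phi> x\<bar> \<le> B" "\<And>x. \<bar>frechet_derivative \<phi> (at x) v\<bar> \<le> B"
    and R: "\<And>x. R < norm x \<Longrightarrow> \<phi> x = 0"
    using test_function_facts(4)[OF \<phi>, of v] by blast
  have pm[measurable]: "\<phi> \<in> borel_measurable borel"
    using test_function_facts(2)[OF \<phi>] by (rule borel_measurable_continuous_onI)
  have fm[measurable]: "(\<lambda>x. frechet_derivative \<phi> (at x) v) \<in> borel_measurable borel"
    using test_function_facts(3)[OF \<phi>] by (rule borel_measurable_continuous_onI)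
  define q where "q n x = real (Suc n) * (\<phi> (x - v /\<^sub>R real (Suc n)) - \<phi> x)" for n x
  have qm[measurable]: "q n \<in> borel_measurable borel" for n
    unfolding q_def by measurable
  have small: "norm (v /\<^sub>R real (Suc n)) \<le> norm v" for n
    using mult_right_mono[of "inverse (real (Suc n))" 1 "norm v"] by (simp add: inverse_le_1_iff)
  have zero: "\<phi> (x - v /\<^sub>R real (Suc n)) = 0" "\<phi> x = 0" if "R + norm v < norm x" for x n
  proof -
    have "R < norm (x - v /\<^sub>R real (Suc n))" "R < norm x"
      using that small[of n] norm_triangle_ineq2[of x "v /\<^sub>R real (Suc n)"] norm_ge_zero[of v] by linarith+
    then show "\<phi> (x - v /\<^sub>R real (Suc n)) = 0" "\<phi> x = 0"
      by (simp_all add: R)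
  qed
  have qB: "\<bar>q n x\<bar> \<le> B" for n x
  proof -
    define t where "t = inverse (real (Suc n))"
    have t: "0 < t"
      by (simp add: t_def)
    have "\<bar>\<phi> x - \<phi> (x - t *\<^sub>R v)\<bar> = \<bar>\<integral>s. indicator {0..t} s * frechet_derivative \<phi> (at (x - s *\<^sub>R v)) v \<partial>lborel\<bar>"
      using test_function_line[OF \<phi>, of t x v] t by simp
    also have "\<dots> \<le> (\<integral>s. B * indicator {0..t} s \<partial>lborel)"
    proof (rule order_trans[OF integral_abs_bound], rule integral_mono')
      show "integrable lborel (\<lambda>s. B * indicator {0..t} s)"
        by (intro integrable_mult_right) (auto simp: integrable_indicator_iff emeasure_lborel_Icc_eq)
      show "\<bar>indicator {0..t} s * frechet_derivative \<phi> (at (x - s *\<^sub>R v)) v\<bar> \<le> B * indicator {0..t} s" for s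
        using B(3) by (auto simp: indicator_def)
    qed (use B in auto)
    also have "\<dots> = B * t"
      using t by simp
    finally have "\<bar>\<phi> x - \<phi> (x - t *\<^sub>R v)\<bar> / t \<le> B"
      using t by (simp add: divide_le_eq)
    moreover have "\<bar>q n x\<bar> = \<bar>\<phi> x - \<phi> (x - t *\<^sub>R v)\<bar> / t"
      by (simp add: q_def t_def abs_mult abs_minus_commute divide_inverse mult.commute)
    ultimately show ?thesis
      by simp
  qed
  have eq: "(\<integral>x. \<phi> x *\<^sub>R (real (Suc n) *\<^sub>R (g (x + v /\<^sub>R real (Suc n)) - g x)) \<partial>lborel) = (\<integral>x. q n x *\<^sub>R g x \<partial>lborel)" for n
  proof -
    define r where "r = real (Suc n)"
    let ?v = "v /\<^sub>R r"
    have i1: "integrable lborel (\<lambda>x. \<phi> x *\<^sub>R g x)"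
      by (rule loc_borel_bounded_mult[OF g pm B(2) R])
    have i2: "integrable lborel (\<lambda>x. \<phi> (x - ?v) *\<^sub>R g x)"
    proof (rule loc_borel_bounded_mult[OF g])
      show "(\<lambda>x. \<phi> (x - ?v)) \<in> borel_measurable borel"
        by measurable
      show "\<bar>\<phi> (x - ?v)\<bar> \<le> B" for x
        by (rule B(2))
      show "\<phi> (x - ?v) = 0" if "R + norm v < norm x" for x
        using zero(1)[OF that] by (simp only: r_def)
    qed
    have i3: "integrable lborel (\<lambda>x. \<phi> x *\<^sub>R g (x + ?v))"
      using i2 lborel_translate(2)[where f = "\<lambda>x. \<phi> (x - ?v) *\<^sub>R g x" and c = ?v] by simp
    have "(\<integral>x. \<phi> x *\<^sub>R g (x + ?v) \<partial>lborel) = (\<integral>x. \<phi> (x - ?v) *\<^sub>R g x \<partial>lborel)"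
      using lborel_translate(1)[where f = "\<lambda>x. \<phi> (x - ?v) *\<^sub>R g x" and c = ?v] by simp
    then have "r *\<^sub>R (\<integral>x. \<phi> x *\<^sub>R g (x + ?v) - \<phi> x *\<^sub>R g x \<partial>lborel) = r *\<^sub>R (\<integral>x. \<phi> (x - ?v) *\<^sub>R g x - \<phi> x *\<^sub>R g x \<partial>lborel)"
      using i1 i2 i3 by simp
    then have "(\<integral>x. r *\<^sub>R (\<phi> x *\<^sub>R g (x + ?v) - \<phi> x *\<^sub>R g x) \<partial>lborel) = (\<integral>x. r *\<^sub>R (\<phi> (x - ?v) *\<^sub>R g x - \<phi> x *\<^sub>R g x) \<partial>lborel)"
      by (simp only: integral_scaleR_right)
    moreover have "r *\<^sub>R (\<phi> x *\<^sub>R g (x + ?v) - \<phi> x *\<^sub>R g x) = \<phi> x *\<^sub>R (r *\<^sub>R (g (x + ?v) - g x))" for x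
      by (simp add: algebra_simps)
    moreover have "r *\<^sub>R (\<phi> (x - ?v) *\<^sub>R g x - \<phi> x *\<^sub>R g x) = (r * (\<phi> (x - ?v) - \<phi> x)) *\<^sub>R g x" for x
      by (simp add: algebra_simps)
    ultimately show ?thesis
      by (simp only: q_def r_def)
  qed
  have "(\<lambda>n. \<integral>x. q n x *\<^sub>R g x \<partial>lborel) \<longlonglongrightarrow> (\<integral>x. (- frechet_derivative \<phi> (at x) v) *\<^sub>R g x \<partial>lborel)"
  proof (rule integral_dominated_convergence)
    show "integrable lborel (\<lambda>x. B * norm (indicator (cball 0 (R + norm v)) x *\<^sub>R g x))"
      using g unfolding loc_borel_def by (intro integrable_mult_right integrable_norm) blast
    show "AE x in lborel. (\<lambda>n. q n x *\<^sub>R g x) \<longlonglongrightarrow> (- frechet_derivative \<phi> (at x) v) *\<^sub>R g x"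
    proof (intro AE_I2 tendsto_scaleR tendsto_const)
      fix x
      have "linear (frechet_derivative \<phi> (at x))"
        using has_derivative_linear[OF test_function_facts(1)[OF \<phi>]] .
      then show "(\<lambda>n. q n x) \<longlonglongrightarrow> - frechet_derivative \<phi> (at x) v"
        using has_derivative_diff_quot[OF test_function_facts(1)[OF \<phi>], of x "- v"] by (simp add: q_def linear_neg)
    qed
    show "AE x in lborel. norm (q n x *\<^sub>R g x) \<le> B * norm (indicator (cball 0 (R + norm v)) x *\<^sub>R g x)" for n
    proof (rule AE_I2)
      fix x
      show "norm (q n x *\<^sub>R g x) \<le> B * norm (indicator (cball 0 (R + norm v)) x *\<^sub>R g x)"
      proof (cases "norm x \<le> R + norm v")
        case True
        then show ?thesis
          using qB[of n x] by (simp add: mult_right_mono)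
      next
        case False
        then have "q n x = 0"
          using zero(1)[of x n] zero(2)[of x] by (simp add: q_def)
        then show ?thesis
          using B by simp
      qed
    qed
  qed measurable
  then show ?thesis
    unfolding eq by simp
qed

text \<open>The difference quotients are bounded by \<open>C * norm v\<close> and supported in a
  fixed ball, hence bounded in L_2, and a weak limit of them is a weak partial derivative. The
  exponent 2 is an arbitrary choice above 1.\<close>

lemma lipschitz_weak_partial:
  fixes g :: "'a::euclidean_space \<Rightarrow> 'b::euclidean_space"
  assumes g: "C-lipschitz_on UNIV g" and R: "\<And>x. R < norm x \<Longrightarrow> g x = 0"
  shows "\<exists>H. loc_borel H \<and> (\<forall>\<phi>. test_function UNIV \<phi> \<longrightarrow>
    (\<integral>x. frechet_derivative \<phi> (at x) v *\<^sub>R g x \<partial>lborel) = - (\<integral>x. \<phi> x *\<^sub>R H x \<partial>lborel))"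
proof -
  have gc: "continuous_on UNIV g"
    using g by (rule lipschitz_on_continuous_on)
  have gm[measurable]: "g \<in> borel_measurable borel"
    by (rule borel_measurable_continuous_onI[OF gc])
  define u where "u n x = real (Suc n) *\<^sub>R (g (x + v /\<^sub>R real (Suc n)) - g x)" for n x
  have um: "u n \<in> borel_measurable lborel" for n
    unfolding u_def by measurable
  have ub: "norm (u n x) \<le> C * norm v" for n x
  proof -
    have "norm (g (x + v /\<^sub>R real (Suc n)) - g x) \<le> C * norm (v /\<^sub>R real (Suc n))"
      using lipschitz_onD[OF g, of "x + v /\<^sub>R real (Suc n)" x] by (simp add: dist_norm)
    then have "real (Suc n) * norm (g (x + v /\<^sub>R real (Suc n)) - g x) \<le> real (Suc n) * (C * norm (v /\<^sub>R real (Suc n)))"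
      by (intro mult_left_mono) auto
    moreover have "real (Suc n) * (C * norm (v /\<^sub>R real (Suc n))) = C * norm v"
      by (simp add: field_simps del: of_nat_Suc)
    ultimately show ?thesis
      by (simp only: u_def norm_scaleR abs_of_nat)
  qed
  have u0: "u n x = 0" if "R + norm v < norm x" for n x
  proof -
    have "norm (v /\<^sub>R real (Suc n)) \<le> norm v"
      using mult_right_mono[of "inverse (real (Suc n))" 1 "norm v"] by (simp add: inverse_le_1_iff)
    moreover have "norm x - norm (v /\<^sub>R real (Suc n)) \<le> norm (x + v /\<^sub>R real (Suc n))"
      using norm_triangle_ineq2[of x "- (v /\<^sub>R real (Suc n))"] by simp
    ultimately have "R < norm (x + v /\<^sub>R real (Suc n))" "R < norm x"
      using that norm_ge_zero[of v] by linarith+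
    then show ?thesis
      using R by (simp add: u_def)
  qed
  define K where "K = enn2real (ennreal ((C * norm v) powr 2) * emeasure lborel (cball (0::'a) (R + norm v)))"
  have fin: "ennreal ((C * norm v) powr 2) * emeasure lborel (cball (0::'a) (R + norm v)) < top"
    using emeasure_bounded_finite[OF bounded_cball[of "0::'a" "R + norm v"]] by (auto simp: ennreal_mult_less_top)
  have uK: "Lpn lborel 2 (u n) \<le> ennreal K" for n
  proof -
    have "Lpn lborel 2 (u n) \<le> (\<integral>\<^sup>+x. ennreal ((C * norm v) powr 2) * indicator (cball (0::'a) (R + norm v)) x \<partial>lborel)"
      unfolding Lpn_def
    proof (rule nn_integral_mono)
      fix x
      show "ennreal (norm (u n x) powr 2) \<le> ennreal ((C * norm v) powr 2) * indicator (cball 0 (R + norm v)) x"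
      proof (cases "norm x \<le> R + norm v")
        case True
        then show ?thesis
          using ennreal_leI[OF powr_mono2[OF _ norm_ge_zero ub[of n x], of 2]] by (simp del: powr_numeral)
      qed (use u0[of x n] in simp)
    qed
    also have "\<dots> = ennreal K"
      unfolding K_def using fin by (simp add: nn_integral_cmult_indicator)
    finally show ?thesis .
  qed
  have "\<exists>H\<in>borel_measurable lborel. Lpn lborel 2 H < \<infinity> \<and>
    (\<forall>\<psi> B T l. \<psi> \<in> borel_measurable lborel \<longrightarrow> (\<forall>x. \<bar>\<psi> x\<bar> \<le> B) \<longrightarrow> T \<in> sets lborel \<longrightarrow> emeasure lborel T < \<infinity> \<longrightarrow>
      (\<forall>x\<in>space lborel. x \<notin> T \<longrightarrow> \<psi> x = 0) \<longrightarrow> (\<lambda>j. \<integral>x. \<psi> x *\<^sub>R u j x \<partial>lborel) \<longlonglongrightarrow> l \<longrightarrow>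
      (\<integral>x. \<psi> x *\<^sub>R H x \<partial>lborel) = l)"
    by (rule Lp_weak_limit[OF _ um uK]) simp
  then obtain H where H: "H \<in> borel_measurable lborel" "Lpn lborel 2 H < \<infinity>"
    and lim: "\<forall>\<psi> B T l. \<psi> \<in> borel_measurable lborel \<longrightarrow> (\<forall>x. \<bar>\<psi> x\<bar> \<le> B) \<longrightarrow> T \<in> sets lborel \<longrightarrow> emeasure lborel T < \<infinity> \<longrightarrow>
      (\<forall>x\<in>space lborel. x \<notin> T \<longrightarrow> \<psi> x = 0) \<longrightarrow> (\<lambda>j. \<integral>x. \<psi> x *\<^sub>R u j x \<partial>lborel) \<longlonglongrightarrow> l \<longrightarrow>
      (\<integral>x. \<psi> x *\<^sub>R H x \<partial>lborel) = l"
    by (elim bexE conjE)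
  have "loc_borel H"
    unfolding loc_borel_def
  proof safe
    show "H \<in> borel_measurable borel"
      using H(1) by simp
    show "integrable lborel (\<lambda>x. indicator (cball 0 r) x *\<^sub>R H x)" for r
      by (rule Lp_mult_integrable[OF _ H, where B = 1 and T = "cball 0 r"])
        (auto simp: indicator_def emeasure_cball_less_top)
  qed
  moreover have "(\<integral>x. frechet_derivative \<phi> (at x) v *\<^sub>R g x \<partial>lborel) = - (\<integral>x. \<phi> x *\<^sub>R H x \<partial>lborel)"
    if \<phi>: "test_function UNIV \<phi>" for \<phi>
  proof -
    obtain r B where B: "\<forall>x. \<bar>\<phi> x\<bar> \<le> B" and r: "\<And>x. r < norm x \<Longrightarrow> \<phi> x = 0"
      using test_function_facts(4)[OF \<phi>, of v] by blast
    have "\<phi> \<in> borel_measurable borel"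
      using test_function_facts(2)[OF \<phi>] by (rule borel_measurable_continuous_onI)
    then have "(\<integral>x. \<phi> x *\<^sub>R H x \<partial>lborel) = - (\<integral>x. frechet_derivative \<phi> (at x) v *\<^sub>R g x \<partial>lborel)"
      using test_diff_quot_tendsto[OF \<phi> continuous_loc_borel[OF gc], of v] B r
      by (intro lim[rule_format, where B = B and T = "cball 0 r"]) (auto simp: u_def emeasure_cball_less_top)
    then show ?thesis
      by simp
  qed
  ultimately show ?thesis
    by blast
qed

text \<open>Only positive rational increments and countable quantifiers occur, so that with
  \<open>l\<close> a Borel function of \<open>x\<close> this is a Borel condition on
  \<open>x\<close>, as \<open>AE_along_lines\<close> requires. The restriction is made up for in
  \<open>has_derivative_of_dense_directions\<close>.\<close>

definition dir_deriv :: "('a::real_normed_vector \<Rightarrow> 'b::real_normed_vector) \<Rightarrow> 'a \<Rightarrow> 'b \<Rightarrow> 'a \<Rightarrow> bool"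
  where "dir_deriv g v l x \<longleftrightarrow> (\<forall>k::nat. \<exists>n::nat. \<forall>q::rat. 0 < real_of_rat q \<and> real_of_rat q < 1 / Suc n \<longrightarrow>
    norm ((g (x + real_of_rat q *\<^sub>R v) - g x) /\<^sub>R real_of_rat q - l) \<le> 1 / Suc k)"

text \<open>On almost every line \<open>g\<close> is an indefinite integral of \<open>H\<close>,
  first for rational parameters, which need countably many null sets, and then for all by
  continuity. Lebesgue's differentiation theorem in one variable gives the derivative at almost
  every point of the line.\<close>

lemma AE_dir_deriv:
  fixes g H :: "'a::euclidean_space \<Rightarrow> 'b::euclidean_space"
  assumes gc: "continuous_on UNIV g" and H: "loc_borel H"
    and weak: "\<And>\<phi>. test_function UNIV \<phi> \<Longrightarrow>
      (\<integral>x. frechet_derivative \<phi> (at x) v *\<^sub>R g x \<partial>lborel) = - (\<integral>x. \<phi> x *\<^sub>R H x \<partial>lborel)"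
  shows "AE x in lborel. dir_deriv g v (H x) x"
proof (rule AE_along_lines[where v = v])
  have gm[measurable]: "g \<in> borel_measurable borel"
    by (rule borel_measurable_continuous_onI[OF gc])
  have Hm[measurable]: "H \<in> borel_measurable borel"
    using H by (simp add: loc_borel_def)
  have "Measurable.pred borel (\<lambda>x. dir_deriv g v (H x) x)"
    unfolding dir_deriv_def by measurable
  then show "{x. dir_deriv g v (H x) x} \<in> sets borel"
    by (simp add: pred_def)
  have "AE x in lborel. \<forall>q::rat. 0 \<le> real_of_rat q \<longrightarrow>
      integrable lborel (\<lambda>s. indicator {0..real_of_rat q} s *\<^sub>R H (x + s *\<^sub>R v)) \<and>
      g (x + real_of_rat q *\<^sub>R v) - g x = (\<integral>s. indicator {0..real_of_rat q} s *\<^sub>R H (x + s *\<^sub>R v) \<partial>lborel)"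
    unfolding AE_all_countable
  proof
    fix q :: rat
    show "AE x in lborel. 0 \<le> real_of_rat q \<longrightarrow>
      integrable lborel (\<lambda>s. indicator {0..real_of_rat q} s *\<^sub>R H (x + s *\<^sub>R v)) \<and>
      g (x + real_of_rat q *\<^sub>R v) - g x = (\<integral>s. indicator {0..real_of_rat q} s *\<^sub>R H (x + s *\<^sub>R v) \<partial>lborel)"
    proof (cases "0 \<le> real_of_rat q")
      case True
      have "AE x in lborel. integrable lborel (\<lambda>s. indicator {0..real_of_rat q} s *\<^sub>R H (x + s *\<^sub>R v)) \<and>
        g (x + real_of_rat q *\<^sub>R v) - g x = (\<integral>s. indicator {0..real_of_rat q} s *\<^sub>R H (x + s *\<^sub>R v) \<partial>lborel)"
        by (rule weak_derivative_line[OF continuous_loc_borel[OF gc] H True]) (rule weak)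
      then show ?thesis
        by eventually_elim simp
    qed simp
  qed
  then show "AE x in lborel. AE s in lborel. 0 < s \<and> s < 1 \<longrightarrow> dir_deriv g v (H (x + s *\<^sub>R v)) (x + s *\<^sub>R v)"
  proof eventually_elim
    case (elim x)
    define f where "f s = indicator {0..1} s *\<^sub>R H (x + s *\<^sub>R v)" for s :: real
    have fi: "integrable lborel f"
      using elim[rule_format, of 1] by (simp add: f_def[abs_def])
    have set_i: "set_integrable lborel S f" if "S \<in> sets borel" for S
      unfolding set_integrable_def using that by (intro integrable_mult_indicator fi) auto
    have on: "f integrable_on {a..b}" for a b
      using set_borel_integral_eq_integral(1)[OF set_i] by simp
    have rat: "g (x + real_of_rat q *\<^sub>R v) - g x = integral {0..real_of_rat q} f"
      if q: "0 \<le> real_of_rat q" "real_of_rat q \<le> 1" for q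
    proof -
      have "integral {0..real_of_rat q} f = (\<integral>s. indicator {0..real_of_rat q} s *\<^sub>R f s \<partial>lborel)"
        using set_borel_integral_eq_integral(2)[OF set_i, of "{0..real_of_rat q}"] by (simp add: set_lebesgue_integral_def)
      also have "\<dots> = (\<integral>s. indicator {0..real_of_rat q} s *\<^sub>R H (x + s *\<^sub>R v) \<partial>lborel)"
      proof (rule Bochner_Integration.integral_cong[OF refl])
        fix s
        have "s \<in> {0..1}" if "s \<in> {0..real_of_rat q}"
          using that q(2) by (meson atLeastAtMost_iff order_trans)
        then show "indicator {0..real_of_rat q} s *\<^sub>R f s = indicator {0..real_of_rat q} s *\<^sub>R H (x + s *\<^sub>R v)"
          by (cases "s \<in> {0..real_of_rat q}") (simp_all add: f_def)
      qed
      finally show ?thesis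
        using elim q by simp
    qed
    have cI: "continuous_on {0..1} (\<lambda>t. integral {0..t} f)"
      by (rule indefinite_integral_continuous_1[OF on])
    have cG: "continuous_on {0..1} (\<lambda>t. g (x + t *\<^sub>R v) - g x)"
      by (intro continuous_intros continuous_on_compose2[OF gc]) auto
    have real: "g (x + t *\<^sub>R v) - g x = integral {0..t} f" if t: "t \<in> {0..1}" for t
    proof (rule LIMSEQ_unique)
      \<comment> \<open>Rationals that approach \<open>t\<close> from below within
        \<open>1 / Suc n\<close>, so that they stay in \<open>{0..1}\<close>.\<close>
      define r where "r n = (of_int \<lfloor>real (Suc n) * t\<rfloor> / of_nat (Suc n) :: rat)" for n
      have rr: "real_of_rat (r n) = of_int \<lfloor>real (Suc n) * t\<rfloor> / real (Suc n)" for n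
        by (simp add: r_def of_rat_divide del: of_nat_Suc)
      have r01: "real_of_rat (r n) \<le> t" "t - 1 / real (Suc n) \<le> real_of_rat (r n)" "0 \<le> real_of_rat (r n)" for n
      proof -
        have "of_int \<lfloor>real (Suc n) * t\<rfloor> \<le> real (Suc n) * t" "real (Suc n) * t - 1 \<le> of_int \<lfloor>real (Suc n) * t\<rfloor>"
          by linarith+
        then have "of_int \<lfloor>real (Suc n) * t\<rfloor> / real (Suc n) \<le> real (Suc n) * t / real (Suc n)"
          "(real (Suc n) * t - 1) / real (Suc n) \<le> of_int \<lfloor>real (Suc n) * t\<rfloor> / real (Suc n)"
          by (intro divide_right_mono; simp)+
        then show "real_of_rat (r n) \<le> t" "t - 1 / real (Suc n) \<le> real_of_rat (r n)" "0 \<le> real_of_rat (r n)"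
          unfolding rr using t by (simp_all add: diff_divide_distrib del: of_nat_Suc)
      qed
      have rt: "(\<lambda>n. real_of_rat (r n)) \<longlonglongrightarrow> t"
      proof (rule tendsto_sandwich)
        have "(\<lambda>n. t - 1 / real (Suc n)) \<longlonglongrightarrow> t - 0"
          by (intro tendsto_intros LIMSEQ_Suc[OF lim_1_over_n])
        then show "(\<lambda>n. t - 1 / real (Suc n)) \<longlonglongrightarrow> t"
          by simp
        show "(\<lambda>n. t) \<longlonglongrightarrow> t"
          by simp
      qed (use r01 in auto)
      have rin: "\<forall>\<^sub>F n in sequentially. real_of_rat (r n) \<in> {0..1}"
      proof (rule always_eventually, rule allI)
        show "real_of_rat (r n) \<in> {0..1}" for n
          using r01(1)[of n] r01(3)[of n] t by (meson atLeastAtMost_iff order_trans)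
      qed
      show "(\<lambda>n. g (x + real_of_rat (r n) *\<^sub>R v) - g x) \<longlonglongrightarrow> g (x + t *\<^sub>R v) - g x"
        by (rule continuous_on_tendsto_compose[OF cG rt t rin])
      have "(\<lambda>n. integral {0..real_of_rat (r n)} f) \<longlonglongrightarrow> integral {0..t} f"
        by (rule continuous_on_tendsto_compose[OF cI rt t rin])
      moreover have "integral {0..real_of_rat (r n)} f = g (x + real_of_rat (r n) *\<^sub>R v) - g x" for n
        by (rule rat[symmetric], rule r01(3)) (use r01(1)[of n] t in \<open>meson atLeastAtMost_iff order_trans\<close>)
      ultimately show "(\<lambda>n. g (x + real_of_rat (r n) *\<^sub>R v) - g x) \<longlonglongrightarrow> integral {0..t} f"
        by simp
    qed
    obtain N where N: "negligible N" and leb: "\<And>s e. s \<notin> N \<Longrightarrow> 0 < e \<Longrightarrow>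
        \<exists>d>0. \<forall>h. 0 < h \<and> h < d \<longrightarrow> norm (integral (cbox s (s + h *\<^sub>R One)) f /\<^sub>R h ^ DIM(real) - f s) < e"
      using integrable_ccontinuous_explicit[of f] on by (metis box_real(2))
    have "AE s in lebesgue. s \<notin> N"
      using N unfolding negligible_iff_null_sets by (rule AE_not_in)
    then have "AE s in lborel. s \<notin> N"
      by (simp add: AE_completion_iff)
    then show ?case
    proof eventually_elim
      case (elim s)
      show ?case
      proof
        assume s: "0 < s \<and> s < 1"
        show "dir_deriv g v (H (x + s *\<^sub>R v)) (x + s *\<^sub>R v)"
          unfolding dir_deriv_def
        proof
          fix k :: nat
          obtain d where d: "0 < d" "\<And>h. 0 < h \<Longrightarrow> h < d \<Longrightarrow> norm (integral {s..s + h} f /\<^sub>R h - f s) < 1 / Suc k"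
            using leb[OF elim, of "1 / Suc k"] by auto
          obtain n where n: "1 / real (Suc n) < min d (1 - s)"
            using reals_Archimedean[of "min d (1 - s)"] d s by (auto simp: inverse_eq_divide)
          show "\<exists>n. \<forall>q. 0 < real_of_rat q \<and> real_of_rat q < 1 / real (Suc n) \<longrightarrow>
             norm ((g (x + s *\<^sub>R v + real_of_rat q *\<^sub>R v) - g (x + s *\<^sub>R v)) /\<^sub>R real_of_rat q - H (x + s *\<^sub>R v)) \<le> 1 / real (Suc k)"
          proof (rule exI[of _ n], intro allI impI)
            fix q assume q: "0 < real_of_rat q \<and> real_of_rat q < 1 / real (Suc n)"
            let ?h = "real_of_rat q"
            have h: "0 < ?h" "?h < d" "s + ?h \<le> 1"
              using q n by auto
            have "integral {0..s + ?h} f = integral {0..s} f + integral {s..s + ?h} f"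
              using Henstock_Kurzweil_Integration.integral_combine[OF _ _ on, of 0 s "s + ?h"] s h by simp
            then have "integral {s..s + ?h} f = (g (x + (s + ?h) *\<^sub>R v) - g x) - (g (x + s *\<^sub>R v) - g x)"
              using real[of s] real[of "s + ?h"] s h by simp
            then have "integral {s..s + ?h} f = g (x + (s + ?h) *\<^sub>R v) - g (x + s *\<^sub>R v)"
              by (simp only: diff_diff_eq2 diff_add_cancel)
            moreover have "f s = H (x + s *\<^sub>R v)"
              using s by (simp add: f_def)
            ultimately show "norm ((g (x + s *\<^sub>R v + ?h *\<^sub>R v) - g (x + s *\<^sub>R v)) /\<^sub>R ?h - H (x + s *\<^sub>R v)) \<le> 1 / real (Suc k)"
              using d(2)[OF h(1,2)] by (simp add: scaleR_add_left add.assoc less_imp_le)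
          qed
        qed
      qed
    qed
  qed
qed

text \<open>By compactness finitely many directions from \<open>V\<close> approximate the whole unit
  sphere, and the Lipschitz bounds on \<open>g\<close> and \<open>L\<close> carry the estimate over
  to nearby directions. Rational step lengths suffice for the same reason.\<close>

lemma has_derivative_of_dense_directions:
  fixes g :: "'a::euclidean_space \<Rightarrow> 'b::euclidean_space"
  assumes g: "C-lipschitz_on UNIV g" and L: "linear L" and V: "closure V = UNIV"
    and d: "\<And>v. v \<in> V \<Longrightarrow> dir_deriv g v (L v) x"
  shows "(g has_derivative L) (at x)"
proof -
  have bl: "bounded_linear L"
    using L by (simp add: linear_conv_bounded_linear)
  obtain B where B: "0 < B" "\<And>z. norm (L z) \<le> B * norm z"
    using bounded_linear.pos_bounded[OF bl] by (metis mult.commute)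
  have C: "0 \<le> C"
    using g lipschitz_on_nonneg by blast
  have "\<exists>d>0. \<forall>y. norm (y - x) < d \<longrightarrow> norm (g y - g x - L (y - x)) \<le> e * norm (y - x)" if e: "0 < e" for e
  proof -
    \<comment> \<open>The error budget at distance \<open>t\<close>:
      \<open>2 * t * ((C + B) * \<delta>)\<close> from the change of direction and step length, and
      \<open>2 * t * (e / 4)\<close> from the directional derivative; each is at most half of
      \<open>e * t\<close>.\<close>
    define \<delta> where "\<delta> = min 1 (e / (4 * (C + B)))"
    have \<delta>: "0 < \<delta>" "\<delta> \<le> 1"
      using e B C by (auto simp: \<delta>_def)
    have "(C + B) * \<delta> \<le> (C + B) * (e / (4 * (C + B)))"
      using B C by (intro mult_left_mono) (auto simp: \<delta>_def)
    also have "\<dots> = e / 4"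
    proof -
      have "c * (e / (4 * c)) = e / 4" if "0 < c" for c :: real
        using that by simp
      then show ?thesis
        using B(1) C by (metis add_nonneg_pos)
    qed
    finally have \<delta>e: "(C + B) * \<delta> \<le> e / 4" .
    obtain k :: nat where k: "1 / real (Suc k) < e / 4"
      using reals_Archimedean[of "e / 4"] e by (auto simp: inverse_eq_divide)
    have "sphere 0 1 \<subseteq> (\<Union>v\<in>V. ball v \<delta>)"
    proof
      fix u :: 'a
      have "u \<in> closure V"
        using V by simp
      then obtain v where "v \<in> V" "dist v u < \<delta>"
        using \<delta> closure_approachable by blast
      then show "u \<in> (\<Union>v\<in>V. ball v \<delta>)"
        by auto
    qed
    then obtain V' where V': "V' \<subseteq> V" "finite V'" "sphere 0 1 \<subseteq> (\<Union>v\<in>V'. ball v \<delta>)"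
      using compactE_image[OF compact_sphere, of V "\<lambda>v. ball v \<delta>" 0 1] by (metis open_ball)
    have "\<forall>v\<in>V'. \<exists>n::nat. \<forall>q::rat. 0 < real_of_rat q \<and> real_of_rat q < 1 / Suc n \<longrightarrow>
        norm ((g (x + real_of_rat q *\<^sub>R v) - g x) /\<^sub>R real_of_rat q - L v) \<le> 1 / Suc k"
      using d V'(1) unfolding dir_deriv_def by blast
    then obtain n where n: "\<And>v q. v \<in> V' \<Longrightarrow> 0 < real_of_rat q \<Longrightarrow> real_of_rat q < 1 / Suc (n v) \<Longrightarrow>
        norm ((g (x + real_of_rat q *\<^sub>R v) - g x) /\<^sub>R real_of_rat q - L v) \<le> 1 / Suc k"
      by metis
    define M where "M = (\<Sum>v\<in>V'. n v)"
    have M: "n v \<le> M" if "v \<in> V'" for v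
      unfolding M_def using V'(2) that by (intro member_le_sum) auto
    have "norm (g y - g x - L (y - x)) \<le> e * norm (y - x)" if y: "norm (y - x) < 1 / (2 * Suc M)" for y
    proof (cases "y = x")
      case True
      then show ?thesis
        using linear_0[OF L] by simp
    next
      case False
      define t where "t = norm (y - x)"
      have t: "0 < t"
        using False by (simp add: t_def)
      define u where "u = (y - x) /\<^sub>R t"
      have u: "u \<in> sphere 0 1" "y - x = t *\<^sub>R u"
        using t by (auto simp: u_def t_def)
      then obtain v where v: "v \<in> V'" "dist v u < \<delta>"
        using V'(3) by auto
      have "0 < t * \<delta> / (1 + norm v)"
        using t \<delta> by (intro divide_pos_pos mult_pos_pos add_pos_nonneg) auto
      \<comment> \<open>The rational step exceeds \<open>t\<close> by so little that the end point
        moves by at most \<open>t * \<delta>\<close>; the summand 1 in the denominator covers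
        \<open>v = 0\<close>.\<close>
      then obtain q where q: "t < real_of_rat q" "real_of_rat q < t + t * \<delta> / (1 + norm v)"
        using of_rat_dense[of t "t + t * \<delta> / (1 + norm v)"] by auto
      define r where "r = real_of_rat q"
      note q = q[folded r_def]
      have nv: "norm v / (1 + norm v) \<le> 1" "1 \<le> 1 + norm v"
        using norm_ge_zero[of v] by (auto simp: pos_divide_le_eq add_pos_nonneg)
      have "t * \<delta> / (1 + norm v) \<le> t * \<delta> / 1"
        using t \<delta> by (intro divide_left_mono mult_pos_pos add_pos_nonneg) auto
      then have "t * \<delta> / (1 + norm v) \<le> t * \<delta>"
        by simp
      also have "\<dots> \<le> t"
        using t \<delta> by simp
      finally have q2: "r < 2 * t"
        using q(2) by simp
      have "t < 1 / (2 * Suc M)"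
        using y by (simp add: t_def)
      then have "2 * t < 1 / Suc M"
        by (simp add: field_simps)
      also have "1 / real (Suc M) \<le> 1 / Suc (n v)"
        using M[OF v(1)] by (intro divide_left_mono) auto
      finally have qn: "r < 1 / Suc (n v)"
        using q2 by simp
      have "(r - t) * norm v \<le> (t * \<delta> / (1 + norm v)) * norm v"
        using q(2) by (intro mult_right_mono) auto
      also have "\<dots> = t * \<delta> * (norm v / (1 + norm v))"
        by simp
      also have "\<dots> \<le> t * \<delta> * 1"
        by (rule mult_left_mono[OF nv(1)]) (use t \<delta> in simp)
      finally have qv: "(r - t) * norm v \<le> t * \<delta>"
        by simp
      have "norm ((y - x) - r *\<^sub>R v) = norm (t *\<^sub>R (u - v) - (r - t) *\<^sub>R v)"
        unfolding u(2) by (simp add: algebra_simps)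
      also have "\<dots> \<le> t * norm (u - v) + (r - t) * norm v"
        using norm_triangle_ineq4[of "t *\<^sub>R (u - v)" "(r - t) *\<^sub>R v"] t q by simp
      also have "\<dots> \<le> t * \<delta> + t * \<delta>"
        using v(2) t qv by (intro add_mono mult_left_mono) (auto simp: dist_norm norm_minus_commute)
      finally have close: "norm ((y - x) - r *\<^sub>R v) \<le> 2 * (t * \<delta>)"
        by (simp only: mult_2)
      have 1: "norm (g y - g (x + r *\<^sub>R v)) \<le> C * (2 * (t * \<delta>))"
      proof -
        have "norm (g y - g (x + r *\<^sub>R v)) \<le> C * norm (y - (x + r *\<^sub>R v))"
          using lipschitz_onD[OF g, of y "x + r *\<^sub>R v"] by (simp add: dist_norm)
        also have "\<dots> \<le> C * (2 * (t * \<delta>))"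
          using close by (intro mult_left_mono[OF _ C]) (simp only: diff_diff_add)
        finally show ?thesis .
      qed
      have 2: "norm (g (x + r *\<^sub>R v) - g x - r *\<^sub>R L v) \<le> r * (e / 4)"
      proof -
        have "norm ((g (x + r *\<^sub>R v) - g x) /\<^sub>R r - L v) \<le> e / 4"
          using n[OF v(1), of q, folded r_def, OF _ qn] q t k by linarith
        then have "r * norm ((g (x + r *\<^sub>R v) - g x) /\<^sub>R r - L v) \<le> r * (e / 4)"
          using q t by (intro mult_left_mono) auto
        moreover have "r *\<^sub>R ((g (x + r *\<^sub>R v) - g x) /\<^sub>R r - L v) = g (x + r *\<^sub>R v) - g x - r *\<^sub>R L v"
          using q t by (simp add: scaleR_diff_right)
        moreover have "r * norm ((g (x + r *\<^sub>R v) - g x) /\<^sub>R r - L v) = norm (r *\<^sub>R ((g (x + r *\<^sub>R v) - g x) /\<^sub>R r - L v))"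
          using q t by simp
        ultimately show ?thesis
          by simp
      qed
      have 3: "norm (r *\<^sub>R L v - L (y - x)) \<le> B * (2 * (t * \<delta>))"
      proof -
        have "r *\<^sub>R L v - L (y - x) = - L ((y - x) - r *\<^sub>R v)"
          using L by (simp add: linear_diff linear_scale)
        then have "norm (r *\<^sub>R L v - L (y - x)) \<le> B * norm ((y - x) - r *\<^sub>R v)"
          using B(2) by (simp only: norm_minus_cancel)
        also have "\<dots> \<le> B * (2 * (t * \<delta>))"
          using close B by (intro mult_left_mono) auto
        finally show ?thesis .
      qed
      have "g y - g x - L (y - x) = (g y - g (x + r *\<^sub>R v)) + (g (x + r *\<^sub>R v) - g x - r *\<^sub>R L v) + (r *\<^sub>R L v - L (y - x))"
        by simp
      then have "norm (g y - g x - L (y - x)) \<le> C * (2 * (t * \<delta>)) + r * (e / 4) + B * (2 * (t * \<delta>))"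
        using norm_triangle_le[OF add_mono[OF norm_triangle_le[OF add_mono[OF 1 2]] 3]] by simp
      also have "\<dots> \<le> 2 * t * ((C + B) * \<delta>) + 2 * t * (e / 4)"
        using q2 e by (simp add: algebra_simps)
      also have "\<dots> \<le> 2 * t * (e / 4) + 2 * t * (e / 4)"
        using \<delta>e t by (intro add_right_mono mult_left_mono) auto
      also have "\<dots> = e * norm (y - x)"
        by (simp add: t_def)
      finally show ?thesis .
    qed
    then show ?thesis
      by (intro exI[of _ "1 / (2 * Suc M)"]) auto
  qed
  then show ?thesis
    unfolding has_derivative_at_alt using bl by blast
qed

text \<open>The candidate differential \<open>G\<close> is assembled linearly from weak partial
  derivatives and is then the weak derivative in every direction. Linearity is thus built in, and a
  countable dense set of directions keeps the exceptional set null.\<close>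

lemma rademacher_compact_support:
  fixes g :: "'a::euclidean_space \<Rightarrow> 'b::euclidean_space"
  assumes g: "C-lipschitz_on UNIV g" and R: "\<And>x. R < norm x \<Longrightarrow> g x = 0"
  shows "AE x in lborel. g differentiable (at x)"
proof -
  have gc: "continuous_on UNIV g"
    using g by (rule lipschitz_on_continuous_on)
  have "\<forall>b. \<exists>H. loc_borel H \<and> (\<forall>\<phi>. test_function UNIV \<phi> \<longrightarrow>
    (\<integral>x. frechet_derivative \<phi> (at x) b *\<^sub>R g x \<partial>lborel) = - (\<integral>x. \<phi> x *\<^sub>R H x \<partial>lborel))"
    using lipschitz_weak_partial[OF g R] by blast
  from choice[OF this] obtain H where H: "\<And>b. loc_borel (H b)" "\<And>b \<phi>. test_function UNIV \<phi> \<Longrightarrow>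
    (\<integral>x. frechet_derivative \<phi> (at x) b *\<^sub>R g x \<partial>lborel) = - (\<integral>x. \<phi> x *\<^sub>R H b x \<partial>lborel)"
    by blast
  define G where "G x v = (\<Sum>b\<in>Basis. (v \<bullet> b) *\<^sub>R H b x)" for x v
  have Gl: "linear (G x)" for x
    unfolding G_def by (intro linearI) (simp_all add: inner_add_left scaleR_add_left sum.distrib scaleR_sum_right)
  have GL: "loc_borel (\<lambda>x. G x v)" for v
    unfolding loc_borel_def
  proof safe
    show "(\<lambda>x. G x v) \<in> borel_measurable borel"
      unfolding G_def using H(1) by (auto simp: loc_borel_def intro!: borel_measurable_sum borel_measurable_scaleR)
    fix r
    have "integrable lborel (\<lambda>x. \<Sum>b\<in>Basis. (v \<bullet> b) *\<^sub>R (indicator (cball 0 r) x *\<^sub>R H b x))"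
      using H(1) unfolding loc_borel_def by (intro Bochner_Integration.integrable_sum integrable_scaleR_right) blast
    then show "integrable lborel (\<lambda>x. indicator (cball 0 r) x *\<^sub>R G x v)"
      by (simp add: G_def scaleR_sum_right mult.commute)
  qed
  obtain V :: "'a set" where V0: "countable V" "V \<subseteq> UNIV" "UNIV \<subseteq> closure V"
    by (rule separable)
  then have V: "countable V" "closure V = UNIV"
    by auto
  have "AE x in lborel. \<forall>v\<in>V. dir_deriv g v (G x v) x"
    unfolding AE_ball_countable[OF V(1)]
  proof
    fix v
    show "AE x in lborel. dir_deriv g v (G x v) x"
    proof (rule AE_dir_deriv[OF gc GL])
      fix \<phi> :: "'a \<Rightarrow> real" assume \<phi>: "test_function UNIV \<phi>"
      have lin: "linear (frechet_derivative \<phi> (at x))" for x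
        using has_derivative_linear[OF test_function_facts(1)[OF \<phi>]] .
      have fd: "frechet_derivative \<phi> (at x) v = (\<Sum>b\<in>Basis. (v \<bullet> b) * frechet_derivative \<phi> (at x) b)" for x
      proof -
        have "frechet_derivative \<phi> (at x) v = frechet_derivative \<phi> (at x) (\<Sum>b\<in>Basis. (v \<bullet> b) *\<^sub>R b)"
          by (simp only: euclidean_representation)
        also have "\<dots> = (\<Sum>b\<in>Basis. (v \<bullet> b) *\<^sub>R frechet_derivative \<phi> (at x) b)"
          by (simp only: linear_sum[OF lin] linear_scale[OF lin])
        finally show ?thesis
          by (simp only: real_scaleR_def)
      qed
      obtain r B where B: "\<And>x. \<bar>\<phi> x\<bar> \<le> B" and r: "\<And>x. r < norm x \<Longrightarrow> \<phi> x = 0"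
        using test_function_facts(4)[OF \<phi>, of 0] by blast
      have pm: "\<phi> \<in> borel_measurable borel"
        using test_function_facts(2)[OF \<phi>] by (rule borel_measurable_continuous_onI)
      have i1: "integrable lborel (\<lambda>x. frechet_derivative \<phi> (at x) b *\<^sub>R g x)" for b
      proof -
        obtain r B where "\<And>x. \<bar>frechet_derivative \<phi> (at x) b\<bar> \<le> B" "\<And>x. r < norm x \<Longrightarrow> frechet_derivative \<phi> (at x) b = 0"
          using test_function_facts(4)[OF \<phi>, of b] by blast
        then show ?thesis
          using loc_borel_bounded_mult[OF continuous_loc_borel[OF gc]
              borel_measurable_continuous_onI[OF test_function_facts(3)[OF \<phi>, of b]]] by blast
      qed
      have i2: "integrable lborel (\<lambda>x. \<phi> x *\<^sub>R H b x)" for b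
        by (rule loc_borel_bounded_mult[OF H(1) pm B r])
      have "(\<integral>x. frechet_derivative \<phi> (at x) v *\<^sub>R g x \<partial>lborel)
          = (\<integral>x. (\<Sum>b\<in>Basis. (v \<bullet> b) *\<^sub>R (frechet_derivative \<phi> (at x) b *\<^sub>R g x)) \<partial>lborel)"
        by (simp add: fd scaleR_sum_left)
      also have "\<dots> = (\<Sum>b\<in>Basis. (v \<bullet> b) *\<^sub>R (\<integral>x. frechet_derivative \<phi> (at x) b *\<^sub>R g x \<partial>lborel))"
        using i1 by (simp add: Bochner_Integration.integral_sum del: scaleR_scaleR)
      also have "\<dots> = - (\<Sum>b\<in>Basis. (v \<bullet> b) *\<^sub>R (\<integral>x. \<phi> x *\<^sub>R H b x \<partial>lborel))"
        by (simp add: H(2)[OF \<phi>] sum_negf)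
      also have "(\<Sum>b\<in>Basis. (v \<bullet> b) *\<^sub>R (\<integral>x. \<phi> x *\<^sub>R H b x \<partial>lborel)) = (\<integral>x. (\<Sum>b\<in>Basis. (v \<bullet> b) *\<^sub>R (\<phi> x *\<^sub>R H b x)) \<partial>lborel)"
        using i2 by (simp add: Bochner_Integration.integral_sum del: scaleR_scaleR)
      also have "\<dots> = (\<integral>x. \<phi> x *\<^sub>R G x v \<partial>lborel)"
        by (simp add: G_def scaleR_sum_right mult.commute)
      finally show "(\<integral>x. frechet_derivative \<phi> (at x) v *\<^sub>R g x \<partial>lborel) = - (\<integral>x. \<phi> x *\<^sub>R G x v \<partial>lborel)" .
    qed
  qed
  then show ?thesis
  proof eventually_elim
    case (elim x)
    then have "(g has_derivative G x) (at x)"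
      by (intro has_derivative_of_dense_directions[OF g Gl V(2)]) auto
    then show ?case
      by (rule differentiableI)
  qed
qed

text \<open>Differentiability is local, so \<open>g\<close> may be cut off: nothing changes on the
  ball of radius \<open>n\<close>, and the product vanishes beyond \<open>n + 1\<close>.\<close>

theorem rademacher:
  fixes g :: "'a::euclidean_space \<Rightarrow> 'b::euclidean_space"
  assumes g: "C-lipschitz_on UNIV g"
  shows "AE x in lborel. g differentiable (at x)"
proof -
  have C: "0 \<le> C"
    using g lipschitz_on_nonneg by blast
  have "AE x in lborel. \<forall>n::nat. norm x < real n \<longrightarrow> g differentiable (at x)"
    unfolding AE_all_countable
  proof
    fix n :: nat
    define cut where "cut x = max 0 (min 1 (real n + 1 - norm x))" for x :: 'a
    define h where "h x = cut x *\<^sub>R g x" for x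
    define B where "B = norm (g 0) + C * (real n + 1)"
    have cut: "0 \<le> cut x" "cut x \<le> 1" "\<bar>cut x - cut y\<bar> \<le> dist x y" for x y
      using norm_triangle_ineq2[of x y] norm_triangle_ineq2[of y x]
      by (auto simp: cut_def dist_norm norm_minus_commute max_def min_def abs_if)
    have gB: "norm (g x) \<le> B" if "cut x \<noteq> 0" for x
    proof -
      have "norm x \<le> real n + 1"
        using that by (auto simp: cut_def max_def min_def split: if_splits)
      then have "C * dist x 0 \<le> C * (real n + 1)"
        using C by (intro mult_left_mono) auto
      then show ?thesis
        using lipschitz_onD[OF g, of x 0] norm_triangle_sub[of "g x" "g 0"] by (simp add: B_def dist_norm)
    qed
    have B: "0 \<le> B"
      using C by (simp add: B_def)
    \<comment> \<open>The product estimate uses a bound on \<open>g\<close>, available where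
      \<open>cut\<close> is nonzero; so one of the two points is taken there, and if neither can be,
      both products are 0.\<close>
    have half: "dist (h x) (h y) \<le> (C + B) * dist x y" if "cut x \<noteq> 0" for x y
    proof -
      have "h x - h y = cut y *\<^sub>R (g x - g y) + (cut x - cut y) *\<^sub>R g x"
        by (simp add: h_def algebra_simps)
      then have "norm (h x - h y) \<le> \<bar>cut y\<bar> * norm (g x - g y) + \<bar>cut x - cut y\<bar> * norm (g x)"
        by (metis norm_scaleR norm_triangle_ineq)
      also have "\<dots> \<le> 1 * (C * dist x y) + dist x y * B"
        using cut(1,2)[of y] cut(3)[of x y] gB[OF that] lipschitz_onD[OF g, of x y]
        by (intro add_mono mult_mono) (auto simp: dist_norm)
      finally show ?thesis
        by (simp add: dist_norm algebra_simps)
    qed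
    have "(C + B)-lipschitz_on UNIV h"
    proof (rule lipschitz_onI)
      fix x y
      show "dist (h x) (h y) \<le> (C + B) * dist x y"
      proof (cases "cut x = 0 \<and> cut y = 0")
        case True
        then show ?thesis
          using C B by (simp add: h_def)
      next
        case False
        then show ?thesis
          using half[of x y] half[of y x] by (auto simp: dist_commute)
      qed
    qed (use C B in simp)
    moreover have "h x = 0" if "real n + 1 < norm x" for x
      using that by (simp add: h_def cut_def)
    ultimately have "AE x in lborel. h differentiable (at x)"
      by (rule rademacher_compact_support)
    then show "AE x in lborel. norm x < real n \<longrightarrow> g differentiable (at x)"
    proof eventually_elim
      case (elim x)
      show ?case
      proof
        assume x: "norm x < real n"
        obtain D where "(h has_derivative D) (at x)"
          using elim by (auto simp: differentiable_def)
        then have "(g has_derivative D) (at x)"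
          by (rule has_derivative_transform_within_open[where s = "ball 0 (real n)"])
            (use x in \<open>auto simp: h_def cut_def\<close>)
        then show "g differentiable (at x)"
          by (rule differentiableI)
      qed
    qed
  qed
  then show ?thesis
  proof eventually_elim
    case (elim x)
    then show ?case
      using reals_Archimedean2[of "norm x"] by blast
  qed
qed

text \<open>The value 0 off the set of differentiability keeps every \<open>total_D g x\<close>
  linear, which \<open>weak_deriv\<close> demands at all points and not at almost all.\<close>

definition total_D :: "('a::euclidean_space \<Rightarrow> 'b::euclidean_space) \<Rightarrow> 'a \<Rightarrow> 'a \<Rightarrow> 'b"
  where "total_D g x = (if g differentiable (at x) then frechet_derivative g (at x) else (\<lambda>_. 0))"

lemma total_D_has_derivative: "g differentiable (at x) \<Longrightarrow> (g has_derivative total_D g x) (at x)"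
  by (simp add: total_D_def frechet_derivative_works)

lemma linear_total_D: "linear (total_D g x)"
  using has_derivative_linear[OF total_D_has_derivative, of g x]
  by (cases "g differentiable (at x)") (auto simp: total_D_def intro: linear_zero)

text \<open>Difference quotients converge almost everywhere by \<open>rademacher\<close> and are
  bounded by \<open>C * norm v\<close>. Dominated convergence and
  \<open>test_diff_quot_tendsto\<close> give two limits of the same test integrals, which identifies
  the classical derivative as the weak one.\<close>

theorem lipschitz_weak_deriv:
  fixes g :: "'a::euclidean_space \<Rightarrow> 'b::euclidean_space"
  assumes g: "C-lipschitz_on UNIV g" and U: "open U"
  shows "weak_deriv U g (total_D g)"
    and "(\<lambda>x. total_D g x v) \<in> borel_measurable lebesgue"
    and "AE x in lborel. (\<lambda>n. real (Suc n) *\<^sub>R (g (x + v /\<^sub>R real (Suc n)) - g x)) \<longlonglongrightarrow> total_D g x v"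
proof -
  have gc: "continuous_on UNIV g"
    using g by (rule lipschitz_on_continuous_on)
  note gL = continuous_loc_borel[OF gc]
  have gm[measurable]: "g \<in> borel_measurable borel"
    by (rule borel_measurable_continuous_onI[OF gc])
  define q where "q v n x = real (Suc n) *\<^sub>R (g (x + v /\<^sub>R real (Suc n)) - g x)" for v n x
  have qm[measurable]: "q v n \<in> borel_measurable borel" for v n
    unfolding q_def by measurable
  have qC: "norm (q v n x) \<le> C * norm v" for v n x
  proof -
    have "norm (g (x + v /\<^sub>R real (Suc n)) - g x) \<le> C * norm (v /\<^sub>R real (Suc n))"
      using lipschitz_onD[OF g, of "x + v /\<^sub>R real (Suc n)" x] by (simp add: dist_norm)
    then have "real (Suc n) * norm (g (x + v /\<^sub>R real (Suc n)) - g x) \<le> real (Suc n) * (C * norm (v /\<^sub>R real (Suc n)))"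
      by (intro mult_left_mono) auto
    moreover have "real (Suc n) * (C * norm (v /\<^sub>R real (Suc n))) = C * norm v"
      by (simp add: field_simps del: of_nat_Suc)
    ultimately show ?thesis
      by (simp only: q_def norm_scaleR abs_of_nat)
  qed
  have qlim: "AE x in lborel. (\<lambda>n. q v n x) \<longlonglongrightarrow> total_D g x v" for v
    using rademacher[OF g]
  proof eventually_elim
    case (elim x)
    show ?case
      unfolding q_def by (rule has_derivative_diff_quot[OF total_D_has_derivative[OF elim]])
  qed
  then show "AE x in lborel. (\<lambda>n. real (Suc n) *\<^sub>R (g (x + v /\<^sub>R real (Suc n)) - g x)) \<longlonglongrightarrow> total_D g x v"
    unfolding q_def .
  \<comment> \<open>A Borel version of \<open>total_D g x v\<close>; the bound
    \<open>C * norm v\<close> is built into it and so holds at every point.\<close>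
  define h where "h v x = (if convergent (\<lambda>n. q v n x) \<and> norm (lim (\<lambda>n. q v n x)) \<le> C * norm v then lim (\<lambda>n. q v n x) else 0)" for v x
  have hm[measurable]: "h v \<in> borel_measurable borel" for v
  proof -
    have [measurable]: "(\<lambda>x. lim (\<lambda>n. q v n x)) \<in> borel_measurable borel"
      by (rule borel_measurable_lim_metric) measurable
    have [measurable]: "Measurable.pred borel (\<lambda>x. convergent (\<lambda>n. q v n x))"
      unfolding Cauchy_convergent_iff[symmetric] by measurable
    show ?thesis
      unfolding h_def by measurable
  qed
  have hb: "norm (h v x) \<le> C * norm v" for v x
    using lipschitz_on_nonneg[OF g] by (auto simp: h_def)
  have hD: "AE x in lborel. h v x = total_D g x v \<and> (\<lambda>n. q v n x) \<longlonglongrightarrow> h v x" for v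
    using qlim[of v]
  proof eventually_elim
    case (elim x)
    have "norm (total_D g x v) \<le> C * norm v"
      by (rule LIMSEQ_le_const2[OF tendsto_norm[OF elim]]) (use qC in blast)
    then have "h v x = total_D g x v"
      using elim limI[OF elim] by (auto simp: h_def convergent_def)
    then show ?case
      using elim by simp
  qed
  have hL: "loc_borel (h v)" for v
    unfolding loc_borel_def
  proof safe
    fix R
    show "integrable lborel (\<lambda>x. indicator (cball 0 R) x *\<^sub>R h v x)"
    proof (rule Bochner_Integration.integrable_bound)
      show "integrable lborel (\<lambda>x. C * norm v * indicator (cball 0 R :: 'a set) x)"
        by (intro integrable_mult_right) (rule integrable_indicator_cball)
      show "AE x in lborel. norm (indicator (cball 0 R) x *\<^sub>R h v x) \<le> norm (C * norm v * indicator (cball 0 R) x)"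
        using hb[of v] order_trans[OF hb abs_ge_self] by (intro AE_I2) (auto simp: indicator_def)
      show "(\<lambda>x. indicator (cball 0 R) x *\<^sub>R h v x) \<in> borel_measurable lborel"
        using hm[of v] by (simp add: borel_measurable_scaleR borel_measurable_indicator)
    qed
  qed (rule hm)
  have Dh: "AE x in lebesgue. h v x = total_D g x v" for v
    using hD[of v] by (intro AE_completion) (auto elim: eventually_mono)
  have hml: "h v \<in> borel_measurable lebesgue" for v
    by (intro measurable_completion) simp
  show Dm: "(\<lambda>x. total_D g x v) \<in> borel_measurable lebesgue" for v
    by (rule borel_measurable_AE[OF hml Dh])
  have UL: "U \<in> sets lebesgue"
    using U by simp
  show "weak_deriv U g (total_D g)"
    unfolding weak_deriv_def
  proof (intro conjI allI ballI impI)
    show "loc_integrable U g"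
      by (rule loc_borel_imp_loc_integrable[OF gL])
    show "linear (total_D g x)" for x
      by (rule linear_total_D)
    fix v :: 'a
    show "loc_integrable U (\<lambda>x. total_D g x v)"
      unfolding loc_integrable_def
    proof (intro allI impI)
      fix K assume K: "compact K \<and> K \<subseteq> U"
      then have KL: "K \<in> sets lebesgue"
        by (auto simp: lmeasurable_compact fmeasurableD)
      have "integrable (lebesgue_on K) (h v)"
        using loc_borel_imp_loc_integrable[OF hL, of U v] K by (simp add: loc_integrable_def)
      moreover have "AE x in lebesgue_on K. h v x = total_D g x v"
        using Dh[of v] KL by (subst AE_restrict_space_iff) (auto elim: eventually_mono)
      ultimately show "integrable (lebesgue_on K) (\<lambda>x. total_D g x v)"
        using measurable_restrict_space1[OF Dm[of v], of K] by (subst integrable_cong_AE[where g = "h v"]) (auto intro: measurable_restrict_space1 hml elim: eventually_mono)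
    qed
    fix \<phi> assume \<phi>U: "test_function U \<phi>"
    then have \<phi>: "test_function UNIV \<phi>"
      by (auto simp: test_function_def)
    obtain R B where B: "0 \<le> B" "\<And>x. \<bar>\<phi> x\<bar> \<le> B" and R: "\<And>x. R < norm x \<Longrightarrow> \<phi> x = 0"
      using test_function_facts(4)[OF \<phi>, of v] by blast
    have pm[measurable]: "\<phi> \<in> borel_measurable borel"
      using test_function_facts(2)[OF \<phi>] by (rule borel_measurable_continuous_onI)
    have fm[measurable]: "(\<lambda>x. frechet_derivative \<phi> (at x) v) \<in> borel_measurable borel"
      using test_function_facts(3)[OF \<phi>] by (rule borel_measurable_continuous_onI)
    have "(\<lambda>n. \<integral>x. \<phi> x *\<^sub>R q v n x \<partial>lborel) \<longlonglongrightarrow> (\<integral>x. \<phi> x *\<^sub>R h v x \<partial>lborel)"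
    proof (rule integral_dominated_convergence)
      show "integrable lborel (\<lambda>x. B * (C * norm v) * indicator (cball 0 R :: 'a set) x)"
        by (intro integrable_mult_right) (rule integrable_indicator_cball)
      show "AE x in lborel. (\<lambda>n. \<phi> x *\<^sub>R q v n x) \<longlonglongrightarrow> \<phi> x *\<^sub>R h v x"
        using hD[of v] by eventually_elim (auto intro: tendsto_scaleR)
      show "AE x in lborel. norm (\<phi> x *\<^sub>R q v n x) \<le> B * (C * norm v) * indicator (cball 0 R) x" for n
      proof (rule AE_I2)
        fix x
        show "norm (\<phi> x *\<^sub>R q v n x) \<le> B * (C * norm v) * indicator (cball 0 R) x"
          using mult_mono[OF B(2)[of x] qC[of v n x] B(1) norm_ge_zero] R[of x] by (cases "norm x \<le> R") auto
      qed
    qed measurable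
    moreover have "(\<lambda>n. \<integral>x. \<phi> x *\<^sub>R q v n x \<partial>lborel) \<longlonglongrightarrow> - (\<integral>x. frechet_derivative \<phi> (at x) v *\<^sub>R g x \<partial>lborel)"
      unfolding q_def by (rule test_diff_quot_tendsto[OF \<phi> gL])
    ultimately have eq: "(\<integral>x. \<phi> x *\<^sub>R h v x \<partial>lborel) = - (\<integral>x. frechet_derivative \<phi> (at x) v *\<^sub>R g x \<partial>lborel)"
      by (rule LIMSEQ_unique)
    have "integral\<^sup>L (lebesgue_on U) (\<lambda>x. frechet_derivative \<phi> (at x) v *\<^sub>R g x) = (\<integral>x. frechet_derivative \<phi> (at x) v *\<^sub>R g x \<partial>lebesgue)"
      unfolding lebesgue_on_integral[OF UL]
      using test_function_facts(6)[OF \<phi>U, where v = v] by (intro Bochner_Integration.integral_cong) (auto simp: indicator_def)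
    also have "\<dots> = (\<integral>x. frechet_derivative \<phi> (at x) v *\<^sub>R g x \<partial>lborel)"
      by (rule integral_completion) measurable
    also have "\<dots> = - (\<integral>x. \<phi> x *\<^sub>R h v x \<partial>lebesgue)"
      using eq by (subst integral_completion) auto
    also have "(\<integral>x. \<phi> x *\<^sub>R h v x \<partial>lebesgue) = (\<integral>x. \<phi> x *\<^sub>R total_D g x v \<partial>lebesgue)"
    proof (rule integral_cong_AE)
      have "\<phi> \<in> borel_measurable lebesgue"
        by (rule measurable_completion) (use pm in simp)
      then show "(\<lambda>x. \<phi> x *\<^sub>R h v x) \<in> borel_measurable lebesgue" "(\<lambda>x. \<phi> x *\<^sub>R total_D g x v) \<in> borel_measurable lebesgue"
        by (simp_all add: borel_measurable_scaleR hml Dm)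
      show "AE x in lebesgue. \<phi> x *\<^sub>R h v x = \<phi> x *\<^sub>R total_D g x v"
        using Dh[of v] by eventually_elim simp
    qed
    also have "\<dots> = integral\<^sup>L (lebesgue_on U) (\<lambda>x. \<phi> x *\<^sub>R total_D g x v)"
      unfolding lebesgue_on_integral[OF UL]
      using test_function_facts(5)[OF \<phi>U] by (intro Bochner_Integration.integral_cong) (auto simp: indicator_def)
    finally show "integral\<^sup>L (lebesgue_on U) (\<lambda>x. frechet_derivative \<phi> (at x) v *\<^sub>R g x) =
        - integral\<^sup>L (lebesgue_on U) (\<lambda>x. \<phi> x *\<^sub>R total_D g x v)" .
  qed
qed

section \<open>Mollification\<close>

text \<open>Jensen's inequality, by integrating the tangent line of the \<open>p\<close>-th power at
  \<open>t\<close>, the mean of \<open>norm (u x)\<close>.\<close>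

lemma norm_integral_powr_le:
  fixes u :: "'a \<Rightarrow> 'b::euclidean_space"
  assumes p: "1 < p" and \<eta>: "\<eta> \<in> borel_measurable M" "\<And>x. 0 \<le> \<eta> x" "integrable M \<eta>" "(\<integral>x. \<eta> x \<partial>M) = 1"
    and u: "u \<in> borel_measurable M"
  shows "ennreal (norm (\<integral>x. \<eta> x *\<^sub>R u x \<partial>M) powr p) \<le> (\<integral>\<^sup>+x. ennreal (\<eta> x) * ennreal (norm (u x) powr p) \<partial>M)"
proof (cases "integrable M (\<lambda>x. \<eta> x *\<^sub>R u x) \<and> (\<integral>\<^sup>+x. ennreal (\<eta> x) * ennreal (norm (u x) powr p) \<partial>M) < \<infinity>
    \<and> (\<integral>x. \<eta> x *\<^sub>R u x \<partial>M) \<noteq> 0")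
  \<comment> \<open>The bound is trivial if the right-hand side is infinite or the integral is 0;
    the latter includes the default value for a function that is not integrable.\<close>
  case False
  then show ?thesis
    using not_integrable_integral_eq[of M "\<lambda>x. \<eta> x *\<^sub>R u x"] by (auto simp: less_top[symmetric])
next
  case True
  note \<eta>(1)[measurable] u[measurable]
  have i1: "integrable M (\<lambda>x. \<eta> x * norm (u x))"
    using integrable_norm[OF conjunct1[OF True]] \<eta>(2) by simp
  have i2: "integrable M (\<lambda>x. \<eta> x * norm (u x) powr p)"
  proof (rule integrableI_bounded)
    have "(\<integral>\<^sup>+x. ennreal (norm (\<eta> x * norm (u x) powr p)) \<partial>M) = (\<integral>\<^sup>+x. ennreal (\<eta> x) * ennreal (norm (u x) powr p) \<partial>M)"
      using \<eta>(2) by (intro nn_integral_cong) (simp add: abs_mult ennreal_mult'[symmetric])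
    then show "(\<integral>\<^sup>+x. ennreal (norm (\<eta> x * norm (u x) powr p)) \<partial>M) < \<infinity>"
      using True by simp
  qed measurable
  define t where "t = (\<integral>x. \<eta> x * norm (u x) \<partial>M)"
  have nt: "norm (\<integral>x. \<eta> x *\<^sub>R u x \<partial>M) \<le> t"
    using integral_norm_bound[of M "\<lambda>x. \<eta> x *\<^sub>R u x"] \<eta>(2) by (simp add: t_def)
  have t: "0 < t"
    using nt True by (meson less_le_trans zero_less_norm_iff)
  have tangent: "t powr p + p * t powr (p - 1) * (s - t) \<le> s powr p" if s: "0 \<le> s" for s
  proof -
    have "1 + p * (s / t - 1) \<le> (s / t) powr p"
      using s t by (intro powr_bernoulli[OF p]) auto
    then have "t powr p * (1 + p * (s / t - 1)) \<le> t powr p * (s / t) powr p"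
      by (intro mult_left_mono) auto
    moreover have "t powr p * (s / t) powr p = s powr p"
      using s t by (simp add: powr_divide)
    moreover have "t powr p * (1 + p * (s / t - 1)) = t powr p + p * t powr (p - 1) * (s - t)"
    proof -
      have "t powr p = t powr (p - 1) * t"
        using t by (simp add: powr_mult_base[symmetric] mult.commute) (simp add: powr_diff)
      then show ?thesis
        using t by (simp add: field_simps)
    qed
    ultimately show ?thesis
      by simp
  qed
  have "t powr p = (\<integral>x. t powr p * \<eta> x + p * t powr (p - 1) * (\<eta> x * norm (u x) - t * \<eta> x) \<partial>M)"
    using i1 \<eta>(3,4) by (simp add: t_def)
  also have "\<dots> \<le> (\<integral>x. \<eta> x * norm (u x) powr p \<partial>M)"
  proof (rule integral_mono)
    show "integrable M (\<lambda>x. t powr p * \<eta> x + p * t powr (p - 1) * (\<eta> x * norm (u x) - t * \<eta> x))"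
      using i1 \<eta>(3) by auto
    fix x
    show "t powr p * \<eta> x + p * t powr (p - 1) * (\<eta> x * norm (u x) - t * \<eta> x) \<le> \<eta> x * norm (u x) powr p"
      using mult_left_mono[OF tangent[OF norm_ge_zero[of "u x"]] \<eta>(2)[of x]] by (simp add: algebra_simps)
  qed (rule i2)
  finally have "ennreal (t powr p) \<le> ennreal (\<integral>x. \<eta> x * norm (u x) powr p \<partial>M)"
    by (rule ennreal_leI)
  also have "\<dots> = (\<integral>\<^sup>+x. ennreal (\<eta> x) * ennreal (norm (u x) powr p) \<partial>M)"
    using nn_integral_eq_integral[OF i2] \<eta>(2) by (simp add: ennreal_mult'[symmetric])
  finally have fin: "ennreal (t powr p) \<le> (\<integral>\<^sup>+x. ennreal (\<eta> x) * ennreal (norm (u x) powr p) \<partial>M)" .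
  have "norm (\<integral>x. \<eta> x *\<^sub>R u x \<partial>M) powr p \<le> t powr p"
    by (rule powr_mono2[OF _ norm_ge_zero nt]) (use p in simp)
  then show ?thesis
    by (rule order_trans[OF ennreal_leI fin])
qed

text \<open>Jensen pointwise, then Tonelli. Used for mollification and, with the uniform density on
  \<open>{0..1}\<close>, for averages over a segment.\<close>

lemma Lpn_average:
  fixes D :: "'a::euclidean_space \<Rightarrow> 'c::euclidean_space \<Rightarrow> 'b::euclidean_space"
  assumes p: "1 < p" and \<eta>: "\<eta> \<in> borel_measurable borel" "\<And>x. 0 \<le> \<eta> x" "integrable lborel \<eta>" "(\<integral>x. \<eta> x \<partial>lborel) = 1"
    and D[measurable]: "(\<lambda>(x, y). D x y) \<in> borel_measurable (lborel \<Otimes>\<^sub>M lborel)"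
    and E: "\<And>y. \<eta> y \<noteq> 0 \<Longrightarrow> Lpn lborel p (\<lambda>x. D x y) \<le> E"
  shows "Lpn lborel p (\<lambda>x. \<integral>y. \<eta> y *\<^sub>R D x y \<partial>lborel) \<le> E"
proof -
  note \<eta>(1)[measurable]
  have Dx: "(\<lambda>y. D x y) \<in> borel_measurable lborel" for x
    using measurable_compose[OF measurable_Pair1'[of x lborel lborel] D] by simp
  have Dy: "(\<lambda>x. D x y) \<in> borel_measurable lborel" for y
    using measurable_compose[OF measurable_Pair2'[of y lborel lborel] D] by simp
  have "Lpn lborel p (\<lambda>x. \<integral>y. \<eta> y *\<^sub>R D x y \<partial>lborel)
      \<le> (\<integral>\<^sup>+x. (\<integral>\<^sup>+y. ennreal (\<eta> y) * ennreal (norm (D x y) powr p) \<partial>lborel) \<partial>lborel)"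
    unfolding Lpn_def using \<eta> Dx by (intro nn_integral_mono norm_integral_powr_le[OF p]) auto
  also have "\<dots> = (\<integral>\<^sup>+y. (\<integral>\<^sup>+x. ennreal (\<eta> y) * ennreal (norm (D x y) powr p) \<partial>lborel) \<partial>lborel)"
  proof -
    have "(\<lambda>(x, y). ennreal (\<eta> y) * ennreal (norm (D x y) powr p)) \<in> borel_measurable (lborel \<Otimes>\<^sub>M lborel)"
      by measurable
    from lborel_pair.Fubini'[OF this] show ?thesis
      by simp
  qed
  also have "\<dots> \<le> (\<integral>\<^sup>+y. ennreal (\<eta> y) * E \<partial>lborel)"
  proof (rule nn_integral_mono)
    fix y
    have "(\<integral>\<^sup>+x. ennreal (\<eta> y) * ennreal (norm (D x y) powr p) \<partial>lborel) = ennreal (\<eta> y) * Lpn lborel p (\<lambda>x. D x y)"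
      unfolding Lpn_def using Dy[of y] by (intro nn_integral_cmult) measurable
    also have "\<dots> \<le> ennreal (\<eta> y) * E"
      using E[of y] by (cases "\<eta> y = 0") (auto intro: mult_left_mono)
    finally show "(\<integral>\<^sup>+x. ennreal (\<eta> y) * ennreal (norm (D x y) powr p) \<partial>lborel) \<le> ennreal (\<eta> y) * E" .
  qed
  also have "\<dots> = (\<integral>\<^sup>+y. ennreal (\<eta> y) \<partial>lborel) * E"
    by (rule nn_integral_multc) measurable
  also have "(\<integral>\<^sup>+y. ennreal (\<eta> y) \<partial>lborel) = 1"
    using nn_integral_eq_integral[OF \<eta>(3)] \<eta>(2,4) by simp
  finally show ?thesis
    by simp
qed

text \<open>A normalised cone: the mollification has to be Lipschitz and no more, so a Lipschitz
  kernel does.\<close>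

lemma tent_kernel:
  assumes h: "0 < h"
  shows "\<exists>\<eta> :: 'a::euclidean_space \<Rightarrow> real. \<exists>A. A-lipschitz_on UNIV \<eta> \<and> (\<forall>y. 0 \<le> \<eta> y) \<and>
    (\<forall>y. h < norm y \<longrightarrow> \<eta> y = 0) \<and> integrable lborel \<eta> \<and> (\<integral>y. \<eta> y \<partial>lborel) = 1"
proof -
  define k where "k y = max 0 (h - norm y)" for y :: 'a
  have kl: "1-lipschitz_on UNIV k"
  proof (rule lipschitz_onI)
    fix x y
    show "dist (k x) (k y) \<le> 1 * dist x y"
      using norm_triangle_ineq2[of x y] norm_triangle_ineq2[of y x]
      by (auto simp: k_def dist_norm norm_minus_commute max_def)
  qed simp
  have km: "k \<in> borel_measurable borel"
    by (rule borel_measurable_continuous_onI[OF lipschitz_on_continuous_on[OF kl]])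
  have ki: "integrable lborel k"
  proof (rule Bochner_Integration.integrable_bound)
    show "integrable lborel (\<lambda>y. h * indicator (cball (0::'a) h) y)"
      by (intro integrable_mult_right integrable_indicator_cball)
    show "AE y in lborel. norm (k y) \<le> norm (h * indicator (cball 0 h) y)"
      using h by (intro AE_I2) (auto simp: k_def indicator_def)
  qed (use km in simp)
  define c where "c = (\<integral>y. k y \<partial>lborel)"
  have "0 < (h / 2) * measure lborel (cball (0::'a) (h / 2))"
    using h content_cball_pos[of "h / 2" "0::'a"] by simp
  also have "\<dots> = (\<integral>y. (h / 2) * indicator (cball (0::'a) (h / 2)) y \<partial>lborel)"
    by simp
  also have "\<dots> \<le> c"
    unfolding c_def using h
    by (intro integral_mono ki integrable_mult_right integrable_indicator_cball) (auto simp: k_def indicator_def)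
  finally have c: "0 < c" .
  have "(1 / c)-lipschitz_on UNIV (\<lambda>y. k y / c)"
  proof (rule lipschitz_onI)
    fix x y
    have "dist (k x / c) (k y / c) = dist (k x) (k y) / c"
      using c by (simp add: dist_real_def diff_divide_distrib[symmetric])
    also have "\<dots> \<le> 1 * dist x y / c"
      using lipschitz_onD[OF kl, of x y] c by (intro divide_right_mono) auto
    finally show "dist (k x / c) (k y / c) \<le> 1 / c * dist x y"
      by simp
  qed (use c in simp)
  moreover have "(\<integral>y. k y / c \<partial>lborel) = 1"
    using c by (simp add: c_def)
  moreover have "0 \<le> k y / c" "h < norm y \<longrightarrow> k y / c = 0" for y
    using c by (auto simp: k_def)
  moreover have "integrable lborel (\<lambda>y. k y / c)"
    using ki by (rule integrable_divide)
  ultimately show ?thesis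
    by (intro exI[of _ "\<lambda>y. k y / c"] exI[of _ "1 / c"]) auto
qed

lemma Lp_loc_borel:
  fixes g :: "'a::euclidean_space \<Rightarrow> 'b::euclidean_space"
  assumes "1 \<le> p" "g \<in> borel_measurable borel" "Lpn lborel p g < \<infinity>"
  shows "loc_borel g"
  unfolding loc_borel_def
proof safe
  show "integrable lborel (\<lambda>x. indicator (cball 0 r) x *\<^sub>R g x)" for r
    by (rule Lp_mult_integrable[OF assms(1) _ assms(3), where B = 1 and T = "cball 0 r"])
      (use assms(2) in \<open>auto simp: indicator_def emeasure_cball_less_top\<close>)
qed (rule assms(2))

text \<open>Both L_p bounds are instances of \<open>Lpn_average\<close>: differences of
  \<open>m\<close> are averages of translated differences of \<open>g\<close>, and
  \<open>m - g\<close> is an average of differences of \<open>g\<close> with increments of norm at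
  most \<open>h\<close>.\<close>

theorem mollify:
  fixes g :: "'a::euclidean_space \<Rightarrow> 'b::euclidean_space"
  assumes p: "1 < p" and gm[measurable]: "g \<in> borel_measurable borel" and gp: "Lpn lborel p g < \<infinity>" and h: "0 < h"
  shows "\<exists>m C. C-lipschitz_on UNIV m \<and>
    (\<forall>c E. Lpn lborel p (\<lambda>x. g (x + c) - g x) \<le> E \<longrightarrow> Lpn lborel p (\<lambda>x. m (x + c) - m x) \<le> E) \<and>
    (\<forall>E. (\<forall>c. norm c \<le> h \<longrightarrow> Lpn lborel p (\<lambda>x. g (x + c) - g x) \<le> E) \<longrightarrow> Lpn lborel p (\<lambda>x. m x - g x) \<le> E)"
proof -
  obtain \<eta> :: "'a \<Rightarrow> real" and A where \<eta>: "A-lipschitz_on UNIV \<eta>" "\<And>y. 0 \<le> \<eta> y"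
    "\<And>y. h < norm y \<Longrightarrow> \<eta> y = 0" "integrable lborel \<eta>" "(\<integral>y. \<eta> y \<partial>lborel) = 1"
    using tent_kernel[OF h, where 'a = 'a] by blast
  have A: "0 \<le> A"
    using \<eta>(1) lipschitz_on_nonneg by blast
  have \<eta>m[measurable]: "\<eta> \<in> borel_measurable borel"
    by (rule borel_measurable_continuous_onI[OF lipschitz_on_continuous_on[OF \<eta>(1)]])
  have gL: "loc_borel g"
    using p by (intro Lp_loc_borel[OF _ gm gp]) simp
  \<comment> \<open>A point outside the support: comparison with it turns the Lipschitz bound on
    \<open>\<eta>\<close> into a bound on its size.\<close>
  define v0 where "v0 = (SOME v :: 'a. h < norm v)"
  have v0: "h < norm v0"
    unfolding v0_def by (rule someI_ex) (metis gt_ex less_trans norm_of_real_add1 vector_choose_size h less_imp_le)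
  have \<eta>B: "\<bar>\<eta> y\<bar> \<le> A * (h + norm v0)" for y
  proof (cases "norm y \<le> h")
    case True
    have "\<bar>\<eta> y - \<eta> v0\<bar> \<le> A * norm (y - v0)"
      using lipschitz_onD[OF \<eta>(1), of y v0] by (simp add: dist_norm)
    also have "\<dots> \<le> A * (h + norm v0)"
      using A True norm_triangle_ineq4[of y v0] by (intro mult_left_mono) auto
    finally show ?thesis
      using \<eta>(3)[OF v0] by simp
  qed (use \<eta>(3)[of y] A h in simp)
  have sub_i: "integrable lborel (\<lambda>y. \<eta> (y - x) *\<^sub>R g y)" for x
  proof (rule loc_borel_bounded_mult[OF gL, where R = "h + norm x"])
    show "\<bar>\<eta> (y - x)\<bar> \<le> A * (h + norm v0)" for y
      by (rule \<eta>B)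
    show "\<eta> (y - x) = 0" if "h + norm x < norm y" for y
      using that norm_triangle_ineq2[of y x] by (intro \<eta>(3)) linarith
  qed measurable
  have int: "integrable lborel (\<lambda>y. \<eta> y *\<^sub>R g (x + y))" for x
    using sub_i[of x] lborel_translate(2)[where f = "\<lambda>y. \<eta> (y - x) *\<^sub>R g y" and c = x] by (simp add: add.commute)
  define m where "m x = (\<integral>y. \<eta> y *\<^sub>R g (x + y) \<partial>lborel)" for x
  have m_alt: "m x = (\<integral>y. \<eta> (y - x) *\<^sub>R g y \<partial>lborel)" for x
    unfolding m_def using lborel_translate(1)[where f = "\<lambda>y. \<eta> (y - x) *\<^sub>R g y" and c = x] by (simp add: add.commute)
  define I where "I = (\<integral>y. norm (g y) powr p \<partial>lborel)"
  have Ii: "integrable lborel (\<lambda>y. norm (g y) powr p)"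
    using gp by (intro Lpn_integrable(1)) auto
  define S where "S = measure lborel (cball (0::'a) h) + I"
  have ball_i: "integrable lborel (\<lambda>y. indicator (cball x h) y + norm (g y) powr p)" for x :: 'a
    using Ii by (intro Bochner_Integration.integrable_add integrable_indicator_cball)
  have ball_S: "(\<integral>y. indicator (cball x h) y + norm (g y) powr p \<partial>lborel) = S" for x :: 'a
  proof -
    have "measure lborel (cball x h) = measure lborel (cball (0::'a) h)"
      using h by (simp add: content_cball)
    then show ?thesis
      using Ii integrable_indicator_cball[of x h] by (simp add: S_def I_def)
  qed
  have one: "norm z \<le> 1 + norm z powr p" for z :: 'b
  proof (cases "norm z \<le> 1")
    case False
    then have "norm z powr 1 \<le> norm z powr p"
      using p by (intro powr_mono) auto
    then show ?thesis by simp
  qed (simp add: add_increasing2)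
  \<comment> \<open>The kernels centred at \<open>x\<close> and \<open>x'\<close> differ by at most
    \<open>A * dist x x'\<close>, and only on two balls of radius \<open>h\<close>, where
    \<open>norm (g y) \<le> 1 + norm (g y) powr p\<close>. Each ball contributes at most
    \<open>S\<close>, whatever its centre.\<close>
  have lip: "(A * (2 * S))-lipschitz_on UNIV m"
  proof (rule lipschitz_onI)
    fix x x' :: 'a
    have "m x - m x' = (\<integral>y. \<eta> (y - x) *\<^sub>R g y - \<eta> (y - x') *\<^sub>R g y \<partial>lborel)"
      unfolding m_alt by (rule Bochner_Integration.integral_diff[OF sub_i sub_i, symmetric])
    then have "norm (m x - m x') \<le> (\<integral>y. norm (\<eta> (y - x) *\<^sub>R g y - \<eta> (y - x') *\<^sub>R g y) \<partial>lborel)"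
      using integral_norm_bound[of lborel "\<lambda>y. \<eta> (y - x) *\<^sub>R g y - \<eta> (y - x') *\<^sub>R g y"] by simp
    also have "\<dots> \<le> (\<integral>y. A * dist x x' * ((indicator (cball x h) y + norm (g y) powr p) + (indicator (cball x' h) y + norm (g y) powr p)) \<partial>lborel)"
    proof (rule integral_mono)
      show "integrable lborel (\<lambda>y. norm (\<eta> (y - x) *\<^sub>R g y - \<eta> (y - x') *\<^sub>R g y))"
        by (intro integrable_norm Bochner_Integration.integrable_diff sub_i)
      show "integrable lborel (\<lambda>y. A * dist x x' * ((indicator (cball x h) y + norm (g y) powr p) + (indicator (cball x' h) y + norm (g y) powr p)))"
        by (intro integrable_mult_right Bochner_Integration.integrable_add[OF ball_i ball_i])
      fix y
      let ?W = "(indicator (cball x h) y + norm (g y) powr p) + (indicator (cball x' h) y + norm (g y) powr p) :: real"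
      show "norm (\<eta> (y - x) *\<^sub>R g y - \<eta> (y - x') *\<^sub>R g y) \<le> A * dist x x' * ?W"
      proof (cases "y \<in> cball x h \<or> y \<in> cball x' h")
        case True
        have "norm (g y) \<le> ?W"
        proof -
          define P where "P = norm (g y) powr p"
          have P: "0 \<le> P" "norm (g y) \<le> 1 + P"
            using one[of "g y"] by (simp_all add: P_def)
          show ?thesis
            unfolding P_def[symmetric] using True P by (auto simp: indicator_def)
        qed
        moreover have "\<bar>\<eta> (y - x) - \<eta> (y - x')\<bar> \<le> A * dist x x'"
          using lipschitz_onD[OF \<eta>(1), of "y - x" "y - x'"] by (simp add: dist_norm norm_minus_commute)
        ultimately have "\<bar>\<eta> (y - x) - \<eta> (y - x')\<bar> * norm (g y) \<le> A * dist x x' * ?W"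
          using A by (intro mult_mono) auto
        then show ?thesis
          by (simp add: scaleR_diff_left[symmetric])
      next
        case False
        then have "\<eta> (y - x) = 0" "\<eta> (y - x') = 0"
          by (auto intro!: \<eta>(3) simp: dist_norm norm_minus_commute)
        then show ?thesis
          using A by simp
      qed
    qed
    also have "\<dots> = A * dist x x' * (S + S)"
      using ball_S[of x] ball_S[of x'] ball_i[of x] ball_i[of x'] by (simp only: integral_mult_right_zero Bochner_Integration.integral_add)
    finally show "dist (m x) (m x') \<le> A * (2 * S) * dist x x'"
      by (simp add: dist_norm mult_ac)
  next
    have "0 \<le> S"
      by (simp add: S_def I_def)
    then show "0 \<le> A * (2 * S)"
      using A by simp
  qed
  have meas1: "(\<lambda>(x, y). g ((x + y) + c) - g (x + y)) \<in> borel_measurable (lborel \<Otimes>\<^sub>M lborel)" for c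
    by measurable
  have meas2: "(\<lambda>(x, y). g (x + y) - g x) \<in> borel_measurable (lborel \<Otimes>\<^sub>M lborel)"
    by measurable
  have tr: "Lpn lborel p (\<lambda>x. m (x + c) - m x) \<le> E" if E: "Lpn lborel p (\<lambda>x. g (x + c) - g x) \<le> E" for c E
  proof -
    have "m (x + c) - m x = (\<integral>y. \<eta> y *\<^sub>R (g ((x + y) + c) - g (x + y)) \<partial>lborel)" for x
      unfolding m_def using int[of "x + c"] int[of x] by (simp add: scaleR_diff_right add_ac)
    moreover have "Lpn lborel p (\<lambda>x. \<integral>y. \<eta> y *\<^sub>R (g ((x + y) + c) - g (x + y)) \<partial>lborel) \<le> E"
    proof (rule Lpn_average[OF p \<eta>m \<eta>(2,4,5) meas1])
      fix y
      have "(\<lambda>x. ennreal (norm (g (x + c) - g x) powr p)) \<in> borel_measurable borel"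
        by measurable
      from lborel_translate_nn[OF this, of y] show "Lpn lborel p (\<lambda>x. g ((x + y) + c) - g (x + y)) \<le> E"
        using E by (simp add: Lpn_def)
    qed
    ultimately show ?thesis
      by simp
  qed
  have ap: "Lpn lborel p (\<lambda>x. m x - g x) \<le> E" if E: "\<And>c. norm c \<le> h \<Longrightarrow> Lpn lborel p (\<lambda>x. g (x + c) - g x) \<le> E" for E
  proof -
    have "m x - g x = (\<integral>y. \<eta> y *\<^sub>R (g (x + y) - g x) \<partial>lborel)" for x
    proof -
      have "(\<integral>y. \<eta> y *\<^sub>R g x \<partial>lborel) = g x"
        using \<eta>(4,5) by simp
      then show ?thesis
        unfolding m_def using int[of x] \<eta>(4) by (simp add: scaleR_diff_right)
    qed
    moreover have "Lpn lborel p (\<lambda>x. \<integral>y. \<eta> y *\<^sub>R (g (x + y) - g x) \<partial>lborel) \<le> E"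
    proof (rule Lpn_average[OF p \<eta>m \<eta>(2,4,5) meas2])
      fix y assume "\<eta> y \<noteq> 0"
      then have "norm y \<le> h"
        using \<eta>(3)[of y] by force
      then show "Lpn lborel p (\<lambda>x. g (x + y) - g x) \<le> E"
        by (rule E)
    qed
    ultimately show ?thesis
      by simp
  qed
  show ?thesis
    using lip tr ap by (intro exI[of _ m] exI[of _ "A * (2 * S)"]) auto
qed

section \<open>Translation estimates for Sobolev functions\<close>

lemma Lpn_lebesgue: "Lpn lebesgue p v = Lpn lborel p v"
  unfolding Lpn_def by (rule nn_integral_completion)

lemma Lpn_cong_AE:
  assumes "AE x in M. v x = w x" shows "Lpn M p v = Lpn M p w"
  unfolding Lpn_def by (rule nn_integral_cong_AE) (use assms in \<open>auto elim: eventually_mono\<close>)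

lemma borel_ae_eq_integral:
  fixes f g :: "'a::euclidean_space \<Rightarrow> 'b::euclidean_space"
  assumes "f \<in> borel_measurable lebesgue" "g \<in> borel_measurable borel" "AE x in lborel. f x = g x"
    and "h \<in> borel_measurable borel"
  shows "(\<integral>x. h x *\<^sub>R f x \<partial>lebesgue) = (\<integral>x. h x *\<^sub>R g x \<partial>lborel)"
proof -
  have h: "h \<in> borel_measurable lebesgue"
    by (rule measurable_completion) (use assms in simp)
  have g: "g \<in> borel_measurable lebesgue"
    by (rule measurable_completion) (use assms in simp)
  have "(\<integral>x. h x *\<^sub>R f x \<partial>lebesgue) = (\<integral>x. h x *\<^sub>R g x \<partial>lebesgue)"
  proof (rule integral_cong_AE)
    show "AE x in lebesgue. h x *\<^sub>R f x = h x *\<^sub>R g x"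
      using AE_completion[OF assms(3)] by eventually_elim simp
  qed (use h g assms(1) in \<open>simp_all add: borel_measurable_scaleR\<close>)
  also have "\<dots> = (\<integral>x. h x *\<^sub>R g x \<partial>lborel)"
    using assms by (intro integral_completion) (simp add: borel_measurable_scaleR)
  finally show ?thesis .
qed

text \<open>By \<open>weak_derivative_line\<close> with \<open>t = 1\<close>, the difference
  \<open>f (x + c) - f x\<close> is the average over the segment of the derivative in direction
  \<open>c\<close>, whose norm is at most \<open>norm c * s\<close>; averages and translations
  preserve L_p bounds. Hence \<open>K\<close> is the \<open>p\<close>-th power of the norm of
  \<open>s\<close>, the sum of the norms of the partial derivatives.\<close>

theorem sobolev_UNIV_translate:
  fixes g :: "'a::euclidean_space \<Rightarrow> 'b::euclidean_space"
  assumes p: "1 < p" and g: "g \<in> sobolev p UNIV"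
  shows "\<exists>f K. f \<in> borel_measurable borel \<and> (AE x in lborel. g x = f x) \<and> Lpn lborel p f < \<infinity> \<and>
    (\<forall>c. Lpn lborel p (\<lambda>x. f (x + c) - f x) \<le> ennreal (norm c powr p * K))"
proof -
  obtain G where gp: "Lp_fun p UNIV g" and G: "weak_deriv UNIV g G" and Gp: "\<And>b. b \<in> Basis \<Longrightarrow> Lp_fun p UNIV (\<lambda>x. G x b)"
    using g by (auto simp: sobolev_def)
  have Lpf: "f \<in> borel_measurable lebesgue \<and> Lpn lborel p f < \<infinity>" if "Lp_fun p UNIV f" for f :: "'a \<Rightarrow> 'b"
    using that unfolding Lp_fun_def lebesgue_on_UNIV_eq Lpn_lebesgue[symmetric] by (simp add: Lpn_def)
  obtain f where f[measurable]: "f \<in> borel_measurable borel" and fg: "AE x in lborel. g x = f x"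
    using borel_representative[of g] Lpf[OF gp] by blast
  have fp: "Lpn lborel p f < \<infinity>"
    using Lpf[OF gp] Lpn_cong_AE[OF fg, of p] by simp
  have "\<forall>b. \<exists>H. b \<in> Basis \<longrightarrow> H \<in> borel_measurable borel \<and> (AE x in lborel. G x b = H x)"
    using borel_representative Lpf[OF Gp] by metis
  from choice[OF this] obtain H where Hm: "\<And>b. b \<in> Basis \<Longrightarrow> H b \<in> borel_measurable borel"
    and HG: "\<And>b. b \<in> Basis \<Longrightarrow> AE x in lborel. G x b = H b x"
    by blast
  have Hp: "Lpn lborel p (H b) < \<infinity>" if "b \<in> Basis" for b
    using Lpf[OF Gp[OF that]] Lpn_cong_AE[OF HG[OF that], of p] by simp
  define s where "s x = (\<Sum>b\<in>Basis. norm (H b x))" for x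
  have sm[measurable]: "s \<in> borel_measurable borel"
    unfolding s_def using Hm by (intro borel_measurable_sum borel_measurable_norm) auto
  have "Lpn lborel p (\<lambda>x. \<Sum>b\<in>S. norm (H b x)) < \<infinity>" if "finite S" "S \<subseteq> Basis" for S
    using that
  proof (induction S rule: finite_induct)
    case empty
    then show ?case
      by (simp add: Lpn_def)
  next
    case (insert b S)
    show ?case
    proof (rule Lpn_add_finite[of p "\<lambda>x. norm (H b x)" lborel "\<lambda>x. \<Sum>b\<in>S. norm (H b x)"])
      show "Lpn lborel p (\<lambda>x. norm (H b x)) < \<infinity>"
        using Hp[of b] insert.prems by (simp add: Lpn_def)
      show "(\<lambda>x. \<Sum>b\<in>S. norm (H b x)) \<in> borel_measurable lborel"
        using Hm insert.prems by (simp add: subset_iff)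
      show "norm (\<Sum>b\<in>insert b S. norm (H b x)) \<le> norm (norm (H b x)) + norm (\<Sum>b\<in>S. norm (H b x))" for x
        using insert.hyps by (simp add: sum_nonneg)
    qed (use p insert Hm Hp in auto)
  qed
  then have sp: "Lpn lborel p s < \<infinity>"
    unfolding s_def by simp
  define K where "K = enn2real (Lpn lborel p s)"
  have K: "ennreal K = Lpn lborel p s" "0 \<le> K"
    unfolding K_def using sp by (simp_all add: ennreal_enn2real)
  have HL: "loc_borel (H b)" if "b \<in> Basis" for b
    using p Hm[OF that] Hp[OF that] by (intro Lp_loc_borel) auto
  have fL: "loc_borel f"
    using p f fp by (intro Lp_loc_borel) auto
  have "Lpn lborel p (\<lambda>x. f (x + c) - f x) \<le> ennreal (norm c powr p * K)" for c
  proof -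
    define Hc where "Hc x = (\<Sum>b\<in>Basis. (c \<bullet> b) *\<^sub>R H b x)" for x
    have Hcm[measurable]: "Hc \<in> borel_measurable borel"
      unfolding Hc_def using Hm by (auto intro!: borel_measurable_sum borel_measurable_scaleR)
    have HcL: "loc_borel Hc"
      unfolding loc_borel_def
    proof safe
      fix r
      have "integrable lborel (\<lambda>x. \<Sum>b\<in>Basis. (c \<bullet> b) *\<^sub>R (indicator (cball 0 r) x *\<^sub>R H b x))"
        using HL unfolding loc_borel_def by (intro Bochner_Integration.integrable_sum integrable_scaleR_right) blast
      then show "integrable lborel (\<lambda>x. indicator (cball 0 r) x *\<^sub>R Hc x)"
        by (simp add: Hc_def scaleR_sum_right mult.commute)
    qed (rule Hcm)
    have weak: "(\<integral>x. frechet_derivative \<phi> (at x) c *\<^sub>R f x \<partial>lborel) = - (\<integral>x. \<phi> x *\<^sub>R Hc x \<partial>lborel)"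
      if \<phi>: "test_function UNIV \<phi>" for \<phi>
    proof -
      have lin: "linear (frechet_derivative \<phi> (at x))" for x
        using has_derivative_linear[OF test_function_facts(1)[OF \<phi>]] .
      have fd: "frechet_derivative \<phi> (at x) c = (\<Sum>b\<in>Basis. (c \<bullet> b) * frechet_derivative \<phi> (at x) b)" for x
      proof -
        have "frechet_derivative \<phi> (at x) c = frechet_derivative \<phi> (at x) (\<Sum>b\<in>Basis. (c \<bullet> b) *\<^sub>R b)"
          by (simp only: euclidean_representation)
        also have "\<dots> = (\<Sum>b\<in>Basis. (c \<bullet> b) *\<^sub>R frechet_derivative \<phi> (at x) b)"
          by (simp only: linear_sum[OF lin] linear_scale[OF lin])
        finally show ?thesis
          by (simp only: real_scaleR_def)
      qed
      have pm: "\<phi> \<in> borel_measurable borel"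
        using test_function_facts(2)[OF \<phi>] by (rule borel_measurable_continuous_onI)
      have dm: "(\<lambda>x. frechet_derivative \<phi> (at x) b) \<in> borel_measurable borel" for b
        using test_function_facts(3)[OF \<phi>] by (rule borel_measurable_continuous_onI)
      have i1: "integrable lborel (\<lambda>x. frechet_derivative \<phi> (at x) b *\<^sub>R f x)" for b
      proof -
        obtain r B where "\<And>x. \<bar>frechet_derivative \<phi> (at x) b\<bar> \<le> B" "\<And>x. r < norm x \<Longrightarrow> frechet_derivative \<phi> (at x) b = 0"
          using test_function_facts(4)[OF \<phi>, of b] by blast
        then show ?thesis
          using loc_borel_bounded_mult[OF fL dm] by blast
      qed
      obtain r B where B: "\<And>x. \<bar>\<phi> x\<bar> \<le> B" and r: "\<And>x. r < norm x \<Longrightarrow> \<phi> x = 0"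
        using test_function_facts(4)[OF \<phi>, of 0] by blast
      have i2: "integrable lborel (\<lambda>x. \<phi> x *\<^sub>R H b x)" if "b \<in> Basis" for b
        by (rule loc_borel_bounded_mult[OF HL[OF that] pm B r])
      have wb: "(\<integral>x. frechet_derivative \<phi> (at x) b *\<^sub>R f x \<partial>lborel) = - (\<integral>x. \<phi> x *\<^sub>R H b x \<partial>lborel)" if b: "b \<in> Basis" for b
      proof -
        have "integral\<^sup>L lebesgue (\<lambda>x. frechet_derivative \<phi> (at x) b *\<^sub>R g x) = - integral\<^sup>L lebesgue (\<lambda>x. \<phi> x *\<^sub>R G x b)"
          using G b \<phi> unfolding weak_deriv_def lebesgue_on_UNIV_eq by blast
        then show ?thesis
          using borel_ae_eq_integral[OF _ f fg dm[of b]] borel_ae_eq_integral[OF _ Hm[OF b] HG[OF b] pm] Lpf[OF gp] Lpf[OF Gp[OF b]]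
          by simp
      qed
      have "(\<integral>x. frechet_derivative \<phi> (at x) c *\<^sub>R f x \<partial>lborel)
          = (\<integral>x. (\<Sum>b\<in>Basis. (c \<bullet> b) *\<^sub>R (frechet_derivative \<phi> (at x) b *\<^sub>R f x)) \<partial>lborel)"
        by (simp add: fd scaleR_sum_left)
      also have "\<dots> = (\<Sum>b\<in>Basis. (c \<bullet> b) *\<^sub>R (\<integral>x. frechet_derivative \<phi> (at x) b *\<^sub>R f x \<partial>lborel))"
        using i1 by (simp add: Bochner_Integration.integral_sum del: scaleR_scaleR)
      also have "\<dots> = - (\<Sum>b\<in>Basis. (c \<bullet> b) *\<^sub>R (\<integral>x. \<phi> x *\<^sub>R H b x \<partial>lborel))"
        by (simp add: wb sum_negf)
      also have "(\<Sum>b\<in>Basis. (c \<bullet> b) *\<^sub>R (\<integral>x. \<phi> x *\<^sub>R H b x \<partial>lborel)) = (\<integral>x. (\<Sum>b\<in>Basis. (c \<bullet> b) *\<^sub>R (\<phi> x *\<^sub>R H b x)) \<partial>lborel)"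
        using i2 by (simp add: Bochner_Integration.integral_sum del: scaleR_scaleR)
      also have "\<dots> = (\<integral>x. \<phi> x *\<^sub>R Hc x \<partial>lborel)"
        by (simp add: Hc_def scaleR_sum_right mult.commute)
      finally show ?thesis .
    qed
    define \<eta> where "\<eta> = (indicator {0..1} :: real \<Rightarrow> real)"
    have "AE x in lborel. integrable lborel (\<lambda>s. indicator {0..1} s *\<^sub>R Hc (x + s *\<^sub>R c)) \<and>
        f (x + 1 *\<^sub>R c) - f x = (\<integral>s. indicator {0..1} s *\<^sub>R Hc (x + s *\<^sub>R c) \<partial>lborel)"
      by (rule weak_derivative_line[OF fL HcL]) (simp, rule weak)
    then have "AE x in lborel. f (x + c) - f x = (\<integral>s. \<eta> s *\<^sub>R Hc (x + s *\<^sub>R c) \<partial>lborel)"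
      by eventually_elim (simp add: \<eta>_def)
    from Lpn_cong_AE[OF this, of p]
    have "Lpn lborel p (\<lambda>x. f (x + c) - f x) = Lpn lborel p (\<lambda>x. \<integral>s. \<eta> s *\<^sub>R Hc (x + s *\<^sub>R c) \<partial>lborel)" .
    also have "\<dots> \<le> ennreal (norm c powr p * K)"
    proof (rule Lpn_average[OF p])
      show "(\<lambda>(x, s). Hc (x + s *\<^sub>R c)) \<in> borel_measurable (lborel \<Otimes>\<^sub>M lborel)"
        by measurable
      fix t :: real
      have "(\<lambda>x. ennreal (norm (Hc x) powr p)) \<in> borel_measurable borel"
        by measurable
      from lborel_translate_nn[OF this, of "t *\<^sub>R c"]
      have "Lpn lborel p (\<lambda>x. Hc (x + t *\<^sub>R c)) = Lpn lborel p Hc"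
        by (simp add: Lpn_def)
      also have "\<dots> \<le> (\<integral>\<^sup>+x. ennreal (norm c powr p) * ennreal (norm (s x) powr p) \<partial>lborel)"
        unfolding Lpn_def
      proof (rule nn_integral_mono)
        fix x
        have "norm (Hc x) \<le> (\<Sum>b\<in>Basis. norm c * norm (H b x))"
          unfolding Hc_def by (rule sum_norm_le) (auto intro!: mult_right_mono Basis_le_norm)
        also have "\<dots> = norm c * s x"
          by (simp add: s_def sum_distrib_left)
        finally have "norm (Hc x) powr p \<le> (norm c * s x) powr p"
          using p by (intro powr_mono2) auto
        also have "\<dots> = norm c powr p * norm (s x) powr p"
          by (simp add: powr_mult s_def sum_nonneg)
        finally show "ennreal (norm (Hc x) powr p) \<le> ennreal (norm c powr p) * ennreal (norm (s x) powr p)"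
          by (simp add: ennreal_mult'[symmetric] ennreal_leI)
      qed
      also have "\<dots> = ennreal (norm c powr p) * ennreal K"
        unfolding K(1) Lpn_def by (rule nn_integral_cmult) measurable
      also have "\<dots> = ennreal (norm c powr p * K)"
        using K(2) by (simp add: ennreal_mult'')
      finally show "Lpn lborel p (\<lambda>x. Hc (x + t *\<^sub>R c)) \<le> ennreal (norm c powr p * K)" .
    qed (auto simp: \<eta>_def integrable_indicator_iff emeasure_lborel_Icc_eq)
    finally show ?thesis .
  qed
  then show ?thesis
    using f fg fp by blast
qed

section \<open>Densities and approximate differentials\<close>

text \<open>Vitali covering: the points of \<open>Z\<close> at which the complement keeps relative
  density above \<open>\<epsilon>\<close> at arbitrarily small scales are covered, up to a null set,
  by disjoint balls inside an open set barely larger than the bounded part of \<open>Z\<close> in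
  question. The balls have measure at most \<open>1 / \<epsilon>\<close> times the small
  excess.\<close>

theorem lebesgue_density:
  fixes Z :: "'a::euclidean_space set"
  assumes Z: "Z \<in> sets lebesgue"
  shows "AE x in lebesgue. x \<in> Z \<longrightarrow> density_zero (- Z) x"
proof -
  let ?\<mu> = "measure lebesgue"
  define E where "E n \<epsilon> = {x \<in> Z \<inter> ball 0 (real n). \<forall>d>0. \<exists>r>0. r < d \<and> \<epsilon> * ?\<mu> (cball x r) < ?\<mu> (- Z \<inter> cball x r)}" for n \<epsilon>
  have neg: "negligible (E n \<epsilon>)" if \<epsilon>: "0 < \<epsilon>" for n \<epsilon>
    unfolding negligible_outer_le
  proof (intro allI impI)
    fix e :: real assume e: "0 < e"
    have ZB: "Z \<inter> ball 0 (real n) \<in> sets lebesgue"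
      using Z by auto
    obtain V where V: "open V" "Z \<inter> ball 0 (real n) \<subseteq> V" "V - (Z \<inter> ball 0 (real n)) \<in> lmeasurable"
      "emeasure lebesgue (V - (Z \<inter> ball 0 (real n))) < ennreal (e * \<epsilon>)"
      using sets_lebesgue_outer_open[OF ZB, of "e * \<epsilon>"] e \<epsilon> by auto
    define O1 where "O1 = V \<inter> ball 0 (real n)"
    have O1: "open O1" "Z \<inter> ball 0 (real n) \<subseteq> O1" "bounded O1"
      using V by (auto simp: O1_def open_Int bounded_Int)
    have OZ: "O1 - Z \<in> lmeasurable"
      using O1 Z by (intro bounded_set_imp_lmeasurable) (auto intro: bounded_subset)
    have "?\<mu> (O1 - Z) \<le> ?\<mu> (V - (Z \<inter> ball 0 (real n)))"
      using V(3) OZ by (intro measure_mono_fmeasurable) (auto simp: O1_def fmeasurableD)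
    also have "\<dots> \<le> e * \<epsilon>"
      using V(3,4) e \<epsilon> by (simp add: emeasure_eq_measure2 ennreal_less_iff)
    finally have small: "?\<mu> (O1 - Z) \<le> e * \<epsilon>" .
    define K where "K = {(x, r). x \<in> E n \<epsilon> \<and> 0 < r \<and> cball x r \<subseteq> O1 \<and> \<epsilon> * ?\<mu> (cball x r) < ?\<mu> (- Z \<inter> cball x r)}"
    obtain C where C: "countable C" "C \<subseteq> K"
      "pairwise (\<lambda>i j. disjnt (cball (fst i) (snd i)) (cball (fst j) (snd j))) C"
      "negligible (E n \<epsilon> - (\<Union>i\<in>C. cball (fst i) (snd i)))"
    proof (rule Vitali_covering_theorem_cballs[of K snd "E n \<epsilon>" fst])
      show "0 < snd i" if "i \<in> K" for i
        using that by (auto simp: K_def)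
      fix x :: 'a and d :: real assume x: "x \<in> E n \<epsilon>" "0 < d"
      then have "x \<in> O1"
        using O1 by (auto simp: E_def)
      then obtain d' where d': "0 < d'" "cball x d' \<subseteq> O1"
        using O1(1) open_contains_cball by blast
      have "\<forall>d>0. \<exists>r>0. r < d \<and> \<epsilon> * ?\<mu> (cball x r) < ?\<mu> (- Z \<inter> cball x r)"
        using x(1) unfolding E_def by blast
      from this[rule_format, of "min d d'"] obtain r where r: "0 < r" "r < min d d'"
        "\<epsilon> * ?\<mu> (cball x r) < ?\<mu> (- Z \<inter> cball x r)"
        using x(2) d'(1) by (metis min_less_iff_conj)
      have "cball x r \<subseteq> cball x d'"
        using r by (intro subset_cball) auto
      then show "\<exists>i. i \<in> K \<and> x \<in> cball (fst i) (snd i) \<and> snd i < d"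
        using r d' x by (intro exI[of _ "(x, r)"]) (auto simp: K_def)
    qed blast
    define T where "T = (E n \<epsilon> - (\<Union>i\<in>C. cball (fst i) (snd i))) \<union> (\<Union>i\<in>C. cball (fst i) (snd i))"
    have fin: "?\<mu> (\<Union>i\<in>J. cball (fst i) (snd i)) \<le> e" if J: "J \<subseteq> C" "finite J" for J
    proof -
      have dj: "disjoint_family_on (\<lambda>i. - Z \<inter> cball (fst i) (snd i)) J"
        unfolding disjoint_family_on_def
      proof (intro ballI impI)
        fix i j assume "i \<in> J" "j \<in> J" "i \<noteq> j"
        then have "cball (fst i) (snd i) \<inter> cball (fst j) (snd j) = {}"
          using C(3) J(1) unfolding pairwise_def disjnt_def by blast
        then show "(- Z \<inter> cball (fst i) (snd i)) \<inter> (- Z \<inter> cball (fst j) (snd j)) = {}"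
          by blast
      qed
      have lm: "- Z \<inter> cball (fst i) (snd i) \<in> lmeasurable" for i
      proof (intro bounded_set_imp_lmeasurable sets.Int)
        show "- Z \<in> sets lebesgue"
          using sets.compl_sets[OF Z] by (simp add: Compl_eq_Diff_UNIV)
      qed (auto simp: bounded_Int)
      have "\<epsilon> * ?\<mu> (\<Union>i\<in>J. cball (fst i) (snd i)) \<le> \<epsilon> * (\<Sum>i\<in>J. ?\<mu> (cball (fst i) (snd i)))"
        using \<epsilon> J by (intro mult_left_mono measure_UNION_le) auto
      also have "\<dots> \<le> (\<Sum>i\<in>J. ?\<mu> (- Z \<inter> cball (fst i) (snd i)))"
        unfolding sum_distrib_left using C(2) J by (intro sum_mono) (auto simp: K_def)
      also have "\<dots> = ?\<mu> (\<Union>i\<in>J. - Z \<inter> cball (fst i) (snd i))"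
      proof (intro measure_finite_Union[symmetric] J dj)
        show "(\<lambda>i. - Z \<inter> cball (fst i) (snd i)) ` J \<subseteq> sets lebesgue"
          using fmeasurableD[OF lm] by blast
        show "emeasure lebesgue (- Z \<inter> cball (fst i) (snd i)) \<noteq> \<infinity>" for i
          using fmeasurableD2[OF lm] by simp
      qed
      also have "\<dots> \<le> ?\<mu> (O1 - Z)"
      proof (intro measure_mono_fmeasurable OZ sets.finite_UN J)
        show "(\<Union>i\<in>J. - Z \<inter> cball (fst i) (snd i)) \<subseteq> O1 - Z"
        proof (rule UN_least)
          fix i assume "i \<in> J"
          then have "i \<in> K"
            using J(1) C(2) by blast
          then show "- Z \<inter> cball (fst i) (snd i) \<subseteq> O1 - Z"
            by (auto simp: K_def)
        qed
      qed (rule fmeasurableD[OF lm])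
      also have "\<dots> \<le> e * \<epsilon>"
        by (rule small)
      finally show ?thesis
        using \<epsilon> by (simp add: mult.commute)
    qed
    have U: "(\<Union>i\<in>C. cball (fst i) (snd i)) \<in> lmeasurable" "?\<mu> (\<Union>i\<in>C. cball (fst i) (snd i)) \<le> e"
    proof -
      have lm: "cball (fst i) (snd i) \<in> lmeasurable" if "i \<in> C" for i
        by simp
      show "(\<Union>i\<in>C. cball (fst i) (snd i)) \<in> lmeasurable"
        by (rule fmeasurable_UN_bound[OF C(1) lm fin])
      show "?\<mu> (\<Union>i\<in>C. cball (fst i) (snd i)) \<le> e"
        by (rule measure_UN_bound[OF C(1) lm fin])
    qed
    show "\<exists>T. E n \<epsilon> \<subseteq> T \<and> T \<in> lmeasurable \<and> ?\<mu> T \<le> e"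
    proof (intro exI[of _ T] conjI)
      show "E n \<epsilon> \<subseteq> T"
        by (auto simp: T_def)
      show "T \<in> lmeasurable"
        unfolding T_def by (rule fmeasurable.Un[OF negligible_imp_measurable[OF C(4)] U(1)])
      have "?\<mu> T = ?\<mu> (\<Union>i\<in>C. cball (fst i) (snd i))"
        by (rule measure_negligible_symdiff[OF U(1)], rule negligible_subset[OF C(4)]) (auto simp: T_def)
      then show "?\<mu> T \<le> e"
        using U(2) by simp
    qed
  qed
  have "AE x in lebesgue. \<forall>n k. x \<notin> E n (1 / real (Suc k))"
    unfolding AE_all_countable
  proof (intro allI)
    fix n k
    have "negligible (E n (1 / real (Suc k)))"
      by (rule neg) simp
    then show "AE x in lebesgue. x \<notin> E n (1 / real (Suc k))"
      unfolding negligible_iff_null_sets by (rule AE_not_in)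
  qed
  then show ?thesis
  proof eventually_elim
    case (elim x)
    show ?case
    proof
      assume x: "x \<in> Z"
      obtain n :: nat where n: "norm x < real n"
        using reals_Archimedean2 by blast
      show "density_zero (- Z) x"
        unfolding density_zero_def
      proof (rule tendstoI)
        fix e :: real assume e: "0 < e"
        obtain k where k: "1 / real (Suc k) < e"
          using reals_Archimedean[OF e] by (auto simp: inverse_eq_divide)
        have "x \<notin> E n (1 / real (Suc k))"
          using elim by blast
        moreover have "x \<in> Z \<inter> ball 0 (real n)"
          using x n by simp
        ultimately have "\<not> (\<forall>d>0. \<exists>r>0. r < d \<and> 1 / real (Suc k) * ?\<mu> (cball x r) < ?\<mu> (- Z \<inter> cball x r))"
          unfolding E_def by blast
        then obtain d where d0: "0 < d" "\<not> (\<exists>r>0. r < d \<and> 1 / real (Suc k) * ?\<mu> (cball x r) < ?\<mu> (- Z \<inter> cball x r))"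
          by blast
        have d: "0 < d" "\<And>r. 0 < r \<Longrightarrow> r < d \<Longrightarrow> ?\<mu> (- Z \<inter> cball x r) \<le> 1 / real (Suc k) * ?\<mu> (cball x r)"
          using d0 not_less by blast+
        have "dist (?\<mu> (- Z \<inter> cball x r) / ?\<mu> (cball x r)) 0 < e" if r: "0 < r" "r < d" for r
        proof -
          have "?\<mu> (- Z \<inter> cball x r) / ?\<mu> (cball x r) \<le> 1 / real (Suc k)"
            using d(2)[OF r] content_cball_pos[OF r(1), of x] by (subst pos_divide_le_eq) auto
          then show ?thesis
            using k by (simp add: dist_real_def)
        qed
        then show "\<forall>\<^sub>F r in at_right 0. dist (?\<mu> (- Z \<inter> cball x r) / ?\<mu> (cball x r)) 0 < e"
          using d(1) by (auto simp: eventually_at_right_field)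
      qed
    qed
  qed
qed

lemma density_zero_mono:
  assumes T: "density_zero T a" "T \<in> sets lebesgue" and d: "0 < d" "S \<inter> cball a d \<subseteq> T"
  shows "density_zero S a"
  unfolding density_zero_def
proof (rule tendsto_sandwich)
  show "\<forall>\<^sub>F r in at_right 0. 0 \<le> measure lebesgue (S \<inter> cball a r) / measure lebesgue (cball a r)"
    by simp
  show "((\<lambda>r. measure lebesgue (T \<inter> cball a r) / measure lebesgue (cball a r)) \<longlongrightarrow> 0) (at_right 0)"
    using T(1) by (simp add: density_zero_def)
  show "\<forall>\<^sub>F r in at_right 0. measure lebesgue (S \<inter> cball a r) / measure lebesgue (cball a r)
      \<le> measure lebesgue (T \<inter> cball a r) / measure lebesgue (cball a r)"
    unfolding eventually_at_right_field
  proof (intro exI[of _ d] conjI allI impI d(1))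
    fix r assume r: "0 < r" "r < d"
    have "cball a r \<subseteq> cball a d"
      using r by (intro subset_cball) auto
    then have sub: "S \<inter> cball a r \<subseteq> T \<inter> cball a r"
      using d(2) by blast
    have T': "T \<inter> cball a r \<in> lmeasurable"
      using T(2) by (intro bounded_set_imp_lmeasurable) (auto simp: bounded_Int)
    have "measure lebesgue (S \<inter> cball a r) \<le> measure lebesgue (T \<inter> cball a r)"
    \<comment> \<open>\<open>S\<close> may fail to be measurable; \<open>measure\<close> then
      returns 0 and the bound is trivial.\<close>
    proof (cases "S \<inter> cball a r \<in> sets lebesgue")
      case True
      then show ?thesis
        by (intro measure_mono_fmeasurable sub T')
    qed (simp add: measure_notin_sets)
    then show "measure lebesgue (S \<inter> cball a r) / measure lebesgue (cball a r)
        \<le> measure lebesgue (T \<inter> cball a r) / measure lebesgue (cball a r)"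
      by (intro divide_right_mono) auto
  qed
qed (rule tendsto_const)

text \<open>A ball of radius \<open>t * \<delta>\<close> about \<open>a + t *\<^sub>R w\<close>
  fills the fixed fraction \<open>\<kappa>\<close> of the ball of radius \<open>t * c\<close> about
  \<open>a\<close>, so for small \<open>t\<close> it cannot lie inside a set of density 0.\<close>

lemma density_zero_good_point:
  fixes S :: "'a::euclidean_space set"
  assumes S: "density_zero S a" "S \<in> sets lebesgue" and \<delta>: "0 < \<delta>"
  shows "\<exists>t0>0. \<forall>t. 0 < t \<longrightarrow> t < t0 \<longrightarrow> (\<exists>x\<in>cball (a + t *\<^sub>R w) (t * \<delta>). x \<notin> S)"
proof -
  define c where "c = norm w + \<delta>"
  have c: "0 < c"
    using \<delta> by (simp add: c_def add_nonneg_pos)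
  define \<kappa> where "\<kappa> = (\<delta> / c) ^ DIM('a)"
  have \<kappa>: "0 < \<kappa>"
    using \<delta> c by (simp add: \<kappa>_def)
  have "\<forall>\<^sub>F r in at_right 0. measure lebesgue (S \<inter> cball a r) / measure lebesgue (cball a r) < \<kappa>"
    using S(1) \<kappa> unfolding density_zero_def by (rule order_tendstoD)
  then obtain b where b: "0 < b" "\<And>r. 0 < r \<Longrightarrow> r < b \<Longrightarrow> measure lebesgue (S \<inter> cball a r) / measure lebesgue (cball a r) < \<kappa>"
    by (auto simp: eventually_at_right_field)
  have "\<exists>x\<in>cball (a + t *\<^sub>R w) (t * \<delta>). x \<notin> S" if t: "0 < t" "t < b / c" for t
  proof (rule ccontr)
    assume "\<not> ?thesis"
    then have sub: "cball (a + t *\<^sub>R w) (t * \<delta>) \<subseteq> S"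
      by blast
    have "cball (a + t *\<^sub>R w) (t * \<delta>) \<subseteq> cball a (t * c)"
    proof
      fix x assume "x \<in> cball (a + t *\<^sub>R w) (t * \<delta>)"
      then have "dist (a + t *\<^sub>R w) x \<le> t * \<delta>"
        by simp
      moreover have "dist a (a + t *\<^sub>R w) = t * norm w"
        using t by (simp add: dist_norm)
      ultimately show "x \<in> cball a (t * c)"
        using dist_triangle[of a x "a + t *\<^sub>R w"] by (simp add: c_def distrib_left)
    qed
    then have "measure lebesgue (cball (a + t *\<^sub>R w) (t * \<delta>)) \<le> measure lebesgue (S \<inter> cball a (t * c))"
      using sub S(2) by (intro measure_mono_fmeasurable bounded_set_imp_lmeasurable) (auto simp: bounded_Int)
    then have "measure lebesgue (cball (a + t *\<^sub>R w) (t * \<delta>)) / measure lebesgue (cball a (t * c))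
        \<le> measure lebesgue (S \<inter> cball a (t * c)) / measure lebesgue (cball a (t * c))"
      by (intro divide_right_mono) auto
    moreover have "measure lebesgue (cball (a + t *\<^sub>R w) (t * \<delta>)) / measure lebesgue (cball a (t * c)) = \<kappa>"
    proof -
      have u: "unit_ball_vol (real DIM('a)) \<noteq> 0"
        by (rule less_imp_neq[THEN not_sym]) (rule unit_ball_vol_pos, rule of_nat_0_le_iff)
      have "measure lebesgue (cball (a + t *\<^sub>R w) (t * \<delta>)) = unit_ball_vol (real DIM('a)) * (t * \<delta>) ^ DIM('a)"
        "measure lebesgue (cball a (t * c)) = unit_ball_vol (real DIM('a)) * (t * c) ^ DIM('a)"
        using t \<delta> c by (simp_all add: content_cball)
      then show ?thesis
        using u t c by (simp add: \<kappa>_def power_mult_distrib power_divide)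
    qed
    moreover have "t * c < b"
      using t c by (simp add: pos_less_divide_eq)
    ultimately show False
      using b(2)[of "t * c"] t c by simp
  qed
  then show ?thesis
    using b c by (intro exI[of _ "b / c"]) auto
qed

section \<open>Local selections and approximate differentiability of Lipschitz maps\<close>

lemma G2_le_dist: "G2 y z \<le> dist y z"
  using G2_le[OF permutes_id, of y z] by simp

lemma dist_abs_qtuple: "dist (abs_qtuple y) (abs_qtuple z) = G2 y z"
  by (simp add: dist_qtuple.abs_eq)

lemma dist_vec_le:
  fixes y z :: "'b::real_normed_vector ^ 'q::finite"
  assumes "\<And>i. dist (y $ i) (z $ i) \<le> d"
  shows "dist y z \<le> real CARD('q) * d"
proof -
  have "dist y z \<le> (\<Sum>i\<in>UNIV. dist (y $ i) (z $ i))"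
    unfolding dist_vec_def by (rule L2_set_le_sum) simp
  also have "\<dots> \<le> (\<Sum>i\<in>(UNIV::'q set). d)"
    by (intro sum_mono assms)
  finally show ?thesis
    by simp
qed

text \<open>A matching that does not fix \<open>y0\<close> confuses two distinct entries, whose
  distance is at least \<open>m\<close> and at most \<open>dist y y0 + G2 y y0\<close>. Below
  \<open>m / 2\<close> this makes the identity at least as good.\<close>

lemma G2_local:
  fixes y0 :: "'b::real_normed_vector ^ 'q::finite"
  shows "\<exists>s>0. \<forall>y. dist y y0 < s \<longrightarrow> G2 y y0 = dist y y0"
proof -
  define S where "S = (\<lambda>(i, j). dist (y0 $ i) (y0 $ j)) ` {(i, j). y0 $ i \<noteq> y0 $ j}"
  have S: "finite S" "\<And>s. s \<in> S \<Longrightarrow> 0 < s"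
    by (auto simp: S_def)
  define m where "m = Min (insert 1 S)"
  have m: "0 < m" "\<And>i j. y0 $ i \<noteq> y0 $ j \<Longrightarrow> m \<le> dist (y0 $ i) (y0 $ j)"
    using S by (auto simp: m_def S_def intro!: Min_le)
  have "G2 y y0 = dist y y0" if y: "dist y y0 < m / 2" for y
  proof (rule antisym[OF G2_le_dist])
    obtain \<sigma> where \<sigma>: "\<sigma> permutes UNIV" "G2 y y0 = dist y (perm_tuple \<sigma> y0)"
      by (rule G2_obtain)
    show "dist y y0 \<le> G2 y y0"
    proof (cases "perm_tuple \<sigma> y0 = y0")
      case True
      then show ?thesis
        using \<sigma> by simp
    next
      case False
      then obtain i where i: "y0 $ \<sigma> i \<noteq> y0 $ i"
        by (auto simp: perm_tuple_def vec_eq_iff)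
      have "m \<le> dist (y0 $ i) (y0 $ \<sigma> i)"
        using m(2) i by metis
      also have "\<dots> \<le> dist (y $ i) (y0 $ i) + dist (y $ i) (y0 $ \<sigma> i)"
        by (rule dist_triangle3)
      also have "\<dots> \<le> dist y y0 + G2 y y0"
        using dist_vec_nth_le[of y i y0] dist_vec_nth_le[of y i "perm_tuple \<sigma> y0"] \<sigma>(2) by (simp add: perm_tuple_def)
      finally show ?thesis
        using y by simp
    qed
  qed
  then show ?thesis
    using m(1) by (intro exI[of _ "m / 2"]) auto
qed

lemma continuous_abs_qtuple: "continuous_on A (abs_qtuple :: ('b::euclidean_space ^ 'q::finite) \<Rightarrow> ('b, 'q) qtuple)"
  unfolding continuous_on_iff dist_abs_qtuple
proof (intro ballI allI impI)
  fix x :: "'b ^ 'q" and e :: real assume "0 < e"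
  then show "\<exists>d>0. \<forall>x'\<in>A. dist x' x < d \<longrightarrow> G2 x' x < e"
    using le_less_trans[OF G2_le_dist] by blast
qed

text \<open>The tuples whose coincidence pattern is that of the centres \<open>c\<close>; on these, \<open>\<G>\<^sub>2\<close> controls
  each coordinate, so the inverse of the quotient map is a Lipschitz selection.\<close>

definition pattern :: "'b::euclidean_space ^ 'q::finite \<Rightarrow> real \<Rightarrow> ('b ^ 'q) set"
  where "pattern c \<rho> = {y. (\<forall>i. dist (y $ i) (c $ i) \<le> \<rho>) \<and> (\<forall>i j. c $ i = c $ j \<longrightarrow> y $ i = y $ j)}"

text \<open>A matching that leaves the cluster of \<open>i\<close> pays at least
  \<open>2 * \<rho>\<close>, which bounds the diameter of a cluster, so staying in place is as
  cheap; one that stays inside the cluster meets equal entries.\<close>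

lemma pattern_dist_le:
  assumes sep: "\<And>i j. c $ i \<noteq> c $ j \<Longrightarrow> 4 * \<rho> \<le> dist (c $ i) (c $ j)"
    and y: "y \<in> pattern c \<rho>" "z \<in> pattern c \<rho>"
  shows "dist (y $ i) (z $ i) \<le> G2 y z"
proof -
  obtain \<sigma> where \<sigma>: "\<sigma> permutes UNIV" "G2 y z = dist y (perm_tuple \<sigma> z)"
    by (rule G2_obtain)
  have le: "dist (y $ i) (z $ \<sigma> i) \<le> G2 y z"
    using dist_vec_nth_le[of y i "perm_tuple \<sigma> z"] \<sigma>(2) by (simp add: perm_tuple_def)
  show ?thesis
  proof (cases "c $ i = c $ \<sigma> i")
    case True
    then have "z $ i = z $ \<sigma> i"
      using y(2) unfolding pattern_def by blast
    then show ?thesis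
      using le by simp
  next
    case False
    have "dist (y $ i) (c $ i) \<le> \<rho>" "dist (z $ i) (c $ i) \<le> \<rho>" "dist (z $ \<sigma> i) (c $ \<sigma> i) \<le> \<rho>"
      using y unfolding pattern_def by blast+
    then have "dist (y $ i) (z $ i) \<le> dist (y $ i) (z $ \<sigma> i)"
      using sep[OF False] dist_triangle2[of "y $ i" "z $ i" "c $ i"] dist_triangle[of "c $ i" "c $ \<sigma> i" "y $ i"]
        dist_triangle[of "y $ i" "c $ \<sigma> i" "z $ \<sigma> i"] by (simp add: dist_commute)
    then show ?thesis
      using le by simp
  qed
qed

text \<open>Compactness makes the image under the quotient map closed, whence the sets
  \<open>Z p\<close> of the next theorem are measurable.\<close>

lemma compact_pattern: "compact (pattern c \<rho>)"
proof -
  have "closed (pattern c \<rho>)"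
  proof -
    have "pattern c \<rho> = (\<Inter>i. {y. dist (y $ i) (c $ i) \<le> \<rho>}) \<inter> (\<Inter>(i, j)\<in>{(i, j). c $ i = c $ j}. {y. y $ i = y $ j})"
      by (auto simp: pattern_def)
    moreover have "closed {y :: 'a ^ 'b. dist (y $ i) (c $ i) \<le> \<rho>}" for i
      by (intro closed_Collect_le continuous_intros)
    moreover have "closed {y :: 'a ^ 'b. y $ i = y $ j}" for i j
      by (intro closed_Collect_eq continuous_intros)
    ultimately show ?thesis
      by (simp only:) (intro closed_Int closed_INT ballI, auto)
  qed
  moreover have "bounded (pattern c \<rho>)"
  proof -
    have "pattern c \<rho> \<subseteq> cball c (real CARD('b) * \<rho>)"
    proof
      fix y assume "y \<in> pattern c \<rho>"
      then have "dist (y $ i) (c $ i) \<le> \<rho>" for i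
        unfolding pattern_def by blast
      then show "y \<in> cball c (real CARD('b) * \<rho>)"
        using dist_vec_le[of y c \<rho>] by (simp add: dist_commute)
    qed
    then show ?thesis
      using bounded_cball bounded_subset by blast
  qed
  ultimately show ?thesis
    by (simp add: compact_eq_bounded_closed)
qed

text \<open>Countably many patterns cover all tuples. On the set \<open>Z p\<close> where
  \<open>f\<close> has a given pattern its coordinates are Lipschitz functions; they are extended to
  the whole space, differentiated by \<open>rademacher\<close>, and compared with \<open>f\<close>
  at density points of \<open>Z p\<close>.\<close>

theorem AE_approx_differentiable:
  fixes f :: "'a::euclidean_space \<Rightarrow> ('b::euclidean_space, 'q::finite) qtuple"
  assumes U: "open U" and f: "C-lipschitz_on U f"
  shows "AE a in lebesgue. a \<in> U \<longrightarrow> approx_differentiable U f a"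
proof -
  have fc: "continuous_on U f"
    using f by (rule lipschitz_on_continuous_on)
  obtain D :: "'b set" where D: "countable D" "\<And>X. open X \<Longrightarrow> X \<noteq> {} \<Longrightarrow> \<exists>d\<in>D. d \<in> X"
    using countable_dense_setE by blast
  define I where "I = {(c :: 'b ^ 'q, k :: nat). (\<forall>i. c $ i \<in> D) \<and>
    (\<forall>i j. c $ i \<noteq> c $ j \<longrightarrow> 4 * (1 / Suc k) \<le> dist (c $ i) (c $ j))}"
  have cI: "countable I"
  proof -
    have "countable (vec_lambda ` (UNIV \<rightarrow>\<^sub>E D))"
      using D(1) by (intro countable_image countable_PiE) auto
    moreover have "{c :: 'b ^ 'q. \<forall>i. c $ i \<in> D} \<subseteq> vec_lambda ` (UNIV \<rightarrow>\<^sub>E D)"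
    proof
      fix c :: "'b ^ 'q" assume "c \<in> {c. \<forall>i. c $ i \<in> D}"
      then show "c \<in> vec_lambda ` (UNIV \<rightarrow>\<^sub>E D)"
        by (intro image_eqI[of _ _ "vec_nth c"]) auto
    qed
    ultimately have "countable {c :: 'b ^ 'q. \<forall>i. c $ i \<in> D}"
      using countable_subset by blast
    then have "countable ({c :: 'b ^ 'q. \<forall>i. c $ i \<in> D} \<times> (UNIV :: nat set))"
      by (intro countable_SIGMA) auto
    then show ?thesis
      by (rule countable_subset[rotated]) (auto simp: I_def)
  qed
  define Z where "Z p = {x \<in> U. f x \<in> abs_qtuple ` pattern (fst p) (1 / Suc (snd p))}" for p
  have Zm: "Z p \<in> sets lebesgue" for p
  proof -
    have "closed (abs_qtuple ` pattern (fst p) (1 / Suc (snd p)))"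
      by (intro compact_imp_closed compact_continuous_image continuous_abs_qtuple compact_pattern)
    then have "closedin (top_of_set U) (U \<inter> f -` (abs_qtuple ` pattern (fst p) (1 / Suc (snd p))))"
      by (rule continuous_closedin_preimage[OF fc])
    then obtain T where "closed T" "U \<inter> f -` (abs_qtuple ` pattern (fst p) (1 / Suc (snd p))) = U \<inter> T"
      by (auto simp: closedin_closed)
    moreover have "Z p = U \<inter> f -` (abs_qtuple ` pattern (fst p) (1 / Suc (snd p)))"
      by (auto simp: Z_def)
    ultimately show ?thesis
      using U by auto
  qed
  have cover: "\<exists>p\<in>I. a \<in> Z p" if a: "a \<in> U" for a
  proof -
    obtain y where y: "f a = abs_qtuple y"
      by (metis Quotient3_abs_rep Quotient3_qtuple)
    define S where "S = (\<lambda>(i, j). dist (y $ i) (y $ j)) ` {(i, j). y $ i \<noteq> y $ j}"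
    have S: "finite S" "\<And>s. s \<in> S \<Longrightarrow> 0 < s"
      by (auto simp: S_def)
    define m where "m = Min (insert 1 S)"
    have m: "0 < m" "\<And>i j. y $ i \<noteq> y $ j \<Longrightarrow> m \<le> dist (y $ i) (y $ j)"
      using S by (auto simp: m_def S_def intro!: Min_le)
    \<comment> \<open>With \<open>1 / Suc k < m / 8\<close>, the centres chosen below for distinct
      entries stay more than \<open>6 / Suc k\<close> apart, which exceeds the
      \<open>4 / Suc k\<close> that \<open>I\<close> asks for.\<close>
    obtain k where k: "1 / real (Suc k) < m / 8"
      using reals_Archimedean[of "m / 8"] m by (auto simp: inverse_eq_divide)
    have "\<forall>u. \<exists>d. d \<in> D \<and> dist u d < 1 / Suc k"
    proof
      fix u :: 'b
      show "\<exists>d. d \<in> D \<and> dist u d < 1 / Suc k"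
        using D(2)[of "ball u (1 / Suc k)"] by auto
    qed
    from choice[OF this] obtain \<pi> where \<pi>: "\<And>u. \<pi> u \<in> D" "\<And>u. dist u (\<pi> u) < 1 / Suc k"
      by blast
    \<comment> \<open>The centre depends on the entry and not on its index, so equal entries receive
      equal centres.\<close>
    define c where "c = (\<chi> i. \<pi> (y $ i))"
    have far: "4 * (1 / Suc k) \<le> dist (c $ i) (c $ j)" if "y $ i \<noteq> y $ j" for i j
    proof -
      have "dist (y $ i) (y $ j) \<le> dist (y $ i) (c $ i) + dist (c $ i) (c $ j) + dist (c $ j) (y $ j)"
        by (meson add_right_mono dist_triangle order_trans)
      moreover have "0 < 1 / real (Suc k)"
        by simp
      ultimately show ?thesis
        using \<pi>(2)[of "y $ i"] \<pi>(2)[of "y $ j"] m(2)[OF that] k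
        unfolding c_def vec_lambda_beta dist_commute[of "\<pi> (y $ j)" "y $ j"] by linarith
    qed
    have "(c, k) \<in> I"
    proof -
      have "4 * (1 / Suc k) \<le> dist (c $ i) (c $ j)" if "c $ i \<noteq> c $ j" for i j
        by (rule far) (use that in \<open>auto simp: c_def\<close>)
      then show ?thesis
        unfolding I_def using \<pi>(1) by (simp add: c_def)
    qed
    moreover have "y \<in> pattern c (1 / Suc k)"
    proof -
      have "y $ i = y $ j" if "c $ i = c $ j" for i j
      proof (rule ccontr)
        assume "y $ i \<noteq> y $ j"
        from far[OF this] show False
          using that by (simp add: divide_le_0_iff)
      qed
      then show ?thesis
        using \<pi>(2) by (auto simp: pattern_def c_def less_imp_le)
    qed
    ultimately show ?thesis
      using a y by (intro bexI[of _ "(c, k)"]) (auto simp: Z_def)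
  qed
  have on_Z: "AE a in lebesgue. a \<in> Z p \<longrightarrow> approx_differentiable U f a" if p: "p \<in> I" for p
  proof -
    obtain c k where ck: "p = (c, k)"
      by fastforce
    define \<rho> where "\<rho> = 1 / real (Suc k)"
    have sep: "c $ i \<noteq> c $ j \<Longrightarrow> 4 * \<rho> \<le> dist (c $ i) (c $ j)" for i j
      using p by (simp add: I_def ck \<rho>_def)
    have "\<forall>x. \<exists>y. x \<in> Z p \<longrightarrow> y \<in> pattern c \<rho> \<and> f x = abs_qtuple y"
      by (auto simp: Z_def ck \<rho>_def)
    from choice[OF this] obtain h where h: "\<And>x. x \<in> Z p \<Longrightarrow> h x \<in> pattern c \<rho>" "\<And>x. x \<in> Z p \<Longrightarrow> f x = abs_qtuple (h x)"
      by blast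
    have hl: "C-lipschitz_on (Z p) (\<lambda>x. h x $ i)" for i
    proof (rule lipschitz_onI)
      fix x y assume xy: "x \<in> Z p" "y \<in> Z p"
      have "dist (h x $ i) (h y $ i) \<le> G2 (h x) (h y)"
        by (rule pattern_dist_le[OF sep h(1)[OF xy(1)] h(1)[OF xy(2)]])
      also have "\<dots> = dist (f x) (f y)"
        using h(2) xy by (simp add: dist_abs_qtuple)
      also have "\<dots> \<le> C * dist x y"
        using lipschitz_onD[OF f] xy by (simp add: Z_def)
      finally show "dist (h x $ i) (h y $ i) \<le> C * dist x y" .
    qed (use f lipschitz_on_nonneg in blast)
    have "\<forall>i. \<exists>g. (real DIM('b) * C)-lipschitz_on UNIV g \<and> (\<forall>x\<in>Z p. g x = h x $ i)"
      using mcshane[OF hl] by blast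
    from choice[OF this] obtain g where g: "\<And>i. (real DIM('b) * C)-lipschitz_on UNIV (g i)" "\<And>i x. x \<in> Z p \<Longrightarrow> g i x = h x $ i"
      by blast
    have "AE a in lborel. \<forall>i\<in>(UNIV :: 'q set). g i differentiable (at a)"
      using rademacher[OF g(1)] by (subst AE_finite_all) auto
    then have "AE a in lebesgue. \<forall>i\<in>(UNIV :: 'q set). g i differentiable (at a)"
      by (rule AE_completion)
    with lebesgue_density[OF Zm[of p]] show ?thesis
    proof eventually_elim
      case (elim a)
      show ?case
      proof
        assume a: "a \<in> Z p"
        define A where "A i x = g i a + total_D (g i) a (x - a)" for i x
        have lin: "linear (total_D (g i) a)" for i
          by (rule linear_total_D)
        have "approx_affine U f a A"
          unfolding approx_affine_def
        proof (intro conjI allI impI)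
          fix i
          have "(\<lambda>x. A i x - A i 0) = total_D (g i) a"
            by (auto simp: A_def fun_eq_iff linear_diff[OF lin] linear_neg[OF lin])
          then show "linear (\<lambda>x. A i x - A i 0)"
            using lin by simp
        next
          fix \<epsilon> :: real assume \<epsilon>: "0 < \<epsilon>"
          define \<epsilon>' where "\<epsilon>' = \<epsilon> / CARD('q)"
          have \<epsilon>': "0 < \<epsilon>'"
            using \<epsilon> by (simp add: \<epsilon>'_def)
          have "\<forall>i. \<exists>d>0. \<forall>y. norm (y - a) < d \<longrightarrow> norm (g i y - g i a - total_D (g i) a (y - a)) \<le> \<epsilon>' * norm (y - a)"
            using elim total_D_has_derivative \<epsilon>' unfolding has_derivative_at_alt by blast
          from choice[OF this] obtain d where d: "\<And>i. 0 < d i"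
            "\<And>i y. norm (y - a) < d i \<Longrightarrow> norm (g i y - g i a - total_D (g i) a (y - a)) \<le> \<epsilon>' * norm (y - a)"
            by blast
          \<comment> \<open>Halved because \<open>cball a d0\<close> is closed whereas the choice of
            \<open>d\<close> asks for strict inequalities.\<close>
          define d0 where "d0 = Min (range d) / 2"
          have "0 < Min (range d)"
            using d(1) by (subst Min_gr_iff) auto
          moreover have "Min (range d) \<le> d i" for i
            by (rule Min_le) auto
          ultimately have d0: "0 < d0" "d0 < d i" for i
            unfolding d0_def by (simp, smt (verit, best) field_sum_of_halves)
          show "density_zero {x \<in> U. \<epsilon> * norm (x - a) < dist (f x) (abs_qtuple (\<chi> i. A i x))} a"
          proof (rule density_zero_mono[of "- Z p" a d0])
            show "density_zero (- Z p) a"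
              using elim a by blast
            show "- Z p \<in> sets lebesgue"
              using sets.compl_sets[OF Zm[of p]] by (simp add: Compl_eq_Diff_UNIV)
            show "{x \<in> U. \<epsilon> * norm (x - a) < dist (f x) (abs_qtuple (\<chi> i. A i x))} \<inter> cball a d0 \<subseteq> - Z p"
            proof (intro subsetI ComplI)
              fix x assume "x \<in> {x \<in> U. \<epsilon> * norm (x - a) < dist (f x) (abs_qtuple (\<chi> i. A i x))} \<inter> cball a d0"
              then have x: "\<epsilon> * norm (x - a) < dist (f x) (abs_qtuple (\<chi> i. A i x))" "dist a x \<le> d0"
                by auto
              assume xZ: "x \<in> Z p"
              have "dist (f x) (abs_qtuple (\<chi> i. A i x)) \<le> dist (h x) (\<chi> i. A i x)"
                using h(2)[OF xZ] G2_le_dist by (simp add: dist_abs_qtuple)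
              also have "\<dots> \<le> real CARD('q) * (\<epsilon>' * norm (x - a))"
              proof (rule dist_vec_le)
                fix i
                have "norm (x - a) < d i"
                  using x(2) d0(2)[of i] by (simp add: dist_norm norm_minus_commute)
                from d(2)[OF this] show "dist (h x $ i) ((\<chi> i. A i x) $ i) \<le> \<epsilon>' * norm (x - a)"
                  using g(2)[OF xZ, of i] by (simp add: A_def dist_norm diff_diff_add)
              qed
              also have "\<dots> = \<epsilon> * norm (x - a)"
                by (simp add: \<epsilon>'_def)
              finally show False
                using x(1) by simp
            qed
          qed (rule d0(1))
        qed
        then show "approx_differentiable U f a"
          by (auto simp: approx_differentiable_def)
      qed
    qed
  qed
  have "AE a in lebesgue. \<forall>p\<in>I. a \<in> Z p \<longrightarrow> approx_differentiable U f a"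
    unfolding AE_ball_countable[OF cI] using on_Z by blast
  then show ?thesis
    by eventually_elim (use cover in blast)
qed

section \<open>The energies of a map and of its embedding\<close>

lemma hs_norm_sq:
  fixes L :: "'a::euclidean_space \<Rightarrow> 'b::euclidean_space"
  shows "(hs_norm L)\<^sup>2 = (\<Sum>j\<in>Basis. (norm (L j))\<^sup>2)"
proof -
  have "(hs_norm L)\<^sup>2 = (\<Sum>j\<in>Basis. \<Sum>k\<in>Basis. (L j \<bullet> k)\<^sup>2)"
    unfolding hs_norm_def by (rule real_sqrt_pow2) (auto intro!: sum_nonneg)
  also have "\<dots> = (\<Sum>j\<in>Basis. (norm (L j))\<^sup>2)"
    by (intro sum.cong refl) (subst power2_norm_eq_inner, subst euclidean_inner, simp add: power2_eq_square)
  finally show ?thesis .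
qed

text \<open>The key step for the energy identity: \<open>\<xi>\<close> is isometric seen from the base point \<open>f a\<close>, and
  near \<open>a\<close> the optimal matching between \<open>A x\<close> and \<open>A a\<close> is the identity.\<close>

lemma approx_affine_norm:
  fixes f :: "'a::euclidean_space \<Rightarrow> ('b::euclidean_space, 'q::finite) qtuple"
    and \<xi> :: "('b, 'q) qtuple \<Rightarrow> 'c::euclidean_space"
  assumes \<xi>: "almgren_white \<xi>" and U: "open U" "a \<in> U" and f: "C-lipschitz_on U f"
    and A: "approx_affine U f a A" and g: "\<And>x. x \<in> U \<Longrightarrow> g x = \<xi> (f x)" and gD: "(g has_derivative D) (at a)"
  shows "norm (D e) = norm (\<chi> i. A i e - A i 0)"
proof -
  have C: "0 \<le> C"
    using f lipschitz_on_nonneg by blast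
  define L where "L z = (\<chi> i. A i z - A i 0)" for z
  have Li: "linear (\<lambda>x. A i x - A i 0)" for i
    using A by (simp add: approx_affine_def)
  have L: "linear L"
    by (rule linearI) (simp_all add: L_def vec_eq_iff linear_add[OF Li] linear_scale[OF Li])
  obtain M where M: "0 < M" "\<And>z. norm (L z) \<le> M * norm z"
  proof -
    have "\<exists>K>0. \<forall>z. norm (L z) \<le> norm z * K"
      using L by (intro bounded_linear.pos_bounded) (simp add: linear_conv_bounded_linear[symmetric])
    then show ?thesis
      using that by (auto simp: mult.commute)
  qed
  have Dl: "linear D"
    by (rule has_derivative_linear[OF gD])
  obtain B where B: "0 < B" "\<And>z. norm (D z) \<le> B * norm z"
    using bounded_linear.pos_bounded[OF has_derivative_bounded_linear[OF gD]] by (auto simp: mult.commute)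
  define y where "y x = (\<chi> i. A i x)" for x
  have yL: "y x - y z = L (x - z)" for x z
    by (simp add: y_def L_def vec_eq_iff linear_diff[OF Li])
  have yc: "continuous_on UNIV y"
  proof -
    have "y = (\<lambda>x. y 0 + L x)"
    proof
      show "y x = y 0 + L x" for x
        using yL[of x 0] unfolding diff_eq_eq by (simp add: add.commute)
    qed
    moreover have "continuous_on UNIV (\<lambda>x. y 0 + L x)"
      by (intro continuous_intros linear_continuous_on) (simp add: L linear_conv_bounded_linear[symmetric])
    ultimately show ?thesis
      by (subst \<open>y = (\<lambda>x. y 0 + L x)\<close>)
  qed
  define bad where "bad \<delta> = {x \<in> U. \<delta> * norm (x - a) < dist (f x) (abs_qtuple (y x))}" for \<delta>
  have bad: "density_zero (bad \<delta>) a" "bad \<delta> \<in> sets lebesgue" if "0 < \<delta>" for \<delta>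
  proof -
    show "density_zero (bad \<delta>) a"
      using A that by (simp add: approx_affine_def bad_def y_def)
    have "continuous_on U (\<lambda>x. dist (f x) (abs_qtuple (y x)) - \<delta> * norm (x - a))"
    proof (intro continuous_intros)
      show "continuous_on U f"
        by (rule lipschitz_on_continuous_on[OF f])
      show "continuous_on U (\<lambda>x. abs_qtuple (y x))"
        by (rule continuous_on_compose2[OF continuous_abs_qtuple[of UNIV] continuous_on_subset[OF yc]]) auto
    qed
    from continuous_on_open_vimage[OF U(1), THEN iffD1, OF this, rule_format, of "{0<..}"]
    have "open ((\<lambda>x. dist (f x) (abs_qtuple (y x)) - \<delta> * norm (x - a)) -` {0<..} \<inter> U)"
      by simp
    moreover have "(\<lambda>x. dist (f x) (abs_qtuple (y x)) - \<delta> * norm (x - a)) -` {0<..} \<inter> U = bad \<delta>"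
      by (auto simp: bad_def)
    ultimately show "bad \<delta> \<in> sets lebesgue"
      by simp
  qed
  obtain \<rho> where \<rho>: "0 < \<rho>" "ball a \<rho> \<subseteq> U"
    using U open_contains_ball by blast
  \<comment> \<open>The exceptional sets have density 0, so for small \<open>t\<close> there are
    points outside them within \<open>t * \<delta>\<close> of
    \<open>a + t *\<^sub>R e\<close>.\<close>
  have good: "\<exists>t x. 0 < t \<and> t < \<tau> \<and> x \<in> U \<and> norm (x - (a + t *\<^sub>R e)) \<le> t * \<delta> \<and> norm (x - a) \<le> t * (norm e + 1) \<and>
      dist (f x) (abs_qtuple (y x)) \<le> \<delta> * norm (x - a)" if \<delta>: "0 < \<delta>" "\<delta> \<le> 1" and \<tau>: "0 < \<tau>" for \<delta> \<tau>
  proof -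
    obtain t0 where t0: "0 < t0" "\<And>t. 0 < t \<Longrightarrow> t < t0 \<Longrightarrow> \<exists>x\<in>cball (a + t *\<^sub>R e) (t * \<delta>). x \<notin> bad \<delta>"
      using density_zero_good_point[OF bad[OF \<delta>(1)] \<delta>(1), of e] by blast
    have ne: "0 < norm e + 1"
      by (simp add: add_nonneg_pos)
    define t where "t = min (t0 / 2) (min (\<tau> / 2) (\<rho> / (2 * (norm e + 1))))"
    have t: "0 < t" "t < t0" "t < \<tau>"
      using t0 \<tau> \<rho> ne by (auto simp: t_def)
    have "t * (norm e + 1) \<le> \<rho> / (2 * (norm e + 1)) * (norm e + 1)"
      using ne by (intro mult_right_mono) (auto simp: t_def)
    also have "\<dots> = \<rho> / 2"
    proof -
      have "r / (2 * c) * c = r / 2" if "0 < c" for r c :: real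
        using that by simp
      then show ?thesis
        using ne by blast
    qed
    finally have tr: "t * (norm e + 1) < \<rho>"
      using \<rho> by simp
    obtain x where x: "x \<in> cball (a + t *\<^sub>R e) (t * \<delta>)" "x \<notin> bad \<delta>"
      using t0(2)[OF t(1,2)] by blast
    have x1: "norm (x - (a + t *\<^sub>R e)) \<le> t * \<delta>"
      using x(1) by (simp add: dist_norm norm_minus_commute)
    have "x - a = (x - (a + t *\<^sub>R e)) + t *\<^sub>R e"
      by simp
    then have "norm (x - a) \<le> norm (x - (a + t *\<^sub>R e)) + norm (t *\<^sub>R e)"
      using norm_triangle_ineq by metis
    also have "\<dots> \<le> t * 1 + t * norm e"
    proof -
      have "t * \<delta> \<le> t * 1" "norm (t *\<^sub>R e) = t * norm e"
        using t \<delta> by (auto intro: mult_left_mono)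
      then show ?thesis
        using x1 by linarith
    qed
    finally have x2: "norm (x - a) \<le> t * (norm e + 1)"
      by (simp add: distrib_left add.commute)
    then have xU: "x \<in> U"
      using tr \<rho> by (auto simp: dist_norm norm_minus_commute subset_iff)
    then show ?thesis
      using t x1 x2 x(2) by (intro exI[of _ t] exI[of _ x]) (auto simp: bad_def not_less)
  qed
  \<comment> \<open>The affine maps pass through \<open>f a\<close>: \<open>f\<close> and
    \<open>y\<close> are Lipschitz, and at good points arbitrarily near \<open>a\<close> they differ
    by at most \<open>norm (x - a)\<close>.\<close>
  have fa: "f a = abs_qtuple (y a)"
  proof (rule ccontr)
    assume ne: "f a \<noteq> abs_qtuple (y a)"
    define \<tau> where "\<tau> = dist (f a) (abs_qtuple (y a)) / ((C + 1 + M) * (norm e + 1))"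
    have pos: "0 < (C + 1 + M) * (norm e + 1)"
      using C M by (intro mult_pos_pos) (auto simp: add_nonneg_pos)
    have \<tau>: "0 < \<tau>"
      using ne pos by (simp add: \<tau>_def)
    obtain t x where x: "0 < t" "t < \<tau>" "x \<in> U" "norm (x - a) \<le> t * (norm e + 1)"
      "dist (f x) (abs_qtuple (y x)) \<le> 1 * norm (x - a)"
      using good[of 1 \<tau>] \<tau> by auto
    have "dist (abs_qtuple (y x)) (abs_qtuple (y a)) \<le> norm (L (x - a))"
      using G2_le_dist[of "y x" "y a"] by (simp add: dist_abs_qtuple dist_norm yL)
    then have "dist (f a) (abs_qtuple (y a)) \<le> C * norm (x - a) + norm (x - a) + M * norm (x - a)"
      using dist_triangle[of "f a" "abs_qtuple (y a)" "f x"] dist_triangle[of "f x" "abs_qtuple (y a)" "abs_qtuple (y x)"]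
        lipschitz_onD[OF f U(2) x(3)] x(5) M(2)[of "x - a"] by (simp add: dist_norm norm_minus_commute)
    also have "\<dots> = (C + 1 + M) * norm (x - a)"
      by (simp add: algebra_simps)
    also have "\<dots> \<le> (C + 1 + M) * (t * (norm e + 1))"
      using x(4) C M by (intro mult_left_mono) auto
    also have "\<dots> = t * ((C + 1 + M) * (norm e + 1))"
      by simp
    also have "\<dots> < \<tau> * ((C + 1 + M) * (norm e + 1))"
      using x(2) pos by (intro mult_strict_right_mono)
    also have "\<dots> = dist (f a) (abs_qtuple (y a))"
    proof -
      have "r / c * c = r" if "0 < c" for r c :: real
        using that by simp
      from this[OF pos] show ?thesis
        unfolding \<tau>_def .
    qed
    finally show False
      by simp
  qed
  obtain r where r: "0 < r" "\<And>v. dist (f a) v < r \<Longrightarrow> norm (\<xi> (f a) - \<xi> v) = dist (f a) v"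
    using \<xi> unfolding almgren_white_def by blast
  obtain s where s: "0 < s" "\<And>z. dist z (y a) < s \<Longrightarrow> G2 z (y a) = dist z (y a)"
    using G2_local[of "y a"] by blast
  define c where "c = 2 * (norm e + 1) + B + M"
  have c: "0 < c"
    using B M by (simp add: c_def add_nonneg_pos)
  \<comment> \<open>At a good point \<open>x\<close> near \<open>a + t *\<^sub>R e\<close>,
    \<open>norm (g x - g a)\<close> agrees up to \<open>\<delta> * norm (x - a)\<close> with both
    \<open>norm (D (x - a))\<close> and \<open>norm (L (x - a))\<close>. Division by
    \<open>t\<close> gives the claim, with \<open>c\<close> collecting the constants.\<close>
  have main: "\<bar>norm (D e) - norm (L e)\<bar> \<le> \<delta> * c" if \<delta>: "0 < \<delta>" "\<delta> \<le> 1" for \<delta>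
  proof -
    obtain d where d: "0 < d" "\<And>x. norm (x - a) < d \<Longrightarrow> norm (g x - g a - D (x - a)) \<le> \<delta> * norm (x - a)"
      using gD \<delta> unfolding has_derivative_at_alt by blast
    define K where "K = norm e + 1"
    have K: "0 < K"
      by (simp add: K_def add_nonneg_pos)
    \<comment> \<open>Small enough for three local facts: differentiability of \<open>g\<close>
      within \<open>d\<close> of \<open>a\<close>, isometry of \<open>\<xi>\<close> within
      \<open>r\<close> of \<open>f a\<close>, and optimality of the identity within \<open>s\<close>
      of \<open>y a\<close>.\<close>
    define \<tau> where "\<tau> = min (d / K) (min (r / ((C + 1) * K)) (s / (M * K)))"
    have pos: "0 < (C + 1) * K" "0 < M * K"
      using C M K by auto
    have \<tau>: "0 < \<tau>"
      using d(1) r(1) s(1) K pos by (simp add: \<tau>_def)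
    obtain t x where x: "0 < t" "t < \<tau>" "x \<in> U" "norm (x - (a + t *\<^sub>R e)) \<le> t * \<delta>" "norm (x - a) \<le> t * K"
      "dist (f x) (abs_qtuple (y x)) \<le> \<delta> * norm (x - a)"
      using good[OF \<delta> \<tau>] unfolding K_def by blast
    have "t < d / K" "t < r / ((C + 1) * K)" "t < s / (M * K)"
      using x(2) by (auto simp: \<tau>_def)
    then have tt: "t * K < d" "t * ((C + 1) * K) < r" "t * (M * K) < s"
      using K pos by (simp_all only: pos_less_divide_eq)
    have "dist (f a) (f x) \<le> C * norm (x - a)"
      using lipschitz_onD[OF f U(2) x(3)] by (simp add: dist_norm norm_minus_commute)
    also have "\<dots> \<le> (C + 1) * (t * K)"
      using x(5) C x(1) K by (intro mult_mono) auto
    also have "\<dots> < r"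
      using tt(2) by (simp add: mult_ac)
    finally have "norm (\<xi> (f a) - \<xi> (f x)) = dist (f a) (f x)"
      by (rule r(2))
    then have 1: "norm (g x - g a) = dist (f x) (f a)"
      using g[OF x(3)] g[OF U(2)] by (simp add: norm_minus_commute dist_commute)
    have "dist (y x) (y a) \<le> M * norm (x - a)"
      using M(2)[of "x - a"] by (simp add: dist_norm yL)
    also have "\<dots> \<le> M * (t * K)"
      using x(5) M by (intro mult_left_mono) auto
    also have "\<dots> < s"
      using tt(3) by (simp add: mult_ac)
    finally have 2: "dist (abs_qtuple (y x)) (f a) = norm (L (x - a))"
      using s(2) by (simp add: fa dist_abs_qtuple dist_norm yL)
    have "norm (x - a) < d"
      using x(5) tt(1) by simp
    then have 3: "norm (g x - g a - D (x - a)) \<le> \<delta> * norm (x - a)"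
      by (rule d(2))
    have 4: "\<bar>norm (g x - g a) - norm (D (x - a))\<bar> \<le> \<delta> * norm (x - a)"
      using norm_triangle_ineq3[of "g x - g a" "D (x - a)"] 3 by linarith
    have 5: "\<bar>norm (g x - g a) - norm (L (x - a))\<bar> \<le> \<delta> * norm (x - a)"
      using dist_triangle[of "f x" "f a" "abs_qtuple (y x)"] dist_triangle[of "abs_qtuple (y x)" "f a" "f x"] x(6)
      unfolding 1 2[symmetric] by (simp add: dist_commute abs_le_iff)
    have e1: "x - a - t *\<^sub>R e = x - (a + t *\<^sub>R e)"
      by simp
    have 6: "\<bar>norm (D (x - a)) - t * norm (D e)\<bar> \<le> B * (t * \<delta>)"
    proof -
      have "norm (t *\<^sub>R D e) = t * norm (D e)"
        using x(1) by simp
      moreover have "norm (D (x - a) - t *\<^sub>R D e) \<le> B * (t * \<delta>)"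
      proof -
        have "D (x - a) - t *\<^sub>R D e = D (x - (a + t *\<^sub>R e))"
          unfolding e1[symmetric] by (simp only: linear_diff[OF Dl] linear_scale[OF Dl])
        moreover have "norm (D (x - (a + t *\<^sub>R e))) \<le> B * (t * \<delta>)"
          by (rule order_trans[OF B(2) mult_left_mono[OF x(4)]]) (use B(1) in simp)
        ultimately show ?thesis
          by simp
      qed
      ultimately show ?thesis
        using norm_triangle_ineq3[of "D (x - a)" "t *\<^sub>R D e"] by linarith
    qed
    have 7: "\<bar>norm (L (x - a)) - t * norm (L e)\<bar> \<le> M * (t * \<delta>)"
    proof -
      have "norm (t *\<^sub>R L e) = t * norm (L e)"
        using x(1) by simp
      moreover have "norm (L (x - a) - t *\<^sub>R L e) \<le> M * (t * \<delta>)"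
      proof -
        have "L (x - a) - t *\<^sub>R L e = L (x - (a + t *\<^sub>R e))"
          unfolding e1[symmetric] by (simp only: linear_diff[OF L] linear_scale[OF L])
        moreover have "norm (L (x - (a + t *\<^sub>R e))) \<le> M * (t * \<delta>)"
          by (rule order_trans[OF M(2) mult_left_mono[OF x(4)]]) (use M(1) in simp)
        ultimately show ?thesis
          by simp
      qed
      ultimately show ?thesis
        using norm_triangle_ineq3[of "L (x - a)" "t *\<^sub>R L e"] by linarith
    qed
    have "\<delta> * norm (x - a) \<le> \<delta> * (t * K)"
      using x(5) \<delta> by (intro mult_left_mono) auto
    then have "\<bar>t * norm (D e) - t * norm (L e)\<bar> \<le> \<delta> * (t * K) + \<delta> * (t * K) + B * (t * \<delta>) + M * (t * \<delta>)"
      using 4 5 6 7 by linarith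
    also have "\<dots> = t * (\<delta> * c)"
      by (simp add: c_def K_def algebra_simps)
    finally have "t * \<bar>norm (D e) - norm (L e)\<bar> \<le> t * (\<delta> * c)"
      using x(1) by (simp add: abs_mult right_diff_distrib[symmetric])
    then show ?thesis
      using x(1) by simp
  qed
  have "\<bar>norm (D e) - norm (L e)\<bar> \<le> 0 + \<epsilon>" if \<epsilon>: "0 < \<epsilon>" for \<epsilon>
  proof -
    define \<delta> where "\<delta> = min 1 (\<epsilon> / c)"
    have "0 < \<delta>" "\<delta> \<le> 1"
      using \<epsilon> c by (auto simp: \<delta>_def)
    from main[OF this] show ?thesis
      using mult_right_mono[of \<delta> "\<epsilon> / c" c] c by (auto simp: \<delta>_def)
  qed
  then have "\<bar>norm (D e) - norm (L e)\<bar> \<le> 0"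
    by (rule field_le_epsilon)
  then show ?thesis
    by (simp add: L_def)
qed

text \<open>\<open>approx_affine_norm\<close> holds for every representation \<open>A\<close> and
  every vector, so the choice made in \<open>qD_norm\<close> is immaterial. Applied to basis
  vectors, with the two sums exchanged, it equates the Hilbert-Schmidt norms.\<close>

theorem AE_qD_norm_eq:
  fixes f :: "'a::euclidean_space \<Rightarrow> ('b::euclidean_space, 'q::finite) qtuple"
    and \<xi> :: "('b, 'q) qtuple \<Rightarrow> 'c::euclidean_space"
  assumes \<xi>: "almgren_white \<xi>" and U: "open U" and f: "C-lipschitz_on U f"
    and g: "K-lipschitz_on UNIV g" "\<And>x. x \<in> U \<Longrightarrow> g x = \<xi> (f x)"
  shows "AE a in lebesgue. a \<in> U \<longrightarrow> qD_norm U f a = hs_norm (total_D g a)"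
proof -
  have "AE a in lebesgue. g differentiable (at a)"
    using rademacher[OF g(1)] by (rule AE_completion)
  with AE_approx_differentiable[OF U f] show ?thesis
  proof eventually_elim
    case (elim a)
    show ?case
    proof
      assume a: "a \<in> U"
      define A where "A = (SOME A. approx_affine U f a A)"
      have ad: "approx_differentiable U f a"
        using elim a by blast
      then have A: "approx_affine U f a A"
        unfolding A_def approx_differentiable_def by (rule someI_ex)
      note n = approx_affine_norm[OF \<xi> U a f A g(2) total_D_has_derivative[OF elim(2)]]
      have "(\<Sum>i\<in>UNIV. (hs_norm (\<lambda>x. A i x - A i 0))\<^sup>2) = (\<Sum>i\<in>UNIV. \<Sum>j\<in>Basis. (norm (A i j - A i 0))\<^sup>2)"
        by (simp only: hs_norm_sq)
      also have "\<dots> = (\<Sum>j\<in>Basis. \<Sum>i\<in>UNIV. (norm (A i j - A i 0))\<^sup>2)"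
        by (rule sum.swap)
      also have "\<dots> = (\<Sum>j\<in>Basis. (norm (\<chi> i. A i j - A i 0))\<^sup>2)"
        by (simp add: norm_vec_def L2_set_def sum_nonneg)
      also have "\<dots> = (hs_norm (total_D g a))\<^sup>2"
        by (simp only: n hs_norm_sq)
      finally have "qD_norm U f a = sqrt ((hs_norm (total_D g a))\<^sup>2)"
        using ad by (simp add: qD_norm_def A_def Let_def)
      also have "\<dots> = hs_norm (total_D g a)"
        by (simp add: hs_norm_def sum_nonneg)
      finally show "qD_norm U f a = hs_norm (total_D g a)" .
    qed
  qed
qed

section \<open>The embedding and its Lipschitz retraction\<close>

lemma almgren_white_lipschitz: "almgren_white \<xi> \<Longrightarrow> 1-lipschitz_on A \<xi>"
  by (rule lipschitz_onI) (auto simp: almgren_white_def dist_norm)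

lemma almgren_white_norm: "almgren_white \<xi> \<Longrightarrow> norm (\<xi> v) = dist v qzero"
  by (simp add: almgren_white_def)

lemma almgren_white_inj:
  assumes "almgren_white \<xi>" shows "inj \<xi>"
proof (rule injI)
  obtain \<alpha> where \<alpha>: "0 < \<alpha>" "\<And>v v'. \<alpha> * dist v v' \<le> norm (\<xi> v - \<xi> v')"
    using assms unfolding almgren_white_def by blast
  fix v v' assume "\<xi> v = \<xi> v'"
  then show "v = v'"
    using \<alpha>(2)[of v v'] \<alpha>(1) zero_le_dist[of v v'] by (simp add: mult_le_0_iff)
qed

lemma G2_le_qnear:
  fixes y z :: "'b::real_normed_vector ^ 'q::finite"
  assumes "qnear UNIV d (vec_nth y) (vec_nth z)"
  shows "G2 y z \<le> real CARD('q) * d"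
proof -
  obtain \<sigma> where \<sigma>: "\<sigma> permutes UNIV" "\<And>i. dist (y $ i) (z $ \<sigma> i) \<le> d"
    using assms unfolding qnear_def by blast
  have "G2 y z \<le> dist y (perm_tuple \<sigma> z)"
    by (rule G2_le[OF \<sigma>(1)])
  also have "\<dots> \<le> real CARD('q) * d"
    by (rule dist_vec_le) (simp add: perm_tuple_def \<sigma>(2))
  finally show ?thesis .
qed

lemma qnear_G2:
  fixes y z :: "'b::real_normed_vector ^ 'q::finite"
  shows "qnear UNIV (G2 y z) (vec_nth y) (vec_nth z)"
proof -
  obtain \<sigma> where \<sigma>: "\<sigma> permutes UNIV" "G2 y z = dist y (perm_tuple \<sigma> z)"
    by (rule G2_obtain)
  have "dist (y $ i) (z $ \<sigma> i) \<le> G2 y z" for i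
    using dist_vec_nth_le[of y i "perm_tuple \<sigma> z"] \<sigma>(2) by (simp add: perm_tuple_def)
  then show ?thesis
    unfolding qnear_def using \<sigma>(1) by blast
qed

text \<open>The lower bound in \<open>almgren_white\<close> makes the inverse of
  \<open>\<xi>\<close> Lipschitz on its range; \<open>qlip_extend\<close> extends it, on the level
  of representatives, to the whole target.\<close>

theorem almgren_white_retraction:
  fixes \<xi> :: "('b::euclidean_space, 'q::finite) qtuple \<Rightarrow> 'c::euclidean_space"
  assumes \<xi>: "almgren_white \<xi>"
  shows "\<exists>R C. C-lipschitz_on UNIV R \<and> (\<forall>v. R (\<xi> v) = v)"
proof -
  obtain \<alpha> where \<alpha>: "0 < \<alpha>" "\<And>v v'. \<alpha> * dist v v' \<le> norm (\<xi> v - \<xi> v')"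
    using \<xi> unfolding almgren_white_def by blast
  have "\<forall>v :: ('b, 'q) qtuple. \<exists>y. abs_qtuple y = v"
    using Quotient3_abs_rep[OF Quotient3_qtuple] by blast
  from choice[OF this] obtain rep :: "('b, 'q) qtuple \<Rightarrow> 'b ^ 'q" where rep: "\<And>v. abs_qtuple (rep v) = v"
    by blast
  define f where "f w = vec_nth (rep (inv \<xi> w))" for w
  have inv: "inv \<xi> (\<xi> v) = v" for v
    by (rule inv_f_f[OF almgren_white_inj[OF \<xi>]])
  have f: "qlip UNIV (1 / \<alpha>) (range \<xi>) f"
    unfolding qlip_def
  proof (intro ballI)
    fix x y assume "x \<in> range \<xi>" "y \<in> range \<xi>"
    then obtain v v' where v: "x = \<xi> v" "y = \<xi> v'"
      by blast
    have "G2 (rep v) (rep v') = dist v v'"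
      using dist_abs_qtuple[of "rep v" "rep v'"] by (simp add: rep)
    also have "\<dots> \<le> 1 / \<alpha> * dist x y"
      using \<alpha>(2)[of v v'] \<alpha>(1) by (simp add: v dist_norm pos_le_divide_eq mult.commute)
    finally show "qnear UNIV (1 / \<alpha> * dist x y) (f x) (f y)"
      using qnear_mono[OF qnear_G2[of "rep v" "rep v'"]] by (simp add: f_def v inv)
  qed
  obtain K where K: "1 \<le> K" "qext (UNIV :: 'q set) K TYPE('c) TYPE('b)"
    using qlip_extend[of "UNIV :: 'q set", where 'e = 'c and 'b = 'b] by auto
  obtain g where g: "qlip UNIV (K * (1 / \<alpha>)) UNIV g" "\<And>x. x \<in> range \<xi> \<Longrightarrow> g x = f x"
    using qextD[OF K(2) _ f] \<alpha>(1) by auto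
  define R where "R w = abs_qtuple (\<chi> i. g w i)" for w
  have "dist (R x) (R y) \<le> real CARD('q) * (K * (1 / \<alpha>)) * dist x y" for x y
  proof -
    have "qnear UNIV (K * (1 / \<alpha>) * dist x y) (vec_nth (\<chi> i. g x i)) (vec_nth (\<chi> i. g y i))"
      using qlipD[OF g(1), of x y] by (simp add: vec_lambda_inverse)
    from G2_le_qnear[OF this] show ?thesis
      by (simp add: R_def dist_abs_qtuple mult.assoc)
  qed
  then have "(real CARD('q) * (K * (1 / \<alpha>)))-lipschitz_on UNIV R"
    using K(1) \<alpha>(1) by (intro lipschitz_onI) auto
  moreover have "R (\<xi> v) = v" for v
    using g(2)[of "\<xi> v"] by (simp add: R_def f_def inv rep vec_nth_inverse)
  ultimately show ?thesis
    by blast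
qed

section \<open>Weak derivatives\<close>

lemma Lp_fun_iff: "Lp_fun p U g \<longleftrightarrow> g \<in> borel_measurable (lebesgue_on U) \<and> Lpn (lebesgue_on U) p g < \<infinity>"
  by (simp add: Lp_fun_def Lpn_def)

lemma weak_deriv_cong:
  assumes "\<And>x. x \<in> U \<Longrightarrow> g x = h x" and g: "weak_deriv U g G"
  shows "weak_deriv U h G"
proof -
  have "loc_integrable U h"
    unfolding loc_integrable_def
  proof (intro allI impI)
    fix K assume K: "compact K \<and> K \<subseteq> U"
    have "integrable (lebesgue_on K) g \<longleftrightarrow> integrable (lebesgue_on K) h"
      using K assms(1) by (intro Bochner_Integration.integrable_cong) auto
    then show "integrable (lebesgue_on K) h"
      using g K by (simp add: weak_deriv_def loc_integrable_def)
  qed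
  moreover have "integral\<^sup>L (lebesgue_on U) (\<lambda>x. frechet_derivative \<phi> (at x) v *\<^sub>R h x) =
      integral\<^sup>L (lebesgue_on U) (\<lambda>x. frechet_derivative \<phi> (at x) v *\<^sub>R g x)" for \<phi> v
    using assms(1) by (intro Bochner_Integration.integral_cong) auto
  ultimately show ?thesis
    using g unfolding weak_deriv_def by simp
qed

lemma loc_integrable_test_function:
  fixes u :: "'a::euclidean_space \<Rightarrow> 'b::euclidean_space"
  assumes U: "open U" and u: "loc_integrable U u" and \<phi>: "test_function U \<phi>"
  shows "integrable (lebesgue_on U) (\<lambda>x. \<phi> x *\<^sub>R u x)"
proof -
  define K where "K = closure {x. \<phi> x \<noteq> 0}"
  have K: "compact K" "K \<subseteq> U" "\<And>x. x \<notin> K \<Longrightarrow> \<phi> x = 0"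
    using \<phi> closure_subset[of "{x. \<phi> x \<noteq> 0}"] by (auto simp: test_function_def K_def)
  have Km: "K \<in> sets lebesgue" and Um: "U \<in> sets lebesgue"
    using compact_imp_closed[OF K(1)] U by auto
  obtain B where B: "\<And>x. \<bar>\<phi> x\<bar> \<le> B"
    using test_function_facts(4)[OF \<phi>, of 0] by blast
  have "integrable (lebesgue_on K) u"
    using u K by (auto simp: loc_integrable_def)
  then have I: "integrable lebesgue (\<lambda>x. indicator K x *\<^sub>R u x)"
    using Km by (simp add: integrable_restrict_space)
  have \<phi>m: "\<phi> \<in> borel_measurable lebesgue"
    by (rule measurable_completion) (use borel_measurable_continuous_onI[OF test_function_facts(2)[OF \<phi>]] in simp)
  have "integrable lebesgue (\<lambda>x. \<phi> x *\<^sub>R (indicator K x *\<^sub>R u x))"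
  proof (rule Bochner_Integration.integrable_bound)
    show "integrable lebesgue (\<lambda>x. B *\<^sub>R (indicator K x *\<^sub>R u x))"
      using I by (rule integrable_scaleR_right)
    show "(\<lambda>x. \<phi> x *\<^sub>R (indicator K x *\<^sub>R u x)) \<in> borel_measurable lebesgue"
      using \<phi>m borel_measurable_integrable[OF I] by (rule borel_measurable_scaleR)
    have "norm (\<phi> x *\<^sub>R (indicator K x *\<^sub>R u x)) \<le> norm (B *\<^sub>R (indicator K x *\<^sub>R u x))" for x
      unfolding norm_scaleR by (rule mult_right_mono) (use B[of x] in auto)
    then show "AE x in lebesgue. norm (\<phi> x *\<^sub>R (indicator K x *\<^sub>R u x)) \<le> norm (B *\<^sub>R (indicator K x *\<^sub>R u x))"
      by simp
  qed
  moreover have "\<phi> x *\<^sub>R (indicator K x *\<^sub>R u x) = indicator U x *\<^sub>R (\<phi> x *\<^sub>R u x)" for x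
    using K(2) K(3)[of x] by (cases "x \<in> K") (auto simp: indicator_def)
  ultimately have "integrable lebesgue (\<lambda>x. indicator U x *\<^sub>R (\<phi> x *\<^sub>R u x))"
    by (simp only:)
  then show ?thesis
    using Um by (simp add: integrable_restrict_space)
qed

text \<open>\<open>fundamental_lemma\<close> applied to differences of partial derivatives. It makes
  the choice in \<open>weak_D\<close> harmless.\<close>

lemma weak_deriv_unique:
  assumes U: "open U" and G: "weak_deriv U g G" and H: "weak_deriv U g H"
  shows "AE x in lebesgue_on U. \<forall>v\<in>Basis. G x v = H x v"
proof -
  have "AE x in lebesgue_on U. G x v = H x v" if v: "v \<in> Basis" for v
  proof -
    have loc: "loc_integrable U (\<lambda>x. G x v)" "loc_integrable U (\<lambda>x. H x v)"
      using G H v by (auto simp: weak_deriv_def)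
    have "AE x in lebesgue_on U. G x v - H x v = 0"
    proof (rule fundamental_lemma[OF U])
      show "loc_integrable U (\<lambda>x. G x v - H x v)"
        using loc unfolding loc_integrable_def by (intro allI impI Bochner_Integration.integrable_diff) blast+
      fix \<phi> assume \<phi>: "test_function U \<phi>"
      have "integral\<^sup>L (lebesgue_on U) (\<lambda>x. \<phi> x *\<^sub>R G x v) = integral\<^sup>L (lebesgue_on U) (\<lambda>x. \<phi> x *\<^sub>R H x v)"
      proof -
        have "integral\<^sup>L (lebesgue_on U) (\<lambda>x. frechet_derivative \<phi> (at x) v *\<^sub>R g x) = - integral\<^sup>L (lebesgue_on U) (\<lambda>x. \<phi> x *\<^sub>R G x v)"
          using G v \<phi> unfolding weak_deriv_def by blast
        moreover have "integral\<^sup>L (lebesgue_on U) (\<lambda>x. frechet_derivative \<phi> (at x) v *\<^sub>R g x) = - integral\<^sup>L (lebesgue_on U) (\<lambda>x. \<phi> x *\<^sub>R H x v)"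
          using H v \<phi> unfolding weak_deriv_def by blast
        ultimately show ?thesis
          by simp
      qed
      then show "integral\<^sup>L (lebesgue_on U) (\<lambda>x. \<phi> x *\<^sub>R (G x v - H x v)) = 0"
        unfolding scaleR_diff_right
        by (subst Bochner_Integration.integral_diff)
          (simp_all add: loc_integrable_test_function[OF U _ \<phi>] loc)
    qed
    then show ?thesis
      by simp
  qed
  then show ?thesis
    by (subst AE_finite_all) auto
qed

lemma Lp_loc_integrable:
  fixes w :: "'a::euclidean_space \<Rightarrow> 'b::euclidean_space"
  assumes p: "1 \<le> p" and U: "open U" and w: "Lp_fun p U w"
  shows "loc_integrable U w"
  unfolding loc_integrable_def
proof (intro allI impI)
  fix K assume K: "compact K \<and> K \<subseteq> U"
  have Km: "K \<in> sets lebesgue" and Um: "U \<in> sets lebesgue"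
    using K U by (auto intro: lmeasurable_compact fmeasurableD)
  have "integrable (lebesgue_on U) (\<lambda>x. indicator K x *\<^sub>R w x)"
  proof (rule Lp_mult_integrable[OF p])
    show "K \<in> sets (lebesgue_on U)"
      using Km Um K by (simp add: sets_restrict_space_iff)
    then show "indicator K \<in> borel_measurable (lebesgue_on U)"
      by simp
    show "emeasure (lebesgue_on U) K < \<infinity>"
      using Um K fmeasurableD2[OF lmeasurable_compact, of K] by (simp add: emeasure_restrict_space less_top)
  qed (use w in \<open>auto simp: Lp_fun_iff indicator_def\<close>)
  then have "integrable lebesgue (\<lambda>x. indicator U x *\<^sub>R (indicator K x *\<^sub>R w x))"
    using Um by (simp add: integrable_restrict_space)
  moreover have "indicator U x *\<^sub>R (indicator K x *\<^sub>R w x) = indicator K x *\<^sub>R w x" for x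
    using K by (auto simp: indicator_def)
  ultimately have "integrable lebesgue (\<lambda>x. indicator K x *\<^sub>R w x)"
    by (simp only:)
  then show "integrable (lebesgue_on K) w"
    using Km by (simp add: integrable_restrict_space)
qed

text \<open>The hypotheses on test functions in \<open>Lp_test_tendsto\<close> and
  \<open>Lp_weak_limit\<close>, for \<open>\<phi>\<close> and its derivative at once.\<close>

lemma test_function_support:
  fixes \<phi> :: "'a::euclidean_space \<Rightarrow> real"
  assumes U: "open U" and \<phi>: "test_function U \<phi>"
  shows "\<exists>B T. \<phi> \<in> borel_measurable (lebesgue_on U) \<and> (\<lambda>x. frechet_derivative \<phi> (at x) v) \<in> borel_measurable (lebesgue_on U) \<and>
    (\<forall>x. \<bar>\<phi> x\<bar> \<le> B) \<and> (\<forall>x. \<bar>frechet_derivative \<phi> (at x) v\<bar> \<le> B) \<and> T \<in> sets (lebesgue_on U) \<and> emeasure (lebesgue_on U) T < \<infinity> \<and>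
    (\<forall>x\<in>space (lebesgue_on U). x \<notin> T \<longrightarrow> \<phi> x = 0) \<and> (\<forall>x\<in>space (lebesgue_on U). x \<notin> T \<longrightarrow> frechet_derivative \<phi> (at x) v = 0)"
proof -
  obtain R B where RB: "\<And>x. \<bar>\<phi> x\<bar> \<le> B" "\<And>x. \<bar>frechet_derivative \<phi> (at x) v\<bar> \<le> B"
    "\<And>x. R < norm x \<Longrightarrow> \<phi> x = 0" "\<And>x. R < norm x \<Longrightarrow> frechet_derivative \<phi> (at x) v = 0"
    using test_function_facts(4)[OF \<phi>, of v] by blast
  have Um: "U \<in> sets lebesgue"
    using U by simp
  have m: "h \<in> borel_measurable (lebesgue_on U)" if "continuous_on UNIV h" for h :: "'a \<Rightarrow> real"
  proof (rule measurable_restrict_space1)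
    show "h \<in> borel_measurable lebesgue"
      by (rule measurable_completion) (use borel_measurable_continuous_onI[OF that] in simp)
  qed
  have "U \<inter> cball 0 R \<in> sets (lebesgue_on U)"
    using Um by (auto simp: sets_restrict_space_iff)
  moreover have "emeasure (lebesgue_on U) (U \<inter> cball 0 R) < \<infinity>"
  proof -
    have "emeasure lebesgue (U \<inter> cball 0 R) \<le> emeasure lebesgue (cball (0::'a) R)"
      by (rule emeasure_mono) auto
    also have "\<dots> < \<infinity>"
      using emeasure_compact_finite[of "cball (0::'a) R"] by simp
    finally show ?thesis
      using Um by (simp add: emeasure_restrict_space)
  qed
  ultimately show ?thesis
    using RB m[OF test_function_facts(2)[OF \<phi>]] m[OF test_function_facts(3)[OF \<phi>, of v]]
    by (intro exI[of _ B] exI[of _ "U \<inter> cball 0 R"] conjI) (auto simp: not_le)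
qed

text \<open>The extension property is about scalar functions, so vector-valued ones are extended by
  components.\<close>

lemma sobolev_component:
  fixes g :: "'a::euclidean_space \<Rightarrow> 'b::euclidean_space"
  assumes p: "1 < p" and U: "open U" and g: "g \<in> sobolev p U" and k: "k \<in> Basis"
  shows "(\<lambda>x. g x \<bullet> k) \<in> sobolev p U"
proof -
  obtain G where gp: "Lp_fun p U g" and G: "weak_deriv U g G" and Gp: "\<And>v. v \<in> Basis \<Longrightarrow> Lp_fun p U (\<lambda>x. G x v)"
    using g by (auto simp: sobolev_def)
  have comp: "Lp_fun p U (\<lambda>x. h x \<bullet> k)" if "Lp_fun p U h" for h :: "'a \<Rightarrow> 'b"
  proof -
    have "Lpn (lebesgue_on U) p (\<lambda>x. h x \<bullet> k) \<le> Lpn (lebesgue_on U) p h"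
      unfolding Lpn_def
    proof (intro nn_integral_mono ennreal_leI powr_mono2)
      show "norm (h x \<bullet> k) \<le> norm (h x)" for x
        using Cauchy_Schwarz_ineq2[of "h x" k] k by simp
    qed (use p in auto)
    then show ?thesis
      using that by (auto simp: Lp_fun_iff)
  qed
  have int: "integral\<^sup>L (lebesgue_on U) (\<lambda>x. \<psi> x *\<^sub>R (h x \<bullet> k)) = integral\<^sup>L (lebesgue_on U) (\<lambda>x. \<psi> x *\<^sub>R h x) \<bullet> k"
    if h: "integrable (lebesgue_on U) (\<lambda>x. \<psi> x *\<^sub>R h x)" for h :: "'a \<Rightarrow> 'b" and \<psi>
    using integral_inner_left[of k "lebesgue_on U" "\<lambda>x. \<psi> x *\<^sub>R h x"] h by simp
  have "weak_deriv U (\<lambda>x. g x \<bullet> k) (\<lambda>x v. G x v \<bullet> k)"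
    unfolding weak_deriv_def
  proof (intro conjI allI ballI impI)
    show "loc_integrable U (\<lambda>x. g x \<bullet> k)"
      using p by (intro Lp_loc_integrable[OF _ U comp[OF gp]]) simp
    have "linear (G x)" for x
      using G by (simp add: weak_deriv_def)
    then show "linear (\<lambda>v. G x v \<bullet> k)" for x
      by (intro linearI) (simp_all add: linear_add linear_scale inner_add_left)
    fix v :: 'a assume v: "v \<in> Basis"
    show "loc_integrable U (\<lambda>x. G x v \<bullet> k)"
      using p by (intro Lp_loc_integrable[OF _ U comp[OF Gp[OF v]]]) simp
    fix \<phi> assume \<phi>: "test_function U \<phi>"
    have "integrable (lebesgue_on U) (\<lambda>x. frechet_derivative \<phi> (at x) v *\<^sub>R g x)"
    proof -
      obtain B T where BT: "(\<lambda>x. frechet_derivative \<phi> (at x) v) \<in> borel_measurable (lebesgue_on U)"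
        "\<And>x. \<bar>frechet_derivative \<phi> (at x) v\<bar> \<le> B" "T \<in> sets (lebesgue_on U)" "emeasure (lebesgue_on U) T < \<infinity>"
        "\<And>x. x \<in> space (lebesgue_on U) \<Longrightarrow> x \<notin> T \<Longrightarrow> frechet_derivative \<phi> (at x) v = 0"
        using test_function_support[OF U \<phi>, of v] by (elim exE conjE) blast
      show ?thesis
        by (rule Lp_mult_integrable[where p = p, OF _ _ _ BT]) (use p gp in \<open>auto simp: Lp_fun_iff\<close>)
    qed
    moreover have "integrable (lebesgue_on U) (\<lambda>x. \<phi> x *\<^sub>R G x v)"
      using G v by (intro loc_integrable_test_function[OF U _ \<phi>]) (simp add: weak_deriv_def)
    moreover have "integral\<^sup>L (lebesgue_on U) (\<lambda>x. frechet_derivative \<phi> (at x) v *\<^sub>R g x) =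
        - integral\<^sup>L (lebesgue_on U) (\<lambda>x. \<phi> x *\<^sub>R G x v)"
      using G v \<phi> by (simp add: weak_deriv_def)
    ultimately show "integral\<^sup>L (lebesgue_on U) (\<lambda>x. frechet_derivative \<phi> (at x) v *\<^sub>R (g x \<bullet> k)) =
        - integral\<^sup>L (lebesgue_on U) (\<lambda>x. \<phi> x *\<^sub>R (G x v \<bullet> k))"
      by (simp only: int inner_minus_left)
  qed
  then show ?thesis
    using comp gp Gp unfolding sobolev_def by blast
qed

lemma norm_le_hs_norm:
  assumes "b \<in> Basis" shows "norm (L b) \<le> hs_norm L"
proof (rule power2_le_imp_le)
  show "(norm (L b))\<^sup>2 \<le> (hs_norm L)\<^sup>2"
    unfolding hs_norm_sq using assms by (intro member_le_sum) auto
  show "0 \<le> hs_norm L"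
    by (simp add: hs_norm_def sum_nonneg)
qed

lemma hs_norm_le_sum: "hs_norm L \<le> (\<Sum>b\<in>Basis. norm (L b))"
proof -
  have "hs_norm L = L2_set (\<lambda>b. norm (L b)) Basis"
    unfolding L2_set_def hs_norm_sq[symmetric] by (simp add: hs_norm_def sum_nonneg)
  then show ?thesis
    by (simp add: L2_set_le_sum)
qed

lemma hs_norm_nonneg: "0 \<le> hs_norm L"
  by (simp add: hs_norm_def sum_nonneg)

section \<open>Sobolev limits of Lipschitz maps\<close>

text \<open>For each basis vector the partial derivatives are bounded in L_p and have a weak limit
  \<open>w\<close>. The integration by parts for \<open>u j\<close> passes to the limit on both
  sides, strongly where \<open>u j\<close> occurs and weakly where its derivative does.\<close>

lemma sobolev_of_lipschitz_limit:
  fixes u :: "nat \<Rightarrow> 'a::euclidean_space \<Rightarrow> 'c::euclidean_space" and C :: "nat \<Rightarrow> real"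
  assumes p: "1 < p" and U: "open U" and u: "\<And>j. (C j)-lipschitz_on UNIV (u j)" "\<And>j. Lpn (lebesgue_on U) p (u j) < \<infinity>"
    and E: "\<And>j. (\<integral>\<^sup>+x. ennreal (hs_norm (total_D (u j) x) powr p) \<partial>lebesgue_on U) \<le> ennreal K"
    and g: "Lp_fun p U g" and lim: "(\<lambda>j. Lpn (lebesgue_on U) p (\<lambda>x. u j x - g x)) \<longlonglongrightarrow> 0"
  shows "g \<in> sobolev p U"
proof -
  let ?M = "lebesgue_on U"
  have um: "u j \<in> borel_measurable ?M" for j
  proof (rule measurable_restrict_space1)
    show "u j \<in> borel_measurable lebesgue"
      by (rule measurable_completion)
        (use borel_measurable_continuous_onI[OF lipschitz_on_continuous_on[OF u(1)[of j]]] in simp)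
  qed
  have wd: "weak_deriv U (u j) (total_D (u j))" for j
    by (rule lipschitz_weak_deriv(1)[OF u(1) U])
  have "\<exists>w\<in>borel_measurable ?M. Lpn ?M p w < \<infinity> \<and> (\<forall>\<phi>. test_function U \<phi> \<longrightarrow>
      integral\<^sup>L ?M (\<lambda>x. frechet_derivative \<phi> (at x) b *\<^sub>R g x) = - integral\<^sup>L ?M (\<lambda>x. \<phi> x *\<^sub>R w x))"
    if b: "b \<in> Basis" for b
  proof -
    have Dm: "(\<lambda>x. total_D (u j) x b) \<in> borel_measurable ?M" for j
      by (rule measurable_restrict_space1[OF lipschitz_weak_deriv(2)[OF u(1) U]])
    have DK: "Lpn ?M p (\<lambda>x. total_D (u j) x b) \<le> ennreal K" for j
    proof -
      have "Lpn ?M p (\<lambda>x. total_D (u j) x b) \<le> (\<integral>\<^sup>+x. ennreal (hs_norm (total_D (u j) x) powr p) \<partial>?M)"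
        unfolding Lpn_def
        by (intro nn_integral_mono ennreal_leI powr_mono2 norm_le_hs_norm[OF b]) (use p in auto)
      then show ?thesis
        using E order_trans by blast
    qed
    have "\<exists>w\<in>borel_measurable ?M. Lpn ?M p w < \<infinity> \<and>
      (\<forall>\<psi> B T l. \<psi> \<in> borel_measurable ?M \<longrightarrow> (\<forall>x. \<bar>\<psi> x\<bar> \<le> B) \<longrightarrow> T \<in> sets ?M \<longrightarrow> emeasure ?M T < \<infinity> \<longrightarrow>
        (\<forall>x\<in>space ?M. x \<notin> T \<longrightarrow> \<psi> x = 0) \<longrightarrow> (\<lambda>j. \<integral>x. \<psi> x *\<^sub>R total_D (u j) x b \<partial>?M) \<longlonglongrightarrow> l \<longrightarrow>
        (\<integral>x. \<psi> x *\<^sub>R w x \<partial>?M) = l)"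
      by (rule Lp_weak_limit[OF p Dm DK])
    then show ?thesis
    proof (elim bexE conjE)
      fix w assume w: "w \<in> borel_measurable ?M" "Lpn ?M p w < \<infinity>"
        and wl: "\<forall>\<psi> B T l. \<psi> \<in> borel_measurable ?M \<longrightarrow> (\<forall>x. \<bar>\<psi> x\<bar> \<le> B) \<longrightarrow> T \<in> sets ?M \<longrightarrow> emeasure ?M T < \<infinity> \<longrightarrow>
        (\<forall>x\<in>space ?M. x \<notin> T \<longrightarrow> \<psi> x = 0) \<longrightarrow> (\<lambda>j. \<integral>x. \<psi> x *\<^sub>R total_D (u j) x b \<partial>?M) \<longlonglongrightarrow> l \<longrightarrow>
        (\<integral>x. \<psi> x *\<^sub>R w x \<partial>?M) = l"
      have "integral\<^sup>L ?M (\<lambda>x. frechet_derivative \<phi> (at x) b *\<^sub>R g x) = - integral\<^sup>L ?M (\<lambda>x. \<phi> x *\<^sub>R w x)"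
        if \<phi>: "test_function U \<phi>" for \<phi>
      proof -
        obtain B T where BT: "\<phi> \<in> borel_measurable ?M" "(\<lambda>x. frechet_derivative \<phi> (at x) b) \<in> borel_measurable ?M"
          "\<forall>x. \<bar>\<phi> x\<bar> \<le> B" "\<forall>x. \<bar>frechet_derivative \<phi> (at x) b\<bar> \<le> B" "T \<in> sets ?M" "emeasure ?M T < \<infinity>"
          "\<forall>x\<in>space ?M. x \<notin> T \<longrightarrow> \<phi> x = 0" "\<forall>x\<in>space ?M. x \<notin> T \<longrightarrow> frechet_derivative \<phi> (at x) b = 0"
          using test_function_support[OF U \<phi>, of b] by (elim exE conjE) blast
        have "(\<lambda>j. integral\<^sup>L ?M (\<lambda>x. frechet_derivative \<phi> (at x) b *\<^sub>R u j x))
            \<longlonglongrightarrow> integral\<^sup>L ?M (\<lambda>x. frechet_derivative \<phi> (at x) b *\<^sub>R g x)"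
          using g by (intro Lp_test_tendsto[OF p um u(2) _ _ lim BT(2) BT(4)[rule_format] BT(5,6) BT(8)[rule_format]])
            (auto simp: Lp_fun_iff)
        from tendsto_minus[OF this]
        have "(\<lambda>j. integral\<^sup>L ?M (\<lambda>x. \<phi> x *\<^sub>R total_D (u j) x b))
            \<longlonglongrightarrow> - integral\<^sup>L ?M (\<lambda>x. frechet_derivative \<phi> (at x) b *\<^sub>R g x)"
          using wd b \<phi> unfolding weak_deriv_def by simp
        from wl[rule_format, OF BT(1) BT(3)[rule_format] BT(5,6) BT(7)[rule_format] this] show ?thesis
          by simp
      qed
      then show ?thesis
        using w by blast
    qed
  qed
  then have "\<forall>b. \<exists>w. b \<in> Basis \<longrightarrow> Lp_fun p U w \<and> (\<forall>\<phi>. test_function U \<phi> \<longrightarrow>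
      integral\<^sup>L ?M (\<lambda>x. frechet_derivative \<phi> (at x) b *\<^sub>R g x) = - integral\<^sup>L ?M (\<lambda>x. \<phi> x *\<^sub>R w x))"
    unfolding Lp_fun_iff by blast
  from choice[OF this] obtain w where w: "\<And>b. b \<in> Basis \<Longrightarrow> Lp_fun p U (w b)"
    "\<And>b \<phi>. b \<in> Basis \<Longrightarrow> test_function U \<phi> \<Longrightarrow>
      integral\<^sup>L ?M (\<lambda>x. frechet_derivative \<phi> (at x) b *\<^sub>R g x) = - integral\<^sup>L ?M (\<lambda>x. \<phi> x *\<^sub>R w b x)"
    by blast
  define G where "G x v = (\<Sum>b\<in>Basis. (v \<bullet> b) *\<^sub>R w b x)" for x v
  have Gb: "(\<lambda>x. G x b) = w b" if b: "b \<in> Basis" for b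
  proof
    fix x
    have "G x b = (\<Sum>c\<in>Basis. if c = b then w b x else 0)"
      unfolding G_def by (intro sum.cong refl) (use b in \<open>auto simp: inner_Basis\<close>)
    then show "G x b = w b x"
      using b by simp
  qed
  have p1: "1 \<le> p"
    using p by simp
  have "weak_deriv U g G"
    unfolding weak_deriv_def
  proof (intro conjI allI ballI impI)
    show "loc_integrable U g"
      by (rule Lp_loc_integrable[OF p1 U g])
    show "linear (G x)" for x
      by (rule linearI) (simp_all add: G_def inner_add_left scaleR_add_left sum.distrib scaleR_sum_right)
    fix b :: 'a assume b: "b \<in> Basis"
    show "loc_integrable U (\<lambda>x. G x b)"
      unfolding Gb[OF b] by (rule Lp_loc_integrable[OF p1 U w(1)[OF b]])
    fix \<phi> assume "test_function U \<phi>"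
    moreover have "G x b = w b x" for x
      using fun_cong[OF Gb[OF b]] by simp
    ultimately show "integral\<^sup>L ?M (\<lambda>x. frechet_derivative \<phi> (at x) b *\<^sub>R g x) = - integral\<^sup>L ?M (\<lambda>x. \<phi> x *\<^sub>R G x b)"
      using w(2)[OF b] by simp
  qed
  moreover have "Lp_fun p U (\<lambda>x. G x b)" if "b \<in> Basis" for b
    unfolding Gb[OF that] by (rule w(1)[OF that])
  ultimately show ?thesis
    using g unfolding sobolev_def by blast
qed

lemma borel_measurable_lebesgue_on:
  assumes "g \<in> borel_measurable (restrict_space borel U)"
  shows "g \<in> borel_measurable (lebesgue_on U)"
proof -
  have "(\<lambda>x. x) \<in> measurable (lebesgue_on U) (restrict_space borel U)"
    by (rule measurable_restrict_space3) (auto intro: measurable_completion)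
  from measurable_compose[OF this assms] show ?thesis
    by simp
qed

lemma AE_lebesgue_on:
  assumes "U \<in> sets lebesgue" shows "(AE x in lebesgue_on U. P x) \<longleftrightarrow> (AE x in lebesgue. x \<in> U \<longrightarrow> P x)"
  using assms by (subst AE_restrict_space_iff) auto

theorem W1p_Yp:
  fixes \<xi> :: "('b::euclidean_space, 'q::finite) qtuple \<Rightarrow> 'c::euclidean_space" and U :: "'a::euclidean_space set"
  assumes \<xi>: "almgren_white \<xi>" and p: "1 < p" and U: "open U" and f: "f \<in> W1p p U"
  shows "\<xi> \<circ> f \<in> Yp \<xi> p U"
proof -
  let ?M = "lebesgue_on U"
  have Um: "U \<in> sets lebesgue"
    using U by simp
  have \<xi>c: "continuous_on UNIV \<xi>"
    by (rule lipschitz_on_continuous_on[OF almgren_white_lipschitz[OF \<xi>]])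
  have Y: "\<xi> \<circ> h \<in> borel_measurable (restrict_space borel U)" "Lp_fun p U (\<xi> \<circ> h)" if h: "h \<in> Lp_q p U" for h
  proof -
    show *: "\<xi> \<circ> h \<in> borel_measurable (restrict_space borel U)"
      using h borel_measurable_continuous_onI[OF \<xi>c] by (intro measurable_comp) (auto simp: Lp_q_def)
    show "Lp_fun p U (\<xi> \<circ> h)"
      using h borel_measurable_lebesgue_on[OF *] by (simp add: Lp_fun_def Lp_q_def almgren_white_norm[OF \<xi>])
  qed
  have "f \<in> Lp_q p U \<and> (\<exists>F :: nat \<Rightarrow> 'a \<Rightarrow> ('b, 'q) qtuple. (\<forall>j. \<exists>C. C-lipschitz_on UNIV (F j)) \<and> (\<forall>j. F j \<in> Lp_q p U) \<and>
      (SUP j. \<integral>\<^sup>+x. ennreal (qD_norm UNIV (F j) x powr p) \<partial>?M) < \<infinity> \<and> (\<lambda>j. dist_Lp p U f (F j)) \<longlonglongrightarrow> 0)"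
    using f unfolding W1p_def by (rule CollectD)
  then obtain F :: "nat \<Rightarrow> 'a \<Rightarrow> ('b, 'q) qtuple" where fp: "f \<in> Lp_q p U"
    and F: "\<forall>j. \<exists>C. C-lipschitz_on UNIV (F j)" "\<And>j. F j \<in> Lp_q p U"
    and S: "(SUP j. \<integral>\<^sup>+x. ennreal (qD_norm UNIV (F j) x powr p) \<partial>?M) < \<infinity>"
    and lim: "(\<lambda>j. dist_Lp p U f (F j)) \<longlonglongrightarrow> 0"
    by (elim conjE exE) blast
  from choice[OF F(1)] obtain C :: "nat \<Rightarrow> real" where C: "\<And>j :: nat. (C j)-lipschitz_on UNIV (F j)"
    by blast
  have u: "(C j)-lipschitz_on UNIV (\<xi> \<circ> F j)" for j
    using lipschitz_on_compose[OF C[of j] almgren_white_lipschitz[OF \<xi>]] by simp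
  have E: "(\<integral>\<^sup>+x. ennreal (hs_norm (total_D (\<xi> \<circ> F j) x) powr p) \<partial>?M)
      \<le> ennreal (enn2real (SUP j. \<integral>\<^sup>+x. ennreal (qD_norm UNIV (F j) x powr p) \<partial>?M))" for j
  proof -
    have "AE x in lebesgue. x \<in> UNIV \<longrightarrow> qD_norm UNIV (F j) x = hs_norm (total_D (\<xi> \<circ> F j) x)"
      by (rule AE_qD_norm_eq[OF \<xi> open_UNIV C u]) simp
    then have "AE x in ?M. qD_norm UNIV (F j) x = hs_norm (total_D (\<xi> \<circ> F j) x)"
      unfolding AE_lebesgue_on[OF Um] by eventually_elim simp
    then have "(\<integral>\<^sup>+x. ennreal (hs_norm (total_D (\<xi> \<circ> F j) x) powr p) \<partial>?M) = (\<integral>\<^sup>+x. ennreal (qD_norm UNIV (F j) x powr p) \<partial>?M)"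
      by (intro nn_integral_cong_AE) (auto elim: eventually_mono)
    also have "\<dots> \<le> (SUP j. \<integral>\<^sup>+x. ennreal (qD_norm UNIV (F j) x powr p) \<partial>?M)"
      by (rule SUP_upper) simp
    finally show ?thesis
      using S by simp
  qed
  have lim': "(\<lambda>j. Lpn ?M p (\<lambda>x. (\<xi> \<circ> F j) x - (\<xi> \<circ> f) x)) \<longlonglongrightarrow> 0"
  proof (rule tendsto_sandwich[OF _ _ tendsto_const])
    \<comment> \<open>\<open>enn2real\<close> sends infinity to 0, so \<open>dist_Lp\<close>
      controls the integral only once it is known to be finite.\<close>
    define I where "I j = (\<integral>\<^sup>+x. ennreal (dist (f x) (F j x) powr p) \<partial>?M)" for j
    have "I j < \<infinity>" for j
    proof -
      have "Lpn ?M p (\<lambda>x. dist (f x) (F j x)) < \<infinity>"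
      proof (rule Lpn_add_finite[where v = "\<xi> \<circ> f" and w = "\<xi> \<circ> F j"])
        show "norm (dist (f x) (F j x)) \<le> norm ((\<xi> \<circ> f) x) + norm ((\<xi> \<circ> F j) x)" for x
          using dist_triangle2[of "f x" "F j x" qzero] by (simp add: almgren_white_norm[OF \<xi>])
      qed (use p Y(2)[OF fp] Y(2)[OF F(2)[of j]] in \<open>auto simp: Lp_fun_iff\<close>)
      then show ?thesis
        by (simp add: I_def Lpn_def)
    qed
    then have I: "I j = ennreal (dist_Lp p U f (F j) powr p)" for j
      using p by (simp add: dist_Lp_def I_def[symmetric] powr_powr)
    have "(\<lambda>j. dist_Lp p U f (F j) powr p) \<longlonglongrightarrow> 0 powr p"
      using p by (intro tendsto_powr'[OF lim tendsto_const]) (auto simp: dist_Lp_def)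
    then have "(\<lambda>j. ennreal (dist_Lp p U f (F j) powr p)) \<longlonglongrightarrow> ennreal (0 powr p)"
      by (rule tendsto_ennrealI)
    moreover have "I = (\<lambda>j. ennreal (dist_Lp p U f (F j) powr p))"
      using I by (rule ext)
    ultimately show "I \<longlonglongrightarrow> 0"
      using p by simp
    show "\<forall>\<^sub>F j in sequentially. Lpn ?M p (\<lambda>x. (\<xi> \<circ> F j) x - (\<xi> \<circ> f) x) \<le> I j"
    proof (intro always_eventually allI)
      fix j
      show "Lpn ?M p (\<lambda>x. (\<xi> \<circ> F j) x - (\<xi> \<circ> f) x) \<le> I j"
        unfolding Lpn_def I_def
      proof (intro nn_integral_mono ennreal_leI powr_mono2)
        show "norm ((\<xi> \<circ> F j) x - (\<xi> \<circ> f) x) \<le> dist (f x) (F j x)" for x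
          using lipschitz_onD[OF almgren_white_lipschitz[OF \<xi>], of "F j x" UNIV "f x"]
          by (simp add: dist_norm[symmetric] dist_commute)
      qed (use p in auto)
    qed
  qed simp
  have "Lpn ?M p (\<xi> \<circ> F j) < \<infinity>" for j
    using Y(2)[OF F(2)] by (simp only: Lp_fun_iff)
  from sobolev_of_lipschitz_limit[OF p U u this E Y(2)[OF fp] lim'] have "\<xi> \<circ> f \<in> sobolev p U" .
  then show ?thesis
    using Y(1)[OF fp] by (simp add: Yp_def)
qed

text \<open>\<open>f\<close> is Lipschitz on \<open>U\<close> only. \<open>mcshane\<close> extends
  \<open>\<xi> \<circ> f\<close> to a Lipschitz map \<open>g\<close> on the whole space, whose
  classical derivative is a weak derivative of \<open>\<xi> \<circ> f\<close> on \<open>U\<close>;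
  \<open>weak_D\<close> agrees with it by uniqueness.\<close>

lemma AE_qD_norm_weak_D:
  fixes \<xi> :: "('b::euclidean_space, 'q::finite) qtuple \<Rightarrow> 'c::euclidean_space" and U :: "'a::euclidean_space set"
  assumes \<xi>: "almgren_white \<xi>" and U: "open U" and f: "C-lipschitz_on U f"
  shows "AE x in lebesgue_on U. qD_norm U f x = hs_norm (weak_D U (\<xi> \<circ> f) x)"
proof -
  have Um: "U \<in> sets lebesgue"
    using U by simp
  have "C-lipschitz_on U (\<xi> \<circ> f)"
    using lipschitz_on_compose[OF f almgren_white_lipschitz[OF \<xi>]] by simp
  from mcshane[OF this] obtain g where g: "(real DIM('c) * C)-lipschitz_on UNIV g" "\<And>x. x \<in> U \<Longrightarrow> g x = (\<xi> \<circ> f) x"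
    by blast
  have G: "weak_deriv U (\<xi> \<circ> f) (total_D g)"
    by (rule weak_deriv_cong[OF g(2) lipschitz_weak_deriv(1)[OF g(1) U]])
  then have "weak_deriv U (\<xi> \<circ> f) (weak_D U (\<xi> \<circ> f))"
    unfolding weak_D_def by (rule someI[of "weak_deriv U (\<xi> \<circ> f)"])
  then have "AE x in lebesgue_on U. \<forall>v\<in>Basis. weak_D U (\<xi> \<circ> f) x v = total_D g x v"
    by (rule weak_deriv_unique[OF U _ G])
  moreover have "AE x in lebesgue_on U. qD_norm U f x = hs_norm (total_D g x)"
    unfolding AE_lebesgue_on[OF Um] using AE_qD_norm_eq[OF \<xi> U f g(1)] g(2) by simp
  ultimately show ?thesis
    by eventually_elim (simp add: hs_norm_def)
qed

section \<open>Every Sobolev map into the image lifts\<close>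

lemma Lpn_scale:
  fixes v :: "'a \<Rightarrow> 'b::euclidean_space"
  assumes p: "0 < p" and L: "0 \<le> L" and v: "v \<in> borel_measurable M" and le: "\<And>x. x \<in> space M \<Longrightarrow> norm (z x) \<le> L * norm (v x)"
  shows "Lpn M p z \<le> ennreal (L powr p) * Lpn M p v"
proof -
  have "Lpn M p z \<le> (\<integral>\<^sup>+x. ennreal (L powr p) * ennreal (norm (v x) powr p) \<partial>M)"
    unfolding Lpn_def
  proof (rule nn_integral_mono)
    fix x assume "x \<in> space M"
    then have "norm (z x) powr p \<le> (L * norm (v x)) powr p"
      using p le by (intro powr_mono2) auto
    also have "\<dots> = L powr p * norm (v x) powr p"
      using L by (simp add: powr_mult)
    finally show "ennreal (norm (z x) powr p) \<le> ennreal (L powr p) * ennreal (norm (v x) powr p)"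
      by (simp add: ennreal_mult[symmetric] ennreal_leI)
  qed
  also have "\<dots> = ennreal (L powr p) * Lpn M p v"
    unfolding Lpn_def using v by (intro nn_integral_cmult) simp
  finally show ?thesis .
qed

lemma nn_integral_lebesgue_on_le:
  assumes "U \<in> sets lebesgue"
  shows "(\<integral>\<^sup>+x. h x \<partial>lebesgue_on U) \<le> (\<integral>\<^sup>+x. h x \<partial>lebesgue)"
proof -
  have "(\<integral>\<^sup>+x. h x \<partial>lebesgue_on U) = (\<integral>\<^sup>+x. h x * indicator U x \<partial>lebesgue)"
    using assms by (subst nn_integral_restrict_space) auto
  also have "\<dots> \<le> (\<integral>\<^sup>+x. h x \<partial>lebesgue)"
    by (intro nn_integral_mono) (auto simp: indicator_def)
  finally show ?thesis .
qed

lemma Lpn_restrict_le: "U \<in> sets lebesgue \<Longrightarrow> Lpn (lebesgue_on U) p v \<le> Lpn lborel p v"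
  using nn_integral_lebesgue_on_le[of U "\<lambda>x. ennreal (norm (v x) powr p)"] Lpn_lebesgue[of p v] by (simp add: Lpn_def)

lemma sum_powr_le:
  fixes a :: "'i \<Rightarrow> real"
  assumes I: "finite I" and a: "\<And>i. i \<in> I \<Longrightarrow> 0 \<le> a i" and p: "0 \<le> p"
  shows "(\<Sum>i\<in>I. a i) powr p \<le> real (card I) powr p * (\<Sum>i\<in>I. a i powr p)"
proof (cases "I = {}")
  case False
  define m where "m = Max (a ` I)"
  have m: "m \<in> a ` I" "\<And>i. i \<in> I \<Longrightarrow> a i \<le> m"
    using I False by (auto simp: m_def)
  then obtain k where k: "k \<in> I" "m = a k"
    by blast
  have "(\<Sum>i\<in>I. a i) powr p \<le> (real (card I) * m) powr p"
    using sum_mono[of I a "\<lambda>_. m"] m a p by (intro powr_mono2) (auto intro: sum_nonneg)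
  also have "\<dots> = real (card I) powr p * a k powr p"
    using a k by (simp add: powr_mult)
  also have "\<dots> \<le> real (card I) powr p * (\<Sum>i\<in>I. a i powr p)"
    using k I by (intro mult_left_mono member_le_sum) auto
  finally show ?thesis .
qed simp

text \<open>The way back from translates to derivatives: the difference quotients in a basis
  direction are bounded by \<open>K\<close> in \<open>p\<close>-th power, and Fatou's lemma passes
  to their limit.\<close>

lemma lipschitz_energy_le:
  fixes g :: "'a::euclidean_space \<Rightarrow> 'c::euclidean_space"
  assumes p: "1 < p" and g: "C-lipschitz_on UNIV g" and K: "0 \<le> K"
    and tr: "\<And>c. Lpn lborel p (\<lambda>x. g (x + c) - g x) \<le> ennreal (norm c powr p * K)"
  shows "(\<integral>\<^sup>+x. ennreal (hs_norm (total_D g x) powr p) \<partial>lebesgue) \<le> ennreal (real DIM('a) powr p * (real DIM('a) * K))"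
proof -
  have gm[measurable]: "g \<in> borel_measurable borel"
    by (rule borel_measurable_continuous_onI[OF lipschitz_on_continuous_on[OF g]])
  have Dm: "(\<lambda>x. total_D g x b) \<in> borel_measurable lebesgue" for b
    by (rule lipschitz_weak_deriv(2)[OF g open_UNIV])
  have part: "Lpn lebesgue p (\<lambda>x. total_D g x b) \<le> ennreal K" if b: "b \<in> Basis" for b
  proof -
    define q where "q n x = real (Suc n) *\<^sub>R (g (x + b /\<^sub>R real (Suc n)) - g x)" for n x
    have qm[measurable]: "q n \<in> borel_measurable borel" for n
      unfolding q_def by measurable
    have qK: "Lpn lborel p (q n) \<le> ennreal K" for n
    proof -
      have "Lpn lborel p (q n) \<le> ennreal (real (Suc n) powr p) * Lpn lborel p (\<lambda>x. g (x + b /\<^sub>R real (Suc n)) - g x)"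
      proof (rule Lpn_scale)
        show "(\<lambda>x. g (x + b /\<^sub>R real (Suc n)) - g x) \<in> borel_measurable lborel"
          by measurable
      qed (use p in \<open>auto simp: q_def\<close>)
      also have "\<dots> \<le> ennreal (real (Suc n) powr p) * ennreal (norm (b /\<^sub>R real (Suc n)) powr p * K)"
        by (intro mult_left_mono tr) simp
      also have "\<dots> = ennreal (real (Suc n) powr p * (norm (b /\<^sub>R real (Suc n)) powr p * K))"
        using K by (intro ennreal_mult[symmetric]) auto
      also have "real (Suc n) powr p * (norm (b /\<^sub>R real (Suc n)) powr p * K) = (real (Suc n) * norm (b /\<^sub>R real (Suc n))) powr p * K"
        by (subst powr_mult) auto
      also have "real (Suc n) * norm (b /\<^sub>R real (Suc n)) = 1"
        using b by (simp add: inverse_eq_divide)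
      finally show ?thesis
        by simp
    qed
    have "AE x in lborel. (\<lambda>n. q n x) \<longlonglongrightarrow> total_D g x b"
      unfolding q_def by (rule lipschitz_weak_deriv(3)[OF g open_UNIV])
    then have lim: "AE x in lebesgue. (\<lambda>n. q n x) \<longlonglongrightarrow> total_D g x b"
      by (rule AE_completion)
    have "Lpn lebesgue p (\<lambda>x. total_D g x b) = (\<integral>\<^sup>+x. liminf (\<lambda>n. ennreal (norm (q n x) powr p)) \<partial>lebesgue)"
      unfolding Lpn_def
    proof (rule nn_integral_cong_AE, use lim in eventually_elim)
      fix x assume "(\<lambda>n. q n x) \<longlonglongrightarrow> total_D g x b"
      then have "(\<lambda>n. ennreal (norm (q n x) powr p)) \<longlonglongrightarrow> ennreal (norm (total_D g x b) powr p)"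
        using p by (intro tendsto_ennrealI tendsto_powr' tendsto_norm tendsto_const) auto
      from lim_imp_Liminf[OF _ this] show "ennreal (norm (total_D g x b) powr p) = liminf (\<lambda>n. ennreal (norm (q n x) powr p))"
        by simp
    qed
    also have "\<dots> \<le> liminf (\<lambda>n. Lpn lebesgue p (q n))"
      unfolding Lpn_def
    proof (rule nn_integral_liminf)
      show "(\<lambda>x. ennreal (norm (q n x) powr p)) \<in> borel_measurable lebesgue" for n
        by (rule measurable_completion) simp
    qed
    also have "\<dots> \<le> liminf (\<lambda>n. ennreal K)"
      unfolding Lpn_lebesgue by (intro Liminf_mono always_eventually allI qK)
    also have "\<dots> = ennreal K"
      by (rule Liminf_const) simp
    finally show ?thesis .
  qed
  \<comment> \<open>The \<open>p\<close>-th power of a sum of \<open>DIM('a)\<close> terms costs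
    \<open>DIM('a) powr p\<close>; the other factor \<open>DIM('a)\<close> counts the partial
    derivatives.\<close>
  have "(\<integral>\<^sup>+x. ennreal (hs_norm (total_D g x) powr p) \<partial>lebesgue)
      \<le> (\<integral>\<^sup>+x. ennreal (real DIM('a) powr p) * (\<Sum>b\<in>Basis. ennreal (norm (total_D g x b) powr p)) \<partial>lebesgue)"
  proof (rule nn_integral_mono)
    fix x
    have "hs_norm (total_D g x) powr p \<le> (\<Sum>b\<in>Basis. norm (total_D g x b)) powr p"
      using p by (intro powr_mono2 hs_norm_le_sum hs_norm_nonneg) auto
    also have "\<dots> \<le> real DIM('a) powr p * (\<Sum>b\<in>Basis. norm (total_D g x b) powr p)"
      by (rule sum_powr_le) (use p in auto)
    finally show "ennreal (hs_norm (total_D g x) powr p) \<le> ennreal (real DIM('a) powr p) * (\<Sum>b\<in>Basis. ennreal (norm (total_D g x b) powr p))"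
      by (simp add: sum_ennreal ennreal_mult[symmetric] ennreal_leI sum_nonneg)
  qed
  also have "\<dots> = ennreal (real DIM('a) powr p) * (\<Sum>b\<in>Basis. Lpn lebesgue p (\<lambda>x. total_D g x b))"
  proof -
    have m: "(\<lambda>x. ennreal (norm (total_D g x b) powr p)) \<in> borel_measurable lebesgue" for b
      using Dm[of b] by simp
    show ?thesis
      unfolding Lpn_def by (subst nn_integral_cmult[OF borel_measurable_sum[OF m]], subst nn_integral_sum[OF m]) (rule refl)
  qed
  also have "\<dots> \<le> ennreal (real DIM('a) powr p) * (\<Sum>b\<in>(Basis :: 'a set). ennreal K)"
    by (intro mult_left_mono sum_mono part) auto
  also have "\<dots> = ennreal (real DIM('a) powr p * (real DIM('a) * K))"
  proof -
    have "(\<Sum>b\<in>(Basis :: 'a set). ennreal K) = ennreal (real DIM('a) * K)"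
      using K by (subst sum_ennreal) auto
    then show ?thesis
      using K by (simp only:) (rule ennreal_mult[symmetric], auto)
  qed
  finally show ?thesis .
qed

text \<open>On a bounded \<open>U\<close> the extension operator supplies functions on the whole
  space, where translations make sense; on \<open>UNIV\<close> the components themselves serve.
  Outside \<open>U\<close> the result obeys no constraint on its values.\<close>

lemma sobolev_translate_extension:
  fixes g :: "'a::euclidean_space \<Rightarrow> 'b::euclidean_space"
  assumes p: "1 < p" and U: "U = UNIV \<or> bounded U \<and> open U \<and> extension_property U" and g: "g \<in> sobolev p U"
  shows "\<exists>f K. f \<in> borel_measurable borel \<and> (AE x in lebesgue_on U. g x = f x) \<and> Lpn lborel p f < \<infinity> \<and> 0 \<le> K \<and>
    (\<forall>c. Lpn lborel p (\<lambda>x. f (x + c) - f x) \<le> ennreal (norm c powr p * K))"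
proof -
  have Uo: "open U"
    using U by auto
  then have Um: "U \<in> sets lebesgue"
    by simp
  have ext: "\<exists>e \<in> sobolev p UNIV. AE x in lebesgue_on U. e x = h x" if h: "h \<in> sobolev p U" for h :: "'a \<Rightarrow> real"
  proof (cases "U = UNIV")
    case True
    then show ?thesis
      using h by (intro bexI[of _ h]) auto
  next
    case False
    then obtain E where "extension_operator p U E"
      using U p unfolding extension_property_def by blast
    then show ?thesis
      using h unfolding extension_operator_def by blast
  qed
  have "\<exists>f K. f \<in> borel_measurable borel \<and> (AE x in lebesgue_on U. g x \<bullet> k = f x) \<and> Lpn lborel p f < \<infinity> \<and>
    (\<forall>c. Lpn lborel p (\<lambda>x. f (x + c) - f x) \<le> ennreal (norm c powr p * K))" if k: "k \<in> Basis" for k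
  proof -
    obtain e where e: "e \<in> sobolev p UNIV" "AE x in lebesgue_on U. e x = g x \<bullet> k"
      using ext[OF sobolev_component[OF p Uo g k]] by blast
    from sobolev_UNIV_translate[OF p e(1)] obtain f K where f: "f \<in> borel_measurable borel" "AE x in lborel. e x = f x"
      "Lpn lborel p f < \<infinity>" "\<forall>c. Lpn lborel p (\<lambda>x. f (x + c) - f x) \<le> ennreal (norm c powr p * K)"
      by (elim exE conjE) blast
    have "AE x in lebesgue. e x = f x"
      using f(2) by (rule AE_completion)
    then have "AE x in lebesgue_on U. e x = f x"
      unfolding AE_lebesgue_on[OF Um] by eventually_elim simp
    with e(2) have "AE x in lebesgue_on U. g x \<bullet> k = f x"
      by eventually_elim simp
    then show ?thesis
      using f by blast
  qed
  then have "\<forall>k. \<exists>f K. k \<in> Basis \<longrightarrow> f \<in> borel_measurable borel \<and> (AE x in lebesgue_on U. g x \<bullet> k = f x) \<and> Lpn lborel p f < \<infinity> \<and>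
    (\<forall>c. Lpn lborel p (\<lambda>x. f (x + c) - f x) \<le> ennreal (norm c powr p * K))"
    by blast
  from choice[OF this] obtain f where "\<forall>k. \<exists>K. k \<in> Basis \<longrightarrow> f k \<in> borel_measurable borel \<and> (AE x in lebesgue_on U. g x \<bullet> k = f k x) \<and>
    Lpn lborel p (f k) < \<infinity> \<and> (\<forall>c. Lpn lborel p (\<lambda>x. f k (x + c) - f k x) \<le> ennreal (norm c powr p * K))"
    by (elim exE)
  from choice[OF this] obtain K where fK: "\<forall>k. k \<in> Basis \<longrightarrow> f k \<in> borel_measurable borel \<and> (AE x in lebesgue_on U. g x \<bullet> k = f k x) \<and>
    Lpn lborel p (f k) < \<infinity> \<and> (\<forall>c. Lpn lborel p (\<lambda>x. f k (x + c) - f k x) \<le> ennreal (norm c powr p * K k))"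
    by (elim exE)
  then have f: "\<And>k. k \<in> Basis \<Longrightarrow> f k \<in> borel_measurable borel" "\<And>k. k \<in> Basis \<Longrightarrow> AE x in lebesgue_on U. g x \<bullet> k = f k x"
    "\<And>k. k \<in> Basis \<Longrightarrow> Lpn lborel p (f k) < \<infinity>"
    "\<And>k c. k \<in> Basis \<Longrightarrow> Lpn lborel p (\<lambda>x. f k (x + c) - f k x) \<le> ennreal (norm c powr p * K k)"
    by blast+
  define f0 where "f0 x = (\<Sum>k\<in>Basis. f k x *\<^sub>R k)" for x
  \<comment> \<open>\<open>K k\<close> is not known to be nonnegative, hence the absolute values;
    the factor in front comes from \<open>sum_powr_le\<close>.\<close>
  define K0 where "K0 = real DIM('b) powr p * (\<Sum>k\<in>Basis. \<bar>K k\<bar>)"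
  have f0m: "f0 \<in> borel_measurable borel"
    unfolding f0_def by (intro borel_measurable_sum borel_measurable_scaleR f(1)) auto
  have comp: "Lpn lborel p v \<le> ennreal (real DIM('b) powr p) * (\<Sum>k\<in>Basis. Lpn lborel p (\<lambda>x. v x \<bullet> k))"
    if v[measurable]: "v \<in> borel_measurable borel" for v :: "'a \<Rightarrow> 'b"
  proof -
    have "Lpn lborel p v \<le> (\<integral>\<^sup>+x. ennreal (real DIM('b) powr p) * (\<Sum>k\<in>Basis. ennreal (norm (v x \<bullet> k) powr p)) \<partial>lborel)"
      unfolding Lpn_def
    proof (rule nn_integral_mono)
      fix x
      have "norm (v x) powr p \<le> (\<Sum>k\<in>Basis. \<bar>v x \<bullet> k\<bar>) powr p"
        using p by (intro powr_mono2 norm_le_l1) auto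
      also have "\<dots> \<le> real DIM('b) powr p * (\<Sum>k\<in>Basis. \<bar>v x \<bullet> k\<bar> powr p)"
        by (rule sum_powr_le) (use p in auto)
      finally show "ennreal (norm (v x) powr p) \<le> ennreal (real DIM('b) powr p) * (\<Sum>k\<in>Basis. ennreal (norm (v x \<bullet> k) powr p))"
        by (simp add: sum_ennreal ennreal_mult[symmetric] ennreal_leI sum_nonneg)
    qed
    also have "\<dots> = ennreal (real DIM('b) powr p) * (\<Sum>k\<in>Basis. Lpn lborel p (\<lambda>x. v x \<bullet> k))"
      unfolding Lpn_def by (subst nn_integral_cmult, measurable) (subst nn_integral_sum, auto)
    finally show ?thesis .
  qed
  have f0k: "f0 x \<bullet> k = f k x" if "k \<in> Basis" for x k
    using that by (simp add: f0_def)
  have "Lpn lborel p f0 \<le> ennreal (real DIM('b) powr p) * (\<Sum>k\<in>Basis. Lpn lborel p (f k))"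
    using comp[OF f0m] f0k by simp
  also have "\<dots> < \<infinity>"
  proof -
    have "(\<Sum>k\<in>Basis. Lpn lborel p (f k)) < top"
      using f(3) by (subst ennreal_sum_less_top) auto
    then show ?thesis
      by (simp add: ennreal_mult_less_top)
  qed
  finally have fin: "Lpn lborel p f0 < \<infinity>" .
  have tr: "Lpn lborel p (\<lambda>x. f0 (x + c) - f0 x) \<le> ennreal (norm c powr p * K0)" for c
  proof -
    have "(\<lambda>x. f0 (x + c) - f0 x) \<in> borel_measurable borel"
      using f0m by measurable
    from comp[OF this] have "Lpn lborel p (\<lambda>x. f0 (x + c) - f0 x)
        \<le> ennreal (real DIM('b) powr p) * (\<Sum>k\<in>Basis. Lpn lborel p (\<lambda>x. f k (x + c) - f k x))"
      using f0k by (simp add: inner_diff_left)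
    also have "\<dots> \<le> ennreal (real DIM('b) powr p) * (\<Sum>k\<in>Basis. ennreal (norm c powr p * \<bar>K k\<bar>))"
    proof (intro mult_left_mono sum_mono)
      fix k :: 'b assume "k \<in> Basis"
      from f(4)[OF this, of c] show "Lpn lborel p (\<lambda>x. f k (x + c) - f k x) \<le> ennreal (norm c powr p * \<bar>K k\<bar>)"
        by (rule order_trans) (intro ennreal_leI mult_left_mono, auto)
    qed simp
    also have "\<dots> = ennreal (norm c powr p * K0)"
      by (simp add: sum_ennreal ennreal_mult[symmetric] sum_nonneg K0_def sum_distrib_left mult_ac)
    finally show ?thesis .
  qed
  have "AE x in lebesgue_on U. \<forall>k\<in>Basis. g x \<bullet> k = f k x"
    using f(2) by (subst AE_finite_all) auto
  then have "AE x in lebesgue_on U. g x = f0 x"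
    by eventually_elim (simp add: euclidean_eq_iff[where 'a = 'b] f0k)
  moreover have "0 \<le> K0"
    by (simp add: K0_def sum_nonneg)
  ultimately show ?thesis
    using f0m fin tr by blast
qed

text \<open>Translation bounds pass to \<open>m j\<close> and then, with a factor
  \<open>L powr p\<close>, to \<open>\<xi> \<circ> R \<circ> m j\<close>;
  \<open>lipschitz_energy_le\<close> converts them into a bound on the energies. On \<open>U\<close>
  almost every value of \<open>g\<close> lies in the range of \<open>\<xi>\<close>, so
  \<open>\<xi> \<circ> R\<close> gives it back.\<close>

theorem Yp_lift:
  fixes \<xi> :: "('b::euclidean_space, 'q::finite) qtuple \<Rightarrow> 'c::euclidean_space" and U :: "'a::euclidean_space set"
  assumes \<xi>: "almgren_white \<xi>" and p: "1 < p" and U: "U = UNIV \<or> bounded U \<and> open U \<and> extension_property U"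
    and g: "g \<in> Yp \<xi> p U"
  shows "\<exists>f\<in>W1p p U. AE x in lebesgue_on U. (\<xi> \<circ> f) x = g x"
proof -
  let ?M = "lebesgue_on U"
  have Um: "U \<in> sets lebesgue"
    using U by auto
  obtain R :: "'c \<Rightarrow> ('b, 'q) qtuple" and L where R: "L-lipschitz_on UNIV R" "\<And>v. R (\<xi> v) = v"
    using almgren_white_retraction[OF \<xi>] by blast
  have L: "0 \<le> L"
    using R(1) lipschitz_on_nonneg by blast
  have Rm: "R \<in> borel_measurable borel"
    by (rule borel_measurable_continuous_onI[OF lipschitz_on_continuous_on[OF R(1)]])
  \<comment> \<open>With \<open>R 0 = qzero\<close>, composition with \<open>R\<close> maps L_p into
    \<open>Lp_q\<close>.\<close>
  have "\<xi> qzero = 0"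
    using almgren_white_norm[OF \<xi>, of qzero] by simp
  then have R0: "R 0 = qzero"
    using R(2)[of qzero] by simp
  have RL: "dist (R x) (R y) \<le> L * norm (x - y)" for x y
    using lipschitz_onD[OF R(1)] by (simp add: dist_norm)
  have "g \<in> sobolev p U" and rng: "AE x in ?M. g x \<in> range \<xi>"
    using g by (auto simp: Yp_def)
  from sobolev_translate_extension[OF p U this(1)] obtain f0 K where f0: "f0 \<in> borel_measurable borel" "AE x in ?M. g x = f0 x"
    "Lpn lborel p f0 < \<infinity>" "0 \<le> K" "\<forall>c. Lpn lborel p (\<lambda>x. f0 (x + c) - f0 x) \<le> ennreal (norm c powr p * K)"
    by (elim exE conjE) blast
  note f0m[measurable] = f0(1)
  define h where "h j = inverse (real (Suc j))" for j
  have h: "0 < h j" for j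
    by (simp add: h_def)
  have "\<exists>m. (\<exists>C. C-lipschitz_on UNIV m) \<and> (\<forall>c. Lpn lborel p (\<lambda>x. m (x + c) - m x) \<le> ennreal (norm c powr p * K)) \<and>
    Lpn lborel p (\<lambda>x. m x - f0 x) \<le> ennreal (h j powr p * K)" for j
  proof -
    have tr: "Lpn lborel p (\<lambda>x. f0 (x + c) - f0 x) \<le> ennreal (h j powr p * K)" if "norm c \<le> h j" for c
      by (rule order_trans[OF f0(5)[rule_format]], intro ennreal_leI mult_right_mono powr_mono2) (use that p f0(4) in auto)
    from mollify[OF p f0(1,3) h[of j]] obtain m C where m: "C-lipschitz_on UNIV m"
      "\<forall>c E. Lpn lborel p (\<lambda>x. f0 (x + c) - f0 x) \<le> E \<longrightarrow> Lpn lborel p (\<lambda>x. m (x + c) - m x) \<le> E"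
      "\<forall>E. (\<forall>c. norm c \<le> h j \<longrightarrow> Lpn lborel p (\<lambda>x. f0 (x + c) - f0 x) \<le> E) \<longrightarrow> Lpn lborel p (\<lambda>x. m x - f0 x) \<le> E"
      by (elim exE conjE) blast
    from m(3)[rule_format, OF tr] m(2)[rule_format, OF f0(5)[rule_format]] m(1) show ?thesis
      by blast
  qed
  then have "\<forall>j. \<exists>m. (\<exists>C. C-lipschitz_on UNIV m) \<and> (\<forall>c. Lpn lborel p (\<lambda>x. m (x + c) - m x) \<le> ennreal (norm c powr p * K)) \<and>
    Lpn lborel p (\<lambda>x. m x - f0 x) \<le> ennreal (h j powr p * K)"
    by blast
  from choice[OF this] obtain m where m: "\<And>j. \<exists>C. C-lipschitz_on UNIV (m j)"
    "\<And>j c. Lpn lborel p (\<lambda>x. m j (x + c) - m j x) \<le> ennreal (norm c powr p * K)"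
    "\<And>j. Lpn lborel p (\<lambda>x. m j x - f0 x) \<le> ennreal (h j powr p * K)"
    by blast
  have mm[measurable]: "m j \<in> borel_measurable borel" for j
    using m(1)[of j] borel_measurable_continuous_onI lipschitz_on_continuous_on by blast
  have mp: "Lpn lborel p (m j) < \<infinity>" for j
  proof (rule Lpn_add_finite[where v = "\<lambda>x. m j x - f0 x" and w = f0])
    show "norm (m j x) \<le> norm (m j x - f0 x) + norm (f0 x)" for x
      using norm_triangle_ineq[of "m j x - f0 x" "f0 x"] by simp
    show "Lpn lborel p (\<lambda>x. m j x - f0 x) < \<infinity>"
      using le_less_trans[OF m(3)[of j]] by simp
  qed (use p f0(3) in auto)
  have Lq: "R \<circ> v \<in> Lp_q p U" if v: "v \<in> borel_measurable borel" "Lpn lborel p v < \<infinity>" for v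
  proof -
    have "Lpn ?M p (\<lambda>x. dist ((R \<circ> v) x) qzero) \<le> Lpn lborel p (\<lambda>x. dist ((R \<circ> v) x) qzero)"
      by (rule Lpn_restrict_le[OF Um])
    also have "\<dots> \<le> ennreal (L powr p) * Lpn lborel p v"
      by (rule Lpn_scale) (use p L v RL[of _ 0] in \<open>auto simp: R0\<close>)
    also have "\<dots> < \<infinity>"
      using v by (simp add: ennreal_mult_less_top)
    finally show ?thesis
      using measurable_restrict_space1[OF measurable_comp[OF v(1) Rm], of U] by (simp add: Lp_q_def Lpn_def)
  qed
  define f where "f = R \<circ> f0"
  define F where "F j = R \<circ> m j" for j
  have FL: "\<exists>C. C-lipschitz_on UNIV (F j)" for j
  proof -
    obtain C where "C-lipschitz_on UNIV (m j)"
      using m(1) by blast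
    from lipschitz_on_compose[OF this lipschitz_on_subset[OF R(1) subset_UNIV]] show ?thesis
      unfolding F_def by blast
  qed
  have E: "(\<integral>\<^sup>+x. ennreal (qD_norm UNIV (F j) x powr p) \<partial>?M)
      \<le> ennreal (real DIM('a) powr p * (real DIM('a) * (L powr p * K)))" for j
  proof -
    obtain C where C: "C-lipschitz_on UNIV (F j)"
      using FL by blast
    have u: "C-lipschitz_on UNIV (\<xi> \<circ> F j)"
      using lipschitz_on_compose[OF C almgren_white_lipschitz[OF \<xi>]] by simp
    have "AE x in lebesgue. x \<in> UNIV \<longrightarrow> qD_norm UNIV (F j) x = hs_norm (total_D (\<xi> \<circ> F j) x)"
      by (rule AE_qD_norm_eq[OF \<xi> open_UNIV C u]) simp
    then have "AE x in ?M. qD_norm UNIV (F j) x = hs_norm (total_D (\<xi> \<circ> F j) x)"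
      unfolding AE_lebesgue_on[OF Um] by eventually_elim simp
    then have "(\<integral>\<^sup>+x. ennreal (qD_norm UNIV (F j) x powr p) \<partial>?M) = (\<integral>\<^sup>+x. ennreal (hs_norm (total_D (\<xi> \<circ> F j) x) powr p) \<partial>?M)"
      by (intro nn_integral_cong_AE) (auto elim: eventually_mono)
    also have "\<dots> \<le> (\<integral>\<^sup>+x. ennreal (hs_norm (total_D (\<xi> \<circ> F j) x) powr p) \<partial>lebesgue)"
      by (rule nn_integral_lebesgue_on_le[OF Um])
    also have "\<dots> \<le> ennreal (real DIM('a) powr p * (real DIM('a) * (L powr p * K)))"
    proof (rule lipschitz_energy_le[OF p u])
      fix c
      have "Lpn lborel p (\<lambda>x. (\<xi> \<circ> F j) (x + c) - (\<xi> \<circ> F j) x) \<le> ennreal (L powr p) * Lpn lborel p (\<lambda>x. m j (x + c) - m j x)"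
      proof (rule Lpn_scale)
        fix x
        have "norm ((\<xi> \<circ> F j) (x + c) - (\<xi> \<circ> F j) x) \<le> dist (F j (x + c)) (F j x)"
          using lipschitz_onD[OF almgren_white_lipschitz[OF \<xi>], of "F j (x + c)" UNIV "F j x"] by (simp add: dist_norm)
        then show "norm ((\<xi> \<circ> F j) (x + c) - (\<xi> \<circ> F j) x) \<le> L * norm (m j (x + c) - m j x)"
          using RL[of "m j (x + c)" "m j x"] by (simp add: F_def)
      next
        show "(\<lambda>x. m j (x + c) - m j x) \<in> borel_measurable lborel"
          by measurable
      qed (use p L in auto)
      also have "\<dots> \<le> ennreal (L powr p) * ennreal (norm c powr p * K)"
        by (intro mult_left_mono m(2)) simp
      also have "\<dots> = ennreal (norm c powr p * (L powr p * K))"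
        using f0(4) by (simp add: ennreal_mult[symmetric] mult_ac)
      finally show "Lpn lborel p (\<lambda>x. (\<xi> \<circ> F j) (x + c) - (\<xi> \<circ> F j) x) \<le> ennreal (norm c powr p * (L powr p * K))" .
    qed (use f0(4) in simp)
    finally show ?thesis .
  qed
  have d: "dist_Lp p U f (F j) \<le> (L powr p * (h j powr p * K)) powr (1 / p)" for j
  proof -
    have "Lpn ?M p (\<lambda>x. dist (f x) (F j x)) \<le> Lpn lborel p (\<lambda>x. dist (f x) (F j x))"
      by (rule Lpn_restrict_le[OF Um])
    also have "\<dots> \<le> ennreal (L powr p) * Lpn lborel p (\<lambda>x. m j x - f0 x)"
    proof (rule Lpn_scale)
      show "norm (dist (f x) (F j x)) \<le> L * norm (m j x - f0 x)" for x
        using RL[of "f0 x" "m j x"] by (simp add: f_def F_def norm_minus_commute)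
      show "(\<lambda>x. m j x - f0 x) \<in> borel_measurable lborel"
        by measurable
    qed (use p L in auto)
    also have "\<dots> \<le> ennreal (L powr p) * ennreal (h j powr p * K)"
      by (intro mult_left_mono m(3)) simp
    also have "\<dots> = ennreal (L powr p * (h j powr p * K))"
      using f0(4) by (simp add: ennreal_mult[symmetric])
    finally have "enn2real (\<integral>\<^sup>+x. ennreal (dist (f x) (F j x) powr p) \<partial>?M) \<le> L powr p * (h j powr p * K)"
      using f0(4) by (intro enn2real_leI) (simp_all add: Lpn_def)
    then show ?thesis
      unfolding dist_Lp_def using p by (intro powr_mono2) auto
  qed
  have "(\<lambda>j. dist_Lp p U f (F j)) \<longlonglongrightarrow> 0"
  proof (rule tendsto_sandwich[OF _ _ tendsto_const])
    have "(\<lambda>j. h j powr p) \<longlonglongrightarrow> 0 powr p"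
      using p LIMSEQ_inverse_real_of_nat less_imp_le[OF h] unfolding h_def[abs_def]
      by (intro tendsto_powr' tendsto_const) auto
    then have "(\<lambda>j. L powr p * (h j powr p * K)) \<longlonglongrightarrow> L powr p * (0 * K)"
      using p by (intro tendsto_intros) simp
    then have "(\<lambda>j. (L powr p * (h j powr p * K)) powr (1 / p)) \<longlonglongrightarrow> (L powr p * (0 * K)) powr (1 / p)"
      using p f0(4) by (intro tendsto_powr' tendsto_const) auto
    then show "(\<lambda>j. (L powr p * (h j powr p * K)) powr (1 / p)) \<longlonglongrightarrow> 0"
      by simp
  qed (use d in \<open>auto simp: dist_Lp_def\<close>)
  moreover have "(SUP j. \<integral>\<^sup>+x. ennreal (qD_norm UNIV (F j) x powr p) \<partial>?M) < \<infinity>"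
    by (rule le_less_trans[OF SUP_least[OF E]]) simp
  moreover have "f \<in> Lp_q p U" "\<And>j. F j \<in> Lp_q p U"
    using Lq[OF f0(1,3)] Lq[OF mm mp] by (simp_all add: f_def F_def)
  ultimately have "f \<in> W1p p U"
    using FL unfolding W1p_def by blast
  moreover have "AE x in ?M. (\<xi> \<circ> f) x = g x"
    using rng f0(2) by eventually_elim (auto simp: f_def R(2))
  ultimately show ?thesis
    by blast
qed

section \<open>The bijection\<close>

lemma ae_rel_equiv: "equiv S (ae_rel U S)"
proof (rule equivI)
  show "refl_on S (ae_rel U S)"
    by (auto simp: refl_on_def ae_rel_def)
  show "sym (ae_rel U S)"
    by (auto simp: sym_def ae_rel_def elim: eventually_mono)
  show "trans (ae_rel U S)"
  proof (rule transI)
    fix f g h assume "(f, g) \<in> ae_rel U S" "(g, h) \<in> ae_rel U S"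
    then have fgh: "f \<in> S" "h \<in> S" "AE x in lebesgue_on U. f x = g x" "AE x in lebesgue_on U. g x = h x"
      by (auto simp: ae_rel_def)
    from fgh(3,4) have "AE x in lebesgue_on U. f x = h x"
      by eventually_elim simp
    then show "(f, h) \<in> ae_rel U S"
      using fgh by (simp add: ae_rel_def)
  qed
  show "ae_rel U S \<subseteq> S \<times> S"
    by (auto simp: ae_rel_def)
qed

text \<open>The single equivalence \<open>iff\<close> yields both that the map respects the
  relations and that it is injective on classes; surjectivity is asked for up to \<open>s\<close>
  only.\<close>

lemma bij_betw_quotient:
  assumes r: "equiv A r" and s: "equiv B s" and h: "\<And>x. x \<in> A \<Longrightarrow> h x \<in> B"
    and iff: "\<And>x y. x \<in> A \<Longrightarrow> y \<in> A \<Longrightarrow> (h x, h y) \<in> s \<longleftrightarrow> (x, y) \<in> r"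
    and surj: "\<And>b. b \<in> B \<Longrightarrow> \<exists>a\<in>A. (h a, b) \<in> s"
  shows "(\<lambda>x. s `` {h x}) respects r" and "bij_betw (\<lambda>F. \<Union>x\<in>F. s `` {h x}) (A // r) (B // s)"
proof -
  show resp: "(\<lambda>x. s `` {h x}) respects r"
  proof (rule congruentI)
    fix x y assume xy: "(x, y) \<in> r"
    then have "x \<in> A" "y \<in> A"
      using equiv_type[OF r] by auto
    then show "s `` {h x} = s `` {h y}"
      using xy iff by (intro equiv_class_eq[OF s]) simp
  qed
  have cls: "(\<Union>x\<in>r `` {a}. s `` {h x}) = s `` {h a}" if "a \<in> A" for a
    by (rule UN_equiv_class[OF r resp that])
  show "bij_betw (\<lambda>F. \<Union>x\<in>F. s `` {h x}) (A // r) (B // s)"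
    unfolding bij_betw_def
  proof (intro conjI inj_onI)
    fix X Y assume "X \<in> A // r" "Y \<in> A // r" and eq: "(\<Union>x\<in>X. s `` {h x}) = (\<Union>x\<in>Y. s `` {h x})"
    then obtain a b where ab: "a \<in> A" "X = r `` {a}" "b \<in> A" "Y = r `` {b}"
      by (elim quotientE) blast
    then have "s `` {h a} = s `` {h b}"
      using eq cls by simp
    then have "(h a, h b) \<in> s"
      using eq_equiv_class[OF _ s h[OF ab(3)]] by blast
    then show "X = Y"
      using ab iff equiv_class_eq[OF r] by simp
  next
    show "(\<lambda>F. \<Union>x\<in>F. s `` {h x}) ` (A // r) = B // s"
    proof (intro equalityI subsetI)
      fix Y assume "Y \<in> (\<lambda>F. \<Union>x\<in>F. s `` {h x}) ` (A // r)"
      then obtain a where a: "a \<in> A" "Y = (\<Union>x\<in>r `` {a}. s `` {h x})"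
        by (auto elim!: quotientE)
      then show "Y \<in> B // s"
        using cls h by (simp add: quotientI)
    next
      fix Y assume "Y \<in> B // s"
      then obtain b where b: "b \<in> B" "Y = s `` {b}"
        by (elim quotientE)
      obtain a where a: "a \<in> A" "(h a, b) \<in> s"
        using surj[OF b(1)] by blast
      have "Y = (\<Union>x\<in>r `` {a}. s `` {h x})"
        using cls[OF a(1)] equiv_class_eq[OF s a(2)] b(2) by simp
      then show "Y \<in> (\<lambda>F. \<Union>x\<in>F. s `` {h x}) ` (A // r)"
        using a(1) quotientI[of a A r] by blast
    qed
  qed
qed

theorem theorem4p3p1:
  fixes \<xi> :: "(real ^ 'n, 'q::finite) qtuple \<Rightarrow> real ^ 'N"
    and U :: "(real ^ 'm) set"
    and p :: real
  assumes "almgren_white \<xi>"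
    and "1 < p"
    and "U = UNIV \<or> (bounded U \<and> open U \<and> extension_property U)"
  defines "W \<equiv> (W1p p U :: (real ^ 'm \<Rightarrow> (real ^ 'n, 'q) qtuple) set)"
    and "Y \<equiv> Yp \<xi> p U"
  shows "(\<forall>f\<in>W. \<xi> \<circ> f \<in> Y)
    \<and> (\<lambda>f. ae_rel U Y `` {\<xi> \<circ> f}) respects (ae_rel U W)
    \<and> bij_betw (\<lambda>F. \<Union>f\<in>F. ae_rel U Y `` {\<xi> \<circ> f}) (W // ae_rel U W) (Y // ae_rel U Y)
    \<and> (\<forall>f\<in>W.
        (\<integral>\<^sup>+x. ennreal (dist (f x) qzero powr p) \<partial>lebesgue_on U)
          = (\<integral>\<^sup>+x. ennreal (norm ((\<xi> \<circ> f) x) powr p) \<partial>lebesgue_on U)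
        \<and> ((\<exists>C. C-lipschitz_on U f) \<longrightarrow>
            (\<integral>\<^sup>+x. ennreal (qD_norm U f x powr p) \<partial>lebesgue_on U)
              = (\<integral>\<^sup>+x. ennreal (hs_norm (weak_D U (\<xi> \<circ> f) x) powr p) \<partial>lebesgue_on U)))"
proof -
  note \<xi> = assms(1) and p = assms(2) and U = assms(3)
  have Uo: "open U"
    using U by auto
  have into: "\<xi> \<circ> f \<in> Y" if "f \<in> W" for f
    using W1p_Yp[OF \<xi> p Uo] that unfolding W_def Y_def by blast
  \<comment> \<open>\<open>\<xi>\<close> is injective, so two maps agree at a point exactly if their
    compositions with \<open>\<xi>\<close> do.\<close>
  have iff: "(\<xi> \<circ> f, \<xi> \<circ> g) \<in> ae_rel U Y \<longleftrightarrow> (f, g) \<in> ae_rel U W" if "f \<in> W" "g \<in> W" for f g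
    using that into inj_eq[OF almgren_white_inj[OF \<xi>]] by (simp add: ae_rel_def)
  have surj: "\<exists>f\<in>W. (\<xi> \<circ> f, g) \<in> ae_rel U Y" if g: "g \<in> Y" for g
  proof -
    obtain f where "f \<in> W" "AE x in lebesgue_on U. (\<xi> \<circ> f) x = g x"
      using Yp_lift[OF \<xi> p U, of g] g unfolding W_def Y_def by blast
    then show ?thesis
      using into g by (intro bexI[of _ f]) (simp_all add: ae_rel_def)
  qed
  note bij = bij_betw_quotient[OF ae_rel_equiv ae_rel_equiv, where h = "\<lambda>f. \<xi> \<circ> f", OF into iff surj]
  have norms: "(\<integral>\<^sup>+x. ennreal (dist (f x) qzero powr p) \<partial>lebesgue_on U)
      = (\<integral>\<^sup>+x. ennreal (norm ((\<xi> \<circ> f) x) powr p) \<partial>lebesgue_on U)" for f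
    by (simp add: almgren_white_norm[OF \<xi>])
  have energy: "(\<integral>\<^sup>+x. ennreal (qD_norm U f x powr p) \<partial>lebesgue_on U)
      = (\<integral>\<^sup>+x. ennreal (hs_norm (weak_D U (\<xi> \<circ> f) x) powr p) \<partial>lebesgue_on U)" if "C-lipschitz_on U f" for f C
    using AE_qD_norm_weak_D[OF \<xi> Uo that] by (intro nn_integral_cong_AE) (auto elim: eventually_mono)
  show ?thesis
    using into bij norms energy by blast
qed

end
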